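(* Let $\mathcal X=[0,1)^d$ and suppose that the graphon $f:\mathcal X\times\mathcal X\to[0,1]$ satisfies, with some $\alpha,L>0$, either the Hölder condition or the Sobolev condition. Then there exists a constant $C=C(\alpha,L,d)$ depending only on $\alpha$, $L$ and $d$ such that for all integers $0\le r\le n-1$, $$\frac1{n^2}\sum_{i\ge r+1}\mathbb E\left[\lambda_i^2(M)\right]\le C(\alpha,L,d)\left(n^{-1}+r^{-2\alpha/d}\right).$$
   Context: Graphon setting: $f:\mathcal X\times\mathcal X\to[0,1]$ is a symmetric measurable function, $x_1,\dots,x_n$ are i.i.d. from a probability distribution $\mu$ on $\mathcal X=[0,1)^d$, $M_{ij}=f(x_i,x_j)$ for $i\neq j$, and $M_{ii}=0$. The eigenvalues of $M$ are ordered so that $|\lambda_1(M)|\ge\cdots\ge|\lambda_n(M)|$. For $r=0$ the right side of the bound is read as $+\infty$. Notation: $\lfloor\alpha\rfloor$ denotes the largest integer strictly smaller than $\alpha$. For a multi-index $\kappa=(\kappa_1,\dots,\kappa_d)$ of nonnegative integers, $|\kappa|=\sum_i\kappa_i$, $\kappa!=\prod_i\kappa_i!$, and $\nabla_\kappa g=\partial^{|\kappa|}g/(\partial x)^\kappa$. Hölder class $\mathcal H(\alpha,L)$: functions $g:\mathcal X\to\mathbb R$ whose partial derivatives satisfy, for all $x,x'\in\mathcal X$, $\sum_{|\kappa|=\lfloor\alpha\rfloor}\frac1{\kappa!}|\nabla_\kappa g(x)-\nabla_\kappa g(x')|\le L\|x-x'\|_\infty^{\alpha-\lfloor\alpha\rfloor}$.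 Sobolev space $\mathcal S(\alpha,L)$: functions $g:\mathcal X\to\mathbb R$ whose partial derivatives (more generally, weak derivatives) satisfy $\sum_{|\kappa|=\alpha}\int_{\mathcal X}|\nabla_\kappa g(x)|^2\,dx\le L^2$ if $\alpha$ is an integer, and $\sum_{|\kappa|=\lfloor\alpha\rfloor}\int_{\mathcal X\times\mathcal X}\frac{|\nabla_\kappa g(x)-\nabla_\kappa g(y)|^2}{\|x-y\|_2^{2(\alpha-\lfloor\alpha\rfloor)+d}}\,dx\,dy\le L^2$ if $\alpha$ is not an integer. Hölder condition on $f$: $f(\cdot,y)\in\mathcal H(\alpha,L)$ for every $y\in\mathcal X$ ($\mu$ is an arbitrary Borel probability measure on $\mathcal X$). Sobolev condition on $f$: $\mu$ is Lebesgue measure on $\mathcal X$, and $f(\cdot,y)\in\mathcal S(\alpha,L(y))$ for every $y\in\mathcal X$, where $L(\cdot):\mathcal X\to\mathbb R$ satisfies $\int_{\mathcal X}L^2(y)\,dy\le L^2$. *)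

theory Defs
  imports "HOL-Probability.Probability" "Jordan_Normal_Form.Char_Poly"
begin

definition unit_cube :: "(real ^ 'd) set" where
  "unit_cube = {x. \<forall>i. 0 \<le> vec_nth x i \<and> vec_nth x i < 1}"

text \<open>Borel probability measures on the cube; the underlying space is the cube itself.\<close>

definition cube_distribution :: "(real ^ 'd) measure \<Rightarrow> bool" where
  "cube_distribution \<mu> \<longleftrightarrow> prob_space \<mu> \<and> sets \<mu> = sets (restrict_space borel unit_cube)"

definition graphon :: "(real ^ 'd \<Rightarrow> real ^ 'd \<Rightarrow> real) \<Rightarrow> bool" where
  "graphon f \<longleftrightarrow>
     (\<lambda>(x, y). f x y) \<in> borel_measurable
        (restrict_space borel unit_cube \<Otimes>\<^sub>M restrict_space borel unit_cube) \<and>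
     (\<forall>x\<in>unit_cube. \<forall>y\<in>unit_cube. f x y \<in> {0..1} \<and> f x y = f y x)"

text \<open>The sample points are indexed from 0.\<close>

definition graphon_matrix ::
  "(real ^ 'd \<Rightarrow> real ^ 'd \<Rightarrow> real) \<Rightarrow> nat \<Rightarrow> (nat \<Rightarrow> real ^ 'd) \<Rightarrow> real Matrix.mat" where
  "graphon_matrix f n x = Matrix.mat n n (\<lambda>(i, j). if i = j then 0 else f (x i) (x j))"

text \<open>
  The real eigenvalues, listed with algebraic multiplicity by decreasing absolute value; a real
  symmetric matrix of size n has exactly n of them.  The numbering starts at 1.  Ties in absolute
  value are broken arbitrarily, which does not affect the squares.
\<close>

definition eigenvalues_abs_desc :: "real Matrix.mat \<Rightarrow> real list" where
  "eigenvalues_abs_desc A =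
     sort_key (\<lambda>a. - \<bar>a\<bar>) (sorted_list_of_multiset (proots (char_poly A)))"

definition nth_eigenvalue :: "real Matrix.mat \<Rightarrow> nat \<Rightarrow> real" where
  "nth_eigenvalue A i = eigenvalues_abs_desc A ! (i - 1)"

definition strict_floor :: "real \<Rightarrow> nat" where
  "strict_floor \<alpha> = nat (\<lceil>\<alpha>\<rceil> - 1)"

lemma strict_floor_greatest:
  assumes "\<alpha> > 0"
  shows "real (strict_floor \<alpha>) < \<alpha>" and "real_of_int m < \<alpha> \<Longrightarrow> m \<le> int (strict_floor \<alpha>)"
proof -
  show "real (strict_floor \<alpha>) < \<alpha>"
    using assms unfolding strict_floor_def by linarith
  show "m \<le> int (strict_floor \<alpha>)" if "real_of_int m < \<alpha>"
    using that assms unfolding strict_floor_def by (simp add: less_ceiling_iff[symmetric])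
qed

definition mi_order :: "('d::finite \<Rightarrow> nat) \<Rightarrow> nat" where
  "mi_order \<kappa> = (\<Sum>i\<in>UNIV. \<kappa> i)"

definition mi_fact :: "('d::finite \<Rightarrow> nat) \<Rightarrow> real" where
  "mi_fact \<kappa> = (\<Prod>i\<in>UNIV. fact (\<kappa> i))"

text \<open>
  \<open>D \<kappa>\<close> is the classical partial derivative of \<open>g\<close> on \<open>S\<close> with multi-index \<open>\<kappa>\<close>, for all \<open>\<kappa>\<close> of
  order at most \<open>k\<close>.  Derivatives are taken within \<open>S\<close>, so they are one-sided on the faces of
  \<^const>\<open>unit_cube\<close> that belong to it.  On the cube this determines \<open>D\<close> uniquely.
\<close>

definition partial_derivatives ::
  "nat \<Rightarrow> (real ^ 'd::finite) set \<Rightarrow> (real ^ 'd \<Rightarrow> real) \<Rightarrow>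
     (('d \<Rightarrow> nat) \<Rightarrow> real ^ 'd \<Rightarrow> real) \<Rightarrow> bool" where
  "partial_derivatives k S g D \<longleftrightarrow>
     (\<forall>x\<in>S. D (\<lambda>_. 0) x = g x) \<and>
     (\<forall>\<kappa> i. \<forall>x\<in>S. mi_order \<kappa> < k \<longrightarrow>
        ((\<lambda>t. D \<kappa> (x + t *\<^sub>R axis i 1)) has_real_derivative D (\<kappa>(i := Suc (\<kappa> i))) x)
          (at 0 within {t. x + t *\<^sub>R axis i 1 \<in> S}))"

definition holder_class :: "real \<Rightarrow> real \<Rightarrow> (real ^ 'd::finite \<Rightarrow> real) set" where
  "holder_class \<alpha> L = {g. \<exists>D.
     partial_derivatives (strict_floor \<alpha>) unit_cube g D \<and>
     (\<forall>x\<in>unit_cube. \<forall>x'\<in>unit_cube.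
        (\<Sum>\<kappa> | mi_order \<kappa> = strict_floor \<alpha>. 1 / mi_fact \<kappa> * \<bar>D \<kappa> x - D \<kappa> x'\<bar>)
          \<le> L * infnorm (x - x') powr (\<alpha> - real (strict_floor \<alpha>)))}"

text \<open>
  \<open>\<Phi>\<close> collects all partial derivatives of the smooth function \<open>\<Phi> (\<lambda>_. 0)\<close>, which is compactly
  supported in \<open>U\<close>.  Continuity has to be required: a function may have partial derivatives of all
  orders everywhere without being continuous.
\<close>

definition test_function ::
  "(real ^ 'd::finite) set \<Rightarrow> (('d \<Rightarrow> nat) \<Rightarrow> real ^ 'd \<Rightarrow> real) \<Rightarrow> bool" where
  "test_function U \<Phi> \<longleftrightarrow>
     (\<forall>k. partial_derivatives k UNIV (\<Phi> (\<lambda>_. 0)) \<Phi>) \<and>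
     (\<forall>\<kappa>. continuous_on UNIV (\<Phi> \<kappa>)) \<and>
     compact (closure {x. \<Phi> (\<lambda>_. 0) x \<noteq> 0}) \<and>
     closure {x. \<Phi> (\<lambda>_. 0) x \<noteq> 0} \<subseteq> U"

definition locally_integrable_on :: "(real ^ 'd \<Rightarrow> real) \<Rightarrow> (real ^ 'd) set \<Rightarrow> bool" where
  "locally_integrable_on g U \<longleftrightarrow> (\<forall>K. compact K \<and> K \<subseteq> U \<longrightarrow> g absolutely_integrable_on K)"

definition weak_derivative ::
  "(real ^ 'd::finite) set \<Rightarrow> ('d \<Rightarrow> nat) \<Rightarrow> (real ^ 'd \<Rightarrow> real) \<Rightarrow> (real ^ 'd \<Rightarrow> real) \<Rightarrow> bool" where
  "weak_derivative U \<kappa> g h \<longleftrightarrow>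
     locally_integrable_on g U \<and> locally_integrable_on h U \<and>
     (\<forall>\<Phi>. test_function U \<Phi> \<longrightarrow>
        (LINT x:U|lebesgue. g x * \<Phi> \<kappa> x) =
          (-1) ^ mi_order \<kappa> * (LINT x:U|lebesgue. h x * \<Phi> (\<lambda>_. 0) x))"

text \<open>
  Weak derivatives live on the open cube, whose complement in \<^const>\<open>unit_cube\<close> is negligible.
  The integrand of the double integral takes the value 0 on the diagonal, again a negligible set.
\<close>

definition sobolev_class :: "real \<Rightarrow> real \<Rightarrow> (real ^ 'd::finite \<Rightarrow> real) set" where
  "sobolev_class \<alpha> L = {g. \<exists>D.
     if \<alpha> \<in> \<int> then
       (\<forall>\<kappa>. real (mi_order \<kappa>) = \<alpha> \<longrightarrow> weak_derivative (interior unit_cube) \<kappa> g (D \<kappa>)) \<and>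
       (\<Sum>\<kappa> | real (mi_order \<kappa>) = \<alpha>.
          \<integral>\<^sup>+ x\<in>unit_cube. ennreal ((D \<kappa> x)\<^sup>2) \<partial>lebesgue) \<le> ennreal (L\<^sup>2)
     else
       (\<forall>\<kappa>. mi_order \<kappa> = strict_floor \<alpha> \<longrightarrow>
          weak_derivative (interior unit_cube) \<kappa> g (D \<kappa>)) \<and>
       (\<Sum>\<kappa> | mi_order \<kappa> = strict_floor \<alpha>.
          \<integral>\<^sup>+ y\<in>unit_cube. (\<integral>\<^sup>+ x\<in>unit_cube.
            ennreal ((D \<kappa> x - D \<kappa> y)\<^sup>2 /
              norm (x - y) powr (2 * (\<alpha> - real (strict_floor \<alpha>)) + real CARD('d)))
            \<partial>lebesgue) \<partial>lebesgue) \<le> ennreal (L\<^sup>2)}"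

definition holder_condition ::
  "real \<Rightarrow> real \<Rightarrow> (real ^ 'd::finite \<Rightarrow> real ^ 'd \<Rightarrow> real) \<Rightarrow> bool" where
  "holder_condition \<alpha> L f \<longleftrightarrow> (\<forall>y\<in>unit_cube. (\<lambda>x. f x y) \<in> holder_class \<alpha> L)"

definition sobolev_condition ::
  "real \<Rightarrow> real \<Rightarrow> (real ^ 'd::finite) measure \<Rightarrow> (real ^ 'd \<Rightarrow> real ^ 'd \<Rightarrow> real) \<Rightarrow> bool" where
  "sobolev_condition \<alpha> L \<mu> f \<longleftrightarrow>
     \<mu> = restrict_space lborel unit_cube \<and>
     (\<exists>l. l \<in> borel_measurable (lebesgue_on unit_cube) \<and>
        (\<integral>\<^sup>+ y\<in>unit_cube. ennreal ((l y)\<^sup>2) \<partial>lebesgue) \<le> ennreal (L\<^sup>2) \<and>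
        (\<forall>y\<in>unit_cube. (\<lambda>x. f x y) \<in> sobolev_class \<alpha> (l y)))"

end

theory Submission
  imports Defs "Jordan_Normal_Form.Spectral_Radius" "HOL-Combinatorics.Permutations" "HOL-Real_Asymp.Real_Asymp"
begin

text \<open>
  Split the cube into \<open>K\<^sup>d\<close> cells and approximate \<open>f(\<cdot>, y)\<close> on each cell by a polynomial of degree at
  most \<open>s = \<lfloor>\<alpha>\<rfloor>\<close> in every coordinate.  The approximation has rank \<open>(K (s + 1))\<^sup>d\<close>, so the Eckart-Young
  inequality bounds the tail of the squared eigenvalues by its squared Frobenius error; the diagonal
  contributes only \<open>O(n)\<close>.  The approximation is a product of one-dimensional projections \<open>P\<^sub>i\<close>, so
  only the pure derivatives \<open>\<partial>\<^sub>i\<^sup>m\<close> enter.  In the Hoelder case the error of \<open>P\<^sub>i\<close> is controlled by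
  Taylor's formula on a cell.  In the Sobolev case one tests \<open>g - P\<^sub>i g\<close> against \<open>\<psi>\<close>: the adjoint
  \<open>I - P\<^sub>i\<^sup>T\<close> kills all moments of degree at most \<open>s\<close> on every cell, so \<open>(I - P\<^sub>i\<^sup>T) \<psi>\<close> has an \<open>m\<close>-fold
  antiderivative supported in the same cells, of size \<open>O(K\<^sup>-\<^sup>m)\<close>, and the weak derivative applies; for
  fractional \<open>\<alpha>\<close> this antiderivative still has mean zero, so the derivative may be replaced by its
  oscillation about cell averages.
\<close>

section \<open>Eigenvalue tails of symmetric matrices\<close>

text \<open>P_i is deliberately not the orthogonal projection onto local polynomials. Its
  coefficients are read off by functions \<open>\<eta> j\<close> that are smooth, vanish near the
  ends of a cell and are biorthogonal to the monomials. Its transpose therefore maps a product of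
  one-variable bumps to such a product, and so do the cellwise antiderivatives taken after the
  residual: everything stays an admissible test function, whereas orthogonal polynomials would jump
  at the cell walls. Only constants are lost, because the norms of the operators P_i are bounded
  independently of K.

  The Sobolev condition supplies a weak derivative separately for each y, with no measurability in
  y, and the graphon is sampled at points. Hence the approximation is a fixed linear expression in
  the values of f, jointly measurable in both variables; derivatives enter only through a bound for
  each fixed y, which is integrated over y afterwards. The identity tested with bumps must reach the
  error itself, which is merely bounded and Borel; a monotone class argument extends it, and neither
  f nor its derivative is smoothed.\<close>

lemma gram_schmidt_span:
  fixes a :: "nat \<Rightarrow> nat \<Rightarrow> real"
  shows "\<exists>\<rho> q. \<rho> \<le> r \<and>
     (\<forall>k<\<rho>. \<forall>l<\<rho>. (\<Sum>i<n. q k i * q l i) = (if k = l then 1 else 0)) \<and>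
     (\<forall>k<r. \<exists>c. \<forall>i<n. a k i = (\<Sum>l<\<rho>. c l * q l i))"
proof (induction r)
  case 0
  show ?case by (rule exI[of _ 0]) auto
next
  case (Suc r)
  then obtain \<rho> q where \<rho>: "\<rho> \<le> r"
    and orth: "\<And>k l. k < \<rho> \<Longrightarrow> l < \<rho> \<Longrightarrow> (\<Sum>i<n. q k i * q l i) = (if k = l then 1 else 0)"
    and sp: "\<And>k. k < r \<Longrightarrow> \<exists>c. \<forall>i<n. a k i = (\<Sum>l<\<rho>. c l * q l i)"
    by blast
  define p where "p l = (\<Sum>i<n. a r i * q l i)" for l
  define v where "v i = a r i - (\<Sum>l<\<rho>. p l * q l i)" for i
  define N where "N = (\<Sum>i<n. (v i)\<^sup>2)"
  have N0: "N \<ge> 0" unfolding N_def by (intro sum_nonneg) auto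
  have vq: "(\<Sum>i<n. v i * q l i) = 0" if "l < \<rho>" for l
  proof -
    have "(\<Sum>i<n. v i * q l i) = p l - (\<Sum>i<n. \<Sum>m<\<rho>. p m * (q m i * q l i))"
      by (simp add: v_def p_def algebra_simps sum_subtractf sum_distrib_left)
    also have "(\<Sum>i<n. \<Sum>m<\<rho>. p m * (q m i * q l i)) = (\<Sum>m<\<rho>. p m * (\<Sum>i<n. q m i * q l i))"
      by (rule trans[OF sum.swap]) (simp add: sum_distrib_left)
    also have "\<dots> = (\<Sum>m<\<rho>. if m = l then p m else 0)"
      using orth that by (intro sum.cong) auto
    also have "\<dots> = p l" using that by simp
    finally show ?thesis by simp
  qed
  show ?case
  \<comment> \<open>A vanishing residual means that the new vector already lies in the span. Nothing
    is added then, which is why \<open>\<rho>\<close> may stay below \<open>r\<close>.\<close>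
  proof (cases "N = 0")
    case True
    then have v0: "v i = 0" if "i < n" for i
      using that unfolding N_def by (subst (asm) sum_nonneg_eq_0_iff) auto
    have "\<exists>c. \<forall>i<n. a k i = (\<Sum>l<\<rho>. c l * q l i)" if "k < Suc r" for k
      using that sp[of k] v0 by (cases "k = r") (auto simp: v_def intro!: exI[of _ p])
    then show ?thesis using \<rho> orth by (intro exI[of _ \<rho>] exI[of _ q]) auto
  next
    case False
    define w where "w i = v i / sqrt N" for i
    have Np: "N > 0" using False N0 by simp
    define q' where "q' l = (if l = \<rho> then w else q l)" for l
    have ww: "(\<Sum>i<n. w i * w i) = 1"
    proof -
      have "(\<Sum>i<n. w i * w i) = (\<Sum>i<n. (v i)\<^sup>2 / N)"
        using Np by (intro sum.cong) (auto simp: w_def power2_eq_square)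
      also have "\<dots> = N / N" by (simp add: N_def sum_divide_distrib[symmetric])
      finally show ?thesis using Np by simp
    qed
    have wq: "(\<Sum>i<n. w i * q l i) = 0" if "l < \<rho>" for l
    proof -
      have "(\<Sum>i<n. w i * q l i) = (\<Sum>i<n. v i * q l i) / sqrt N"
        by (simp add: w_def sum_divide_distrib)
      then show ?thesis using vq[OF that] by simp
    qed
    have wq': "(\<Sum>i<n. q l i * w i) = 0" if "l < \<rho>" for l
      using wq[OF that] by (simp add: mult.commute)
    have o': "(\<Sum>i<n. q' k i * q' l i) = (if k = l then 1 else 0)"
      if "k < Suc \<rho>" "l < Suc \<rho>" for k l
      using that orth[of k l] ww wq[of l] wq'[of k] by (auto simp: q'_def less_Suc_eq)
    have "\<exists>c. \<forall>i<n. a k i = (\<Sum>l<Suc \<rho>. c l * q' l i)" if "k < Suc r" for k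
    proof (cases "k = r")
      case True
      show ?thesis
        using Np True by (intro exI[of _ "\<lambda>l. if l = \<rho> then sqrt N else p l"])
          (auto simp: q'_def v_def w_def)
    next
      case False
      then have "k < r" using that by simp
      from sp[OF this] obtain c where "\<forall>i<n. a k i = (\<Sum>l<\<rho>. c l * q l i)" by blast
      then show ?thesis
        by (intro exI[of _ "\<lambda>l. if l = \<rho> then 0 else c l"]) (auto simp: q'_def)
    qed
    then show ?thesis using \<rho> o' by (intro exI[of _ "Suc \<rho>"] exI[of _ q']) auto
  qed
qed

text \<open>Bathtub principle: compared with unit mass on the first r terms, moving mass to later
  indices trades values above \<open>f r\<close> for values below it. A total mass smaller than r
  does no harm because \<open>f r\<close> is non-negative.\<close>

lemma sum_weighted_le_top:
  fixes f w :: "nat \<Rightarrow> real"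
  assumes dec: "\<And>i j. i \<le> j \<Longrightarrow> j < n \<Longrightarrow> f j \<le> f i"
    and f0: "\<And>i. i < n \<Longrightarrow> 0 \<le> f i"
    and w: "\<And>i. i < n \<Longrightarrow> 0 \<le> w i \<and> w i \<le> 1"
    and sw: "(\<Sum>i<n. w i) \<le> real r" and r: "r \<le> n"
  shows "(\<Sum>i<n. f i * w i) \<le> (\<Sum>i<r. f i)"
proof (cases "r = n")
  case True
  then show ?thesis using f0 w by (auto intro!: sum_mono mult_left_le)
next
  case False
  then have rn: "r < n" using r by simp
  have "f i * w i - (if i < r then f i else 0) \<le> f r * (w i - (if i < r then 1 else 0))" if "i < n" for i
  proof (cases "i < r")
    case True
    then have "(f i - f r) * (w i - 1) \<le> 0"
      using dec[of i r] w[OF that] rn by (intro mult_nonneg_nonpos) auto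
    then show ?thesis using True by (simp add: algebra_simps)
  next
    case False
    then show ?thesis using dec[of r i] w[OF that] that by (auto intro: mult_right_mono)
  qed
  then have "(\<Sum>i<n. f i * w i - (if i < r then f i else 0)) \<le> (\<Sum>i<n. f r * (w i - (if i < r then 1 else 0)))"
    by (intro sum_mono) auto
  also have "\<dots> = f r * ((\<Sum>i<n. w i) - real r)"
  proof -
    have "{..<n} \<inter> {i. i < r} = {..<r}" using r by auto
    then show ?thesis by (simp add: sum_distrib_left[symmetric] sum_subtractf sum.If_cases)
  qed
  also have "\<dots> \<le> 0" using f0[OF rn] sw by (intro mult_nonneg_nonpos) auto
  finally have "(\<Sum>i<n. f i * w i) - (\<Sum>i<n. if i < r then f i else 0) \<le> 0"
    by (simp add: sum_subtractf)
  moreover have "(\<Sum>i<n. if i < r then f i else 0) = (\<Sum>i<r. f i)"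
  proof -
    have "{..<n} \<inter> {i. i < r} = {..<r}" using r by auto
    then show ?thesis by (simp add: sum.If_cases)
  qed
  ultimately show ?thesis by simp
qed

lemma sum_orthonormal_square:
  fixes q :: "nat \<Rightarrow> nat \<Rightarrow> real"
  assumes "\<And>k l. k < m \<Longrightarrow> l < m \<Longrightarrow> (\<Sum>i<n. q k i * q l i) = (if k = l then 1 else 0)"
  shows "(\<Sum>i<n. (\<Sum>l<m. z l * q l i)\<^sup>2) = (\<Sum>l<m. (z l)\<^sup>2)"
proof -
  have "(\<Sum>i<n. (\<Sum>l<m. z l * q l i)\<^sup>2) = (\<Sum>i<n. \<Sum>l<m. \<Sum>k<m. z l * z k * (q l i * q k i))"
    by (simp add: power2_eq_square sum_product algebra_simps)
  also have "\<dots> = (\<Sum>l<m. \<Sum>i<n. \<Sum>k<m. z l * z k * (q l i * q k i))"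
    by (rule sum.swap)
  also have "\<dots> = (\<Sum>l<m. \<Sum>k<m. \<Sum>i<n. z l * z k * (q l i * q k i))"
    by (rule sum.cong[OF refl], rule sum.swap)
  also have "\<dots> = (\<Sum>l<m. \<Sum>k<m. if l = k then z l * z k else 0)"
    using assms by (intro sum.cong refl) (auto simp: sum_distrib_left[symmetric])
  also have "\<dots> = (\<Sum>l<m. (z l)\<^sup>2)"
    by (intro sum.cong refl) (simp add: power2_eq_square)
  finally show ?thesis .
qed

text \<open>Pythagoras for an arbitrary coefficient vector \<open>z\<close>. Taking the inner
  products for \<open>z\<close> gives Bessel's inequality; dropping the last, non-negative sum shows
  that no element of the span is closer than the projection.\<close>

lemma sum_orthonormal_dist:
  fixes q :: "nat \<Rightarrow> nat \<Rightarrow> real"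
  assumes "\<And>k l. k < m \<Longrightarrow> l < m \<Longrightarrow> (\<Sum>i<n. q k i * q l i) = (if k = l then 1 else 0)"
  defines "ip \<equiv> \<lambda>v l. \<Sum>i<n. v i * q l i"
  shows "(\<Sum>i<n. (v i - (\<Sum>l<m. z l * q l i))\<^sup>2)
       = (\<Sum>i<n. (v i)\<^sup>2) - (\<Sum>l<m. (ip v l)\<^sup>2) + (\<Sum>l<m. (z l - ip v l)\<^sup>2)"
proof -
  have s1: "(\<Sum>i<n. v i * (\<Sum>l<m. z l * q l i)) = (\<Sum>l<m. z l * ip v l)"
    unfolding ip_def sum_distrib_left by (rule trans[OF sum.swap]) (simp add: algebra_simps)
  have "(\<Sum>i<n. (v i - (\<Sum>l<m. z l * q l i))\<^sup>2)
      = (\<Sum>i<n. (v i)\<^sup>2) - 2 * (\<Sum>i<n. v i * (\<Sum>l<m. z l * q l i)) + (\<Sum>i<n. (\<Sum>l<m. z l * q l i)\<^sup>2)"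
    unfolding power2_diff sum.distrib sum_subtractf sum_distrib_left[of 2] by (simp add: mult.assoc)
  also have "\<dots> = (\<Sum>i<n. (v i)\<^sup>2) - 2 * (\<Sum>l<m. z l * ip v l) + (\<Sum>l<m. (z l)\<^sup>2)"
    by (simp only: s1 sum_orthonormal_square[where n = n and m = m and q = q, OF assms(1)])
  also have "\<dots> = (\<Sum>i<n. (v i)\<^sup>2) - (\<Sum>l<m. (ip v l)\<^sup>2) + (\<Sum>l<m. (z l - ip v l)\<^sup>2)"
    unfolding power2_diff sum.distrib sum_subtractf sum_distrib_left[of 2] by (simp add: mult.assoc)
  finally show ?thesis .
qed

text \<open>The column space of \<open>B\<close> captures at most the \<open>r\<close> largest squared eigenvalues: by
  Parseval its orthonormal basis puts weights in \<open>[0,1]\<close> of total mass at most \<open>r\<close> on them.\<close>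

lemma eckart_young_tail:
  fixes A B u :: "nat \<Rightarrow> nat \<Rightarrow> real" and e :: "nat \<Rightarrow> real"
  assumes spec: "\<And>i j. i < n \<Longrightarrow> j < n \<Longrightarrow> A i j = (\<Sum>k<n. e k * u k i * u k j)"
    and orth: "\<And>k l. k < n \<Longrightarrow> l < n \<Longrightarrow> (\<Sum>i<n. u k i * u l i) = (if k = l then 1 else 0)"
    and orth': "\<And>i j. i < n \<Longrightarrow> j < n \<Longrightarrow> (\<Sum>k<n. u k i * u k j) = (if i = j then 1 else 0)"
    and dec: "\<And>i j. i \<le> j \<Longrightarrow> j < n \<Longrightarrow> (e j)\<^sup>2 \<le> (e i)\<^sup>2"
    and B: "\<And>i j. i < n \<Longrightarrow> j < n \<Longrightarrow> B i j = (\<Sum>k<r. a k i * b k j)"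
    and r: "r \<le> n"
  shows "(\<Sum>k=r..<n. (e k)\<^sup>2) \<le> (\<Sum>i<n. \<Sum>j<n. (A i j - B i j)\<^sup>2)"
proof -
  obtain \<rho> q where \<rho>: "\<rho> \<le> r"
    and qo: "\<And>k l. k < \<rho> \<Longrightarrow> l < \<rho> \<Longrightarrow> (\<Sum>i<n. q k i * q l i) = (if k = l then 1 else 0)"
    and "\<And>k. k < r \<Longrightarrow> \<exists>c. \<forall>i<n. a k i = (\<Sum>l<\<rho>. c l * q l i)"
    using gram_schmidt_span[of r n a] by blast
  then obtain c where c: "\<And>k i. k < r \<Longrightarrow> i < n \<Longrightarrow> a k i = (\<Sum>l<\<rho>. c k l * q l i)"
    by metis
  \<comment> \<open>Every column j of \<open>B\<close> lies in the span of the orthonormal vectors,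
    with coordinates \<open>d j\<close>.\<close>
  define d where "d j l = (\<Sum>k<r. c k l * b k j)" for j l
  have Bq: "B i j = (\<Sum>l<\<rho>. d j l * q l i)" if "i < n" "j < n" for i j
  proof -
    have "B i j = (\<Sum>k<r. (\<Sum>l<\<rho>. c k l * q l i) * b k j)"
      using B[OF that] c that by simp
    also have "\<dots> = (\<Sum>l<\<rho>. d j l * q l i)"
      unfolding d_def sum_distrib_right
      by (rule trans[OF sum.swap]) (simp add: algebra_simps)
    finally show ?thesis .
  qed
  define ip where "ip v l = (\<Sum>i<n. v i * q l i)" for v l
  have dist: "(\<Sum>i<n. (v i - (\<Sum>l<\<rho>. z l * q l i))\<^sup>2)
      = (\<Sum>i<n. (v i)\<^sup>2) - (\<Sum>l<\<rho>. (ip v l)\<^sup>2) + (\<Sum>l<\<rho>. (z l - ip v l)\<^sup>2)" for v z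
    unfolding ip_def by (rule sum_orthonormal_dist[OF qo])
  note parseval = sum_orthonormal_square[where n = n and m = n and q = u, OF orth]
  have parseval': "(\<Sum>k<n. (\<Sum>i<n. y i * u k i)\<^sup>2) = (\<Sum>i<n. (y i)\<^sup>2)" for y
    using sum_orthonormal_square[where n = n and m = n and q = "\<lambda>i k. u k i" and z = y, OF orth'] by simp
  define t where "t l k = (\<Sum>i<n. q l i * u k i)" for l k
  have frob: "(\<Sum>j<n. \<Sum>i<n. (A i j)\<^sup>2) = (\<Sum>k<n. (e k)\<^sup>2)"
  proof -
    have "(\<Sum>j<n. \<Sum>i<n. (A i j)\<^sup>2) = (\<Sum>j<n. \<Sum>k<n. (e k * u k j)\<^sup>2)"
    proof (rule sum.cong[OF refl])
      fix j assume "j \<in> {..<n}"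
      then have "(\<Sum>i<n. (A i j)\<^sup>2) = (\<Sum>i<n. (\<Sum>k<n. (e k * u k j) * u k i)\<^sup>2)"
        by (intro sum.cong refl) (simp add: spec algebra_simps)
      then show "(\<Sum>i<n. (A i j)\<^sup>2) = (\<Sum>k<n. (e k * u k j)\<^sup>2)" by (simp only: parseval)
    qed
    also have "\<dots> = (\<Sum>k<n. (e k)\<^sup>2 * (\<Sum>j<n. u k j * u k j))"
      by (rule trans[OF sum.swap]) (simp add: sum_distrib_left power2_eq_square ac_simps)
    also have "\<dots> = (\<Sum>k<n. (e k)\<^sup>2)" using orth by simp
    finally show ?thesis .
  qed
  have Aq: "(\<Sum>j<n. (ip (\<lambda>i. A i j) l)\<^sup>2) = (\<Sum>k<n. (e k)\<^sup>2 * (t l k)\<^sup>2)" if "l < \<rho>" for l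
  proof -
    have "ip (\<lambda>i. A i j) l = (\<Sum>k<n. (e k * t l k) * u k j)" if "j < n" for j
    proof -
      have "ip (\<lambda>i. A i j) l = (\<Sum>i<n. \<Sum>k<n. e k * u k i * u k j * q l i)"
        using that by (simp add: ip_def spec sum_distrib_right)
      also have "\<dots> = (\<Sum>k<n. (e k * t l k) * u k j)"
        by (rule trans[OF sum.swap]) (simp add: t_def sum_distrib_left sum_distrib_right algebra_simps)
      finally show ?thesis .
    qed
    then have "(\<Sum>j<n. (ip (\<lambda>i. A i j) l)\<^sup>2) = (\<Sum>j<n. (\<Sum>k<n. (e k * t l k) * u k j)\<^sup>2)"
      by (intro sum.cong refl) auto
    also have "\<dots> = (\<Sum>k<n. (e k)\<^sup>2 * (t l k)\<^sup>2)"
      by (simp only: parseval power_mult_distrib)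
    finally show ?thesis .
  qed
  define w where "w k = (\<Sum>l<\<rho>. (t l k)\<^sup>2)" for k
  have w0: "w k \<ge> 0" for k unfolding w_def by (intro sum_nonneg) auto
  have w1: "w k \<le> 1" if "k < n" for k
  proof -
    have "0 \<le> (\<Sum>i<n. (u k i - (\<Sum>l<\<rho>. ip (u k) l * q l i))\<^sup>2)" by (intro sum_nonneg) auto
    also have "\<dots> = (\<Sum>i<n. (u k i)\<^sup>2) - (\<Sum>l<\<rho>. (ip (u k) l)\<^sup>2)"
      unfolding dist by simp
    also have "(\<Sum>i<n. (u k i)\<^sup>2) = 1" using orth[OF that that] by (simp add: power2_eq_square)
    also have "(\<Sum>l<\<rho>. (ip (u k) l)\<^sup>2) = w k" by (simp add: w_def ip_def t_def mult.commute)
    finally show ?thesis by simp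
  qed
  have "(\<Sum>k<n. w k) = (\<Sum>l<\<rho>. \<Sum>k<n. (t l k)\<^sup>2)"
    unfolding w_def by (rule sum.swap)
  also have "\<dots> = (\<Sum>l<\<rho>. \<Sum>i<n. (q l i)\<^sup>2)"
    unfolding t_def parseval' ..
  also have "\<dots> = real \<rho>" using qo by (simp add: power2_eq_square)
  finally have "(\<Sum>k<n. w k) \<le> real r" using \<rho> by simp
  then have top: "(\<Sum>k<n. (e k)\<^sup>2 * w k) \<le> (\<Sum>k<r. (e k)\<^sup>2)"
    using w0 w1 dec r by (intro sum_weighted_le_top) auto
  have "(\<Sum>k=r..<n. (e k)\<^sup>2) = (\<Sum>k<n. (e k)\<^sup>2) - (\<Sum>k<r. (e k)\<^sup>2)"
    using r sum.atLeastLessThan_concat[of 0 r n "\<lambda>k. (e k)\<^sup>2"] by (simp add: atLeast0LessThan)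
  \<comment> \<open>The right side is the squared Frobenius norm of \<open>A\<close> minus that of
    its projection onto the span. Column by column this is a squared distance to the span, and the
    corresponding column of \<open>B\<close> is a competitor in that span.\<close>
  also have "\<dots> \<le> (\<Sum>j<n. \<Sum>i<n. (A i j)\<^sup>2) - (\<Sum>k<n. (e k)\<^sup>2 * w k)"
    using top by (simp add: frob)
  also have "(\<Sum>k<n. (e k)\<^sup>2 * w k) = (\<Sum>l<\<rho>. \<Sum>k<n. (e k)\<^sup>2 * (t l k)\<^sup>2)"
    unfolding w_def sum_distrib_left by (rule sum.swap)
  also have "\<dots> = (\<Sum>l<\<rho>. \<Sum>j<n. (ip (\<lambda>i. A i j) l)\<^sup>2)"
    using Aq by simp
  also have "\<dots> = (\<Sum>j<n. \<Sum>l<\<rho>. (ip (\<lambda>i. A i j) l)\<^sup>2)" by (rule sum.swap)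
  also have "(\<Sum>j<n. \<Sum>i<n. (A i j)\<^sup>2) - \<dots> \<le> (\<Sum>j<n. \<Sum>i<n. (A i j - B i j)\<^sup>2)"
    unfolding sum_subtractf[symmetric]
  proof (rule sum_mono)
    fix j assume "j \<in> {..<n}"
    then have "(\<Sum>i<n. (A i j - B i j)\<^sup>2) = (\<Sum>i<n. (A i j - (\<Sum>l<\<rho>. d j l * q l i))\<^sup>2)"
      by (intro sum.cong refl) (simp add: Bq)
    then show "(\<Sum>i<n. (A i j)\<^sup>2) - (\<Sum>l<\<rho>. (ip (\<lambda>i. A i j) l)\<^sup>2) \<le> (\<Sum>i<n. (A i j - B i j)\<^sup>2)"
      using dist[of "\<lambda>i. A i j" "d j"] sum_nonneg[of "{..<\<rho>}" "\<lambda>l. (d j l - ip (\<lambda>i. A i j) l)\<^sup>2"] by simp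
  qed
  also have "\<dots> = (\<Sum>i<n. \<Sum>j<n. (A i j - B i j)\<^sup>2)" by (rule sum.swap)
  finally show ?thesis .
qed

section \<open>The spectral theorem for real symmetric matrices and the sorted list of
  eigenvalues\<close>

lemma orthonormal_defect:
  fixes q :: "nat \<Rightarrow> nat \<Rightarrow> real"
  assumes "\<And>k l. k < m \<Longrightarrow> l < m \<Longrightarrow> (\<Sum>i<n. q k i * q l i) = (if k = l then 1 else 0)"
  shows "(\<Sum>i<n. \<Sum>j<n. ((if i = j then 1 else 0) - (\<Sum>k<m. q k i * q k j))\<^sup>2) = real n - real m"
proof -
  \<comment> \<open>Row i measures the squared distance of the i-th unit vector from the span of the
    vectors \<open>q k\<close>.\<close>
  have "(\<Sum>j<n. ((if i = j then 1 else 0) - (\<Sum>k<m. q k i * q k j))\<^sup>2) = 1 - (\<Sum>k<m. q k i * q k i)"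
    if "i < n" for i
  proof -
    have d: "(\<Sum>j<n. (if i = j then 1 else 0) * q l j) = q l i" for l
      using that by (simp add: if_distrib[of "\<lambda>x. x * _"] cong: if_cong)
    have s: "(\<Sum>j<n. (if i = j then 1 else 0 :: real)\<^sup>2) = 1"
      using that by (simp add: if_distrib[of "\<lambda>x. x\<^sup>2"] cong: if_cong)
    show ?thesis
      using sum_orthonormal_dist[where n = n and m = m and q = q and v = "\<lambda>j. if i = j then 1 else 0"
          and z = "\<lambda>k. q k i", OF assms]
      by (simp only: d s) (simp add: power2_eq_square)
  qed
  then have "(\<Sum>i<n. \<Sum>j<n. ((if i = j then 1 else 0) - (\<Sum>k<m. q k i * q k j))\<^sup>2)
      = (\<Sum>i<n. 1 - (\<Sum>k<m. q k i * q k i))" by simp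
  also have "\<dots> = real n - (\<Sum>k<m. \<Sum>i<n. q k i * q k i)"
    by (simp add: sum_subtractf) (rule sum.swap)
  also have "\<dots> = real n - real m" using assms by simp
  finally show ?thesis .
qed

text \<open>For m = n the defect is 0, so every entry of I - Q Q^T vanishes, where Q has the columns
  \<open>q k\<close>.\<close>

lemma orthonormal_complete:
  fixes q :: "nat \<Rightarrow> nat \<Rightarrow> real"
  assumes "\<And>k l. k < n \<Longrightarrow> l < n \<Longrightarrow> (\<Sum>i<n. q k i * q l i) = (if k = l then 1 else 0)"
    and "i < n" "j < n"
  shows "(\<Sum>k<n. q k i * q k j) = (if i = j then 1 else 0)"
proof -
  have "(\<Sum>i<n. \<Sum>j<n. ((if i = j then 1 else 0) - (\<Sum>k<n. q k i * q k j))\<^sup>2) = 0"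
    using orthonormal_defect[where n = n and m = n and q = q, OF assms(1)] by simp
  then have "\<forall>i\<in>{..<n}. (\<Sum>j<n. ((if i = j then 1 else 0) - (\<Sum>k<n. q k i * q k j))\<^sup>2) = 0"
    by (subst (asm) sum_nonneg_eq_0_iff) (auto intro: sum_nonneg)
  then have "(\<Sum>j<n. ((if i = j then 1 else 0) - (\<Sum>k<n. q k i * q k j))\<^sup>2) = 0" using assms(2) by auto
  then have "\<forall>j\<in>{..<n}. ((if i = j then 1 else 0) - (\<Sum>k<n. q k i * q k j))\<^sup>2 = 0"
    by (subst (asm) sum_nonneg_eq_0_iff) auto
  then show ?thesis using assms(3) by auto
qed

lemma orthonormal_extend:
  fixes q :: "nat \<Rightarrow> nat \<Rightarrow> real"
  assumes "\<And>k l. k < m \<Longrightarrow> l < m \<Longrightarrow> (\<Sum>i<n. q k i * q l i) = (if k = l then 1 else 0)"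
    and v: "\<And>k. k < m \<Longrightarrow> (\<Sum>i<n. v i * q k i) = 0" and "\<exists>i<n. v i \<noteq> 0"
  defines "q' \<equiv> q(m := (\<lambda>i. v i / sqrt (\<Sum>i<n. (v i)\<^sup>2)))"
  shows "\<And>k l. k < Suc m \<Longrightarrow> l < Suc m \<Longrightarrow> (\<Sum>i<n. q' k i * q' l i) = (if k = l then 1 else 0)"
proof -
  fix k l assume kl: "k < Suc m" "l < Suc m"
  define N where "N = (\<Sum>i<n. (v i)\<^sup>2)"
  obtain i0 where i0: "i0 < n" "v i0 \<noteq> 0" using assms by blast
  have Np: "N > 0"
    unfolding N_def using i0 by (intro sum_pos2[of _ i0]) auto
  have ww: "(\<Sum>i<n. (v i / sqrt N) * (v i / sqrt N)) = 1"
  proof -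
    have "(\<Sum>i<n. (v i / sqrt N) * (v i / sqrt N)) = (\<Sum>i<n. (v i)\<^sup>2 / N)"
      using Np by (intro sum.cong) (auto simp: power2_eq_square)
    also have "\<dots> = N / N" by (simp add: N_def sum_divide_distrib[symmetric])
    finally show ?thesis using Np by simp
  qed
  have wq: "(\<Sum>i<n. (v i / sqrt N) * q l i) = 0" "(\<Sum>i<n. q l i * (v i / sqrt N)) = 0" if "l < m" for l
    using v[OF that] by (simp_all add: sum_divide_distrib[symmetric] mult.commute)
  show "(\<Sum>i<n. q' k i * q' l i) = (if k = l then 1 else 0)"
    using kl assms(1)[of k l] ww wq[of l] wq[of k]
    unfolding q'_def N_def[symmetric] by (auto simp: less_Suc_eq)
qed

text \<open>For m < n the defect n - m is positive, so some unit vector has a non-zero residual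
  modulo the span. Normalised, this residual is the next vector; the given vectors are kept
  unchanged.\<close>

lemma orthonormal_completion:
  fixes q :: "nat \<Rightarrow> nat \<Rightarrow> real"
  assumes "\<And>k l. k < m \<Longrightarrow> l < m \<Longrightarrow> (\<Sum>i<n. q k i * q l i) = (if k = l then 1 else 0)"
    and "m \<le> n"
  shows "\<exists>q'. (\<forall>k<m. q' k = q k) \<and>
     (\<forall>k<n. \<forall>l<n. (\<Sum>i<n. q' k i * q' l i) = (if k = l then 1 else 0))"
  using assms
proof (induction "n - m" arbitrary: m q)
  case 0
  then show ?case by (intro exI[of _ q]) auto
next
  case (Suc d)
  note o = Suc.prems(1)
  have mn: "m < n" using Suc.hyps(2) by simp
  have "\<exists>i<n. \<exists>j<n. (if i = j then 1 else 0) - (\<Sum>k<m. q k i * q k j) \<noteq> 0"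
  proof (rule ccontr)
    assume "\<not> ?thesis"
    then have "(\<Sum>i<n. \<Sum>j<n. ((if i = j then 1 else 0) - (\<Sum>k<m. q k i * q k j))\<^sup>2) = 0" by simp
    then show False using orthonormal_defect[where n = n and m = m and q = q, OF o] mn by simp
  qed
  then obtain i0 where i0: "i0 < n" and ne: "\<exists>j<n. (if i0 = j then 1 else 0) - (\<Sum>k<m. q k i0 * q k j) \<noteq> 0"
    by blast
  define v where "v j = (if i0 = j then 1 else 0) - (\<Sum>k<m. q k i0 * q k j)" for j
  have vq: "(\<Sum>j<n. v j * q l j) = 0" if "l < m" for l
  proof -
    have "(\<Sum>j<n. v j * q l j) = (\<Sum>j<n. (if i0 = j then 1 else 0) * q l j) - (\<Sum>j<n. \<Sum>k<m. q k i0 * q k j * q l j)"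
      by (simp add: v_def left_diff_distrib sum_subtractf sum_distrib_right)
    also have "(\<Sum>j<n. (if i0 = j then 1 else 0) * q l j) = q l i0"
      using i0 by (simp add: if_distrib[of "\<lambda>x. x * _"] cong: if_cong)
    also have "(\<Sum>j<n. \<Sum>k<m. q k i0 * q k j * q l j) = (\<Sum>k<m. q k i0 * (\<Sum>j<n. q k j * q l j))"
      by (rule trans[OF sum.swap]) (simp add: sum_distrib_left mult.assoc)
    also have "\<dots> = (\<Sum>k<m. if k = l then q k i0 else 0)"
      using o that by (intro sum.cong) auto
    also have "\<dots> = q l i0" using that by simp
    finally show ?thesis by simp
  qed
  define q1 where "q1 = q(m := (\<lambda>i. v i / sqrt (\<Sum>i<n. (v i)\<^sup>2)))"
  have "\<exists>j<n. v j \<noteq> 0" using ne by (simp add: v_def)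
  then have o1: "(\<Sum>i<n. q1 k i * q1 l i) = (if k = l then 1 else 0)"
    if "k < Suc m" "l < Suc m" for k l
    using orthonormal_extend[where n = n and m = m and q = q and v = v, OF o vq] that
    unfolding q1_def by blast
  have "d = n - Suc m" using Suc.hyps(2) by simp
  from Suc.hyps(1)[OF this o1] mn obtain q' where
    "\<forall>k<Suc m. q' k = q1 k" "\<forall>k<n. \<forall>l<n. (\<Sum>i<n. q' k i * q' l i) = (if k = l then 1 else 0)"
    by auto
  then show ?case by (intro exI[of _ q']) (auto simp: q1_def)
qed

text \<open>A complex eigenvector y exists. For real symmetric A the number y* A y equals its own
  conjugate, which makes the eigenvalue real. The real and the imaginary part of y then both solve
  the eigenvalue equation, and one of them is non-zero.\<close>

lemma real_symmetric_eigenvector: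
  fixes A :: "nat \<Rightarrow> nat \<Rightarrow> real"
  assumes sym: "\<And>i j. i < n \<Longrightarrow> j < n \<Longrightarrow> A i j = A j i" and n: "n > 0"
  shows "\<exists>x \<mu>. (\<exists>i<n. x i \<noteq> 0) \<and> (\<forall>i<n. (\<Sum>j<n. A i j * x j) = \<mu> * x i)"
proof -
  define M where "M = Matrix.mat n n (\<lambda>(i, j). complex_of_real (A i j))"
  have M: "M \<in> carrier_mat n n" by (simp add: M_def)
  obtain z where "eigenvalue M z"
    using spectrum_non_empty[OF M] n unfolding spectrum_def by auto
  then obtain v where v: "v \<in> carrier_vec n" "v \<noteq> 0\<^sub>v n" "M *\<^sub>v v = z \<cdot>\<^sub>v v"
    unfolding eigenvalue_def eigenvector_def using M by auto
  define y where "y i = Matrix.vec_index v i" for i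
  have eq: "(\<Sum>j<n. complex_of_real (A i j) * y j) = z * y i" if "i < n" for i
  proof -
    have "Matrix.vec_index (M *\<^sub>v v) i = (\<Sum>j<n. complex_of_real (A i j) * y j)"
      using that v(1) by (simp add: M_def scalar_prod_def y_def atLeast0LessThan)
    then show ?thesis using that v by (simp add: y_def)
  qed
  obtain i0 where i0: "i0 < n" "y i0 \<noteq> 0"
    using v(1,2) unfolding y_def by (metis carrier_vecD eq_vecI index_zero_vec)
  define S where "S = (\<Sum>i<n. (cmod (y i))\<^sup>2)"
  have S: "S > 0" unfolding S_def using i0 by (intro sum_pos2[of _ i0]) auto
  define Q where "Q = (\<Sum>i<n. \<Sum>j<n. cnj (y i) * (complex_of_real (A i j) * y j))"
  have Q: "Q = z * of_real S"
  proof -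
    have "Q = (\<Sum>i<n. cnj (y i) * (z * y i))"
      unfolding Q_def sum_distrib_left[symmetric] using eq by simp
    also have "\<dots> = z * (\<Sum>i<n. y i * cnj (y i))" by (simp add: sum_distrib_left ac_simps)
    also have "\<dots> = z * of_real S" by (simp add: S_def complex_norm_square del: of_real_power)
    finally show ?thesis .
  qed
  have "cnj Q = (\<Sum>i<n. \<Sum>j<n. y i * (complex_of_real (A i j) * cnj (y j)))"
    by (simp add: Q_def)
  also have "\<dots> = (\<Sum>j<n. \<Sum>i<n. y i * (complex_of_real (A i j) * cnj (y j)))" by (rule sum.swap)
  also have "\<dots> = Q" unfolding Q_def
    by (intro sum.cong refl) (simp add: sym ac_simps)
  finally have "cnj z * of_real S = z * of_real S" unfolding Q by simp
  then have "cnj z = z" using S by simp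
  then obtain \<mu> where \<mu>: "z = of_real \<mu>" using Reals_cases complex_is_Real_iff complex_eq_iff
    by (metis Reals_cnj_iff)
  have re: "(\<Sum>j<n. A i j * Re (y j)) = \<mu> * Re (y i)" if "i < n" for i
    using arg_cong[OF eq[OF that], of Re] by (simp add: \<mu>)
  have im: "(\<Sum>j<n. A i j * Im (y j)) = \<mu> * Im (y i)" if "i < n" for i
    using arg_cong[OF eq[OF that], of Im] by (simp add: \<mu>)
  show ?thesis
  proof (cases "Re (y i0) = 0")
    case True
    then have "Im (y i0) \<noteq> 0" using i0 by (simp add: complex_eq_iff)
    then show ?thesis using i0 im by (intro exI[of _ "\<lambda>i. Im (y i)"] exI[of _ \<mu>]) auto
  next
    case False
    then show ?thesis using i0 re by (intro exI[of _ "\<lambda>i. Re (y i)"] exI[of _ \<mu>]) auto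
  qed
qed

text \<open>Deflation: the eigenvectors found so far are completed to an orthonormal basis, A is
  compressed to the remaining n - m directions, and an eigenvector of the compressed matrix
  \<open>B\<close> is lifted to the next eigenvector of A.\<close>

lemma real_symmetric_orthonormal_eigenvectors:
  fixes A :: "nat \<Rightarrow> nat \<Rightarrow> real"
  assumes sym: "\<And>i j. i < n \<Longrightarrow> j < n \<Longrightarrow> A i j = A j i" and "m \<le> n"
  shows "\<exists>u e. (\<forall>k<m. \<forall>l<m. (\<Sum>i<n. u k i * u l i) = (if k = l then 1 else 0)) \<and>
     (\<forall>k<m. \<forall>i<n. (\<Sum>j<n. A i j * u k j) = e k * u k i)"
  using \<open>m \<le> n\<close>
proof (induction m)
  case 0
  show ?case by auto
next
  case (Suc m)
  then obtain u e where H: "\<forall>k<m. \<forall>l<m. (\<Sum>i<n. u k i * u l i) = (if k = l then 1 else 0)"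
    "\<forall>k<m. \<forall>i<n. (\<Sum>j<n. A i j * u k j) = e k * u k i" by auto
  have o: "(\<Sum>i<n. u k i * u l i) = (if k = l then 1 else 0)" if "k < m" "l < m" for k l
    using H(1) that by blast
  have ev: "(\<Sum>j<n. A i j * u k j) = e k * u k i" if "k < m" "i < n" for k i
    using H(2) that by blast
  have mn: "m < n" using Suc by simp
  obtain q where qu: "\<And>k. k < m \<Longrightarrow> q k = u k"
    and qo: "\<And>k l. k < n \<Longrightarrow> l < n \<Longrightarrow> (\<Sum>i<n. q k i * q l i) = (if k = l then 1 else 0)"
    using orthonormal_completion[where n = n and m = m and q = u, OF o] mn by auto
  define B where "B k l = (\<Sum>i<n. \<Sum>j<n. q (m + k) i * A i j * q (m + l) j)" for k l
  have "B k l = B l k" for k l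
    unfolding B_def by (rule trans[OF sum.swap], intro sum.cong refl) (simp add: sym ac_simps)
  then obtain x \<mu> where x: "\<exists>k<n-m. x k \<noteq> 0"
    and Bx: "\<And>k. k < n-m \<Longrightarrow> (\<Sum>l<n-m. B k l * x l) = \<mu> * x k"
    using real_symmetric_eigenvector[of "n-m" B] mn by auto
  define v where "v i = (\<Sum>l<n-m. x l * q (m + l) i)" for i
  have qv1: "(\<Sum>i<n. v i * q k i) = (if k < m then 0 else x (k - m))" if "k < n" for k
  proof -
    have "(\<Sum>i<n. v i * q k i) = (\<Sum>l<n-m. x l * (\<Sum>i<n. q (m + l) i * q k i))"
      unfolding v_def sum_distrib_right
      by (rule trans[OF sum.swap]) (simp add: sum_distrib_left ac_simps)
    also have "\<dots> = (\<Sum>l<n-m. if m + l = k then x l else 0)"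
      using qo that by (intro sum.cong) auto
    also have "\<dots> = (if k < m then 0 else x (k - m))"
    proof (cases "k < m")
      case False
      then have "(\<Sum>l<n-m. if m + l = k then x l else 0) = (\<Sum>l<n-m. if l = k - m then x l else 0)"
        by (intro sum.cong) auto
      then show ?thesis using False that by simp
    qed auto
    finally show ?thesis .
  qed
  \<comment> \<open>The residual of the eigenvalue equation for the lifted vector \<open>v\<close>.
    It is orthogonal to the old eigenvectors because A is symmetric and leaves their span invariant,
    and to the other basis vectors by the eigenvalue equation for \<open>B\<close>; hence it is
    0.\<close>
  define w where "w i = (\<Sum>j<n. A i j * v j) - \<mu> * v i" for i
  have wq: "(\<Sum>i<n. w i * q k i) = 0" if "k < n" for k
  proof -
    have e1: "(\<Sum>i<n. w i * q k i) = (\<Sum>i<n. \<Sum>j<n. A i j * v j * q k i) - \<mu> * (\<Sum>i<n. v i * q k i)"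
      by (simp add: w_def left_diff_distrib sum_subtractf sum_distrib_right sum_distrib_left mult.assoc)
    show ?thesis
    proof (cases "k < m")
      case True
      have "(\<Sum>i<n. \<Sum>j<n. A i j * v j * q k i) = (\<Sum>j<n. v j * (\<Sum>i<n. A j i * u k i))"
        by (rule trans[OF sum.swap]) (simp add: sum_distrib_left qu[OF True] sym ac_simps)
      also have "\<dots> = (\<Sum>j<n. v j * q k j) * e k"
        using ev[OF True] by (simp add: sum_distrib_right sum_distrib_left qu[OF True] ac_simps)
      finally show ?thesis using e1 qv1[OF that] True by simp
    next
      case False
      define k' where "k' = k - m"
      have k': "k = m + k'" "k' < n - m" using that False by (auto simp: k'_def)
      have "(\<Sum>i<n. \<Sum>j<n. A i j * v j * q k i) = (\<Sum>i<n. \<Sum>j<n. \<Sum>l<n-m. q k i * A i j * q (m + l) j * x l)"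
        by (simp add: v_def sum_distrib_left sum_distrib_right ac_simps)
      also have "\<dots> = (\<Sum>i<n. \<Sum>l<n-m. \<Sum>j<n. q k i * A i j * q (m + l) j * x l)"
        by (rule sum.cong[OF refl], rule sum.swap)
      also have "\<dots> = (\<Sum>l<n-m. \<Sum>i<n. \<Sum>j<n. q k i * A i j * q (m + l) j * x l)"
        by (rule sum.swap)
      also have "\<dots> = (\<Sum>l<n-m. B k' l * x l)"
        by (simp add: B_def k' sum_distrib_right)
      also have "\<dots> = \<mu> * x k'" by (rule Bx[OF k'(2)])
      finally show ?thesis using e1 qv1[OF that] False k' by simp
    qed
  qed
  have w0: "w j = 0" if "j < n" for j
  proof -
    have "w j = (\<Sum>i<n. w i * (if i = j then 1 else 0))"
      using that by (simp add: if_distrib[of "\<lambda>x. _ * x"] cong: if_cong)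
    also have "\<dots> = (\<Sum>i<n. w i * (\<Sum>k<n. q k i * q k j))"
      using that by (intro sum.cong refl) (simp add: orthonormal_complete[where n = n and q = q, OF qo])
    also have "\<dots> = (\<Sum>k<n. (\<Sum>i<n. w i * q k i) * q k j)"
      unfolding sum_distrib_left sum_distrib_right by (rule trans[OF sum.swap]) (simp add: ac_simps)
    finally show ?thesis using wq by simp
  qed
  have v0: "\<exists>i<n. v i \<noteq> 0"
  proof (rule ccontr)
    assume "\<not> ?thesis"
    then have "(\<Sum>i<n. v i * q k i) = 0" for k by simp
    moreover obtain k where k: "k < n - m" "x k \<noteq> 0" using x by blast
    moreover have "m + k < n" using k(1) by linarith
    ultimately show False using qv1[of "m + k"] by simp
  qed
  have vu: "(\<Sum>i<n. v i * u k i) = 0" if "k < m" for k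
    using qv1[of k] that mn by (simp add: qu)
  define u' where "u' = u(m := (\<lambda>i. v i / sqrt (\<Sum>i<n. (v i)\<^sup>2)))"
  have "(\<Sum>i<n. u' k i * u' l i) = (if k = l then 1 else 0)" if "k < Suc m" "l < Suc m" for k l
    using orthonormal_extend[where n = n and m = m and q = u and v = v, OF o vu v0] that
    unfolding u'_def by blast
  moreover have "(\<Sum>j<n. A i j * u' k j) = (e(m := \<mu>)) k * u' k i" if "k < Suc m" "i < n" for k i
    using w0[OF that(2)] ev[OF _ that(2), of k] that(1)
    by (auto simp: less_Suc_eq u'_def w_def sum_divide_distrib[symmetric])
  ultimately show ?case by (intro exI[of _ u'] exI[of _ "e(m := \<mu>)"]) blast
qed

lemma proots_prod_linear_real: "proots (\<Prod>a\<leftarrow>as. [:- a, 1:] :: real poly) = mset as"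
proof -
  have "proots (\<Prod>a\<leftarrow>as. [:- a, 1:] :: real poly) = (\<Sum>a\<leftarrow>as. proots [:- a, 1:])"
    using proots_prod_list[of "map (\<lambda>a. [:- a, 1:]) as"] by (fastforce simp: comp_def)
  also have "\<dots> = mset as" by (simp only: proots_linear_factor minus_minus) (induction as, auto)
  finally show ?thesis .
qed

text \<open>Connects the roots of the characteristic polynomial with an orthonormal eigenbasis: the
  matrix is similar to a diagonal one, whose characteristic polynomial splits into the factors of
  its diagonal entries, so both lists of eigenvalues agree as multisets.\<close>

lemma eigenvalues_abs_desc_tail_le:
  fixes M :: "nat \<Rightarrow> nat \<Rightarrow> real"
  assumes sym: "\<And>i j. i < n \<Longrightarrow> j < n \<Longrightarrow> M i j = M j i"
    and B: "\<And>i j. i < n \<Longrightarrow> j < n \<Longrightarrow> B i j = (\<Sum>k<r. a k i * b k j)"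
    and r: "r \<le> n"
  shows "(\<Sum>i=r+1..n. (nth_eigenvalue (Matrix.mat n n (\<lambda>(i, j). M i j)) i)\<^sup>2)
     \<le> (\<Sum>i<n. \<Sum>j<n. (M i j - B i j)\<^sup>2)"
proof -
  obtain u e where H: "\<forall>k<n. \<forall>l<n. (\<Sum>i<n. u k i * u l i) = (if k = l then 1 else 0)"
    "\<forall>k<n. \<forall>i<n. (\<Sum>j<n. M i j * u k j) = e k * u k i"
    using real_symmetric_orthonormal_eigenvectors[where n = n and m = n and A = M, OF sym] by auto
  have o: "(\<Sum>i<n. u k i * u l i) = (if k = l then 1 else 0)" if "k < n" "l < n" for k l
    using H(1) that by blast
  have ev: "(\<Sum>j<n. M i j * u k j) = e k * u k i" if "k < n" "i < n" for k i
    using H(2) that by blast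
  have o': "(\<Sum>k<n. u k i * u k j) = (if i = j then 1 else 0)" if "i < n" "j < n" for i j
    by (rule orthonormal_complete[where q = u and n = n]) (use that o in auto)
  define MM where "MM = Matrix.mat n n (\<lambda>(i, j). M i j)"
  define P where "P = Matrix.mat n n (\<lambda>(i, k). u k i)"
  define Q where "Q = Matrix.mat n n (\<lambda>(k, j). u k j)"
  define D where "D = Matrix.mat n n (\<lambda>(k, l). if k = l then e k else 0)"
  have PQ: "P * Q = 1\<^sub>m n"
    by (rule eq_matI) (auto simp: P_def Q_def scalar_prod_def o' atLeast0LessThan)
  have QP: "Q * P = 1\<^sub>m n"
    by (rule eq_matI) (auto simp: P_def Q_def scalar_prod_def o atLeast0LessThan)
  have MP: "MM * P = P * D"
  proof (rule eq_matI)
    fix i k assume "i < dim_row (P * D)" "k < dim_col (P * D)"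
    then have ik: "i < n" "k < n" by (auto simp: P_def D_def)
    have "(\<Sum>l<n. u l i * (if l = k then e l else 0)) = e k * u k i"
      using ik by (simp add: if_distrib[of "\<lambda>x. _ * x"] cong: if_cong)
    then show "(MM * P) $$ (i, k) = (P * D) $$ (i, k)"
      using ik ev[OF ik(2,1)] by (simp add: MM_def P_def D_def scalar_prod_def atLeast0LessThan)
  qed (auto simp: MM_def P_def D_def)
  have carr: "MM \<in> carrier_mat n n" "P \<in> carrier_mat n n" "Q \<in> carrier_mat n n" "D \<in> carrier_mat n n"
    by (auto simp: MM_def P_def Q_def D_def)
  have MPQ: "MM = P * D * Q"
  proof -
    have "MM = MM * (P * Q)" using carr PQ by simp
    also have "\<dots> = MM * P * Q" using carr by (simp add: assoc_mult_mat[of _ n n _ n _ n])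
    finally show ?thesis by (simp add: MP)
  qed
  have "similar_mat MM D"
    unfolding similar_mat_def similar_mat_wit_def Let_def
    using carr PQ QP MPQ by (intro exI[of _ P] exI[of _ Q]) auto
  then have "char_poly MM = char_poly D" by (rule char_poly_similar)
  also have "\<dots> = (\<Prod>a\<leftarrow>diag_mat D. [:- a, 1:])"
    using carr(4) by (rule char_poly_upper_triangular) (auto simp: D_def upper_triangular_def)
  also have "diag_mat D = map e [0..<n]"
    by (auto simp: diag_mat_def D_def intro!: nth_equalityI)
  finally have cp: "proots (char_poly MM) = mset (map e [0..<n])"
    by (simp only: proots_prod_linear_real)
  define es where "es = eigenvalues_abs_desc MM"
  have mes: "mset es = mset (map e [0..<n])"
    by (simp add: es_def eigenvalues_abs_desc_def cp del: mset_map)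
  then have len: "length es = n" using mset_eq_length by fastforce
  \<comment> \<open>Equal multisets differ by a permutation. The eigenvectors are reordered by the
    same \<open>p\<close>, so that the squared eigenvalues decrease.\<close>
  obtain p where p: "p permutes {..<n}" and pe: "permute_list p (map e [0..<n]) = es"
    using mset_eq_permutation[OF mes] by auto
  have pn: "p k < n" if "k < n" for k using permutes_in_image[OF p] that by auto
  have es_nth: "es ! k = e (p k)" if "k < n" for k
    using that pn[OF that] by (simp add: pe[symmetric] permute_list_def)
  have dec: "(e (p j))\<^sup>2 \<le> (e (p i))\<^sup>2" if "i \<le> j" "j < n" for i j
  proof -
    have "sorted (map (\<lambda>a. - \<bar>a\<bar>) es)" unfolding es_def eigenvalues_abs_desc_def by (rule sorted_sort_key)
    then have "- \<bar>es ! i\<bar> \<le> - \<bar>es ! j\<bar>"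
      using that len by (auto simp: sorted_iff_nth_mono)
    then have "\<bar>e (p j)\<bar> \<le> \<bar>e (p i)\<bar>" using that by (simp add: es_nth)
    then show ?thesis by (simp add: abs_le_square_iff)
  qed
  have "(\<Sum>k=r..<n. (e (p k))\<^sup>2) \<le> (\<Sum>i<n. \<Sum>j<n. (M i j - B i j)\<^sup>2)"
  proof (rule eckart_young_tail[where e = "\<lambda>k. e (p k)" and u = "\<lambda>k. u (p k)"])
    show "M i j = (\<Sum>k<n. e (p k) * u (p k) i * u (p k) j)" if "i < n" "j < n" for i j
    proof -
      have "M i j = (P * D * Q) $$ (i, j)" using that by (simp add: MPQ[symmetric]) (simp add: MM_def)
      also have "\<dots> = (MM * P * Q) $$ (i, j)" by (simp add: MP)
      also have "\<dots> = (\<Sum>k<n. e k * u k i * u k j)"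
        using that carr by (simp add: MM_def P_def Q_def scalar_prod_def atLeast0LessThan ev)
      also have "\<dots> = (\<Sum>k<n. e (p k) * u (p k) i * u (p k) j)"
        by (rule trans[OF sum.permute[OF p]]) (simp add: o_def)
      finally show ?thesis .
    qed
    show "(\<Sum>i<n. u (p k) i * u (p l) i) = (if k = l then 1 else 0)" if "k < n" "l < n" for k l
      using o[OF pn[OF that(1)] pn[OF that(2)]] permutes_inj[OF p] by (auto dest: injD)
    show "(\<Sum>k<n. u (p k) i * u (p k) j) = (if i = j then 1 else 0)" if "i < n" "j < n" for i j
      using o'[OF that] sum.permute[OF p, of "\<lambda>k. u k i * u k j"] by (simp add: o_def)
  qed (use dec B r in auto)
  \<comment> \<open>Eigenvalues are numbered from 1 and list positions from 0: the indices r + 1,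
    ..., n are the positions r, ..., n - 1.\<close>
  moreover have "(\<Sum>i=r+1..n. (nth_eigenvalue MM i)\<^sup>2) = (\<Sum>k=r..<n. (e (p k))\<^sup>2)"
  proof -
    have "(\<Sum>i=r+1..n. (nth_eigenvalue MM i)\<^sup>2) = (\<Sum>i=Suc r..<Suc n. (nth_eigenvalue MM i)\<^sup>2)"
      by (simp add: atLeastLessThanSuc_atLeastAtMost)
    also have "\<dots> = (\<Sum>k=r..<n. (nth_eigenvalue MM (Suc k))\<^sup>2)" by (rule sum.shift_bounds_Suc_ivl)
    also have "\<dots> = (\<Sum>k=r..<n. (e (p k))\<^sup>2)"
      by (intro sum.cong refl) (simp add: nth_eigenvalue_def es_def[symmetric] es_nth)
    finally show ?thesis .
  qed
  ultimately show ?thesis by (simp add: MM_def)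
qed

section \<open>Bump functions\<close>

primrec ck :: "nat \<Rightarrow> (real \<Rightarrow> real) \<Rightarrow> bool" where
  "ck 0 f = True"
| "ck (Suc n) f = (\<exists>f'. (\<forall>x. (f has_real_derivative f' x) (at x)) \<and> ck n f')"

text \<open>Each stage only asserts that a derivative exists everywhere; the continuity of every
  derivative comes from the existence of the next one.\<close>

definition smooth :: "(real \<Rightarrow> real) \<Rightarrow> bool" where
  "smooth f \<longleftrightarrow> (\<forall>n. ck n f)"

lemma ck_Suc_D: "ck (Suc n) f \<Longrightarrow> ck n f"
  by (induction n arbitrary: f) auto

lemma ck_const: "ck n (\<lambda>x. c)"
  by (induction n arbitrary: c) (auto intro!: exI[of _ "\<lambda>x. 0"])

lemma ck_id: "ck n (\<lambda>x. x)"
  by (cases n) (auto intro!: exI[of _ "\<lambda>x. 1"] derivative_eq_intros ck_const)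

lemma ck_add: "ck n f \<Longrightarrow> ck n g \<Longrightarrow> ck n (\<lambda>x. f x + g x)"
proof (induction n arbitrary: f g)
  case (Suc n)
  then obtain f' g' where "\<forall>x. (f has_real_derivative f' x) (at x)" "ck n f'"
    "\<forall>x. (g has_real_derivative g' x) (at x)" "ck n g'" by auto
  then show ?case using Suc.IH
    by (auto intro!: exI[of _ "\<lambda>x. f' x + g' x"] derivative_eq_intros)
qed auto

lemma ck_mult: "ck n f \<Longrightarrow> ck n g \<Longrightarrow> ck n (\<lambda>x. f x * g x)"
proof (induction n arbitrary: f g)
  case (Suc n)
  then obtain f' g' where "\<forall>x. (f has_real_derivative f' x) (at x)" "ck n f'"
    "\<forall>x. (g has_real_derivative g' x) (at x)" "ck n g'" by auto
  moreover have "ck n f" "ck n g" using Suc.prems ck_Suc_D by blast+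
  ultimately show ?case using Suc.IH
    by (auto intro!: exI[of _ "\<lambda>x. f' x * g x + f x * g' x"] derivative_eq_intros ck_add)
qed auto

lemma ck_compose: "ck n f \<Longrightarrow> ck n g \<Longrightarrow> ck n (\<lambda>x. f (g x))"
proof (induction n arbitrary: f g)
  case (Suc n)
  then obtain f' g' where f': "\<And>x. (f has_real_derivative f' x) (at x)" "ck n f'"
    and g': "\<And>x. (g has_real_derivative g' x) (at x)" "ck n g'" by auto
  have "ck n g" using Suc.prems ck_Suc_D by blast
  then have "ck n (\<lambda>x. f' (g x) * g' x)" using f'(2) g'(2) Suc.IH by (intro ck_mult) auto
  then show ?case using DERIV_chain2[OF f'(1) g'(1)]
    by (auto intro!: exI[of _ "\<lambda>x. f' (g x) * g' x"])
qed auto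

lemma smooth_const: "smooth (\<lambda>x. c)" by (simp add: smooth_def ck_const)
lemma smooth_id: "smooth (\<lambda>x. x)" by (simp add: smooth_def ck_id)
lemma smooth_add: "smooth f \<Longrightarrow> smooth g \<Longrightarrow> smooth (\<lambda>x. f x + g x)" by (simp add: smooth_def ck_add)
lemma smooth_mult: "smooth f \<Longrightarrow> smooth g \<Longrightarrow> smooth (\<lambda>x. f x * g x)" by (simp add: smooth_def ck_mult)
lemma smooth_compose: "smooth f \<Longrightarrow> smooth g \<Longrightarrow> smooth (\<lambda>x. f (g x))" by (simp add: smooth_def ck_compose)
lemma smooth_cmult: "smooth f \<Longrightarrow> smooth (\<lambda>x. c * f x)" by (simp add: smooth_mult smooth_const)
lemma smooth_diff: "smooth f \<Longrightarrow> smooth g \<Longrightarrow> smooth (\<lambda>x. f x - g x)"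
  using smooth_add[OF _ smooth_cmult[of g "-1"], of f] by simp

lemma smooth_antiderivative:
  assumes "\<And>x. (F has_real_derivative f x) (at x)" "smooth f"
  shows "smooth F"
  unfolding smooth_def
proof
  show "ck n F" for n
    using assms ck_Suc_D[of n F] by (auto simp: smooth_def)
qed

lemma smooth_has_derivative:
  assumes "smooth f"
  shows "(f has_real_derivative deriv f x) (at x)"
proof -
  have "ck (Suc 0) f" using assms smooth_def by blast
  then obtain f' where "(f has_real_derivative f' x) (at x)" by auto
  then show ?thesis using DERIV_imp_deriv by metis
qed

lemma smooth_deriv:
  assumes "smooth f"
  shows "smooth (deriv f)"
  unfolding smooth_def
proof
  fix n
  have "ck (Suc n) f" using assms smooth_def by blast
  then obtain f' where f': "\<And>x. (f has_real_derivative f' x) (at x)" "ck n f'" by auto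
  then have "deriv f = f'" by (auto intro: DERIV_imp_deriv)
  then show "ck n (deriv f)" using f' by simp
qed

lemma smooth_funpow_deriv: "smooth f \<Longrightarrow> smooth ((deriv ^^ n) f)"
  by (induction n) (auto simp: smooth_deriv)

lemma smooth_continuous: "smooth f \<Longrightarrow> continuous_on A f"
  using smooth_has_derivative by (meson DERIV_isCont continuous_at_imp_continuous_on)

lemma smooth_borel [measurable_dest]: "smooth f \<Longrightarrow> f \<in> borel_measurable borel"
  by (intro borel_measurable_continuous_onI smooth_continuous)

section \<open>Smoothness of the flat function exp (-1/x)\<close>

definition poly_flat :: "real poly \<Rightarrow> real \<Rightarrow> real" where
  "poly_flat p x = (if x > 0 then poly p (1 / x) * exp (- (1 / x)) else 0)"

lemma poly_flat_tendsto_0: "(poly_flat p \<longlongrightarrow> 0) (at_right 0)"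
proof -
  have "((\<lambda>t. \<Sum>i\<le>degree p. coeff p i * (t ^ i / exp t)) \<longlongrightarrow> (\<Sum>i\<le>degree p. coeff p i * 0)) at_top"
    by (intro tendsto_intros tendsto_power_div_exp_0)
  then have "((\<lambda>t. poly p t * exp (- t)) \<longlongrightarrow> 0) at_top"
    by (simp add: poly_altdef exp_minus sum_distrib_right divide_inverse mult.assoc)
  then have "((\<lambda>x. poly p (inverse x) * exp (- inverse x)) \<longlongrightarrow> 0) (at_right 0)"
    by (rule filterlim_compose[OF _ filterlim_inverse_at_top_right])
  then show ?thesis
    by (rule Lim_transform_eventually)
      (auto simp: poly_flat_def eventually_at_filter inverse_eq_divide)
qed

text \<open>With t = 1/x, the derivative in x of p(t) exp(-t) is t^2 (p(t) - p'(t)) exp(-t), so the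
  family over all polynomials p is closed under differentiation and smoothness becomes an induction.
  At 0 the difference quotient belongs to the family too, since division by x multiplies p by the
  variable.\<close>

lemma poly_flat_has_derivative:
  "(poly_flat p has_real_derivative poly_flat ([:0, 0, 1:] * (p - pderiv p)) x) (at x)"
proof -
  consider "x > 0" | "x < 0" | "x = 0" by linarith
  then show ?thesis
  proof cases
    case 1
    have "((\<lambda>x. poly p (1 / x) * exp (- (1 / x))) has_real_derivative
        poly_flat ([:0, 0, 1:] * (p - pderiv p)) x) (at x)"
      using 1 unfolding poly_flat_def
      by (auto intro!: derivative_eq_intros simp: field_simps power2_eq_square)
    then show ?thesis
      by (rule has_field_derivative_transform_within_open[where S = "{0<..}"])
        (use 1 in \<open>auto simp: poly_flat_def\<close>)
  next
    case 2
    have "((\<lambda>x. 0) has_real_derivative poly_flat ([:0, 0, 1:] * (p - pderiv p)) x) (at x)"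
      using 2 unfolding poly_flat_def by auto
    then show ?thesis
      by (rule has_field_derivative_transform_within_open[where S = "{..<0}"])
        (use 2 in \<open>auto simp: poly_flat_def\<close>)
  next
    case 3
    have "(\<lambda>h. (poly_flat p (0 + h) - poly_flat p 0) / h) = poly_flat (pCons 0 p)"
      by (auto simp: poly_flat_def fun_eq_iff)
    moreover have "(poly_flat (pCons 0 p) \<longlongrightarrow> 0) (at 0)"
    proof (rule filterlim_split_at)
      have "eventually (\<lambda>x. poly_flat (pCons 0 p) x = 0) (at_left 0)"
        by (auto simp: poly_flat_def eventually_at_filter)
      then show "(poly_flat (pCons 0 p) \<longlongrightarrow> 0) (at_left 0)"
        by (rule tendsto_eventually)
    qed (rule poly_flat_tendsto_0)
    ultimately show ?thesis unfolding 3 DERIV_def by (simp add: poly_flat_def)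
  qed
qed

lemma smooth_poly_flat: "smooth (poly_flat p)"
proof -
  have "ck n (poly_flat p)" for n
    by (induction n arbitrary: p) (use poly_flat_has_derivative in auto)
  then show ?thesis by (simp add: smooth_def)
qed

definition expflat :: "real \<Rightarrow> real" where
  "expflat x = (if x > 0 then exp (- (1 / x)) else 0)"

lemma smooth_expflat: "smooth expflat"
proof -
  have "expflat = poly_flat 1" by (auto simp: expflat_def poly_flat_def)
  then show ?thesis using smooth_poly_flat by metis
qed

lemma expflat_bounds: "0 \<le> expflat x" "expflat x \<le> 1"
  by (auto simp: expflat_def)

text \<open>The support stays away from 0 and 1: products over the coordinates then have compact
  support in the open cube, and a bump rescaled to one cell vanishes near the walls of this
  cell.\<close>

definition bump_fun :: "(real \<Rightarrow> real) \<Rightarrow> bool" where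
  "bump_fun \<phi> \<longleftrightarrow> smooth \<phi> \<and> (\<exists>a b. 0 < a \<and> a < b \<and> b < 1 \<and> (\<forall>x. x \<notin> {a..b} \<longrightarrow> \<phi> x = 0))"

lemma csD: "bump_fun \<phi> \<Longrightarrow> smooth \<phi>" by (simp add: bump_fun_def)

lemma bump_fun_zero: "bump_fun (\<lambda>x. 0)"
  unfolding bump_fun_def by (intro conjI smooth_const exI[of _ "1/3"] exI[of _ "1/2"]) auto

lemma bump_fun_mult_left: "bump_fun \<phi> \<Longrightarrow> smooth f \<Longrightarrow> bump_fun (\<lambda>x. f x * \<phi> x)"
  unfolding bump_fun_def using smooth_mult by fastforce

lemma bump_fun_cmult: "bump_fun \<phi> \<Longrightarrow> bump_fun (\<lambda>x. c * \<phi> x)"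
  by (rule bump_fun_mult_left) (auto intro: smooth_const)

lemma bump_fun_add:
  assumes "bump_fun \<phi>" "bump_fun \<psi>"
  shows "bump_fun (\<lambda>x. \<phi> x + \<psi> x)"
proof -
  obtain a b where 1: "0 < a" "a < b" "b < 1" "\<And>x. x \<notin> {a..b} \<Longrightarrow> \<phi> x = 0" using assms(1) bump_fun_def by blast
  obtain c d where 2: "0 < c" "c < d" "d < 1" "\<And>x. x \<notin> {c..d} \<Longrightarrow> \<psi> x = 0" using assms(2) bump_fun_def by blast
  have "\<phi> x + \<psi> x = 0" if "x \<notin> {min a c..max b d}" for x
  proof -
    have "x \<notin> {a..b}" "x \<notin> {c..d}" using that by auto
    then show ?thesis using 1(4) 2(4) by simp
  qed
  moreover have "0 < min a c" "min a c < max b d" "max b d < 1" using 1 2 by auto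
  ultimately show ?thesis unfolding bump_fun_def using assms smooth_add csD by blast
qed

lemma bump_fun_diff: "bump_fun \<phi> \<Longrightarrow> bump_fun \<psi> \<Longrightarrow> bump_fun (\<lambda>x. \<phi> x - \<psi> x)"
  using bump_fun_add[OF _ bump_fun_cmult[of \<psi> "-1"], of \<phi>] by simp

lemma bump_fun_sum: "finite A \<Longrightarrow> (\<And>i. i \<in> A \<Longrightarrow> bump_fun (\<phi> i)) \<Longrightarrow> bump_fun (\<lambda>x. \<Sum>i\<in>A. \<phi> i x)"
  by (induction A rule: finite_induct) (auto simp: bump_fun_zero intro: bump_fun_add)

lemma deriv_eq_0_outside:
  assumes "smooth \<phi>" "\<And>x. x \<notin> {a..b::real} \<Longrightarrow> \<phi> x = 0" "x \<notin> {a..b}"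
  shows "deriv \<phi> x = 0"
proof -
  have "((\<lambda>x. 0) has_real_derivative 0) (at x)" by simp
  then have "(\<phi> has_real_derivative 0) (at x)"
    by (rule has_field_derivative_transform_within_open[where S = "- {a..b}"]) (use assms in auto)
  then show ?thesis by (rule DERIV_imp_deriv)
qed

lemma bump_fun_deriv: "bump_fun \<phi> \<Longrightarrow> bump_fun (deriv \<phi>)"
  unfolding bump_fun_def using deriv_eq_0_outside[of \<phi>] smooth_deriv by blast

lemma bump_fun_outside: "bump_fun \<phi> \<Longrightarrow> x \<le> 0 \<or> x \<ge> 1 \<Longrightarrow> \<phi> x = 0"
  unfolding bump_fun_def by fastforce

lemma bump_fun_bounded:
  assumes "bump_fun \<phi>"
  shows "\<exists>B>0. \<forall>x. \<bar>\<phi> x\<bar> \<le> B"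
proof -
  have "compact (\<phi> ` {0..1})"
    by (intro compact_continuous_image smooth_continuous csD assms) auto
  then obtain B where B: "B > 0" "\<forall>y\<in>\<phi> ` {0..1}. norm y \<le> B"
    using compact_imp_bounded bounded_pos by blast
  have "\<bar>\<phi> x\<bar> \<le> B" for x
    using B bump_fun_outside[OF assms, of x] by (cases "x \<in> {0..1}") auto
  then show ?thesis using B by blast
qed

text \<open>The function is positive only where (t - a)(b - t) exceeds 1/n. Subtracting 1 keeps the
  support inside the open unit interval even for a = 0 and b = 1.\<close>

lemma bump_fun_expflat:
  assumes "0 \<le> a" "a \<le> b" "b \<le> 1" "n > 0"
  shows "bump_fun (\<lambda>t. expflat (real n * ((t - a) * (b - t)) - 1))"
proof -
  have sm: "smooth (\<lambda>t. expflat (real n * ((t - a) * (b - t)) - 1))"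
    by (intro smooth_compose[OF smooth_expflat] smooth_diff smooth_cmult smooth_mult smooth_id smooth_const)
  \<comment> \<open>For t in [a,b] within distance \<delta> of 0 or 1 one factor is below \<delta>
    and the other at most 1, so the product is at most 1/(2n). The cap 1/4 keeps \<delta> below 1 -
    \<delta>.\<close>
  define \<delta> where "\<delta> = min (1 / (2 * real n)) (1 / 4)"
  have d: "0 < \<delta>" "\<delta> < 1 - \<delta>" using assms by (auto simp: \<delta>_def min_def)
  have "expflat (real n * ((t - a) * (b - t)) - 1) = 0" if "t \<notin> {\<delta>..1-\<delta>}" for t
  proof -
    have "(t - a) * (b - t) \<le> \<delta>"
    proof (cases "a \<le> t \<and> t \<le> b")
      case True
      then have "t < \<delta> \<or> 1 - t < \<delta>" using that by auto
      then show ?thesis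
      proof
        assume "t < \<delta>"
        have "(t - a) * (b - t) \<le> (t - a) * 1" using True assms by (intro mult_left_mono) auto
        then show ?thesis using \<open>t < \<delta>\<close> assms by simp
      next
        assume "1 - t < \<delta>"
        have "(t - a) * (b - t) \<le> 1 * (b - t)" using True assms by (intro mult_right_mono) auto
        then show ?thesis using \<open>1 - t < \<delta>\<close> assms by simp
      qed
    next
      case False
      then have "(t - a) * (b - t) \<le> 0" using assms by (auto simp: mult_le_0_iff)
      then show ?thesis using d by simp
    qed
    also have "\<delta> \<le> 1 / (2 * real n)" by (simp add: \<delta>_def)
    finally have "real n * ((t - a) * (b - t)) \<le> 1"
      using assms(4) by (simp add: field_simps)
    then show ?thesis by (simp add: expflat_def)
  qed
  then show ?thesis using sm d unfolding bump_fun_def by (intro conjI exI[of _ \<delta>] exI[of _ "1-\<delta>"]) auto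
qed

text \<open>Inside the interval the exponent -1/(n q - 1), with q = (t - a)(b - t), tends to 0;
  elsewhere the argument never becomes positive. This is the passage from smooth bumps to indicators
  of boxes.\<close>

lemma expflat_tendsto_indicator:
  assumes "a \<le> b"
  shows "(\<lambda>n. expflat (real (Suc n) * ((t - a) * (b - t)) - 1)) \<longlonglongrightarrow> indicator {a<..<b} t"
proof (cases "t \<in> {a<..<b}")
  case True
  define q where "q = (t - a) * (b - t)"
  have q: "q > 0" using True by (simp add: q_def)
  have lim: "filterlim (\<lambda>n. real (Suc n) * q - 1) at_top sequentially"
    using q by real_asymp
  have "(\<lambda>n. exp (- (1 / (real (Suc n) * q - 1)))) \<longlonglongrightarrow> exp (- 0)"
    by (intro tendsto_intros tendsto_divide_0[OF tendsto_const] filterlim_at_top_imp_at_infinity[OF lim])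
  moreover have "eventually (\<lambda>n. exp (- (1 / (real (Suc n) * q - 1))) = expflat (real (Suc n) * q - 1)) sequentially"
    using filterlim_at_top_dense[THEN iffD1, OF lim, rule_format, of 0]
    by eventually_elim (simp add: expflat_def)
  ultimately show ?thesis
    using True unfolding q_def[symmetric] by (simp add: Lim_transform_eventually)
next
  case False
  then have "(t - a) * (b - t) \<le> 0" using assms by (auto simp: mult_le_0_iff)
  then have "real (Suc n) * ((t - a) * (b - t)) - 1 \<le> 0" for n
    using mult_nonneg_nonpos[of "real (Suc n)" "(t - a) * (b - t)"] by linarith
  then show ?thesis using False by (simp add: expflat_def not_less[symmetric])
qed

section \<open>Integral operators along a coordinate\<close>

no_notation vec_index (infixl \<open>$\<close> 100)
no_notation scalar_prod (infix \<open>\<bullet>\<close> 70)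

text \<open>The uniform distribution on the open unit cube, realised as a measure on the whole
  space: changing one coordinate then never leaves the space, and measurability is Borel
  measurability.\<close>

definition unif :: "'a::euclidean_space measure" where
  "unif = density lborel (\<lambda>x. ennreal (indicator (box 0 One) x))"

lemma sets_unif [simp, measurable_cong]: "sets unif = sets borel"
  and space_unif [simp]: "space unif = UNIV"
  by (simp_all add: unif_def)

lemma measurable_unif [simp]: "measurable unif N = measurable borel N"
  by (rule measurable_cong_sets) simp_all

lemma prob_space_unif: "prob_space (unif :: 'a::euclidean_space measure)"
proof
  have "emeasure unif (space (unif :: 'a measure)) = emeasure lborel (box 0 One :: 'a set)"
    by (simp add: unif_def emeasure_density ennreal_indicator)
  also have "\<dots> = 1" by (simp add: emeasure_lborel_box_eq)
  finally show "emeasure unif (space (unif :: 'a measure)) = 1" .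
qed

interpretation unif: prob_space "unif :: 'a::euclidean_space measure"
  by (rule prob_space_unif)

interpretation unif_pair: pair_prob_space "unif :: 'a::euclidean_space measure" "unif :: 'b::euclidean_space measure"
  by unfold_locales

lemma integral_unif:
  fixes f :: "'a::euclidean_space \<Rightarrow> real"
  assumes [measurable]: "f \<in> borel_measurable borel"
  shows "(\<integral>x. f x \<partial>unif) = (\<integral>x. indicator (box 0 One) x * f x \<partial>lborel)"
  unfolding unif_def by (subst integral_density) auto

lemma nn_integral_unif:
  fixes f :: "'a::euclidean_space \<Rightarrow> ennreal"
  assumes [measurable]: "f \<in> borel_measurable borel"
  shows "(\<integral>\<^sup>+x. f x \<partial>unif) = (\<integral>\<^sup>+x. indicator (box 0 One) x * f x \<partial>lborel)"
  unfolding unif_def by (subst nn_integral_density) (auto simp: ennreal_indicator)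

lemma AE_unif_box: "AE x in unif. x \<in> box 0 (One::'a::euclidean_space)"
  unfolding unif_def by (subst AE_density) (auto simp: indicator_def)

section \<open>Exchanging one coordinate with an independent variable\<close>

definition upd :: "real ^ 'd \<Rightarrow> 'd \<Rightarrow> real \<Rightarrow> real ^ 'd" where
  "upd x i t = (\<chi> j. if j = i then t else x $ j)"

lemma upd_nth [simp]: "upd x i t $ j = (if j = i then t else x $ j)"
  by (simp add: upd_def)

lemma upd_upd [simp]: "upd (upd x i s) i t = upd x i t"
  by (simp add: Finite_Cartesian_Product.vec_eq_iff)

lemma upd_same [simp]: "upd x i (x $ i) = x"
  by (simp add: Finite_Cartesian_Product.vec_eq_iff)

lemma upd_commute: "i \<noteq> j \<Longrightarrow> upd (upd x i s) j t = upd (upd x j t) i s"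
  by (simp add: Finite_Cartesian_Product.vec_eq_iff)

lemma upd_conv: "upd x i t = x + (t - x $ i) *\<^sub>R axis i 1"
  by (simp add: Finite_Cartesian_Product.vec_eq_iff axis_def)

lemma borel_measurable_vec_nth [measurable (raw)]:
  "f \<in> M \<rightarrow>\<^sub>M borel \<Longrightarrow> (\<lambda>z. (f z :: real ^ 'd::finite) $ i) \<in> M \<rightarrow>\<^sub>M borel"
  by (rule measurable_compose[of f _ borel])
    (auto intro!: borel_measurable_continuous_onI continuous_intros)

lemma measurable_upd [measurable (raw)]:
  fixes f :: "'z \<Rightarrow> real ^ 'd::finite"
  assumes [measurable]: "f \<in> M \<rightarrow>\<^sub>M borel" "g \<in> M \<rightarrow>\<^sub>M borel"
  shows "(\<lambda>z. upd (f z) i (g z)) \<in> M \<rightarrow>\<^sub>M borel"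
  unfolding upd_conv by measurable

lemma sum_Basis_vec_nth: "(\<Sum>x\<in>Basis. (x :: real ^ 'd::finite) $ i) = 1"
proof -
  have "(\<Sum>x\<in>Basis. (x :: real ^ 'd) $ i) = One \<bullet> (axis i 1 :: real ^ 'd)"
    unfolding inner_sum_left by (simp add: cart_eq_inner_axis)
  also have "\<dots> = 1" using inner_sum_left_Basis[of "axis i 1 :: real ^ 'd" "\<lambda>_. 1"] by (simp add: axis_in_Basis_iff)
  finally show ?thesis .
qed

lemma mem_unit_box: "(x :: real ^ 'd::finite) \<in> box 0 One \<longleftrightarrow> (\<forall>i. 0 < x $ i \<and> x $ i < 1)"
  by (simp add: mem_box_cart sum_Basis_vec_nth)

text \<open>Exchanges the i-th coordinate with an extra real variable. Invariance of the measure
  under this involution serves as Fubini's theorem in a single coordinate, without splitting the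
  space into factors.\<close>

definition swap_coord :: "'d \<Rightarrow> (real ^ 'd) \<times> real \<Rightarrow> (real ^ 'd) \<times> real" where
  "swap_coord i p = (upd (fst p) i (snd p), fst p $ i)"

lemma swap_coord_swap [simp]: "swap_coord i (swap_coord i p) = p"
  by (simp add: swap_coord_def)

lemma swap_coord_inner: "swap_coord i p \<bullet> q = (p :: (real ^ 'd::finite) \<times> real) \<bullet> swap_coord i q"
  by (cases p; cases q) (simp add: swap_coord_def upd_conv inner_simps inner_axis inner_axis' algebra_simps)

lemma swap_coord_diff: "swap_coord i p - swap_coord i q = swap_coord i ((p :: (real ^ 'd::finite) \<times> real) - q)"
  by (simp add: swap_coord_def Finite_Cartesian_Product.vec_eq_iff)

lemma swap_coord_Basis: "(b :: (real ^ 'd::finite) \<times> real) \<in> Basis \<Longrightarrow> swap_coord i b \<in> Basis"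
proof -
  have 1: "swap_coord i (axis j 1 :: real ^ 'd, 0) = (if j = i then (0, 1) else (axis j 1, 0))" for j
    by (auto simp: swap_coord_def Finite_Cartesian_Product.vec_eq_iff axis_def)
  have 2: "swap_coord i (0 :: real ^ 'd, 1) = (axis i 1, 0)"
    by (auto simp: swap_coord_def Finite_Cartesian_Product.vec_eq_iff axis_def)
  have 3: "(axis j 1 :: real ^ 'd, 0 :: real) \<in> Basis" "(0 :: real ^ 'd, 1 :: real) \<in> Basis" for j
    by (auto simp: Basis_prod_def Basis_vec_def)
  assume "b \<in> Basis"
  then consider j where "b = (axis j 1, 0)" | "b = (0, 1)"
    by (auto simp: Basis_prod_def Basis_vec_def)
  then show "swap_coord i b \<in> Basis"
    by cases (simp_all add: 1 2 3)
qed

lemma bij_betw_swap_Basis: "bij_betw (swap_coord i) (Basis :: ((real ^ 'd::finite) \<times> real) set) Basis"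
  by (rule bij_betw_byWitness[where f' = "swap_coord i"]) (auto simp: swap_coord_Basis)

lemma measurable_swap [measurable]: "swap_coord i \<in> borel \<Otimes>\<^sub>M borel \<rightarrow>\<^sub>M (borel \<Otimes>\<^sub>M borel :: ((real ^ 'd::finite) \<times> real) measure)"
  unfolding swap_coord_def[abs_def] by measurable

text \<open>The swap permutes the standard basis and is its own transpose, so it maps a box onto a
  box with the same side lengths in another order.\<close>

lemma distr_swap_lborel:
  "distr lborel borel (swap_coord i) = (lborel :: ((real ^ 'd::finite) \<times> real) measure)"
proof (rule lborel_eqI[symmetric])
  fix l u :: "(real ^ 'd) \<times> real"
  assume lu: "\<And>b. b \<in> Basis \<Longrightarrow> l \<bullet> b \<le> u \<bullet> b"
  have vim: "swap_coord i -` box l u = box (swap_coord i l) (swap_coord i u)"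
  proof (rule Set.set_eqI)
    fix x
    have "x \<in> swap_coord i -` box l u \<longleftrightarrow> (\<forall>b\<in>Basis. l \<bullet> b < x \<bullet> swap_coord i b \<and> x \<bullet> swap_coord i b < u \<bullet> b)"
      by (simp add: mem_box swap_coord_inner)
    also have "\<dots> \<longleftrightarrow> (\<forall>b\<in>swap_coord i ` Basis. l \<bullet> b < x \<bullet> swap_coord i b \<and> x \<bullet> swap_coord i b < u \<bullet> b)"
      using bij_betw_swap_Basis[of i] by (simp add: bij_betw_def)
    also have "\<dots> \<longleftrightarrow> x \<in> box (swap_coord i l) (swap_coord i u)"
      by (simp add: mem_box swap_coord_inner)
    finally show "x \<in> swap_coord i -` box l u \<longleftrightarrow> x \<in> box (swap_coord i l) (swap_coord i u)" .
  qed
  have lu': "swap_coord i l \<bullet> b \<le> swap_coord i u \<bullet> b" if "b \<in> Basis" for b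
    using lu[OF swap_coord_Basis[OF that]] by (simp add: swap_coord_inner)
  have "swap_coord i \<in> borel \<rightarrow>\<^sub>M (borel :: ((real ^ 'd) \<times> real) measure)"
    using measurable_swap[of i] by (simp add: borel_prod)
  then have "emeasure (distr lborel borel (swap_coord i)) (box l u) = emeasure lborel (box (swap_coord i l) (swap_coord i u))"
    by (subst emeasure_distr) (auto simp: vim)
  also have "\<dots> = (\<Prod>b\<in>Basis. (swap_coord i u - swap_coord i l) \<bullet> b)"
    using lu' by (subst emeasure_lborel_box) auto
  also have "\<dots> = (\<Prod>b\<in>Basis. (u - l) \<bullet> swap_coord i b)"
    by (simp add: swap_coord_diff swap_coord_inner)
  also have "\<dots> = (\<Prod>b\<in>Basis. (u - l) \<bullet> b)"
    by (rule arg_cong[of _ _ ennreal]) (rule prod.reindex_bij_betw[OF bij_betw_swap_Basis])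
  finally show "emeasure (distr lborel borel (swap_coord i)) (box l u) = (\<Prod>b\<in>Basis. (u - l) \<bullet> b)" .
qed simp

lemma unif_pair_density:
  "unif \<Otimes>\<^sub>M (unif :: real measure) = density (lborel :: ((real ^ 'd::finite) \<times> real) measure)
     (\<lambda>p. ennreal (indicator (box 0 One) (fst p) * indicator (box 0 One) (snd p)))"
proof -
  have "sigma_finite_measure (density lborel (\<lambda>x. ennreal (indicator (box 0 One :: real set) x)))"
    using unif.sigma_finite_measure_axioms[where 'a = real] unfolding unif_def .
  then have "unif \<Otimes>\<^sub>M (unif :: real measure) = density ((lborel :: (real ^ 'd) measure) \<Otimes>\<^sub>M lborel)
     (\<lambda>(x, t). ennreal (indicator (box 0 One) x) * ennreal (indicator (box 0 One) t))"
    unfolding unif_def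
    by (intro pair_measure_density lborel.sigma_finite_measure_axioms) measurable
  then show ?thesis
    unfolding lborel_prod by (simp only: case_prod_unfold ennreal_mult indicator_pos_le)
qed

lemma distr_swap_unif:
  "distr (unif \<Otimes>\<^sub>M unif) (unif \<Otimes>\<^sub>M unif) (swap_coord i) = (unif \<Otimes>\<^sub>M unif :: ((real ^ 'd::finite) \<times> real) measure)"
proof (rule measure_eqI)
  fix A :: "((real ^ 'd) \<times> real) set"
  assume "A \<in> sets (distr (unif \<Otimes>\<^sub>M unif) (unif \<Otimes>\<^sub>M unif) (swap_coord i))"
  then have A: "A \<in> sets borel" by (simp add: borel_prod[symmetric] cong: sets_pair_measure_cong)
  define w where "w p = ennreal (indicator (box 0 One) (fst p) * indicator (box 0 One) (snd p))"
    for p :: "(real ^ 'd) \<times> real"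
  have dens: "unif \<Otimes>\<^sub>M unif = density lborel w"
    unfolding unif_pair_density w_def ..
  have sw: "swap_coord i \<in> borel \<rightarrow>\<^sub>M (borel :: ((real ^ 'd) \<times> real) measure)"
    using measurable_swap[of i] by (simp add: borel_prod)
  have [measurable]: "w \<in> borel_measurable borel"
    unfolding borel_prod[symmetric] w_def by measurable
  have w: "w (swap_coord i p) = w p" for p
    by (cases p) (auto simp: swap_coord_def mem_unit_box indicator_def w_def)
  have "emeasure (distr (unif \<Otimes>\<^sub>M unif) (unif \<Otimes>\<^sub>M unif) (swap_coord i)) A
      = emeasure (unif \<Otimes>\<^sub>M unif) (swap_coord i -` A)"
    using A by (subst emeasure_distr) (auto simp: space_pair_measure borel_prod[symmetric] cong: sets_pair_measure_cong)
  also have "\<dots> = (\<integral>\<^sup>+p. w p * indicator A (swap_coord i p) \<partial>lborel)"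
    unfolding dens using A measurable_sets[OF sw A]
    by (subst emeasure_density) (auto simp: indicator_vimage o_def simp del: box_real)
  also have "\<dots> = (\<integral>\<^sup>+p. w (swap_coord i p) * indicator A (swap_coord i p) \<partial>lborel)"
    by (simp only: w)
  also have "\<dots> = (\<integral>\<^sup>+p. w p * indicator A p \<partial>distr lborel borel (swap_coord i))"
    using sw A by (subst nn_integral_distr) auto
  also have "\<dots> = emeasure (unif \<Otimes>\<^sub>M unif) A"
    unfolding dens distr_swap_lborel using A by (subst emeasure_density) (auto simp del: box_real)
  finally show "emeasure (distr (unif \<Otimes>\<^sub>M unif) (unif \<Otimes>\<^sub>M unif) (swap_coord i)) A = emeasure (unif \<Otimes>\<^sub>M unif) A" .
qed simp

text \<open>If x is uniform and t is an independent uniform variable, then exchanging the i-th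
  coordinate of x with t does not change their joint law.\<close>

lemma integral_swap:
  fixes F :: "real ^ 'd::finite \<Rightarrow> real \<Rightarrow> real"
  assumes F: "integrable (unif \<Otimes>\<^sub>M unif) (\<lambda>(x, t). F x t)"
  shows "(\<integral>x. (\<integral>t. F (upd x i t) (x $ i) \<partial>unif) \<partial>unif) = (\<integral>x. (\<integral>t. F x t \<partial>unif) \<partial>unif)"
proof -
  let ?G = "\<lambda>p. F (fst p) (snd p)"
  have G: "integrable (unif \<Otimes>\<^sub>M unif) ?G" using F by (simp add: case_prod_unfold)
  then have Gm: "?G \<in> borel_measurable (unif \<Otimes>\<^sub>M unif)" by simp
  have sm: "swap_coord i \<in> unif \<Otimes>\<^sub>M unif \<rightarrow>\<^sub>M unif \<Otimes>\<^sub>M unif" by simp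
  have Gs: "integrable (unif \<Otimes>\<^sub>M unif) (\<lambda>p. ?G (swap_coord i p))"
    using G by (subst integrable_distr_eq[OF sm Gm, symmetric]) (simp add: distr_swap_unif)
  have "(\<integral>x. (\<integral>t. F (upd x i t) (x $ i) \<partial>unif) \<partial>unif) = (\<integral>p. ?G (swap_coord i p) \<partial>(unif \<Otimes>\<^sub>M unif))"
    using unif_pair.integral_fst'[OF Gs] by (simp add: swap_coord_def)
  also have "\<dots> = (\<integral>p. ?G p \<partial>(unif \<Otimes>\<^sub>M unif))"
    using integral_distr[OF sm Gm] by (simp add: distr_swap_unif)
  also have "\<dots> = (\<integral>x. (\<integral>t. F x t \<partial>unif) \<partial>unif)"
    using unif_pair.integral_fst'[OF G] by simp
  finally show ?thesis .
qed

section \<open>Bounded Borel functions and operators with bounded kernels\<close>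

definition bdd_borel :: "('a::topological_space \<Rightarrow> real) \<Rightarrow> bool" where
  "bdd_borel g \<longleftrightarrow> g \<in> borel_measurable borel \<and> (\<exists>B. \<forall>x. \<bar>g x\<bar> \<le> B)"

lemma bdd_borel_measurable [measurable_dest]: "bdd_borel g \<Longrightarrow> g \<in> borel_measurable borel"
  by (simp add: bdd_borel_def)

lemma bbI: "g \<in> borel_measurable borel \<Longrightarrow> (\<And>x. \<bar>g x\<bar> \<le> B) \<Longrightarrow> bdd_borel g"
  by (auto simp: bdd_borel_def)

lemma bdd_borel_bound:
  assumes "bdd_borel g" shows "\<exists>B>0. \<forall>x. \<bar>g x\<bar> \<le> B"
proof -
  obtain B where B: "\<forall>x. \<bar>g x\<bar> \<le> B" using assms unfolding bdd_borel_def by blast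
  then have "\<forall>x. \<bar>g x\<bar> \<le> max B 1" by (auto simp: le_max_iff_disj)
  then show ?thesis by (intro exI[of _ "max B 1"]) auto
qed

lemma bdd_borel_integrable: "bdd_borel (g :: 'a::euclidean_space \<Rightarrow> real) \<Longrightarrow> integrable unif g"
  by (metis bdd_borel_def unif.integrable_const_bound[OF AE_I2] measurable_unif real_norm_def)

lemma bdd_borel_const [simp]: "bdd_borel (\<lambda>x. c)" by (rule bbI[of _ "\<bar>c\<bar>"]) auto

lemma bdd_borel_add:
  assumes "bdd_borel f" "bdd_borel g"
  shows "bdd_borel (\<lambda>x. f x + g x)"
proof -
  obtain A B where b: "\<And>x. \<bar>f x\<bar> \<le> A" "\<And>x. \<bar>g x\<bar> \<le> B"
    using assms by (meson bdd_borel_def)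
  have "\<bar>f x + g x\<bar> \<le> A + B" for x
    using b(1)[of x] b(2)[of x] by linarith
  then show ?thesis using bdd_borel_measurable[OF assms(1)] bdd_borel_measurable[OF assms(2)] by (intro bbI) auto
qed

lemma bdd_borel_mult:
  assumes "bdd_borel f" "bdd_borel g"
  shows "bdd_borel (\<lambda>x. f x * g x)"
proof -
  obtain A where A: "0 < A" "\<And>x. \<bar>f x\<bar> \<le> A" using bdd_borel_bound[OF assms(1)] by auto
  obtain B where B: "0 < B" "\<And>x. \<bar>g x\<bar> \<le> B" using bdd_borel_bound[OF assms(2)] by auto
  have "\<bar>f x * g x\<bar> \<le> A * B" for x unfolding abs_mult using A B by (intro mult_mono) auto
  then show ?thesis using bdd_borel_measurable[OF assms(1)] bdd_borel_measurable[OF assms(2)] by (intro bbI) auto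
qed

lemma bdd_borel_cmult: "bdd_borel f \<Longrightarrow> bdd_borel (\<lambda>x. c * f x)" by (intro bdd_borel_mult) auto

lemma bdd_borel_diff: "bdd_borel f \<Longrightarrow> bdd_borel g \<Longrightarrow> bdd_borel (\<lambda>x. f x - g x)"
  using bdd_borel_add[OF _ bdd_borel_cmult[of g "-1"], of f] by simp

lemma bdd_borel_compose: "bdd_borel g \<Longrightarrow> h \<in> borel \<rightarrow>\<^sub>M borel \<Longrightarrow> bdd_borel (\<lambda>x. g (h x))"
  unfolding bdd_borel_def by auto

lemma bdd_borel_indicator: "A \<in> sets borel \<Longrightarrow> bdd_borel (indicator A)"
  by (rule bbI[of _ 1]) (auto simp: indicator_def)

lemma abs_integral_le:
  fixes f :: "'a \<Rightarrow> real"
  shows "\<bar>\<integral>x. f x \<partial>M\<bar> \<le> (\<integral>x. \<bar>f x\<bar> \<partial>M)"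
  using integral_norm_bound[of M f] by simp

lemma measure_unif_UNIV [simp]: "measure (unif :: 'a::euclidean_space measure) UNIV = 1"
  using unif.prob_space[where 'a = 'a] by simp

text \<open>The first argument of the kernel is the output variable, the second is integrated; the
  adjoint operator has the kernel with exchanged arguments.\<close>

definition line_op :: "(real \<Rightarrow> real \<Rightarrow> real) \<Rightarrow> (real \<Rightarrow> real) \<Rightarrow> real \<Rightarrow> real" where
  "line_op k \<phi> u = (\<integral>t. k u t * \<phi> t \<partial>unif)"

definition coord_op :: "'d \<Rightarrow> (real \<Rightarrow> real \<Rightarrow> real) \<Rightarrow> (real ^ 'd::finite \<Rightarrow> real) \<Rightarrow> real ^ 'd \<Rightarrow> real" where
  "coord_op i k g x = line_op k (\<lambda>t. g (upd x i t)) (x $ i)"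

definition bdd_ker :: "(real \<Rightarrow> real \<Rightarrow> real) \<Rightarrow> bool" where
  "bdd_ker k \<longleftrightarrow> (\<lambda>(u, t). k u t) \<in> borel_measurable (borel \<Otimes>\<^sub>M borel) \<and> (\<exists>B. \<forall>u t. \<bar>k u t\<bar> \<le> B)"

lemma bkerI:
  "(\<lambda>(u, t). k u t) \<in> borel_measurable (borel \<Otimes>\<^sub>M borel) \<Longrightarrow> (\<And>u t. \<bar>k u t\<bar> \<le> B) \<Longrightarrow> bdd_ker k"
  by (auto simp: bdd_ker_def)

lemma bdd_ker_bound:
  assumes "bdd_ker k" shows "\<exists>B>0. \<forall>u t. \<bar>k u t\<bar> \<le> B"
proof -
  obtain B where "\<forall>u t. \<bar>k u t\<bar> \<le> B" using assms unfolding bdd_ker_def by blast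
  then have "\<forall>u t. \<bar>k u t\<bar> \<le> max B 1" by (auto simp: le_max_iff_disj)
  then show ?thesis by (intro exI[of _ "max B 1"]) auto
qed

lemma bdd_ker_measurable:
  assumes "bdd_ker k" and [measurable]: "f \<in> borel_measurable M" "g \<in> borel_measurable M"
  shows "(\<lambda>z. k (f z) (g z)) \<in> borel_measurable M"
proof -
  have [measurable]: "(\<lambda>(u, t). k u t) \<in> borel_measurable (borel \<Otimes>\<^sub>M borel)"
    using assms by (simp add: bdd_ker_def)
  have "(\<lambda>z. (\<lambda>(u, t). k u t) (f z, g z)) \<in> borel_measurable M" by measurable
  then show ?thesis by simp
qed

lemma bdd_ker_transpose: "bdd_ker k \<Longrightarrow> bdd_ker (\<lambda>u t. k t u)"
  using bdd_ker_measurable[of k "\<lambda>p. snd p" "borel \<Otimes>\<^sub>M borel" "\<lambda>p. fst p"]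
  unfolding bdd_ker_def by (auto simp: case_prod_unfold)

lemma bdd_borel_slice: "bdd_borel g \<Longrightarrow> bdd_borel (\<lambda>t. g (upd x i t))"
  for g :: "real ^ 'd::finite \<Rightarrow> real"
  by (rule bdd_borel_compose) simp_all

lemma bdd_borel_ker:
  assumes k: "bdd_ker k"
  shows "bdd_borel (k u)"
proof -
  obtain B where "B > 0" "\<And>u t. \<bar>k u t\<bar> \<le> B" using bdd_ker_bound[OF k] by auto
  moreover have "(\<lambda>t. k u t) \<in> borel_measurable borel" by (rule bdd_ker_measurable[OF k]) simp_all
  ultimately show ?thesis by (intro bbI) auto
qed

lemma line_op_measurable:
  assumes k: "bdd_ker k" and [measurable]: "(\<lambda>(z, t). G z t) \<in> borel_measurable (M \<Otimes>\<^sub>M borel)"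
    and [measurable]: "f \<in> borel_measurable M"
  shows "(\<lambda>z. line_op k (G z) (f z)) \<in> borel_measurable M"
proof -
  have [measurable]: "(\<lambda>p. k (f (fst p)) (snd p)) \<in> borel_measurable (M \<Otimes>\<^sub>M unif)"
    by (rule bdd_ker_measurable[OF k]) measurable
  have [measurable]: "(\<lambda>(z, t). G z t) \<in> borel_measurable (M \<Otimes>\<^sub>M unif)"
    using assms(2) by (simp cong: measurable_cong_sets sets_pair_measure_cong)
  have "(\<lambda>z. \<integral>t. (\<lambda>p. k (f (fst p)) (snd p) * (\<lambda>(z, t). G z t) p) (z, t) \<partial>unif) \<in> borel_measurable M"
    by measurable
  then show ?thesis by (simp add: line_op_def[abs_def])
qed

text \<open>The parameter z will be the second argument of the graphon. Expectations over pairs of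
  sample points require the approximation to be measurable jointly in both arguments.\<close>

lemma coord_op_measurable:
  fixes G :: "'z \<Rightarrow> real ^ 'd::finite \<Rightarrow> real"
  assumes k: "bdd_ker k" and G: "(\<lambda>(z, x). G z x) \<in> borel_measurable (M \<Otimes>\<^sub>M borel)"
  shows "(\<lambda>(z, x). coord_op i k (G z) x) \<in> borel_measurable (M \<Otimes>\<^sub>M borel)"
proof -
  have "(\<lambda>p. line_op k (\<lambda>t. G (fst p) (upd (snd p) i t)) (snd p $ i)) \<in> borel_measurable (M \<Otimes>\<^sub>M borel)"
  proof (rule line_op_measurable[OF k])
    have "(\<lambda>q. (fst (fst q), upd (snd (fst q)) i (snd q))) \<in> (M \<Otimes>\<^sub>M borel) \<Otimes>\<^sub>M borel \<rightarrow>\<^sub>M M \<Otimes>\<^sub>M borel"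
      by measurable
    from measurable_compose[OF this G]
    show "(\<lambda>(p, t). G (fst p) (upd (snd p) i t)) \<in> borel_measurable ((M \<Otimes>\<^sub>M borel) \<Otimes>\<^sub>M borel)"
      by (simp add: case_prod_unfold)
  qed measurable
  then show ?thesis by (simp add: coord_op_def case_prod_unfold)
qed

lemma line_op_bound:
  assumes "\<And>u t. \<bar>k u t\<bar> \<le> B" "\<And>t. \<bar>\<phi> t\<bar> \<le> A" "bdd_ker k" "bdd_borel \<phi>"
  shows "\<bar>line_op k \<phi> u\<bar> \<le> B * A"
proof -
  have "\<bar>line_op k \<phi> u\<bar> \<le> (\<integral>t. B * A \<partial>(unif :: real measure))"
    unfolding line_op_def
  proof (rule order.trans[OF abs_integral_le], rule integral_mono)
    show "integrable unif (\<lambda>t. \<bar>k u t * \<phi> t\<bar>)"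
      by (intro integrable_abs bdd_borel_integrable bdd_borel_mult bdd_borel_ker assms)
    show "\<bar>k u t * \<phi> t\<bar> \<le> B * A" for t
      unfolding abs_mult using assms(1)[of u t] assms(2)[of t] by (intro mult_mono) auto
  qed auto
  then show ?thesis by (simp add: unif.prob_space)
qed

lemma bdd_borel_op1: "bdd_ker k \<Longrightarrow> bdd_borel \<phi> \<Longrightarrow> bdd_borel (line_op k \<phi>)"
proof -
  assume k: "bdd_ker k" and \<phi>: "bdd_borel \<phi>"
  obtain B where B: "B > 0" "\<And>u t. \<bar>k u t\<bar> \<le> B" using bdd_ker_bound[OF k] by auto
  obtain A where A: "A > 0" "\<And>t. \<bar>\<phi> t\<bar> \<le> A" using bdd_borel_bound[OF \<phi>] by auto
  have [measurable]: "\<phi> \<in> borel_measurable borel" using \<phi> by (rule bdd_borel_measurable)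
  have "(\<lambda>u. line_op k \<phi> u) \<in> borel_measurable borel"
    by (rule line_op_measurable[OF k]) measurable
  then show ?thesis using line_op_bound[OF B(2) A(2) k \<phi>] by (intro bbI) auto
qed

lemma bdd_borel_op: "bdd_ker k \<Longrightarrow> bdd_borel g \<Longrightarrow> bdd_borel (coord_op i k g)"
proof -
  assume k: "bdd_ker k" and g: "bdd_borel g"
  obtain B where B: "B > 0" "\<And>u t. \<bar>k u t\<bar> \<le> B" using bdd_ker_bound[OF k] by auto
  obtain A where A: "A > 0" "\<And>t. \<bar>g t\<bar> \<le> A" using bdd_borel_bound[OF g] by auto
  have [measurable]: "g \<in> borel_measurable borel" using g by (rule bdd_borel_measurable)
  have "(\<lambda>(z, x). coord_op i k ((\<lambda>_. g) z) x) \<in> borel_measurable ((borel :: real measure) \<Otimes>\<^sub>M borel)"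
    by (rule coord_op_measurable[OF k]) measurable
  from measurable_compose[OF _ this, of "\<lambda>x. (0, x)" borel]
  have "(\<lambda>x. coord_op i k g x) \<in> borel_measurable borel" by simp
  moreover have "\<bar>coord_op i k g x\<bar> \<le> B * A" for x
    unfolding coord_op_def by (rule line_op_bound[OF B(2) A(2) k bdd_borel_slice[OF g]])
  ultimately show ?thesis by (rule bbI)
qed

lemma bdd_borel_op_funpow: "bdd_ker k \<Longrightarrow> bdd_borel g \<Longrightarrow> bdd_borel ((coord_op i k ^^ m) g)"
  by (induction m) (auto intro: bdd_borel_op)

lemma line_op_add: "bdd_ker k \<Longrightarrow> bdd_borel f \<Longrightarrow> bdd_borel g \<Longrightarrow> line_op k (\<lambda>t. f t + g t) u = line_op k f u + line_op k g u"
  unfolding line_op_def by (simp add: distrib_left bdd_borel_integrable bdd_borel_mult bdd_borel_ker)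

lemma line_op_cmult: "line_op k (\<lambda>t. c * g t) u = c * line_op k g u"
  unfolding line_op_def by (simp add: mult.left_commute)

lemma line_op_diff: "bdd_ker k \<Longrightarrow> bdd_borel f \<Longrightarrow> bdd_borel g \<Longrightarrow> line_op k (\<lambda>t. f t - g t) u = line_op k f u - line_op k g u"
  unfolding line_op_def by (simp add: right_diff_distrib bdd_borel_integrable bdd_borel_mult bdd_borel_ker)

lemma coord_op_add: "bdd_ker k \<Longrightarrow> bdd_borel f \<Longrightarrow> bdd_borel g \<Longrightarrow> coord_op i k (\<lambda>x. f x + g x) = (\<lambda>x. coord_op i k f x + coord_op i k g x)"
  unfolding coord_op_def by (simp add: line_op_add bdd_borel_slice)

lemma coord_op_cmult: "coord_op i k (\<lambda>x. c * g x) = (\<lambda>x. c * coord_op i k g x)"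
  unfolding coord_op_def by (simp add: line_op_cmult)

lemma coord_op_diff: "bdd_ker k \<Longrightarrow> bdd_borel f \<Longrightarrow> bdd_borel g \<Longrightarrow> coord_op i k (\<lambda>x. f x - g x) = (\<lambda>x. coord_op i k f x - coord_op i k g x)"
  unfolding coord_op_def by (simp add: line_op_diff bdd_borel_slice)

lemma coord_op_funpow_eq: "(coord_op i k ^^ m) g x = (line_op k ^^ m) (\<lambda>t. g (upd x i t)) (x $ i)"
proof (induction m arbitrary: x)
  case (Suc m)
  show ?case by (simp add: coord_op_def[of i k "(coord_op i k ^^ m) g"] Suc)
qed simp

lemma coord_op_product:
  assumes "\<And>x t. R (upd x i t) = R x"
  shows "coord_op i k (\<lambda>x. \<phi> (x $ i) * R x) = (\<lambda>x. line_op k \<phi> (x $ i) * R x)"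
  using line_op_cmult[of k "R _" \<phi>] by (simp add: coord_op_def fun_eq_iff assms mult.commute)

lemma line_op_tendsto:
  assumes k: "bdd_ker k" and g: "\<And>n. bdd_borel (g n)" "\<And>n t. \<bar>g n t\<bar> \<le> A" and lim: "\<And>t. (\<lambda>n. g n t) \<longlonglongrightarrow> h t"
  shows "(\<lambda>n. line_op k (g n) u) \<longlonglongrightarrow> line_op k h u"
proof -
  obtain B where B: "B > 0" "\<And>u t. \<bar>k u t\<bar> \<le> B" using bdd_ker_bound[OF k] by auto
  have [measurable]: "k u \<in> borel_measurable borel" "\<And>n. g n \<in> borel_measurable borel"
    using bdd_borel_ker[OF k] g(1) by (auto intro: bdd_borel_measurable)
  have [measurable]: "h \<in> borel_measurable borel"
    by (rule borel_measurable_LIMSEQ_real[OF lim]) simp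
  show ?thesis unfolding line_op_def
  proof (rule integral_dominated_convergence[where w = "\<lambda>_. B * A"])
    show "AE t in unif. norm (k u t * g n t) \<le> B * A" for n
      unfolding real_norm_def abs_mult using B g(2) by (intro AE_I2 mult_mono) auto
    show "AE t in unif. (\<lambda>n. k u t * g n t) \<longlonglongrightarrow> k u t * h t"
      by (intro AE_I2 tendsto_intros lim)
  qed auto
qed

text \<open>Both sides integrate the same function \<open>F\<close> of a point y and a number s, one
  of them after the exchange of the i-th coordinate of y with s.\<close>

lemma coord_op_adjoint:
  fixes g \<psi> :: "real ^ 'd::finite \<Rightarrow> real"
  assumes k: "bdd_ker k" and g: "bdd_borel g" and \<psi>: "bdd_borel \<psi>"
  shows "(\<integral>x. coord_op i k g x * \<psi> x \<partial>unif) = (\<integral>x. g x * coord_op i (\<lambda>u t. k t u) \<psi> x \<partial>unif)"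
proof -
  obtain B where B: "B > 0" "\<And>u t. \<bar>k u t\<bar> \<le> B" using bdd_ker_bound[OF k] by auto
  obtain A where A: "A > 0" "\<And>t. \<bar>g t\<bar> \<le> A" using bdd_borel_bound[OF g] by auto
  obtain A' where A': "A' > 0" "\<And>t. \<bar>\<psi> t\<bar> \<le> A'" using bdd_borel_bound[OF \<psi>] by auto
  note [measurable] = bdd_borel_measurable[OF g] bdd_borel_measurable[OF \<psi>]
  define F where "F y s = k s (y $ i) * g y * \<psi> (upd y i s)" for y s
  have [measurable]: "(\<lambda>p. k (snd p) (fst p $ i)) \<in> borel_measurable (borel \<Otimes>\<^sub>M borel)"
    by (rule bdd_ker_measurable[OF k]) measurable
  have Fm: "(\<lambda>p. F (fst p) (snd p)) \<in> borel_measurable (unif \<Otimes>\<^sub>M unif)"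
    unfolding F_def by (simp cong: measurable_cong_sets sets_pair_measure_cong)
  have "\<bar>F y s\<bar> \<le> B * A * A'" for y s
    unfolding F_def abs_mult using A A' B by (intro mult_mono) auto
  then have "integrable (unif \<Otimes>\<^sub>M unif) (\<lambda>p. F (fst p) (snd p))"
    using Fm by (intro unif_pair.P.integrable_const_bound[of _ "B * A * A'"]) auto
  then have "(\<integral>x. (\<integral>t. F (upd x i t) (x $ i) \<partial>unif) \<partial>unif) = (\<integral>x. (\<integral>t. F x t \<partial>unif) \<partial>unif)"
    by (intro integral_swap) (simp add: case_prod_unfold)
  moreover have "(\<integral>t. F (upd x i t) (x $ i) \<partial>unif) = coord_op i k g x * \<psi> x" for x
    by (simp add: F_def coord_op_def line_op_def)
  moreover have "(\<integral>t. F x t \<partial>unif) = g x * coord_op i (\<lambda>u t. k t u) \<psi> x" for x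
    by (simp add: F_def coord_op_def line_op_def mult.left_commute mult.assoc)
  ultimately show ?thesis by simp
qed

section \<open>Cells of length 1/K and kernels concentrated on them\<close>

definition same_cell :: "nat \<Rightarrow> real \<Rightarrow> real \<Rightarrow> bool" where
  "same_cell K u t \<longleftrightarrow> \<lfloor>real K * u\<rfloor> = \<lfloor>real K * t\<rfloor>"

lemma same_cell_sym: "same_cell K u t \<longleftrightarrow> same_cell K t u"
  by (auto simp: same_cell_def)

lemma measurable_same_cell [measurable (raw)]:
  assumes [measurable]: "f \<in> borel_measurable M" "g \<in> borel_measurable M"
  shows "Measurable.pred M (\<lambda>z. same_cell K (f z) (g z))"
  unfolding same_cell_def by measurable

text \<open>Kernels cut off at cell walls lead to integrands that are continuous on a subinterval
  and 0 on the rest of the unit interval. Values at the two end points are left open, as they form a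
  null set.\<close>

lemma integral_unif_Icc:
  fixes f :: "real \<Rightarrow> real"
  assumes "0 \<le> a" "a \<le> b" "b \<le> 1"
    and F: "\<And>x. a \<le> x \<Longrightarrow> x \<le> b \<Longrightarrow> (F has_real_derivative f x) (at x)"
    and f: "\<And>x. isCont f x"
    and g: "g \<in> borel_measurable borel"
       "\<And>x. a < x \<Longrightarrow> x < b \<Longrightarrow> g x = f x" "\<And>x. 0 < x \<Longrightarrow> x < 1 \<Longrightarrow> x < a \<or> b < x \<Longrightarrow> g x = 0"
  shows "(\<integral>x. g x \<partial>unif) = F b - F a"
proof -
  have [measurable]: "f \<in> borel_measurable borel"
    using f by (intro borel_measurable_continuous_onI) (auto simp: continuous_on_eq_continuous_at)
  have "(\<integral>x. g x \<partial>unif) = (\<integral>x. indicator {0<..<1} x * g x \<partial>lborel)"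
    using integral_unif[OF g(1)] by simp
  also have "\<dots> = (\<integral>x. f x * indicator {a..b} x \<partial>lborel)"
  proof (rule integral_cong_AE)
    show "AE x in lborel. indicator {0<..<1} x * g x = f x * indicator {a..b} x"
      using AE_lborel_singleton[of a] AE_lborel_singleton[of b]
    proof eventually_elim
      case (elim x)
      then show ?case
        using g(2)[of x] g(3)[of x] assms(1-3) by (auto simp: indicator_def)
    qed
  qed (use g in auto)
  also have "\<dots> = F b - F a"
    using assms by (intro integral_FTC_Icc_real) auto
  finally show ?thesis .
qed

lemma floor_cell:
  assumes "K > 0"
  shows "\<lfloor>real K * t\<rfloor> = int c \<longleftrightarrow> real c / real K \<le> t \<and> t < real (Suc c) / real K"
  using assms by (auto simp: floor_eq_iff field_simps)

lemma cell_exists: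
  assumes "K > 0" "0 \<le> u" "u < 1"
  obtains c where "c < K" "\<lfloor>real K * u\<rfloor> = int c"
proof -
  have "0 \<le> \<lfloor>real K * u\<rfloor>" using assms by simp
  moreover have "\<lfloor>real K * u\<rfloor> < int K" using assms by (simp add: floor_less_iff)
  ultimately have "nat \<lfloor>real K * u\<rfloor> < K" "\<lfloor>real K * u\<rfloor> = int (nat \<lfloor>real K * u\<rfloor>)" by linarith+
  then show ?thesis by (rule that)
qed

lemma integral_same_cell:
  assumes K: "K > 0" and u: "0 < u" "u < 1"
  shows "(\<integral>t. (if same_cell K u t then 1 else 0) \<partial>unif) = 1 / real K"
proof -
  obtain c where c: "c < K" "\<lfloor>real K * u\<rfloor> = int c" using cell_exists[OF K, of u] u by auto
  have "(\<integral>t. (if same_cell K u t then 1 else 0) \<partial>unif) = real (Suc c) / real K - real c / real K"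
  proof (rule integral_unif_Icc[where f = "\<lambda>_. 1" and F = "\<lambda>x. x"])
    show "real c / real K \<le> real (Suc c) / real K" "real (Suc c) / real K \<le> 1"
      using c K by (auto simp: field_simps)
    have sc: "same_cell K u t \<longleftrightarrow> real c / real K \<le> t \<and> t < real (Suc c) / real K" for t
      unfolding same_cell_def c(2) using floor_cell[OF K] by metis
    then show "(if same_cell K u x then 1 else 0) = (1::real)" if "real c / real K < x" "x < real (Suc c) / real K" for x
      using that unfolding sc by auto
    show "(if same_cell K u x then 1 else 0) = (0::real)" if "x < real c / real K \<or> real (Suc c) / real K < x" for x
      using that unfolding sc by auto
    show "(\<lambda>t. if same_cell K u t then 1 else 0 :: real) \<in> borel_measurable borel" by measurable
  qed (auto intro!: derivative_eq_intros)
  then show ?thesis using K by (simp add: field_simps)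
qed

text \<open>Cauchy-Schwarz on a single cell. The squared kernel bound contributes K^2, and the
  length 1/K of the cell leaves one factor K in front of the integral.\<close>

lemma line_op_square_le:
  assumes K: "K > 0" and k: "bdd_ker k" and c: "c \<ge> 0"
    and kb: "\<And>t. 0 < t \<Longrightarrow> t < 1 \<Longrightarrow> \<bar>k u t\<bar> \<le> c * real K * (if same_cell K u t then 1 else 0)"
    and \<phi>: "bdd_borel \<phi>" and u: "0 < u" "u < 1"
  shows "(line_op k \<phi> u)\<^sup>2 \<le> c\<^sup>2 * real K * (\<integral>t. (if same_cell K u t then 1 else 0) * (\<phi> t)\<^sup>2 \<partial>unif)"
proof -
  define w :: "real \<Rightarrow> real" where "w t = (if same_cell K u t then 1 else 0)" for t
  have bw: "bdd_borel w" unfolding w_def by (rule bbI[of _ 1]) auto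
  have b1: "bdd_borel (\<lambda>t. w t * \<bar>\<phi> t\<bar>)" 
    using bw \<phi> by (intro bdd_borel_mult) (auto simp: bdd_borel_def)
  have b2: "bdd_borel (\<lambda>t. w t * (\<phi> t)\<^sup>2)"
    unfolding power2_eq_square by (intro bdd_borel_mult bw \<phi>)
  define S where "S = (\<integral>t. w t * \<bar>\<phi> t\<bar> \<partial>unif)"
  define V where "V = (\<integral>t. w t * (\<phi> t)\<^sup>2 \<partial>unif)"
  have iw: "(\<integral>t. w t \<partial>unif) = 1 / real K"
    unfolding w_def by (rule integral_same_cell[OF K u])
  have S0: "S \<ge> 0" unfolding S_def by (intro Bochner_Integration.integral_nonneg) (auto simp: w_def)
  \<comment> \<open>Cauchy-Schwarz in the form that a variance is non-negative: S * K is the mean of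
    the absolute value of \<phi> over the cell.\<close>
  have "0 \<le> (\<integral>t. w t * (\<bar>\<phi> t\<bar> - S * K)\<^sup>2 \<partial>unif)"
    by (intro Bochner_Integration.integral_nonneg) (auto simp: w_def)
  also have "(\<lambda>t. w t * (\<bar>\<phi> t\<bar> - S * K)\<^sup>2)
      = (\<lambda>t. w t * (\<phi> t)\<^sup>2 - 2 * S * K * (w t * \<bar>\<phi> t\<bar>) + (S * K)\<^sup>2 * w t)"
    by (auto simp: fun_eq_iff power2_diff algebra_simps)
  also have "(\<integral>t. w t * (\<phi> t)\<^sup>2 - 2 * S * K * (w t * \<bar>\<phi> t\<bar>) + (S * K)\<^sup>2 * w t \<partial>unif)
      = V - 2 * S * K * S + (S * K)\<^sup>2 * (1 / real K)"
    using bdd_borel_integrable[OF bw] bdd_borel_integrable[OF b1] bdd_borel_integrable[OF b2]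
    by (simp add: V_def S_def iw)
  also have "\<dots> = V - K * S\<^sup>2" using K by (simp add: field_simps power2_eq_square)
  finally have SV: "K * S\<^sup>2 \<le> V" by simp
  have "\<bar>line_op k \<phi> u\<bar> \<le> (\<integral>t. c * K * (w t * \<bar>\<phi> t\<bar>) \<partial>unif)"
    unfolding line_op_def
  proof (rule order.trans[OF abs_integral_le], rule integral_mono_AE)
    show "integrable unif (\<lambda>t. \<bar>k u t * \<phi> t\<bar>)"
      by (intro integrable_abs bdd_borel_integrable bdd_borel_mult bdd_borel_ker k \<phi>)
    show "integrable unif (\<lambda>t. c * K * (w t * \<bar>\<phi> t\<bar>))"
      by (intro bdd_borel_integrable bdd_borel_cmult b1)
    show "AE t in unif. \<bar>k u t * \<phi> t\<bar> \<le> c * K * (w t * \<bar>\<phi> t\<bar>)"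
      using AE_unif_box
    proof eventually_elim
      case (elim t)
      then have "\<bar>k u t\<bar> * \<bar>\<phi> t\<bar> \<le> (c * K * w t) * \<bar>\<phi> t\<bar>"
        unfolding w_def by (intro mult_right_mono kb) auto
      then show ?case by (simp add: abs_mult mult.assoc)
    qed
  qed
  also have "\<dots> = c * K * S" by (simp add: S_def)
  finally have "(line_op k \<phi> u)\<^sup>2 \<le> (c * K * S)\<^sup>2"
    using abs_le_square_iff[of "line_op k \<phi> u" "c * K * S"] S0 c by simp
  also have "\<dots> = c\<^sup>2 * K * (K * S\<^sup>2)" by (simp add: power2_eq_square algebra_simps)
  also have "\<dots> \<le> c\<^sup>2 * K * V" using SV by (intro mult_left_mono) auto
  finally show ?thesis by (simp add: V_def w_def)
qed

text \<open>The pointwise bound by cell integrals is integrated. The adjoint moves the cell kernel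
  to the constant function 1, where it yields 1/K almost everywhere and cancels the factor K. The
  resulting operator norm is free of K.\<close>

lemma coord_op_L2_bound:
  fixes g :: "real ^ 'd::finite \<Rightarrow> real"
  assumes K: "K > 0" and k: "bdd_ker k" and c: "c \<ge> 0"
    and kb: "\<And>u t. 0 < u \<Longrightarrow> u < 1 \<Longrightarrow> 0 < t \<Longrightarrow> t < 1 \<Longrightarrow>
       \<bar>k u t\<bar> \<le> c * real K * (if same_cell K u t then 1 else 0)"
    and g: "bdd_borel g"
  shows "(\<integral>x. (coord_op i k g x)\<^sup>2 \<partial>unif) \<le> c\<^sup>2 * (\<integral>x. (g x)\<^sup>2 \<partial>unif)"
proof -
  define w :: "real \<Rightarrow> real \<Rightarrow> real" where "w u t = (if same_cell K u t then 1 else 0)" for u t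
  have bw: "bdd_ker w" unfolding w_def by (rule bkerI[of _ 1]) auto
  have bg: "bdd_borel (\<lambda>x. (g x)\<^sup>2)" unfolding power2_eq_square by (intro bdd_borel_mult g)
  have "(\<integral>x. (coord_op i k g x)\<^sup>2 \<partial>unif) \<le> (\<integral>x. c\<^sup>2 * real K * coord_op i w (\<lambda>x. (g x)\<^sup>2) x \<partial>unif)"
  proof (rule integral_mono_AE)
    show "integrable unif (\<lambda>x. (coord_op i k g x)\<^sup>2)"
      unfolding power2_eq_square by (intro bdd_borel_integrable bdd_borel_mult bdd_borel_op k g)
    show "integrable unif (\<lambda>x. c\<^sup>2 * real K * coord_op i w (\<lambda>x. (g x)\<^sup>2) x)"
      by (intro bdd_borel_integrable bdd_borel_cmult bdd_borel_op bw bg)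
    show "AE x in unif. (coord_op i k g x)\<^sup>2 \<le> c\<^sup>2 * real K * coord_op i w (\<lambda>x. (g x)\<^sup>2) x"
      using AE_unif_box
    proof eventually_elim
      case (elim x)
      then have "0 < x $ i" "x $ i < 1" by (auto simp: mem_unit_box)
      then show ?case
        unfolding coord_op_def unfolding line_op_def[of w] w_def
        by (intro line_op_square_le[OF K k c] kb bdd_borel_slice g)
    qed
  qed
  also have "\<dots> = c\<^sup>2 * real K * (\<integral>x. coord_op i w (\<lambda>x. (g x)\<^sup>2) x * 1 \<partial>unif)" by simp
  also have "(\<integral>x. coord_op i w (\<lambda>x. (g x)\<^sup>2) x * 1 \<partial>unif) = (\<integral>x. (g x)\<^sup>2 * coord_op i (\<lambda>u t. w t u) (\<lambda>_. 1) x \<partial>unif)"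
    by (rule coord_op_adjoint[OF bw bg]) simp
  also have "\<dots> = (\<integral>x. (g x)\<^sup>2 * (1 / real K) \<partial>unif)"
  proof (rule integral_cong_AE)
    show "AE x in unif. (g x)\<^sup>2 * coord_op i (\<lambda>u t. w t u) (\<lambda>_. 1) x = (g x)\<^sup>2 * (1 / real K)"
      using AE_unif_box
    proof eventually_elim
      case (elim x)
      then show ?case
        using integral_same_cell[OF K, of "x $ i"]
        by (simp add: mem_unit_box coord_op_def line_op_def w_def same_cell_sym[of K _ "x $ i"])
    qed
    show "(\<lambda>x. (g x)\<^sup>2 * coord_op i (\<lambda>u t. w t u) (\<lambda>_. 1) x) \<in> borel_measurable unif"
      using bdd_borel_measurable[OF bdd_borel_mult[OF bg bdd_borel_op[OF bdd_ker_transpose[OF bw] bdd_borel_const, of i 1]]] by simp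
    show "(\<lambda>x. (g x)\<^sup>2 * (1 / real K)) \<in> borel_measurable unif"
      using bdd_borel_measurable[OF bg] by simp
  qed
  also have "\<dots> = (\<integral>x. (g x)\<^sup>2 \<partial>unif) / real K" by simp
  finally show ?thesis using K by simp
qed

section \<open>Local polynomial projections\<close>

lemma bump_fun_measurable: "bump_fun \<phi> \<Longrightarrow> \<phi> \<in> borel_measurable borel"
  by (rule smooth_borel[OF csD])

lemma bump_fun_bb: "bump_fun \<phi> \<Longrightarrow> bdd_borel \<phi>"
  using bump_fun_bounded[of \<phi>] bump_fun_measurable[of \<phi>] by (auto simp: bdd_borel_def)

text \<open>Kernel of the antiderivative that is restarted at the left wall of every cell.\<close>

definition int_ker :: "nat \<Rightarrow> real \<Rightarrow> real \<Rightarrow> real" where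
  "int_ker K u t = (if t \<le> u \<and> same_cell K u t then 1 else 0)"

lemma bdd_ker_kJ: "bdd_ker (int_ker K)"
  unfolding int_ker_def by (rule bkerI[of _ 1]) auto

text \<open>The monomials are taken in the local variable K t - c, which runs through [0,1) over the
  cell. Moments on a cell are thus moments on the unit interval up to a factor K.\<close>

definition cell_moment :: "nat \<Rightarrow> nat \<Rightarrow> nat \<Rightarrow> (real \<Rightarrow> real) \<Rightarrow> real" where
  "cell_moment K c l \<phi> = (\<integral>t. \<phi> t * (if \<lfloor>real K * t\<rfloor> = int c then (real K * t - real c) ^ l else 0) \<partial>unif)"

lemma cell_monomial_bounded:
  assumes "\<lfloor>real K * t\<rfloor> = int c"
  shows "\<bar>(real K * t - real c) ^ l\<bar> \<le> 1"
proof -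
  have "0 \<le> real K * t - real c" "real K * t - real c \<le> 1" using assms by linarith+
  then show ?thesis by (simp add: power_le_one)
qed

lemma bdd_borel_cell_monomial: "bdd_borel (\<lambda>t. if \<lfloor>real K * t\<rfloor> = int c then (real K * t - real c) ^ l else 0)"
  by (rule bbI[of _ 1]) (use cell_monomial_bounded in auto)

lemma cell_moment_diff: "bdd_borel \<phi> \<Longrightarrow> bdd_borel \<psi> \<Longrightarrow> cell_moment K c l (\<lambda>t. \<phi> t - \<psi> t) = cell_moment K c l \<phi> - cell_moment K c l \<psi>"
  unfolding cell_moment_def
  by (simp add: left_diff_distrib bdd_borel_integrable bdd_borel_mult bdd_borel_cell_monomial)

lemma cell_moment_cmult: "cell_moment K c l (\<lambda>t. a * \<phi> t) = a * cell_moment K c l \<phi>"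
  unfolding cell_moment_def by (simp add: mult.assoc)

lemma bdd_borel_sum: "finite A \<Longrightarrow> (\<And>i. i \<in> A \<Longrightarrow> bdd_borel (\<phi> i)) \<Longrightarrow> bdd_borel (\<lambda>t. \<Sum>i\<in>A. \<phi> i t)"
  by (induction A rule: finite_induct) (auto intro: bdd_borel_add)

lemma cell_moment_sum:
  assumes "finite A" "\<And>i. i \<in> A \<Longrightarrow> bdd_borel (\<phi> i)"
  shows "cell_moment K c l (\<lambda>t. \<Sum>i\<in>A. \<phi> i t) = (\<Sum>i\<in>A. cell_moment K c l (\<phi> i))"
  unfolding cell_moment_def sum_distrib_right
  by (rule Bochner_Integration.integral_sum) (intro bdd_borel_integrable bdd_borel_mult bdd_borel_cell_monomial assms)

lemma line_op_adjoint:
  assumes k: "bdd_ker k" and \<phi>: "bdd_borel \<phi>" and \<psi>: "bdd_borel \<psi>"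
  shows "(\<integral>u. line_op k \<phi> u * \<psi> u \<partial>unif) = (\<integral>t. \<phi> t * line_op (\<lambda>t u. k u t) \<psi> t \<partial>unif)"
proof -
  obtain B where B: "B > 0" "\<And>u t. \<bar>k u t\<bar> \<le> B" using bdd_ker_bound[OF k] by auto
  obtain A where A: "A > 0" "\<And>t. \<bar>\<phi> t\<bar> \<le> A" using bdd_borel_bound[OF \<phi>] by auto
  obtain A' where A': "A' > 0" "\<And>t. \<bar>\<psi> t\<bar> \<le> A'" using bdd_borel_bound[OF \<psi>] by auto
  note [measurable] = bdd_borel_measurable[OF \<phi>] bdd_borel_measurable[OF \<psi>]
  have [measurable]: "(\<lambda>p. k (fst p) (snd p)) \<in> borel_measurable (borel \<Otimes>\<^sub>M borel)"
    by (rule bdd_ker_measurable[OF k]) measurable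
  define F where "F p = k (fst p) (snd p) * \<phi> (snd p) * \<psi> (fst p)" for p
  have Fm: "F \<in> borel_measurable (unif \<Otimes>\<^sub>M unif)"
    unfolding F_def[abs_def] by (simp cong: measurable_cong_sets sets_pair_measure_cong)
  have "\<bar>F p\<bar> \<le> B * A * A'" for p
    unfolding F_def abs_mult using A A' B by (intro mult_mono) auto
  then have F: "integrable (unif \<Otimes>\<^sub>M unif) F"
    using Fm by (intro unif_pair.P.integrable_const_bound[of _ "B * A * A'"]) auto
  have F': "integrable (unif \<Otimes>\<^sub>M unif) (\<lambda>(u, t). F (u, t))" using F by simp
  have "(\<integral>u. line_op k \<phi> u * \<psi> u \<partial>unif) = (\<integral>u. (\<integral>t. F (u, t) \<partial>unif) \<partial>unif)"
    by (simp add: F_def line_op_def)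
  also have "\<dots> = (\<integral>t. (\<integral>u. F (u, t) \<partial>unif) \<partial>unif)"
    using unif_pair.Fubini_integral[OF F'] by simp
  also have "\<dots> = (\<integral>t. \<phi> t * line_op (\<lambda>t u. k u t) \<psi> t \<partial>unif)"
    by (simp add: F_def line_op_def mult.assoc mult.left_commute)
  finally show ?thesis .
qed

text \<open>On the cell, the transposed integration turns (K u - c)^l into (1 - (K t - c)^(l+1)) /
  (K (l+1)). Moment l of the antiderivative is therefore a combination of the moments of orders 0
  and l + 1.\<close>

lemma cell_moment_op1_kJ:
  assumes K: "K > 0" and c: "c < K" and \<phi>: "bdd_borel \<phi>"
    and "cell_moment K c 0 \<phi> = 0" "cell_moment K c (Suc l) \<phi> = 0"
  shows "cell_moment K c l (line_op (int_ker K) \<phi>) = 0"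
proof -
  define \<psi> where "\<psi> u = (if \<lfloor>real K * u\<rfloor> = int c then (real K * u - real c) ^ l else 0)" for u
  have \<psi>: "bdd_borel \<psi>" unfolding \<psi>_def by (rule bdd_borel_cell_monomial)
  define w where "w j t = (if \<lfloor>real K * t\<rfloor> = int c then (real K * t - real c) ^ j else 0)" for j t
  have w: "bdd_borel (w j)" for j unfolding w_def by (rule bdd_borel_cell_monomial)
  have "cell_moment K c l (line_op (int_ker K) \<phi>) = (\<integral>u. line_op (int_ker K) \<phi> u * \<psi> u \<partial>unif)"
    by (simp add: cell_moment_def \<psi>_def)
  also have "\<dots> = (\<integral>t. \<phi> t * line_op (\<lambda>t u. int_ker K u t) \<psi> t \<partial>unif)"
    by (rule line_op_adjoint[OF bdd_ker_kJ \<phi> \<psi>])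
  also have "\<dots> = (\<integral>t. (\<phi> t * w 0 t - \<phi> t * w (Suc l) t) / (K * Suc l) \<partial>unif)"
  proof (rule integral_cong_AE)
    show "AE t in unif. \<phi> t * line_op (\<lambda>t u. int_ker K u t) \<psi> t = (\<phi> t * w 0 t - \<phi> t * w (Suc l) t) / (K * Suc l)"
      using AE_unif_box
    proof eventually_elim
      case (elim t)
      then have t: "0 < t" "t < 1" by auto
      have "line_op (\<lambda>t u. int_ker K u t) \<psi> t = (w 0 t - w (Suc l) t) / (K * Suc l)"
      proof (cases "\<lfloor>real K * t\<rfloor> = int c")
        case False
        then have "int_ker K u t * \<psi> u = 0" for u by (auto simp: int_ker_def \<psi>_def same_cell_def)
        then have "line_op (\<lambda>t u. int_ker K u t) \<psi> t = 0" unfolding line_op_def by (simp only: Bochner_Integration.integral_zero)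
        then show ?thesis using False by (simp add: w_def)
      next
        case True
        then have tc: "real c / real K \<le> t" "t < real (Suc c) / real K" using floor_cell[OF K] by auto
        have "line_op (\<lambda>t u. int_ker K u t) \<psi> t
            = (real K * (real (Suc c) / real K) - c) ^ Suc l / (K * Suc l) - (real K * t - c) ^ Suc l / (K * Suc l)"
          unfolding line_op_def
        proof (rule integral_unif_Icc[where f = "\<lambda>u. (real K * u - c) ^ l"
            and F = "\<lambda>u. (real K * u - c) ^ Suc l / (K * Suc l)" and a = t and b = "real (Suc c) / real K"])
          show "real (Suc c) / real K \<le> 1" using c K by (simp add: field_simps)
          show "(\<lambda>u. int_ker K u t * \<psi> u) \<in> borel_measurable borel"
            using bdd_borel_measurable[OF bdd_borel_mult[OF bdd_borel_ker[OF bdd_ker_transpose[OF bdd_ker_kJ]] \<psi>]] .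
          show "int_ker K u t * \<psi> u = (real K * u - c) ^ l" if "t < u" "u < real (Suc c) / real K" for u
          proof -
            have "\<lfloor>real K * u\<rfloor> = int c" using floor_cell[OF K] tc that by auto
            then show ?thesis using True that by (simp add: int_ker_def \<psi>_def same_cell_def)
          qed
          show "int_ker K u t * \<psi> u = 0" if "u < t \<or> real (Suc c) / real K < u" for u
          proof (cases "u < t")
            case False
            then have "\<lfloor>real K * u\<rfloor> \<noteq> int c" using floor_cell[OF K] that by auto
            then show ?thesis by (simp add: \<psi>_def)
          qed (simp add: int_ker_def)
          show "((\<lambda>u. (real K * u - c) ^ Suc l / (K * Suc l)) has_real_derivative (real K * u - c) ^ l) (at u)" for u
          proof -
            have "((\<lambda>u. real K * u - c) has_real_derivative real K) (at u)"
              by (auto intro!: derivative_eq_intros)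
            from DERIV_cdivide[OF DERIV_power_Suc[OF this, of l], of "real K * real (Suc l)"]
            have "((\<lambda>u. (real K * u - c) ^ Suc l / (real K * Suc l)) has_real_derivative
                (1 + real l) * (real K * (real K * u - c) ^ l) / (real K * Suc l)) (at u)" .
            moreover have "(1 + real l) * (real K * (real K * u - c) ^ l) / (real K * Suc l) = (real K * u - c) ^ l"
              using K by simp
            ultimately show ?thesis by (simp only: of_nat_mult)
          qed
        qed (use t tc in auto)
        also have "real K * (real (Suc c) / real K) - c = 1" using K by simp
        finally show ?thesis using True K by (simp add: w_def diff_divide_distrib)
      qed
      then show ?case by (simp only: right_diff_distrib times_divide_eq_right)
    qed
    show "(\<lambda>t. \<phi> t * line_op (\<lambda>t u. int_ker K u t) \<psi> t) \<in> borel_measurable unif"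
      using bdd_borel_measurable[OF bdd_borel_mult[OF \<phi> bdd_borel_op1[OF bdd_ker_transpose[OF bdd_ker_kJ] \<psi>]]] by simp
    show "(\<lambda>t. (\<phi> t * w 0 t - \<phi> t * w (Suc l) t) / (K * Suc l)) \<in> borel_measurable unif"
      using bdd_borel_measurable[OF \<phi>] bdd_borel_measurable[OF w] by simp
  qed
  also have "\<dots> = (cell_moment K c 0 \<phi> - cell_moment K c (Suc l) \<phi>) / (K * Suc l)"
    unfolding cell_moment_def w_def[symmetric]
    using bdd_borel_integrable[OF bdd_borel_mult[OF \<phi> w]] by simp
  finally show ?thesis using assms by simp
qed

text \<open>Every antiderivative uses up one order of vanishing moments.\<close>

lemma cell_moment_op1_kJ_funpow:
  assumes K: "K > 0" and c: "c < K" and "bdd_borel \<phi>" "\<And>j. j \<le> l + m \<Longrightarrow> cell_moment K c j \<phi> = 0"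
  shows "cell_moment K c l ((line_op (int_ker K) ^^ m) \<phi>) = 0"
  using assms(3-)
proof (induction m arbitrary: \<phi>)
  case (Suc m)
  have "cell_moment K c l ((line_op (int_ker K) ^^ m) (line_op (int_ker K) \<phi>)) = 0"
  proof (rule Suc.IH)
    show "bdd_borel (line_op (int_ker K) \<phi>)" by (rule bdd_borel_op1[OF bdd_ker_kJ Suc.prems(1)])
    show "cell_moment K c j (line_op (int_ker K) \<phi>) = 0" if "j \<le> l + m" for j
      using that by (intro cell_moment_op1_kJ K c Suc.prems) auto
  qed
  then show ?case by (simp add: funpow_swap1)
qed simp

lemma bump_fun_antiderivative_eq_0:
  assumes F: "\<And>x. (F has_real_derivative \<phi> x) (at x)" and z: "\<And>x. x \<notin> {a..b} \<Longrightarrow> \<phi> x = 0"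
    and "F p = 0" and side: "(p < a \<and> u < a) \<or> (b < p \<and> b < u)"
  shows "F u = 0"
proof (cases u p rule: linorder_cases)
  case less
  from MVT2[OF less, of F \<phi>] F obtain \<xi> where "u < \<xi>" "\<xi> < p" "F p - F u = (p - u) * \<phi> \<xi>" by blast
  then show ?thesis using z[of \<xi>] side assms(3) by auto
next
  case greater
  from MVT2[OF greater, of F \<phi>] F obtain \<xi> where "p < \<xi>" "\<xi> < u" "F u - F p = (u - p) * \<phi> \<xi>" by blast
  then show ?thesis using z[of \<xi>] side assms(3) by auto
qed (use assms in simp)

text \<open>The primitive \<open>F\<close> of \<phi> with F 0 = 0 is smooth. Vanishing cell
  integrals make it 0 at every cell wall, so restarting the integration at the walls changes nothing
  and the cellwise antiderivative is \<open>F\<close> itself. As F 0 = F 1 = 0, it vanishes wherever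
  \<phi> is forced to vanish near the ends of the interval.\<close>

lemma line_op_kJ_cs:
  assumes K: "K > 0" and \<phi>: "bump_fun \<phi>" and m0: "\<And>c. c < K \<Longrightarrow> cell_moment K c 0 \<phi> = 0"
  shows "bump_fun (line_op (int_ker K) \<phi>)" "deriv (line_op (int_ker K) \<phi>) = \<phi>"
proof -
  obtain a b where ab: "0 < a" "a < b" "b < 1" "\<And>x. x \<notin> {a..b} \<Longrightarrow> \<phi> x = 0"
    using \<phi> bump_fun_def by blast
  have cont: "continuous_on A \<phi>" for A by (rule smooth_continuous[OF csD[OF \<phi>]])
  have ic: "isCont \<phi> x" for x
    using cont[of UNIV] by (simp add: continuous_on_eq_continuous_at)
  define F where "F u = (LBINT y=ereal 0..ereal u. \<phi> y)" for u
  have F: "(F has_real_derivative \<phi> x) (at x)" for x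
  proof -
    define R where "R = \<bar>x\<bar> + 1"
    have "((\<lambda>u. LBINT y=ereal 0..ereal u. \<phi> y) has_vector_derivative \<phi> x) (at x within {-R..R})"
      by (rule interval_integral_FTC2) (auto simp: R_def cont)
    moreover have "at x within {-R..R} = at x"
      by (rule at_within_interior) (auto simp: R_def)
    ultimately show ?thesis
      unfolding F_def by (simp add: has_real_derivative_iff_has_vector_derivative)
  qed
  have F0: "F 0 = 0" unfolding F_def by simp
  have Fc: "F (real c / real K) = 0" if "c \<le> K" for c
    using that
  proof (induction c)
    case (Suc c)
    have "cell_moment K c 0 \<phi> = F (real (Suc c) / real K) - F (real c / real K)"
      unfolding cell_moment_def
    proof (rule integral_unif_Icc[where f = \<phi> and F = F and a = "real c / real K" and b = "real (Suc c) / real K"])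
      show "real (Suc c) / real K \<le> 1" using Suc.prems K by (simp add: field_simps)
      show "real c / real K \<le> real (Suc c) / real K" using K by (simp add: field_simps)
      show "\<phi> x * (if \<lfloor>real K * x\<rfloor> = int c then (real K * x - real c) ^ 0 else 0) = \<phi> x"
        if "real c / real K < x" "x < real (Suc c) / real K" for x
        unfolding floor_cell[OF K] using that by simp
      show "\<phi> x * (if \<lfloor>real K * x\<rfloor> = int c then (real K * x - real c) ^ 0 else 0) = 0"
        if "x < real c / real K \<or> real (Suc c) / real K < x" for x
        unfolding floor_cell[OF K] using that by auto
      show "(\<lambda>x. \<phi> x * (if \<lfloor>real K * x\<rfloor> = int c then (real K * x - real c) ^ 0 else 0)) \<in> borel_measurable borel"
        using bdd_borel_measurable[OF bdd_borel_mult[OF bump_fun_bb[OF \<phi>] bdd_borel_cell_monomial[of K c 0]]] .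
    qed (auto intro: F ic)
    then show ?case using Suc m0[of c] by simp
  qed (simp add: F0)
  have F1: "F 1 = 0" using Fc[of K] K by simp
  have Fl: "F u = 0" if "u < a" for u
    by (rule bump_fun_antiderivative_eq_0[OF F ab(4) F0]) (use ab that in auto)
  have Fr: "F u = 0" if "u > b" for u
    by (rule bump_fun_antiderivative_eq_0[OF F ab(4) F1]) (use ab that in auto)
  have JF: "line_op (int_ker K) \<phi> u = F u" for u
  proof (cases "0 < u \<and> u < 1")
    case False
    have "line_op (int_ker K) \<phi> u = (\<integral>t. 0 \<partial>(unif :: real measure))"
      unfolding line_op_def
    proof (rule integral_cong_AE)
      show "AE t in unif. int_ker K u t * \<phi> t = 0"
        using AE_unif_box
      proof eventually_elim
        case (elim t)
        then have t: "0 < t" "t < 1" by auto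
        show ?case
        proof (cases "u \<le> 0")
          case True then show ?thesis using t by (simp add: int_ker_def)
        next
          case u: False
          then have "u \<ge> 1" using False by auto
          then have "real K \<le> real K * u" using K by simp
          moreover have "real K * t < real K" using t K by simp
          ultimately have "\<not> same_cell K u t" unfolding same_cell_def
            by (metis floor_less_iff floor_of_nat le_floor_iff of_int_of_nat_eq not_le)
          then show ?thesis by (simp add: int_ker_def)
        qed
      qed
      show "(\<lambda>t. int_ker K u t * \<phi> t) \<in> borel_measurable unif"
        using bdd_borel_measurable[OF bdd_borel_mult[OF bdd_borel_ker[OF bdd_ker_kJ] bump_fun_bb[OF \<phi>]]] by simp
    qed simp
    moreover have "F u = 0" using False Fl[of u] Fr[of u] ab by linarith
    ultimately show ?thesis by simp
  next
    case True
    then obtain c where c: "c < K" "\<lfloor>real K * u\<rfloor> = int c" using cell_exists[OF K, of u] by auto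
    then have uc: "real c / real K \<le> u" "u < real (Suc c) / real K" using floor_cell[OF K] by auto
    have "line_op (int_ker K) \<phi> u = F u - F (real c / real K)"
      unfolding line_op_def
    proof (rule integral_unif_Icc[where f = \<phi> and F = F and a = "real c / real K" and b = u])
      show "int_ker K u x * \<phi> x = \<phi> x" if "real c / real K < x" "x < u" for x
      proof -
        have "\<lfloor>real K * x\<rfloor> = int c" unfolding floor_cell[OF K] using that uc by linarith
        then show ?thesis using that c(2) by (simp add: int_ker_def same_cell_def)
      qed
      show "int_ker K u x * \<phi> x = 0" if "x < real c / real K \<or> u < x" for x
      proof (cases "u < x")
        case False
        then have "\<lfloor>real K * x\<rfloor> \<noteq> int c" unfolding floor_cell[OF K] using that by linarith
        then show ?thesis using c(2) by (simp add: int_ker_def same_cell_def)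
      qed (simp add: int_ker_def)
      show "(\<lambda>t. int_ker K u t * \<phi> t) \<in> borel_measurable borel"
        using bdd_borel_measurable[OF bdd_borel_mult[OF bdd_borel_ker[OF bdd_ker_kJ] bump_fun_bb[OF \<phi>]]] .
    qed (use True uc in \<open>auto intro: F ic\<close>)
    then show ?thesis using Fc[of c] c by simp
  qed
  have JF': "line_op (int_ker K) \<phi> = F" using JF by auto
  have "smooth F" by (rule smooth_antiderivative[OF F csD[OF \<phi>]])
  then show "bump_fun (line_op (int_ker K) \<phi>)"
  proof -
    have "\<forall>x. x \<notin> {a..b} \<longrightarrow> F x = 0" using Fl Fr by (metis atLeastAtMost_iff not_le)
    then show ?thesis unfolding JF' bump_fun_def using ab(1-3) \<open>smooth F\<close> by blast
  qed
  show "deriv (line_op (int_ker K) \<phi>) = \<phi>"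
    unfolding JF' using DERIV_imp_deriv[OF F] by auto
qed

lemma line_op_kJ_funpow_cs:
  assumes K: "K > 0" and "bump_fun \<phi>" and "\<And>c l. c < K \<Longrightarrow> l < m \<Longrightarrow> cell_moment K c l \<phi> = 0"
  shows "bump_fun ((line_op (int_ker K) ^^ m) \<phi>) \<and> (deriv ^^ m) ((line_op (int_ker K) ^^ m) \<phi>) = \<phi>"
  using assms(2-)
proof (induction m arbitrary: \<phi>)
  case (Suc m)
  have J: "bump_fun (line_op (int_ker K) \<phi>)" "deriv (line_op (int_ker K) \<phi>) = \<phi>"
    using line_op_kJ_cs[OF K Suc.prems(1)] Suc.prems(2) by auto
  have "cell_moment K c l (line_op (int_ker K) \<phi>) = 0" if "c < K" "l < m" for c l
    using that by (intro cell_moment_op1_kJ K bump_fun_bb Suc.prems) auto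
  from Suc.IH[OF J(1) this] J(2) show ?case by (simp add: funpow_swap1)
qed simp

text \<open>Functions biorthogonal to 1, t, ..., t^s on the unit interval, with a common bound. One
  family is fixed for each s, so every constant built from \<open>C\<eta>\<close> depends on the
  order s alone.\<close>

locale dual_functions =
  fixes s :: nat and \<eta> :: "nat \<Rightarrow> real \<Rightarrow> real" and C\<eta> :: real
  assumes eta_cs: "j \<le> s \<Longrightarrow> bump_fun (\<eta> j)"
    and eta_moment: "j \<le> s \<Longrightarrow> l \<le> s \<Longrightarrow> (\<integral>t. \<eta> j t * t ^ l \<partial>unif) = (if j = l then 1 else 0)"
    and eta_bound: "j \<le> s \<Longrightarrow> \<bar>\<eta> j t\<bar> \<le> C\<eta>"
    and C_eta_pos: "C\<eta> > 0"

lemma bump_fun_moment_integrable: "bump_fun \<phi> \<Longrightarrow> bdd_borel (\<lambda>t. \<phi> t * t ^ l)"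
  using bump_fun_bb[OF bump_fun_mult_left[of \<phi> "\<lambda>t. t ^ l"]] 
proof -
  assume a: "bump_fun \<phi>" and b: "bump_fun \<phi> \<Longrightarrow> smooth (\<lambda>t. t ^ l) \<Longrightarrow> bdd_borel (\<lambda>t. t ^ l * \<phi> t)"
  have "smooth (\<lambda>t. t ^ l)" by (induction l) (auto intro: smooth_const smooth_mult smooth_id)
  then show ?thesis using b[OF a] by (simp add: mult.commute)
qed

text \<open>Integration by parts; a bump vanishes at 0 and at 1, so there are no boundary
  terms.\<close>

lemma moment_deriv:
  assumes \<phi>: "bump_fun \<phi>"
  shows "(\<integral>t. deriv \<phi> t * t ^ l \<partial>unif) = - (real l * (\<integral>t. \<phi> t * t ^ (l - 1) \<partial>unif))"
proof -
  have "(\<integral>t. deriv \<phi> t * t ^ l + real l * (\<phi> t * t ^ (l - 1)) \<partial>unif) = \<phi> 1 * 1 ^ l - \<phi> 0 * 0 ^ l"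
  proof (rule integral_unif_Icc[where f = "\<lambda>t. deriv \<phi> t * t ^ l + real l * (\<phi> t * t ^ (l - 1))"
        and F = "\<lambda>t. \<phi> t * t ^ l" and a = 0 and b = 1])
    have c1: "continuous_on UNIV \<phi>" by (rule smooth_continuous[OF csD[OF \<phi>]])
    have c2: "continuous_on UNIV (deriv \<phi>)" by (rule smooth_continuous[OF smooth_deriv[OF csD[OF \<phi>]]])
    have c: "continuous_on UNIV (\<lambda>t. deriv \<phi> t * t ^ l + real l * (\<phi> t * t ^ (l - 1)))"
      by (intro continuous_intros c1 c2)
    then show "isCont (\<lambda>t. deriv \<phi> t * t ^ l + real l * (\<phi> t * t ^ (l - 1))) x" for x
      by (simp add: continuous_on_eq_continuous_at)
    show "(\<lambda>t. deriv \<phi> t * t ^ l + real l * (\<phi> t * t ^ (l - 1))) \<in> borel_measurable borel"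
      by (rule borel_measurable_continuous_onI[OF c])
    show "((\<lambda>t. \<phi> t * t ^ l) has_real_derivative deriv \<phi> x * x ^ l + real l * (\<phi> x * x ^ (l - 1))) (at x)" for x
      using DERIV_mult[OF smooth_has_derivative[OF csD[OF \<phi>]] DERIV_pow[of l x UNIV]]
      by (simp add: algebra_simps)
  qed auto
  moreover have "\<phi> 1 = 0" "\<phi> 0 = 0" using bump_fun_outside[OF \<phi>] by auto
  ultimately have "(\<integral>t. deriv \<phi> t * t ^ l + real l * (\<phi> t * t ^ (l - 1)) \<partial>unif) = 0" by simp
  then show ?thesis
    using bdd_borel_integrable[OF bump_fun_moment_integrable[OF bump_fun_deriv[OF \<phi>], of l]]
      bdd_borel_integrable[OF bump_fun_moment_integrable[OF \<phi>, of "l - 1"]] by simp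
qed

text \<open>Differentiation shifts moments, so a bump produces functions whose first non-vanishing
  moment is the one of any prescribed order.\<close>

lemma leading_moment_exists:
  "\<exists>\<gamma>. bump_fun \<gamma> \<and> (\<forall>l<j. (\<integral>t. \<gamma> t * t ^ l \<partial>unif) = 0) \<and> (\<integral>t. \<gamma> t * t ^ j \<partial>unif) = 1"
proof (induction j)
  case 0
  \<comment> \<open>The factor 8 makes the argument positive on (1/4, 1/2), since t (1 - t) > 1/8
    there.\<close>
  define \<beta> where "\<beta> t = expflat (real 8 * ((t - 0) * (1 - t)) - 1)" for t :: real
  have \<beta>: "bump_fun \<beta>" unfolding \<beta>_def by (rule bump_fun_expflat) auto
  have "(\<integral>t. \<beta> t \<partial>unif) \<noteq> 0"
  proof
    assume "(\<integral>t. \<beta> t \<partial>unif) = 0"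
    then have "AE t in unif. \<beta> t = 0"
      using bdd_borel_integrable[OF bump_fun_bb[OF \<beta>]]
      by (subst (asm) integral_nonneg_eq_0_iff_AE) (auto simp: \<beta>_def expflat_bounds)
    then have "AE t in lborel. t \<in> box 0 One \<longrightarrow> \<beta> t = 0"
      unfolding unif_def by (subst (asm) AE_density) (auto simp: indicator_def bump_fun_measurable \<beta>)
    then have "AE t in lborel. t \<notin> {1/4<..<1/2::real}"
    proof eventually_elim
      case (elim t)
      show ?case
      proof
        assume t: "t \<in> {1/4<..<1/2}"
        have "1/4 * (1/2) \<le> t * (1 - t)" using t by (intro mult_mono) auto
        moreover have "(1/4 * (1/2) :: real) < t * (1 - t)" 
          using t mult_strict_mono[of "1/4" t "1/2" "1 - t"] by auto
        ultimately have "\<beta> t \<noteq> 0" unfolding \<beta>_def expflat_def by auto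
        then show False using elim t by auto
      qed
    qed
    then have "emeasure lborel {1/4<..<1/2::real} = 0"
      by (subst (asm) AE_iff_measurable[of "{1/4<..<1/2}"]) auto
    then show False by simp
  qed
  then have "(\<integral>t. (1 / (\<integral>t. \<beta> t \<partial>unif)) * \<beta> t * t ^ 0 \<partial>unif) = 1" by simp
  moreover have "bump_fun (\<lambda>t. (1 / (\<integral>t. \<beta> t \<partial>unif)) * \<beta> t)" by (rule bump_fun_cmult[OF \<beta>])
  ultimately show ?case by blast
next
  case (Suc j)
  then obtain \<gamma> where \<gamma>: "bump_fun \<gamma>" "\<forall>l<j. (\<integral>t. \<gamma> t * t ^ l \<partial>unif) = 0" "(\<integral>t. \<gamma> t * t ^ j \<partial>unif) = 1"
    by blast
  \<comment> \<open>Integration by parts multiplies the moment by -(j + 1) in the step from order j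
    to order j + 1; the normalisation undoes this.\<close>
  define \<delta> where "\<delta> t = (- 1 / real (Suc j)) * deriv \<gamma> t" for t
  have \<delta>: "(\<integral>t. \<delta> t * t ^ l \<partial>unif) = real l / real (Suc j) * (\<integral>t. \<gamma> t * t ^ (l - 1) \<partial>unif)" for l
    using moment_deriv[OF \<gamma>(1), of l] by (simp add: \<delta>_def mult.assoc del: of_nat_Suc)
  have "bump_fun \<delta>" unfolding \<delta>_def by (intro bump_fun_cmult bump_fun_deriv \<gamma>)
  moreover have "(\<integral>t. \<delta> t * t ^ l \<partial>unif) = 0" if "l < Suc j" for l
    using \<gamma>(2) that unfolding \<delta> by (cases l) auto
  moreover have "(\<integral>t. \<delta> t * t ^ Suc j \<partial>unif) = 1"
    unfolding \<delta> using \<gamma>(3) by (simp del: of_nat_Suc)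
  ultimately show ?case by blast
qed

text \<open>A triangular system: a multiple of a bump whose first non-zero moment has order m
  corrects moment m and leaves the lower moments alone.\<close>

lemma prescribed_moments_exist:
  "\<exists>\<phi>. bump_fun \<phi> \<and> (\<forall>l<m. (\<integral>t. \<phi> t * t ^ l \<partial>unif) = v l)"
proof (induction m)
  case 0
  show ?case using bump_fun_zero by auto
next
  case (Suc m)
  then obtain \<phi> where \<phi>: "bump_fun \<phi>" "\<forall>l<m. (\<integral>t. \<phi> t * t ^ l \<partial>unif) = v l" by blast
  obtain \<gamma> where \<gamma>: "bump_fun \<gamma>" "\<forall>l<m. (\<integral>t. \<gamma> t * t ^ l \<partial>unif) = 0" "(\<integral>t. \<gamma> t * t ^ m \<partial>unif) = 1"
    using leading_moment_exists[of m] by blast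
  define a where "a = v m - (\<integral>t. \<phi> t * t ^ m \<partial>unif)"
  have "(\<integral>t. (\<phi> t + a * \<gamma> t) * t ^ l \<partial>unif) = (\<integral>t. \<phi> t * t ^ l \<partial>unif) + a * (\<integral>t. \<gamma> t * t ^ l \<partial>unif)" for l
    using bdd_borel_integrable[OF bump_fun_moment_integrable[OF \<phi>(1), of l]]
      bdd_borel_integrable[OF bump_fun_moment_integrable[OF \<gamma>(1), of l]]
    by (simp add: distrib_right mult.assoc)
  then have "\<forall>l<Suc m. (\<integral>t. (\<phi> t + a * \<gamma> t) * t ^ l \<partial>unif) = v l"
    using \<phi>(2) \<gamma>(2,3) by (auto simp: less_Suc_eq a_def)
  moreover have "bump_fun (\<lambda>t. \<phi> t + a * \<gamma> t)" by (intro bump_fun_add bump_fun_cmult \<phi> \<gamma>)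
  ultimately show ?case by (intro exI[of _ "\<lambda>t. \<phi> t + a * \<gamma> t"]) blast
qed

lemma dual_functions_exist: "\<exists>\<eta> C. dual_functions s \<eta> C"
proof -
  have "\<forall>j. \<exists>\<phi>. bump_fun \<phi> \<and> (\<forall>l<Suc s. (\<integral>t. \<phi> t * t ^ l \<partial>unif) = (if j = l then 1 else 0))"
    using prescribed_moments_exist[of "Suc s" "\<lambda>l. if _ = l then 1 else 0"] by (intro allI)
  then obtain \<eta> where \<eta>: "\<And>j. bump_fun (\<eta> j)"
    "\<And>j l. l < Suc s \<Longrightarrow> (\<integral>t. \<eta> j t * t ^ l \<partial>unif) = (if j = l then 1 else 0)" by metis
  have "\<forall>j. \<exists>B>0. \<forall>x. \<bar>\<eta> j x\<bar> \<le> B" using bump_fun_bounded[OF \<eta>(1)] by blast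
  then obtain B where B: "\<And>j. B j > 0" "\<And>j x. \<bar>\<eta> j x\<bar> \<le> B j" by metis
  have "dual_functions s \<eta> (\<Sum>j\<le>s. B j)"
  proof
    show "\<bar>\<eta> j t\<bar> \<le> (\<Sum>j\<le>s. B j)" if "j \<le> s" for j t
      using B(2)[of j t] member_le_sum[of j "{..s}" B] B(1) that by (force intro: less_imp_le)
    show "(\<Sum>j\<le>s. B j) > 0" using B(1) by (intro sum_pos) auto
  qed (use \<eta> in auto)
  then show ?thesis by blast
qed

text \<open>The substitution v = K t - c maps cell c onto the unit interval, and the factor K
  compensates for dt = dv / K. On all other cells the rescaled bump vanishes.\<close>

lemma cell_moment_scaled:
  assumes K: "K > 0" and c: "c < K" and \<phi>: "bump_fun \<phi>"
  shows "bump_fun (\<lambda>t. \<phi> (real K * t - real c))"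
    and "cell_moment K c' l (\<lambda>t. real K * \<phi> (real K * t - real c)) = (if c = c' then \<integral>t. \<phi> t * t ^ l \<partial>unif else 0)"
proof -
  obtain a b where ab: "0 < a" "a < b" "b < 1" "\<And>x. x \<notin> {a..b} \<Longrightarrow> \<phi> x = 0"
    using \<phi> bump_fun_def by blast
  have sm: "smooth (\<lambda>t. \<phi> (real K * t - real c))"
    by (intro smooth_compose[OF csD[OF \<phi>]] smooth_diff smooth_cmult smooth_id smooth_const)
  show "bump_fun (\<lambda>t. \<phi> (real K * t - real c))"
    unfolding bump_fun_def
  proof (rule conjI[OF sm], rule exI[of _ "(a + c) / K"], rule exI[of _ "(b + c) / K"], intro conjI allI impI)
    show "0 < (a + c) / K" using ab K by (auto intro!: divide_pos_pos add_pos_nonneg)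
    show "(a + c) / K < (b + c) / K" using ab K by (simp add: divide_strict_right_mono)
    have "real c + 1 \<le> K" using c by linarith
    then have "b + c < K" using ab by linarith
    then show "(b + c) / K < 1" using K by simp
    show "\<phi> (real K * x - real c) = 0" if "x \<notin> {(a + c) / K..(b + c) / K}" for x
    proof (rule ab(4))
      show "real K * x - real c \<notin> {a..b}" using that K by (auto simp: field_simps)
    qed
  qed
  have fl: "\<lfloor>real K * t\<rfloor> = int c'' \<longleftrightarrow> 0 \<le> real K * t - c'' \<and> real K * t - c'' < 1" for t c''
    by (simp add: floor_eq_iff) linarith
  show "cell_moment K c' l (\<lambda>t. real K * \<phi> (real K * t - real c)) = (if c = c' then \<integral>t. \<phi> t * t ^ l \<partial>unif else 0)"
  proof (cases "c = c'")
    case False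
    have "real K * \<phi> (real K * t - real c) * (if \<lfloor>real K * t\<rfloor> = int c' then (real K * t - real c') ^ l else 0) = 0" for t
    proof (cases "\<lfloor>real K * t\<rfloor> = int c'")
      case True
      then have "\<lfloor>real K * t\<rfloor> \<noteq> int c" using False by simp
      then have "\<phi> (real K * t - real c) = 0" using fl[of t c] by (intro bump_fun_outside[OF \<phi>]) auto
      then show ?thesis by simp
    qed simp
    then show ?thesis using False unfolding cell_moment_def by (simp only: Bochner_Integration.integral_zero if_False)
  next
    case True
    define F where "F v = indicator {0<..<1} v * (\<phi> v * v ^ l)" for v
    have F1: "indicator {0<..<1} t * (real K * \<phi> (real K * t - real c) *
       (if \<lfloor>real K * t\<rfloor> = int c then (real K * t - real c) ^ l else 0)) = real K * F (- real c + real K * t)" for t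
    proof (cases "0 < real K * t - real c \<and> real K * t - real c < 1")
      case True
      have "0 < t" using True K by (metis add.commute add_pos_nonneg diff_add_cancel of_nat_0_le_iff of_nat_0_less_iff zero_less_mult_pos)
      moreover have "real c + 1 \<le> K" using c by linarith
      then have "real K * t < real K" using True by linarith
      then have "t < 1" using K by simp
      ultimately show ?thesis using True fl[of t c] by (simp add: F_def)
    next
      case False
      then have "\<phi> (real K * t - real c) = 0" by (intro bump_fun_outside[OF \<phi>]) auto
      then show ?thesis by (simp add: F_def)
    qed
    have "cell_moment K c l (\<lambda>t. real K * \<phi> (real K * t - real c)) = (\<integral>t. real K * F (- real c + real K * t) \<partial>lborel)"
      unfolding cell_moment_def
      using bdd_borel_measurable[OF bdd_borel_mult[OF bdd_borel_cmult[OF bump_fun_bb[OF \<open>bump_fun (\<lambda>t. \<phi> (real K * t - real c))\<close>], of "real K"] bdd_borel_cell_monomial[of K c l]]]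
      by (subst integral_unif) (auto simp: F1)
    also have "\<dots> = (\<integral>v. F v \<partial>lborel)"
      using lborel_integral_real_affine[of "real K" F "- real c"] K by simp
    also have "\<dots> = (\<integral>t. \<phi> t * t ^ l \<partial>unif)"
      using bdd_borel_measurable[OF bump_fun_moment_integrable[OF \<phi>, of l]]
      by (subst integral_unif) (auto simp: F_def[abs_def])
    finally show ?thesis using True by simp
  qed
qed

section \<open>The cellwise polynomial projection and the residual of its transpose\<close>

context dual_functions
begin

text \<open>The dual functions, rescaled to the cell of u, extract the coefficients of a local
  polynomial; the powers of the local variable of u reassemble it. The value 0 outside [0,1) leaves
  only K cells, which keeps the rank finite.\<close>

definition proj_ker :: "nat \<Rightarrow> real \<Rightarrow> real \<Rightarrow> real" where
  "proj_ker K u t = (if 0 \<le> u \<and> u < 1 then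
     (\<Sum>j\<le>s. (real K * u - of_int \<lfloor>real K * u\<rfloor>) ^ j * (real K * \<eta> j (real K * t - of_int \<lfloor>real K * u\<rfloor>))) else 0)"

definition proj_const :: real where "proj_const = real (Suc s) * C\<eta>"

lemma proj_const_pos: "proj_const > 0"
  using C_eta_pos by (simp add: proj_const_def)

lemma proj_ker_bound:
  "\<bar>proj_ker K u t\<bar> \<le> proj_const * real K * (if same_cell K u t then 1 else 0)"
proof (cases "same_cell K u t")
  case False
  have "\<eta> j (real K * t - of_int \<lfloor>real K * u\<rfloor>) = 0" if "j \<le> s" for j
  proof (rule bump_fun_outside[OF eta_cs[OF that]])
    show "real K * t - of_int \<lfloor>real K * u\<rfloor> \<le> 0 \<or> 1 \<le> real K * t - of_int \<lfloor>real K * u\<rfloor>"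
      using False unfolding same_cell_def by (metis add.commute diff_ge_0_iff_ge floor_unique le_diff_eq nle_le not_less)
  qed
  then show ?thesis using False by (simp add: proj_ker_def)
next
  case True
  define v where "v = real K * u - of_int \<lfloor>real K * u\<rfloor>"
  have v: "0 \<le> v" "v \<le> 1" unfolding v_def by linarith+
  have "\<bar>proj_ker K u t\<bar> \<le> (\<Sum>j\<le>s. \<bar>v ^ j * (real K * \<eta> j (real K * t - of_int \<lfloor>real K * u\<rfloor>))\<bar>)"
    unfolding proj_ker_def v_def[symmetric] by (simp add: sum_nonneg)
  also have "\<dots> \<le> (\<Sum>j\<le>s. 1 * (real K * C\<eta>))"
    unfolding abs_mult using v eta_bound
    by (intro sum_mono mult_mono) (auto simp: power_le_one)
  also have "\<dots> = proj_const * real K" by (simp add: proj_const_def)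
  finally show ?thesis using True by simp
qed

lemma bdd_ker_kP: "bdd_ker (proj_ker K)"
proof (rule bkerI)
  have [measurable]: "\<eta> j \<in> borel_measurable borel" if "j \<le> s" for j
    by (rule bump_fun_measurable[OF eta_cs[OF that]])
  have "(\<lambda>p. \<Sum>j\<le>s. (real K * fst p - of_int \<lfloor>real K * fst p\<rfloor>) ^ j *
       (real K * \<eta> j (real K * snd p - of_int \<lfloor>real K * fst p\<rfloor>))) \<in> borel_measurable (borel \<Otimes>\<^sub>M borel)"
    by (rule borel_measurable_sum) measurable
  then show "(\<lambda>(u, t). proj_ker K u t) \<in> borel_measurable (borel \<Otimes>\<^sub>M borel)"
    unfolding proj_ker_def case_prod_unfold by measurable
  show "\<bar>proj_ker K u t\<bar> \<le> proj_const * real K" for u t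
    using proj_ker_bound[of K u t] proj_const_pos by (auto split: if_splits)
qed

lemma proj_ker_eq:
  assumes "0 \<le> u" "u < 1" "\<lfloor>real K * u\<rfloor> = int c"
  shows "proj_ker K u t = (\<Sum>j\<le>s. (real K * u - real c) ^ j * (real K * \<eta> j (real K * t - real c)))"
  using assms by (simp add: proj_ker_def)

text \<open>Biorthogonality selects the single term j = l, so polynomials of degree at most s in the
  local variable are reproduced.\<close>

lemma integral_kP_monomial:
  assumes K: "K > 0" and u: "0 \<le> u" "u < 1" "\<lfloor>real K * u\<rfloor> = int c" and l: "l \<le> s"
  shows "(\<integral>t. proj_ker K u t * (if \<lfloor>real K * t\<rfloor> = int c then (real K * t - real c) ^ l else 0) \<partial>unif)
    = (real K * u - real c) ^ l"
proof -
  have c: "c < K" using cell_exists[OF K u(1,2)] u(3) by (metis of_nat_eq_iff)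
  have "(\<integral>t. proj_ker K u t * (if \<lfloor>real K * t\<rfloor> = int c then (real K * t - real c) ^ l else 0) \<partial>unif)
      = cell_moment K c l (\<lambda>t. \<Sum>j\<le>s. (real K * u - real c) ^ j * (real K * \<eta> j (real K * t - real c)))"
    unfolding cell_moment_def proj_ker_eq[OF u] ..
  also have "\<dots> = (\<Sum>j\<le>s. (real K * u - real c) ^ j * cell_moment K c l (\<lambda>t. real K * \<eta> j (real K * t - real c)))"
  proof (subst cell_moment_sum)
    show "bdd_borel (\<lambda>t. (real K * u - real c) ^ j * (real K * \<eta> j (real K * t - real c)))" if "j \<in> {..s}" for j
      by (rule bdd_borel_cmult, rule bdd_borel_cmult, rule bump_fun_bb, rule cell_moment_scaled(1)[OF K c eta_cs]) (use that in auto)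
  qed (simp_all add: cell_moment_cmult)
  also have "\<dots> = (\<Sum>j\<le>s. if j = l then (real K * u - real c) ^ j else 0)"
    using cell_moment_scaled(2)[OF K c eta_cs] eta_moment l by (intro sum.cong) auto
  also have "\<dots> = (real K * u - real c) ^ l" using l by simp
  finally show ?thesis .
qed

text \<open>For any bounded Borel \<psi> the transpose is a finite sum of bumps, each supported in
  one cell, with the cell moments of \<psi> as coefficients. Smoothness is produced by the kernel
  and not inherited from \<psi>.\<close>

lemma line_op_kP_transpose:
  assumes K: "K > 0" and \<psi>: "bdd_borel \<psi>"
  shows "line_op (\<lambda>t u. proj_ker K u t) \<psi> t = (\<Sum>c<K. \<Sum>j\<le>s. cell_moment K c j \<psi> * (real K * \<eta> j (real K * t - real c)))"
proof -
  have "line_op (\<lambda>t u. proj_ker K u t) \<psi> t = (\<integral>u. (\<Sum>c<K. \<Sum>j\<le>s. (real K * \<eta> j (real K * t - real c)) *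
     (\<psi> u * (if \<lfloor>real K * u\<rfloor> = int c then (real K * u - real c) ^ j else 0))) \<partial>unif)"
    unfolding line_op_def
  proof (rule integral_cong_AE)
    show "AE u in unif. proj_ker K u t * \<psi> u = (\<Sum>c<K. \<Sum>j\<le>s. (real K * \<eta> j (real K * t - real c)) *
     (\<psi> u * (if \<lfloor>real K * u\<rfloor> = int c then (real K * u - real c) ^ j else 0)))"
      using AE_unif_box
    proof eventually_elim
      case (elim u)
      then have u: "0 \<le> u" "u < 1" by auto
      obtain c where c: "c < K" "\<lfloor>real K * u\<rfloor> = int c" using cell_exists[OF K u] .
      have "(\<Sum>c'<K. \<Sum>j\<le>s. (real K * \<eta> j (real K * t - real c')) *
          (\<psi> u * (if \<lfloor>real K * u\<rfloor> = int c' then (real K * u - real c') ^ j else 0)))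
        = (\<Sum>c'<K. if c' = c then \<Sum>j\<le>s. (real K * \<eta> j (real K * t - real c)) * (\<psi> u * (real K * u - real c) ^ j) else 0)"
        using c by (intro sum.cong) auto
      also have "\<dots> = (\<Sum>j\<le>s. (real K * \<eta> j (real K * t - real c)) * (\<psi> u * (real K * u - real c) ^ j))"
        using c by simp
      also have "\<dots> = proj_ker K u t * \<psi> u"
        by (simp add: proj_ker_eq[OF u c(2)] sum_distrib_left sum_distrib_right ac_simps)
      finally show ?case by simp
    qed
    show "(\<lambda>u. proj_ker K u t * \<psi> u) \<in> borel_measurable unif"
      using bdd_borel_measurable[OF bdd_borel_mult[OF bdd_borel_ker[OF bdd_ker_transpose[OF bdd_ker_kP]] \<psi>]] by simp
    show "(\<lambda>u. \<Sum>c<K. \<Sum>j\<le>s. (real K * \<eta> j (real K * t - real c)) *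
     (\<psi> u * (if \<lfloor>real K * u\<rfloor> = int c then (real K * u - real c) ^ j else 0))) \<in> borel_measurable unif"
      using bdd_borel_measurable[OF \<psi>] by simp
  qed
  also have "\<dots> = (\<Sum>c<K. \<Sum>j\<le>s. (real K * \<eta> j (real K * t - real c)) * cell_moment K c j \<psi>)"
  proof -
    have I: "integrable unif (\<lambda>u. a * (\<psi> u * (if \<lfloor>real K * u\<rfloor> = int c then (real K * u - real c) ^ j else 0)))" for a c j
      by (intro bdd_borel_integrable bdd_borel_cmult bdd_borel_mult \<psi> bdd_borel_cell_monomial)
    show ?thesis
      unfolding cell_moment_def
      by (simp only: Bochner_Integration.integral_sum Bochner_Integration.integrable_sum I
          Bochner_Integration.integral_mult_right_zero)
  qed
  finally show ?thesis by (simp add: mult.commute)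
qed

definition resid1 :: "nat \<Rightarrow> (real \<Rightarrow> real) \<Rightarrow> real \<Rightarrow> real" where
  "resid1 K \<psi> t = \<psi> t - line_op (\<lambda>t u. proj_ker K u t) \<psi> t"

lemma bdd_borel_resid1: "bdd_borel \<psi> \<Longrightarrow> bdd_borel (resid1 K \<psi>)"
  unfolding resid1_def[abs_def] by (intro bdd_borel_diff bdd_borel_op1[OF bdd_ker_transpose[OF bdd_ker_kP]])

lemma resid1_cs:
  assumes K: "K > 0" and \<psi>: "bump_fun \<psi>"
  shows "bump_fun (resid1 K \<psi>)"
  unfolding resid1_def[abs_def] line_op_kP_transpose[OF K bump_fun_bb[OF \<psi>]]
proof (intro bump_fun_diff bump_fun_sum \<psi>)
  show "bump_fun (\<lambda>t. cell_moment K c j \<psi> * (real K * \<eta> j (real K * t - real c)))" if "c \<in> {..<K}" "j \<in> {..s}" for c j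
    by (rule bump_fun_cmult, rule bump_fun_cmult, rule cell_moment_scaled(1)[OF K _ eta_cs]) (use that in auto)
qed auto

text \<open>By biorthogonality the transposed projection preserves all cell moments up to order s;
  this is the dual form of reproducing polynomials.\<close>

lemma cell_moment_resid1:
  assumes K: "K > 0" and c: "c < K" and l: "l \<le> s" and \<psi>: "bdd_borel \<psi>"
  shows "cell_moment K c l (resid1 K \<psi>) = 0"
proof -
  have b: "bdd_borel (\<lambda>t. real K * \<eta> j (real K * t - real c'))" if "j \<le> s" "c' < K" for j c'
    by (rule bdd_borel_cmult, rule bump_fun_bb, rule cell_moment_scaled(1)[OF K that(2) eta_cs[OF that(1)]])
  have "cell_moment K c l (resid1 K \<psi>) = cell_moment K c l \<psi>
      - cell_moment K c l (\<lambda>t. \<Sum>c'<K. \<Sum>j\<le>s. cell_moment K c' j \<psi> * (real K * \<eta> j (real K * t - real c')))"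
    unfolding resid1_def[abs_def] line_op_kP_transpose[OF K \<psi>] by (intro cell_moment_diff \<psi> bdd_borel_sum bdd_borel_cmult b) auto
  also have "cell_moment K c l (\<lambda>t. \<Sum>c'<K. \<Sum>j\<le>s. cell_moment K c' j \<psi> * (real K * \<eta> j (real K * t - real c')))
    = (\<Sum>c'<K. \<Sum>j\<le>s. cell_moment K c' j \<psi> * cell_moment K c l (\<lambda>t. real K * \<eta> j (real K * t - real c')))"
    by (subst cell_moment_sum, simp, intro bdd_borel_sum bdd_borel_cmult b, simp_all, intro sum.cong refl, subst cell_moment_sum, simp, intro bdd_borel_cmult b)
      (auto simp: cell_moment_cmult[of K c l "cell_moment _ _ _ _"])
  also have "\<dots> = (\<Sum>c'<K. \<Sum>j\<le>s. if c' = c \<and> j = l then cell_moment K c l \<psi> else 0)"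
    using cell_moment_scaled(2)[OF K _ eta_cs] eta_moment l by (intro sum.cong refl) auto
  also have "\<dots> = (\<Sum>c'<K. if c' = c then cell_moment K c l \<psi> else 0)"
    using l by (intro sum.cong refl) auto
  also have "\<dots> = cell_moment K c l \<psi>" using c by simp
  finally show ?thesis by simp
qed

end

section \<open>Weak derivatives\<close>

text \<open>Bounded pointwise convergence: by dominated convergence, integrals against a fixed
  integrable function and all operators with bounded kernels respect it.\<close>

definition bdd_conv :: "(nat \<Rightarrow> 'a::topological_space \<Rightarrow> real) \<Rightarrow> ('a \<Rightarrow> real) \<Rightarrow> bool" where
  "bdd_conv \<psi>s \<psi> \<longleftrightarrow> (\<forall>n. bdd_borel (\<psi>s n)) \<and> (\<exists>A. \<forall>n x. \<bar>\<psi>s n x\<bar> \<le> A) \<and> (\<forall>x. (\<lambda>n. \<psi>s n x) \<longlonglongrightarrow> \<psi> x)"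

lemma bconvI:
  "(\<And>n. \<psi>s n \<in> borel_measurable borel) \<Longrightarrow> (\<And>n x. \<bar>\<psi>s n x\<bar> \<le> A) \<Longrightarrow> (\<And>x. (\<lambda>n. \<psi>s n x) \<longlonglongrightarrow> \<psi> x) \<Longrightarrow>
   bdd_conv \<psi>s \<psi>"
  unfolding bdd_conv_def bdd_borel_def by blast

lemma bconvD:
  assumes "bdd_conv \<psi>s \<psi>"
  shows "bdd_borel (\<psi>s n)" "(\<lambda>n. \<psi>s n x) \<longlonglongrightarrow> \<psi> x" "\<exists>A. \<forall>n x. \<bar>\<psi>s n x\<bar> \<le> A"
  using assms by (auto simp: bdd_conv_def)

lemma bdd_conv_bb:
  assumes "bdd_conv \<psi>s \<psi>"
  shows "bdd_borel \<psi>"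
proof -
  obtain A where A: "\<forall>n x. \<bar>\<psi>s n x\<bar> \<le> A" using bconvD(3)[OF assms] by blast
  have "\<psi> \<in> borel_measurable borel"
    by (rule borel_measurable_LIMSEQ_real[OF bconvD(2)[OF assms]]) (rule bdd_borel_measurable[OF bconvD(1)[OF assms]])
  moreover have "\<bar>\<psi> x\<bar> \<le> A" for x
    using tendsto_rabs[OF bconvD(2)[OF assms, of x]] A by (intro LIMSEQ_le_const2) auto
  ultimately show ?thesis by (rule bbI)
qed

lemma bdd_conv_diff:
  assumes "bdd_conv \<phi>s \<phi>" "bdd_conv \<psi>s \<psi>"
  shows "bdd_conv (\<lambda>n x. \<phi>s n x - \<psi>s n x) (\<lambda>x. \<phi> x - \<psi> x)"
proof -
  obtain A where A: "\<forall>n x. \<bar>\<phi>s n x\<bar> \<le> A" using bconvD(3)[OF assms(1)] by blast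
  obtain B where B: "\<forall>n x. \<bar>\<psi>s n x\<bar> \<le> B" using bconvD(3)[OF assms(2)] by blast
  show ?thesis
  proof (rule bconvI)
    show "(\<lambda>x. \<phi>s n x - \<psi>s n x) \<in> borel_measurable borel" for n
      by (rule bdd_borel_measurable[OF bdd_borel_diff[OF bconvD(1)[OF assms(1)] bconvD(1)[OF assms(2)]]])
    show "\<bar>\<phi>s n x - \<psi>s n x\<bar> \<le> A + B" for n x
      using A[rule_format, of n x] B[rule_format, of n x] by linarith
    show "(\<lambda>n. \<phi>s n x - \<psi>s n x) \<longlonglongrightarrow> \<phi> x - \<psi> x" for x
      by (intro tendsto_diff bconvD(2) assms)
  qed
qed

lemma bdd_conv_op:
  fixes \<psi>s :: "nat \<Rightarrow> real ^ 'd::finite \<Rightarrow> real"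
  assumes k: "bdd_ker k" and "bdd_conv \<psi>s \<psi>"
  shows "bdd_conv (\<lambda>n. coord_op i k (\<psi>s n)) (coord_op i k \<psi>)"
proof -
  obtain A where A: "\<forall>n x. \<bar>\<psi>s n x\<bar> \<le> A" using bconvD(3)[OF assms(2)] by blast
  obtain B where B: "B > 0" "\<And>u t. \<bar>k u t\<bar> \<le> B" using bdd_ker_bound[OF k] by auto
  show ?thesis
  proof (rule bconvI)
    show "coord_op i k (\<psi>s n) \<in> borel_measurable borel" for n
      by (rule bdd_borel_measurable[OF bdd_borel_op[OF k bconvD(1)[OF assms(2)]]])
    show "\<bar>coord_op i k (\<psi>s n) x\<bar> \<le> B * A" for n x
      unfolding coord_op_def using A by (intro line_op_bound[OF B(2) _ k] bdd_borel_slice bconvD(1)[OF assms(2)]) auto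
    show "(\<lambda>n. coord_op i k (\<psi>s n) x) \<longlonglongrightarrow> coord_op i k \<psi> x" for x
      unfolding coord_op_def
      using A by (intro line_op_tendsto[OF k, where A = A] bdd_borel_slice bconvD[OF assms(2)]) auto
  qed
qed

lemma bdd_conv_op_funpow:
  fixes \<psi>s :: "nat \<Rightarrow> real ^ 'd::finite \<Rightarrow> real"
  assumes k: "bdd_ker k" and "bdd_conv \<psi>s \<psi>"
  shows "bdd_conv (\<lambda>n. (coord_op i k ^^ m) (\<psi>s n)) ((coord_op i k ^^ m) \<psi>)"
  by (induction m) (auto intro: assms bdd_conv_op)

lemma bdd_conv_integral:
  fixes \<psi>s :: "nat \<Rightarrow> 'a::euclidean_space \<Rightarrow> real"
  assumes D: "integrable unif D" and "bdd_conv \<psi>s \<psi>"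
  shows "(\<lambda>n. \<integral>x. D x * \<psi>s n x \<partial>unif) \<longlonglongrightarrow> (\<integral>x. D x * \<psi> x \<partial>unif)"
proof -
  obtain A where A: "\<forall>n x. \<bar>\<psi>s n x\<bar> \<le> A" using bconvD(3)[OF assms(2)] by blast
  have Dm: "D \<in> borel_measurable borel" using borel_measurable_integrable[OF D] by simp
  show ?thesis
  proof (rule integral_dominated_convergence[where w = "\<lambda>x. \<bar>D x\<bar> * A"])
    show "integrable unif (\<lambda>x. \<bar>D x\<bar> * A)" using D by simp
    show "(\<lambda>x. D x * \<psi> x) \<in> borel_measurable unif"
      using Dm bdd_borel_measurable[OF bdd_conv_bb[OF assms(2)]] by simp
    show "(\<lambda>x. D x * \<psi>s n x) \<in> borel_measurable unif" for n
      using Dm bdd_borel_measurable[OF bconvD(1)[OF assms(2)]] by simp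
    show "AE x in unif. (\<lambda>n. D x * \<psi>s n x) \<longlonglongrightarrow> D x * \<psi> x"
      by (intro AE_I2 tendsto_mult tendsto_const bconvD(2) assms)
    show "AE x in unif. norm (D x * \<psi>s n x) \<le> \<bar>D x\<bar> * A" for n
      unfolding real_norm_def abs_mult using A by (intro AE_I2 mult_left_mono) auto
  qed
qed

text \<open>A monotone class argument whose generators are products of smooth bumps. They reach
  indicators of boxes, disjoint unions and complements reach all Borel sets, and monotone limits and
  differences reach bounded functions. The cut-off to the open cube is forced, since every bump
  vanishes outside it.\<close>

lemma bounded_borel_induct_bumps:
  fixes P :: "(real ^ 'd::finite \<Rightarrow> real) \<Rightarrow> bool"
  assumes bump: "\<And>\<phi>. (\<And>j. bump_fun (\<phi> j)) \<Longrightarrow> P (\<lambda>x. \<Prod>j\<in>UNIV. \<phi> j (x $ j))"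
    and padd: "\<And>f g. bdd_borel f \<Longrightarrow> bdd_borel g \<Longrightarrow> P f \<Longrightarrow> P g \<Longrightarrow> P (\<lambda>x. f x + g x)"
    and pcmult: "\<And>c f. bdd_borel f \<Longrightarrow> P f \<Longrightarrow> P (\<lambda>x. c * f x)"
    and plim: "\<And>fs f. bdd_conv fs f \<Longrightarrow> (\<And>n. P (fs n)) \<Longrightarrow> P f"
    and \<psi>: "bdd_borel \<psi>"
  shows "P (\<lambda>x. indicator (box 0 One) x * \<psi> x)"
proof -
  let ?U = "box 0 One :: (real ^ 'd) set"
  have zero: "P (\<lambda>x. 0)"
    using pcmult[of "\<lambda>x. \<Prod>j\<in>UNIV. 0" 0] bump[of "\<lambda>j x. 0"] bump_fun_zero by simp
  have box: "P (indicator (box a b \<inter> ?U))" for a b :: "real ^ 'd"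
  proof -
    \<comment> \<open>Clipping to the unit interval keeps the approximating bumps inside the cube;
      an interval that becomes reversed means that the box misses the cube.\<close>
    define a' where "a' j = max (a $ j) 0" for j
    define b' where "b' j = min (b $ j) 1" for j
    have mem: "x \<in> box a b \<inter> ?U \<longleftrightarrow> (\<forall>j. x $ j \<in> {a' j<..<b' j})" for x
      by (auto simp: mem_box_cart sum_Basis_vec_nth a'_def b'_def)
    show ?thesis
    proof (cases "\<forall>j. a' j \<le> b' j")
      case False
      then have "box a b \<inter> ?U = {}" using mem by (metis all_not_in_conv greaterThanLessThan_iff less_imp_le less_trans)
      then show ?thesis using zero by (simp add: indicator_def[abs_def])
    next
      case True
      define \<phi> where "\<phi> n j t = expflat (real (Suc n) * ((t - a' j) * (b' j - t)) - 1)" for n j t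
      have bump_fun: "bump_fun (\<phi> n j)" for n j
        unfolding \<phi>_def[abs_def] using True
        by (intro bump_fun_expflat) (auto simp: a'_def b'_def)
      have "bdd_conv (\<lambda>n x. \<Prod>j\<in>UNIV. \<phi> n j (x $ j)) (indicator (box a b \<inter> ?U))"
      proof (rule bconvI)
        have [measurable]: "\<phi> n j \<in> borel_measurable borel" for n j by (rule bump_fun_measurable[OF bump_fun])
        show "(\<lambda>x. \<Prod>j\<in>UNIV. \<phi> n j (x $ j)) \<in> borel_measurable borel" for n
          by measurable
        show "\<bar>\<Prod>j\<in>UNIV. \<phi> n j (x $ j)\<bar> \<le> 1" for n x
          unfolding abs_prod by (intro prod_le_1) (auto simp: \<phi>_def expflat_bounds)
        show "(\<lambda>n. \<Prod>j\<in>UNIV. \<phi> n j (x $ j)) \<longlonglongrightarrow> indicator (box a b \<inter> ?U) x" for x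
        proof -
          have "(\<lambda>n. \<Prod>j\<in>UNIV. \<phi> n j (x $ j)) \<longlonglongrightarrow> (\<Prod>j\<in>UNIV. indicator {a' j<..<b' j} (x $ j))"
            unfolding \<phi>_def using True by (intro tendsto_prod expflat_tendsto_indicator) auto
          moreover have "(\<Prod>j\<in>UNIV. indicator {a' j<..<b' j} (x $ j) :: real) = indicator (box a b \<inter> ?U) x"
          proof (cases "x \<in> box a b \<inter> ?U")
            case True
            then have "\<forall>j. x $ j \<in> {a' j<..<b' j}" using mem by blast
            then show ?thesis using True by simp
          next
            case False
            then obtain j where "x $ j \<notin> {a' j<..<b' j}" using mem by blast
            then have "(\<Prod>j\<in>UNIV. indicator {a' j<..<b' j} (x $ j) :: real) = 0"
              by (intro prod_zero bexI[of _ j]) auto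
            then show ?thesis using False by simp
          qed
          ultimately show ?thesis by simp
        qed
      qed
      then show ?thesis by (rule plim) (rule bump[OF bump_fun])
    qed
  qed
  have U: "P (indicator ?U)" using box[of 0 One] by simp
  have pset: "P (indicator (A \<inter> ?U))" if "A \<in> sets borel" for A
  proof -
    let ?G = "range (\<lambda>(a, b). box a b :: (real ^ 'd) set)"
    have "Int_stable ?G"
    proof (rule Int_stableI)
      fix a b assume "a \<in> ?G" "b \<in> ?G"
      then obtain l u l' u' where ab: "a = box l u" "b = box l' u'" by auto
      have "a \<inter> b = box (\<Sum>i\<in>Basis. max (l \<bullet> i) (l' \<bullet> i) *\<^sub>R i) (\<Sum>i\<in>Basis. min (u \<bullet> i) (u' \<bullet> i) *\<^sub>R i)"
        unfolding ab by (rule box_Int_box)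
      then show "a \<inter> b \<in> ?G" by auto
    qed
    moreover have "?G \<subseteq> Pow UNIV" by simp
    moreover have "A \<in> sigma_sets UNIV ?G" using that unfolding borel_eq_box by simp
    ultimately show ?thesis
    proof (induction rule: sigma_sets_induct_disjoint)
      case (basic A)
      then show ?case using box by auto
    next
      case empty
      then show ?case using zero by (simp add: indicator_def[abs_def])
    next
      case (compl A)
      have "A \<in> sets borel" using compl.hyps unfolding borel_eq_box by simp
      then have b: "bdd_borel (indicator (A \<inter> ?U) :: real ^ 'd \<Rightarrow> real)" by (intro bdd_borel_indicator) auto
      have bU: "bdd_borel (indicator ?U :: real ^ 'd \<Rightarrow> real)" by (intro bdd_borel_indicator) auto
      have "P (\<lambda>x. indicator ?U x + (-1) * indicator (A \<inter> ?U) x)"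
        by (intro padd pcmult bU bdd_borel_cmult b U compl.IH)
      moreover have "(\<lambda>x. indicator ?U x + (-1) * indicator (A \<inter> ?U) x) = (indicator ((UNIV - A) \<inter> ?U) :: real ^ 'd \<Rightarrow> real)"
        by (auto simp: fun_eq_iff indicator_def)
      ultimately show ?case by simp
    next
      case (union A)
      have Am: "A i \<in> sets borel" for i using union.hyps(2) unfolding borel_eq_box by auto
      define fs where "fs n x = (\<Sum>i<n. indicator (A i \<inter> ?U) x :: real)" for n x
      have fs: "fs n = indicator ((\<Union>i<n. A i) \<inter> ?U)" for n
      proof
        fix x
        show "fs n x = indicator ((\<Union>i<n. A i) \<inter> ?U) x"
        proof (induction n)
          case (Suc n)
          have "x \<notin> A n \<or> x \<notin> (\<Union>i<n. A i)" 
            using union.hyps(1) unfolding disjoint_family_on_def by (auto, metis IntI empty_iff less_irrefl)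
          moreover have "fs (Suc n) x = fs n x + indicator (A n \<inter> ?U) x"
            unfolding fs_def by (rule sum.lessThan_Suc)
          ultimately show ?case unfolding Suc by (auto simp: indicator_def lessThan_Suc)
        qed (simp add: fs_def)
      qed
      have Pfs: "P (fs n) \<and> bdd_borel (fs n)" for n
      proof (induction n)
        case 0
        then show ?case using zero by (simp add: fs_def[abs_def])
      next
        case (Suc n)
        have b: "bdd_borel (indicator (A n \<inter> ?U) :: real ^ 'd \<Rightarrow> real)" using Am by (intro bdd_borel_indicator) auto
        have "fs (Suc n) = (\<lambda>x. fs n x + indicator (A n \<inter> ?U) x)" unfolding fs_def by (simp only: sum.lessThan_Suc)
        then show ?case using Suc padd[OF _ b] bdd_borel_add[OF _ b] union.IH by simp
      qed
      have "bdd_conv fs (indicator ((\<Union>i. A i) \<inter> ?U))"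
      proof (rule bconvI)
        show "fs n \<in> borel_measurable borel" for n using Pfs bdd_borel_measurable by blast
        show "\<bar>fs n x\<bar> \<le> 1" for n x unfolding fs by (simp add: indicator_def)
        show "(\<lambda>n. fs n x) \<longlonglongrightarrow> indicator ((\<Union>i. A i) \<inter> ?U) x" for x
        proof (cases "x \<in> (\<Union>i. A i)")
          case True
          then obtain k where k: "x \<in> A k" by blast
          have "eventually (\<lambda>n. fs n x = indicator ((\<Union>i. A i) \<inter> ?U) x) sequentially"
            using eventually_gt_at_top[of k]
          proof eventually_elim
            case (elim n)
            then show ?case using k unfolding fs by (auto simp: indicator_def)
          qed
          then show ?thesis by (rule tendsto_eventually)
        next
          case False
          then have "fs n x = 0" for n unfolding fs by (auto simp: indicator_def)
          then show ?thesis using False by (simp add: indicator_def)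
        qed
      qed
      then show ?case by (rule plim) (use Pfs in blast)
    qed
  qed
  have bdd_borel_ind: "bdd_borel (\<lambda>x. indicator ?U x * u x)"
    if "u \<in> borel_measurable borel" "\<And>x. 0 \<le> u x" "\<And>x. u x \<le> B" for u and B :: real
  proof (rule bbI)
    show "\<bar>indicator ?U x * u x\<bar> \<le> \<bar>B\<bar>" for x
      using that(2)[of x] that(3)[of x] by (auto simp: indicator_def)
  qed (use that(1) in simp)
  \<comment> \<open>The induction rule passes through all non-negative Borel functions, while the
    closure properties of \<open>P\<close> concern bounded ones; hence boundedness is a premise
    inside the induction predicate.\<close>
  have nonneg: "(\<exists>B. \<forall>x. f x \<le> B) \<longrightarrow> P (\<lambda>x. indicator ?U x * f x)"
    if "f \<in> borel_measurable borel" "\<And>x. 0 \<le> f x" for f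
    using that
  proof (induction f rule: borel_measurable_induct_real)
    case (set A)
    have "(\<lambda>x. indicator ?U x * indicator A x) = (indicator (A \<inter> ?U) :: real ^ 'd \<Rightarrow> real)"
      by (auto simp: fun_eq_iff indicator_def)
    then show ?case using pset set by simp
  next
    case (mult u c)
    show ?case
    proof
      assume "\<exists>B. \<forall>x. c * u x \<le> B"
      then obtain B where B: "\<And>x. c * u x \<le> B" by blast
      show "P (\<lambda>x. indicator ?U x * (c * u x))"
      proof (cases "c = 0")
        case True
        then show ?thesis using zero by simp
      next
        case False
        then have u: "u x \<le> B / c" for x using B[of x] mult(1) by (simp add: field_simps)
        have "bdd_borel (\<lambda>x. indicator ?U x * u x)"
          using mult(2,3) u by (intro bdd_borel_ind) auto
        from pcmult[OF this, of c] show ?thesis using mult(4) u by (auto simp: ac_simps)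
      qed
    qed
  next
    case (add u v)
    show ?case
    proof
      assume "\<exists>B. \<forall>x. v x + u x \<le> B"
      then obtain B where B: "\<And>x. v x + u x \<le> B" by blast
      have u: "u x \<le> B" and v: "v x \<le> B" for x using B[of x] add.hyps(2)[of x] add.hyps(4)[of x] by linarith+
      have "P (\<lambda>x. indicator ?U x * v x + indicator ?U x * u x)"
      proof (intro padd)
        show "P (\<lambda>x. indicator ?U x * u x)" "P (\<lambda>x. indicator ?U x * v x)"
          using add.IH u v by blast+
        show "bdd_borel (\<lambda>x. indicator ?U x * u x)" "bdd_borel (\<lambda>x. indicator ?U x * v x)"
          using bdd_borel_ind[OF add.hyps(1,2) u] bdd_borel_ind[OF add.hyps(3,4) v] by auto
      qed
      then show "P (\<lambda>x. indicator ?U x * (v x + u x))" by (simp add: distrib_left)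
    qed
  next
    case (seq us)
    show ?case
    proof
      assume "\<exists>B. \<forall>x. f x \<le> B"
      then obtain B where B: "\<And>x. f x \<le> B" by blast
      have us: "us n x \<le> B" for n x
        using incseq_le[of "\<lambda>n. us n x" "f x" n] seq.hyps(3,4) B[of x]
        by (auto simp: incseq_def le_fun_def)
      show "P (\<lambda>x. indicator ?U x * f x)"
      proof (rule plim)
        show "bdd_conv (\<lambda>n x. indicator ?U x * us n x) (\<lambda>x. indicator ?U x * f x)"
        proof (rule bconvI)
          show "(\<lambda>x. indicator ?U x * us n x) \<in> borel_measurable borel" for n
            using seq.hyps(1)[of n] by simp
          show "\<bar>indicator ?U x * us n x\<bar> \<le> \<bar>B\<bar>" for n x
            using us[of n x] seq.hyps(2)[of n x] by (auto simp: indicator_def)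
          show "(\<lambda>n. indicator ?U x * us n x) \<longlonglongrightarrow> indicator ?U x * f x" for x
            using seq.hyps(4)[of x] by (intro tendsto_mult tendsto_const) simp
        qed
        show "P (\<lambda>x. indicator ?U x * us n x)" for n using seq.IH[of n] us by blast
      qed
    qed
  qed
  obtain B where B: "B > 0" "\<And>x. \<bar>\<psi> x\<bar> \<le> B" using bdd_borel_bound[OF \<psi>] by auto
  have m: "\<psi> \<in> borel_measurable borel" by (rule bdd_borel_measurable[OF \<psi>])
  have b1: "\<And>x. max (\<psi> x) 0 \<le> B" and b2: "\<And>x. max (- \<psi> x) 0 \<le> B"
    using B by (auto simp: abs_le_iff max_def)
  have p1: "P (\<lambda>x. indicator ?U x * max (\<psi> x) 0)" and p2: "P (\<lambda>x. indicator ?U x * max (- \<psi> x) 0)"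
    using nonneg[of "\<lambda>x. max (\<psi> x) 0"] nonneg[of "\<lambda>x. max (- \<psi> x) 0"] m b1 b2 by auto
  have i1: "bdd_borel (\<lambda>x. indicator ?U x * max (\<psi> x) 0)" and i2: "bdd_borel (\<lambda>x. indicator ?U x * max (- \<psi> x) 0)"
    using bdd_borel_ind[OF _ _ b1] bdd_borel_ind[OF _ _ b2] m by auto
  have "P (\<lambda>x. indicator ?U x * max (\<psi> x) 0 + (-1) * (indicator ?U x * max (- \<psi> x) 0))"
    by (intro padd pcmult bdd_borel_cmult p1 p2 i1 i2)
  moreover have "indicator ?U x * max (\<psi> x) 0 + (-1) * (indicator ?U x * max (- \<psi> x) 0) = indicator ?U x * \<psi> x" for x
    by (simp add: max_def indicator_def)
  ultimately show ?thesis by simp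
qed

lemma integrable_mult_bb:
  fixes D f :: "'a::euclidean_space \<Rightarrow> real"
  assumes D: "integrable unif D" and f: "bdd_borel f"
  shows "integrable unif (\<lambda>x. D x * f x)"
proof -
  obtain B where B: "B > 0" "\<And>x. \<bar>f x\<bar> \<le> B" using bdd_borel_bound[OF f] by auto
  have Dm: "D \<in> borel_measurable borel" using borel_measurable_integrable[OF D] by simp
  show ?thesis
  proof (rule Bochner_Integration.integrable_bound[of unif "\<lambda>x. B * D x"])
    show "integrable unif (\<lambda>x. B * D x)" using D by simp
    show "(\<lambda>x. D x * f x) \<in> borel_measurable unif" using Dm bdd_borel_measurable[OF f] by simp
    show "AE x in unif. norm (D x * f x) \<le> norm (B * D x)"
    proof (rule AE_I2)
      fix x
      show "norm (D x * f x) \<le> norm (B * D x)"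
        using mult_right_mono[OF B(2)[of x], of "\<bar>D x\<bar>"] B(1) by (simp only: real_norm_def abs_mult mult.commute abs_of_pos)
    qed
  qed
qed

section \<open>Testing the projection error against the residual of the transpose\<close>

context dual_functions
begin

definition resid :: "nat \<Rightarrow> 'd \<Rightarrow> (real ^ 'd::finite \<Rightarrow> real) \<Rightarrow> real ^ 'd \<Rightarrow> real" where
  "resid K i \<psi> x = \<psi> x - coord_op i (\<lambda>t u. proj_ker K u t) \<psi> x"

lemma bdd_ker_kP_transpose: "bdd_ker (\<lambda>t u. proj_ker K u t)"
  by (rule bdd_ker_transpose[OF bdd_ker_kP])

lemma bdd_borel_resid: "bdd_borel \<psi> \<Longrightarrow> bdd_borel (resid K i \<psi>)"
  unfolding resid_def[abs_def] by (intro bdd_borel_diff bdd_borel_op[OF bdd_ker_kP_transpose])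

lemma resid_upd: "resid K i \<psi> (upd x i t) = resid1 K (\<lambda>t. \<psi> (upd x i t)) t"
  by (simp add: resid_def resid1_def coord_op_def)

text \<open>The m-fold cellwise antiderivative, in direction i, of (I - P_i^T) applied to
  \<psi>.\<close>

definition int_resid :: "nat \<Rightarrow> nat \<Rightarrow> 'd \<Rightarrow> (real ^ 'd::finite \<Rightarrow> real) \<Rightarrow> real ^ 'd \<Rightarrow> real" where
  "int_resid K m i \<psi> = (coord_op i (int_ker K) ^^ m) (resid K i \<psi>)"

lemma bdd_borel_int_resid: "bdd_borel \<psi> \<Longrightarrow> bdd_borel (int_resid K m i \<psi>)"
  unfolding int_resid_def by (intro bdd_borel_op_funpow bdd_ker_kJ bdd_borel_resid)

lemma int_resid_upd:
  "int_resid K m i \<psi> (upd x i t) = (line_op (int_ker K) ^^ m) (resid1 K (\<lambda>t. \<psi> (upd x i t))) t"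
  unfolding int_resid_def coord_op_funpow_eq by (simp add: resid_upd)

lemma coord_op_funpow_add:
  "bdd_ker k \<Longrightarrow> bdd_borel f \<Longrightarrow> bdd_borel g \<Longrightarrow> (coord_op i k ^^ m) (\<lambda>x. f x + g x) = (\<lambda>x. (coord_op i k ^^ m) f x + (coord_op i k ^^ m) g x)"
  by (induction m) (auto simp: coord_op_add bdd_borel_op_funpow)

lemma coord_op_funpow_cmult: "(coord_op i k ^^ m) (\<lambda>x. c * f x) = (\<lambda>x. c * (coord_op i k ^^ m) f x)"
  by (induction m) (auto simp: coord_op_cmult)

lemma resid_add: "bdd_borel f \<Longrightarrow> bdd_borel g \<Longrightarrow> resid K i (\<lambda>x. f x + g x) = (\<lambda>x. resid K i f x + resid K i g x)"
  by (auto simp: resid_def fun_eq_iff coord_op_add bdd_ker_kP_transpose)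

lemma resid_cmult: "resid K i (\<lambda>x. c * f x) = (\<lambda>x. c * resid K i f x)"
  by (auto simp: resid_def fun_eq_iff coord_op_cmult algebra_simps)

lemma int_resid_add:
  "bdd_borel f \<Longrightarrow> bdd_borel g \<Longrightarrow> int_resid K m i (\<lambda>x. f x + g x) = (\<lambda>x. int_resid K m i f x + int_resid K m i g x)"
  unfolding int_resid_def by (simp add: resid_add coord_op_funpow_add bdd_ker_kJ bdd_borel_resid)

lemma int_resid_cmult: "int_resid K m i (\<lambda>x. c * f x) = (\<lambda>x. c * int_resid K m i f x)"
  unfolding int_resid_def by (simp add: resid_cmult coord_op_funpow_cmult)

lemma bdd_conv_resid: "bdd_conv \<psi>s \<psi> \<Longrightarrow> bdd_conv (\<lambda>n. resid K i (\<psi>s n)) (resid K i \<psi>)"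
  unfolding resid_def[abs_def] by (intro bdd_conv_diff bdd_conv_op[OF bdd_ker_kP_transpose])

lemma bdd_conv_int_resid: "bdd_conv \<psi>s \<psi> \<Longrightarrow> bdd_conv (\<lambda>n. int_resid K m i (\<psi>s n)) (int_resid K m i \<psi>)"
  unfolding int_resid_def by (intro bdd_conv_op_funpow bdd_ker_kJ bdd_conv_resid)

lemma int_resid_bumps:
  fixes \<phi> :: "'d::finite \<Rightarrow> real \<Rightarrow> real"
  shows "resid K i (\<lambda>x. \<Prod>j\<in>UNIV. \<phi> j (x $ j)) = (\<lambda>x. resid1 K (\<phi> i) (x $ i) * (\<Prod>j\<in>UNIV - {i}. \<phi> j (x $ j)))"
    and "int_resid K m i (\<lambda>x. \<Prod>j\<in>UNIV. \<phi> j (x $ j))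
      = (\<lambda>x. (line_op (int_ker K) ^^ m) (resid1 K (\<phi> i)) (x $ i) * (\<Prod>j\<in>UNIV - {i}. \<phi> j (x $ j)))"
proof -
  define R where "R x = (\<Prod>j\<in>UNIV - {i}. \<phi> j (x $ j))" for x :: "real ^ 'd"
  have R: "R (upd x i t) = R x" for x t unfolding R_def by (intro prod.cong) auto
  have p: "(\<Prod>j\<in>UNIV. \<phi> j (x $ j)) = \<phi> i (x $ i) * R x" for x :: "real ^ 'd"
    unfolding R_def by (rule prod.remove) auto
  show 1: "resid K i (\<lambda>x. \<Prod>j\<in>UNIV. \<phi> j (x $ j)) = (\<lambda>x. resid1 K (\<phi> i) (x $ i) * (\<Prod>j\<in>UNIV - {i}. \<phi> j (x $ j)))"
    unfolding p R_def[symmetric] resid_def[abs_def] coord_op_product[OF R] resid1_def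
    by (simp add: left_diff_distrib)
  have 2: "(coord_op i (int_ker K) ^^ m) (\<lambda>x. w' (x $ i) * R x) = (\<lambda>x. (line_op (int_ker K) ^^ m) w' (x $ i) * R x)" for w'
  proof (induction m)
    case (Suc m)
    show ?case by (simp add: Suc coord_op_product[OF R])
  qed simp
  show "int_resid K m i (\<lambda>x. \<Prod>j\<in>UNIV. \<phi> j (x $ j))
      = (\<lambda>x. (line_op (int_ker K) ^^ m) (resid1 K (\<phi> i)) (x $ i) * (\<Prod>j\<in>UNIV - {i}. \<phi> j (x $ j)))"
    unfolding int_resid_def 1 unfolding R_def[symmetric] by (rule 2)
qed

text \<open>For a product of bumps, the residual of the i-th factor has a bump \<Phi> as m-fold
  antiderivative, because its cell moments of orders 0 to s vanish and m \<le> s + 1. The weak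
  identity for the product with \<Phi> in place of that factor is the claim. Both sides are linear
  and stable under bounded convergence, so it extends to bounded Borel functions.\<close>

lemma integral_resid_eq:
  fixes g D :: "real ^ 'd::finite \<Rightarrow> real"
  assumes K: "K > 0" and g: "bdd_borel g" and D: "integrable unif D" and m: "m \<le> Suc s"
    and weak: "\<And>\<phi>. (\<And>j. bump_fun (\<phi> j)) \<Longrightarrow>
       (\<integral>x. g x * ((deriv ^^ m) (\<phi> i) (x $ i) * (\<Prod>j\<in>UNIV - {i}. \<phi> j (x $ j))) \<partial>unif)
         = (-1) ^ m * (\<integral>x. D x * (\<Prod>j\<in>UNIV. \<phi> j (x $ j)) \<partial>unif)"
    and \<psi>: "bdd_borel \<psi>"
  shows "(\<integral>x. g x * resid K i (\<lambda>x. indicator (box 0 One) x * \<psi> x) x \<partial>unif)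
       = (-1) ^ m * (\<integral>x. D x * int_resid K m i (\<lambda>x. indicator (box 0 One) x * \<psi> x) x \<partial>unif)"
proof -
  note Di = integrable_mult_bb[OF D]
  have gi: "integrable unif (\<lambda>x. g x * f x)" if "bdd_borel f" for f
    by (intro bdd_borel_integrable bdd_borel_mult g that)
  show ?thesis
  proof (rule bounded_borel_induct_bumps[OF _ _ _ _ \<psi>,
      where P = "\<lambda>\<psi>. (\<integral>x. g x * resid K i \<psi> x \<partial>unif) = (-1) ^ m * (\<integral>x. D x * int_resid K m i \<psi> x \<partial>unif)"])
    fix \<phi> :: "'d \<Rightarrow> real \<Rightarrow> real"
    assume \<phi>: "\<And>j. bump_fun (\<phi> j)"
    define \<Phi> where "\<Phi> = (line_op (int_ker K) ^^ m) (resid1 K (\<phi> i))"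
    have "bump_fun \<Phi> \<and> (deriv ^^ m) \<Phi> = resid1 K (\<phi> i)"
      unfolding \<Phi>_def using m
      by (intro line_op_kJ_funpow_cs K resid1_cs \<phi> cell_moment_resid1 bump_fun_bb) auto
    then have \<Phi>: "bump_fun \<Phi>" "(deriv ^^ m) \<Phi> = resid1 K (\<phi> i)" by auto
    have "bump_fun ((\<phi>(i := \<Phi>)) j)" for j using \<phi> \<Phi> by simp
    moreover have pc: "(\<Prod>j\<in>UNIV - {i}. (\<phi>(i := \<Phi>)) j (x $ j)) = (\<Prod>j\<in>UNIV - {i}. \<phi> j (x $ j))" for x :: "real ^ 'd"
      by (rule prod.cong) auto
    ultimately have "(\<integral>x. g x * (resid1 K (\<phi> i) (x $ i) * (\<Prod>j\<in>UNIV - {i}. \<phi> j (x $ j))) \<partial>unif)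
        = (-1) ^ m * (\<integral>x. D x * (\<Prod>j\<in>UNIV. (\<phi>(i := \<Phi>)) j (x $ j)) \<partial>unif)"
      using weak[of "\<phi>(i := \<Phi>)"] by (simp only: fun_upd_same \<Phi>(2) pc)
    moreover have "(\<Prod>j\<in>UNIV. (\<phi>(i := \<Phi>)) j (x $ j)) = \<Phi> (x $ i) * (\<Prod>j\<in>UNIV - {i}. \<phi> j (x $ j))" for x :: "real ^ 'd"
      by (subst prod.remove[of UNIV i]) auto
    ultimately show "(\<integral>x. g x * resid K i (\<lambda>x. \<Prod>j\<in>UNIV. \<phi> j (x $ j)) x \<partial>unif)
        = (-1) ^ m * (\<integral>x. D x * int_resid K m i (\<lambda>x. \<Prod>j\<in>UNIV. \<phi> j (x $ j)) x \<partial>unif)"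
      unfolding int_resid_bumps \<Phi>_def[symmetric] by simp
  next
    fix f h :: "real ^ 'd \<Rightarrow> real"
    assume "bdd_borel f" "bdd_borel h"
      and "(\<integral>x. g x * resid K i f x \<partial>unif) = (-1) ^ m * (\<integral>x. D x * int_resid K m i f x \<partial>unif)"
      and "(\<integral>x. g x * resid K i h x \<partial>unif) = (-1) ^ m * (\<integral>x. D x * int_resid K m i h x \<partial>unif)"
    then show "(\<integral>x. g x * resid K i (\<lambda>x. f x + h x) x \<partial>unif) = (-1) ^ m * (\<integral>x. D x * int_resid K m i (\<lambda>x. f x + h x) x \<partial>unif)"
      by (simp add: resid_add int_resid_add distrib_left gi Di bdd_borel_resid bdd_borel_int_resid)
  next
    fix c and f :: "real ^ 'd \<Rightarrow> real"
    assume "bdd_borel f"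
      and "(\<integral>x. g x * resid K i f x \<partial>unif) = (-1) ^ m * (\<integral>x. D x * int_resid K m i f x \<partial>unif)"
    then show "(\<integral>x. g x * resid K i (\<lambda>x. c * f x) x \<partial>unif) = (-1) ^ m * (\<integral>x. D x * int_resid K m i (\<lambda>x. c * f x) x \<partial>unif)"
      by (simp add: resid_cmult int_resid_cmult mult.left_commute[of _ c])
  next
    fix fs and f :: "real ^ 'd \<Rightarrow> real"
    assume b: "bdd_conv fs f"
      and eq: "\<And>n. (\<integral>x. g x * resid K i (fs n) x \<partial>unif) = (-1) ^ m * (\<integral>x. D x * int_resid K m i (fs n) x \<partial>unif)"
    have "(\<lambda>n. \<integral>x. g x * resid K i (fs n) x \<partial>unif) \<longlonglongrightarrow> (\<integral>x. g x * resid K i f x \<partial>unif)"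
      by (intro bdd_conv_integral bdd_borel_integrable g bdd_conv_resid b)
    moreover have "(\<lambda>n. (-1) ^ m * (\<integral>x. D x * int_resid K m i (fs n) x \<partial>unif)) \<longlonglongrightarrow> (-1) ^ m * (\<integral>x. D x * int_resid K m i f x \<partial>unif)"
      by (intro tendsto_mult tendsto_const bdd_conv_integral D bdd_conv_int_resid b)
    ultimately show "(\<integral>x. g x * resid K i f x \<partial>unif) = (-1) ^ m * (\<integral>x. D x * int_resid K m i f x \<partial>unif)"
      unfolding eq by (rule LIMSEQ_unique)
  qed
qed

text \<open>A function constant in direction i on each cell equals its own cell average in that
  direction. The adjoint moves the averaging to the other factor, whose zeroth cell moments vanish:
  after m integrations this still holds as long as m \<le> s.\<close>

lemma integral_cellwise_const_int_resid:
  fixes c \<psi> :: "real ^ 'd::finite \<Rightarrow> real"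
  assumes K: "K > 0" and c: "bdd_borel c" "\<And>x t. same_cell K (x $ i) t \<Longrightarrow> c (upd x i t) = c x"
    and \<psi>: "bdd_borel \<psi>" and m: "m \<le> s"
  shows "(\<integral>x. c x * int_resid K m i \<psi> x \<partial>unif) = 0"
proof -
  define w :: "real \<Rightarrow> real \<Rightarrow> real" where "w u t = (if same_cell K u t then real K else 0)" for u t
  have w: "bdd_ker w" unfolding w_def by (rule bkerI[of _ "real K"]) auto
  have wt: "(\<lambda>u t. w t u) = w" by (auto simp: w_def same_cell_def fun_eq_iff)
  have bT: "bdd_borel (int_resid K m i \<psi>)" by (rule bdd_borel_int_resid[OF \<psi>])
  have "(\<integral>x. c x * int_resid K m i \<psi> x \<partial>unif) = (\<integral>x. coord_op i w c x * int_resid K m i \<psi> x \<partial>unif)"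
  proof (rule integral_cong_AE)
    show "AE x in unif. c x * int_resid K m i \<psi> x = coord_op i w c x * int_resid K m i \<psi> x"
      using AE_unif_box
    proof eventually_elim
      case (elim x)
      then have xi: "0 < x $ i" "x $ i < 1" by (auto simp: mem_unit_box)
      have "coord_op i w c x = (\<integral>t. (real K * c x) * (if same_cell K (x $ i) t then 1 else 0) \<partial>unif)"
        unfolding coord_op_def line_op_def w_def using c(2) by (intro Bochner_Integration.integral_cong) auto
      also have "\<dots> = c x" using integral_same_cell[OF K xi] K by simp
      finally show ?case by simp
    qed
  qed (use bdd_borel_measurable[OF bdd_borel_mult[OF c(1) bT]] bdd_borel_measurable[OF bdd_borel_mult[OF bdd_borel_op[OF w c(1)] bT]] in auto)
  also have "\<dots> = (\<integral>x. c x * coord_op i w (int_resid K m i \<psi>) x \<partial>unif)"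
    using coord_op_adjoint[OF w c(1) bT, of i] by (simp only: wt)
  also have "\<dots> = (\<integral>x. 0 \<partial>(unif :: (real ^ 'd) measure))"
  proof (rule integral_cong_AE)
    show "AE x in unif. c x * coord_op i w (int_resid K m i \<psi>) x = 0"
      using AE_unif_box
    proof eventually_elim
      case (elim x)
      then have xi: "0 < x $ i" "x $ i < 1" by (auto simp: mem_unit_box)
      obtain c' where c': "c' < K" "\<lfloor>real K * x $ i\<rfloor> = int c'" using cell_exists[OF K, of "x $ i"] xi by auto
      define w' where "w' = (line_op (int_ker K) ^^ m) (resid1 K (\<lambda>t. \<psi> (upd x i t)))"
      have "coord_op i w (int_resid K m i \<psi>) x = (\<integral>t. real K * (w' t * (if \<lfloor>real K * t\<rfloor> = int c' then (real K * t - real c') ^ 0 else 0)) \<partial>unif)"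
        unfolding coord_op_def line_op_def int_resid_upd w'_def[symmetric] w_def same_cell_def c'(2)
        by (intro Bochner_Integration.integral_cong) auto
      also have "\<dots> = real K * cell_moment K c' 0 w'" by (simp add: cell_moment_def)
      also have "cell_moment K c' 0 w' = 0"
        unfolding w'_def using m
        by (intro cell_moment_op1_kJ_funpow K c'(1) bdd_borel_resid1 bdd_borel_slice \<psi> cell_moment_resid1) auto
      finally show ?case by simp
    qed
  qed (use bdd_borel_measurable[OF bdd_borel_mult[OF c(1) bdd_borel_op[OF w bT]]] in auto)
  finally show ?thesis by simp
qed

text \<open>The integration kernel is bounded by 1 = (1/K) K on the cell, so each antiderivative
  gains a factor 1/K in the L2 norm. Forming the residual costs at most 2 + 2
  \<open>proj_const\<^sup>2\<close> in the squared norm.\<close>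

lemma int_resid_L2:
  fixes \<psi> :: "real ^ 'd::finite \<Rightarrow> real"
  assumes K: "K > 0" and \<psi>: "bdd_borel \<psi>"
  shows "(\<integral>x. (int_resid K m i \<psi> x)\<^sup>2 \<partial>unif) \<le> (2 + 2 * proj_const\<^sup>2) / real K ^ (2 * m) * (\<integral>x. (\<psi> x)\<^sup>2 \<partial>unif)"
proof -
  have sq: "integrable unif (\<lambda>x. (f x)\<^sup>2)" if "bdd_borel f" for f :: "real ^ 'd \<Rightarrow> real"
    unfolding power2_eq_square by (intro bdd_borel_integrable bdd_borel_mult that)
  have J: "(\<integral>x. ((coord_op i (int_ker K) ^^ m) f x)\<^sup>2 \<partial>unif) \<le> 1 / real K ^ (2 * m) * (\<integral>x. (f x)\<^sup>2 \<partial>unif)"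
    if f: "bdd_borel f" for f :: "real ^ 'd \<Rightarrow> real"
  proof (induction m)
    case (Suc m)
    have "(\<integral>x. (coord_op i (int_ker K) ((coord_op i (int_ker K) ^^ m) f) x)\<^sup>2 \<partial>unif)
        \<le> (1 / real K)\<^sup>2 * (\<integral>x. ((coord_op i (int_ker K) ^^ m) f x)\<^sup>2 \<partial>unif)"
      by (rule coord_op_L2_bound[OF K bdd_ker_kJ]) (use K in \<open>auto simp: int_ker_def intro!: bdd_borel_op_funpow bdd_ker_kJ f\<close>)
    also have "\<dots> \<le> (1 / real K)\<^sup>2 * (1 / real K ^ (2 * m) * (\<integral>x. (f x)\<^sup>2 \<partial>unif))"
      by (rule mult_left_mono[OF Suc]) simp
    also have "\<dots> = 1 / real K ^ (2 * Suc m) * (\<integral>x. (f x)\<^sup>2 \<partial>unif)"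
      by (simp add: power_divide power_add power2_eq_square)
    finally show ?case by simp
  qed simp
  define Q where "Q = coord_op i (\<lambda>t u. proj_ker K u t) \<psi>"
  have Q: "bdd_borel Q" unfolding Q_def by (rule bdd_borel_op[OF bdd_ker_kP_transpose \<psi>])
  have Q2: "(\<integral>x. (Q x)\<^sup>2 \<partial>unif) \<le> proj_const\<^sup>2 * (\<integral>x. (\<psi> x)\<^sup>2 \<partial>unif)"
    unfolding Q_def
  proof (rule coord_op_L2_bound[OF K bdd_ker_kP_transpose _ _ \<psi>])
    show "\<bar>proj_ker K t u\<bar> \<le> proj_const * real K * (if same_cell K u t then 1 else 0)" for u t
      using proj_ker_bound[of K t u] unfolding same_cell_sym[of K t u] .
  qed (use proj_const_pos in simp)
  have "(\<integral>x. (resid K i \<psi> x)\<^sup>2 \<partial>unif) \<le> (\<integral>x. 2 * (\<psi> x)\<^sup>2 + 2 * (Q x)\<^sup>2 \<partial>unif)"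
  proof (rule integral_mono)
    show "(resid K i \<psi> x)\<^sup>2 \<le> 2 * (\<psi> x)\<^sup>2 + 2 * (Q x)\<^sup>2" for x
    proof -
      have "0 \<le> (\<psi> x + Q x)\<^sup>2" by simp
      then show ?thesis unfolding resid_def Q_def[symmetric] power2_diff power2_sum by linarith
    qed
  qed (use sq[OF bdd_borel_resid[OF \<psi>]] sq[OF \<psi>] sq[OF Q] in auto)
  also have "\<dots> = 2 * (\<integral>x. (\<psi> x)\<^sup>2 \<partial>unif) + 2 * (\<integral>x. (Q x)\<^sup>2 \<partial>unif)"
    using sq[OF \<psi>] sq[OF Q] by simp
  also have "\<dots> \<le> (2 + 2 * proj_const\<^sup>2) * (\<integral>x. (\<psi> x)\<^sup>2 \<partial>unif)"
    using Q2 by (simp add: distrib_right)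
  finally have "1 / real K ^ (2 * m) * (\<integral>x. (resid K i \<psi> x)\<^sup>2 \<partial>unif)
     \<le> 1 / real K ^ (2 * m) * ((2 + 2 * proj_const\<^sup>2) * (\<integral>x. (\<psi> x)\<^sup>2 \<partial>unif))"
    by (intro mult_left_mono) auto
  then show ?thesis
    unfolding int_resid_def by (intro order.trans[OF J[OF bdd_borel_resid[OF \<psi>]]]) simp
qed

text \<open>Duality with the error as its own test function: \<open>g\<close> is traded for its
  derivative and the error for its small antiderivative, and a function \<open>c\<close> that this
  antiderivative annihilates may be subtracted from the derivative. The choice 0 serves integer
  smoothness with m = s + 1; cellwise constants serve fractional smoothness with m = s.\<close>

lemma coordinate_projection_L2:
  fixes g D c :: "real ^ 'd::finite \<Rightarrow> real"
  assumes K: "K > 0" and g: "bdd_borel g" and D: "integrable unif D" and m: "m \<le> Suc s"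
    and weak: "\<And>\<phi>. (\<And>j. bump_fun (\<phi> j)) \<Longrightarrow>
       (\<integral>x. g x * ((deriv ^^ m) (\<phi> i) (x $ i) * (\<Prod>j\<in>UNIV - {i}. \<phi> j (x $ j))) \<partial>unif)
         = (-1) ^ m * (\<integral>x. D x * (\<Prod>j\<in>UNIV. \<phi> j (x $ j)) \<partial>unif)"
    and c: "bdd_borel c" and D2: "integrable unif (\<lambda>x. (D x - c x)\<^sup>2)"
    and cc: "c = (\<lambda>x. 0) \<or> m \<le> s \<and> (\<forall>x t. same_cell K (x $ i) t \<longrightarrow> c (upd x i t) = c x)"
  shows "(\<integral>x. (g x - coord_op i (proj_ker K) g x)\<^sup>2 \<partial>unif)
     \<le> (2 + 2 * proj_const\<^sup>2) / real K ^ (2 * m) * (\<integral>x. (D x - c x)\<^sup>2 \<partial>unif)"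
proof -
  define e where "e x = g x - coord_op i (proj_ker K) g x" for x
  have e: "bdd_borel e" unfolding e_def[abs_def] by (intro bdd_borel_diff g bdd_borel_op bdd_ker_kP)
  \<comment> \<open>Only functions cut off to the open cube can be tested; the cut-off changes the
    error on a null set of \<open>unif\<close>.\<close>
  define E where "E x = indicator (box 0 One) x * e x" for x
  have ind: "bdd_borel (indicator (box 0 One) :: real ^ 'd \<Rightarrow> real)" by (rule bdd_borel_indicator) simp
  have E: "bdd_borel E" unfolding E_def[abs_def] by (rule bdd_borel_mult[OF ind e])
  define T where "T = int_resid K m i E"
  have T: "bdd_borel T" unfolding T_def by (rule bdd_borel_int_resid[OF E])
  define B where "B = (2 + 2 * proj_const\<^sup>2) / real K ^ (2 * m)"
  have B: "B > 0" unfolding B_def using K by (intro divide_pos_pos add_pos_nonneg) auto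
  define X where "X = (\<integral>x. (E x)\<^sup>2 \<partial>unif)"
  have Xe: "(\<integral>x. (e x)\<^sup>2 \<partial>unif) = X"
    unfolding X_def
  proof (rule integral_cong_AE)
    show "AE x in unif. (e x)\<^sup>2 = (E x)\<^sup>2"
      using AE_unif_box by eventually_elim (simp add: E_def)
  qed (use bdd_borel_measurable[OF e] bdd_borel_measurable[OF E] in auto)
  have "X = (\<integral>x. e x * E x \<partial>unif)"
    unfolding X_def
    by (intro Bochner_Integration.integral_cong) (auto simp: E_def power2_eq_square indicator_def)
  also have "\<dots> = (\<integral>x. g x * E x \<partial>unif) - (\<integral>x. coord_op i (proj_ker K) g x * E x \<partial>unif)"
    unfolding e_def left_diff_distrib
    by (intro Bochner_Integration.integral_diff bdd_borel_integrable bdd_borel_mult g E bdd_borel_op bdd_ker_kP)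
  also have "(\<integral>x. coord_op i (proj_ker K) g x * E x \<partial>unif) = (\<integral>x. g x * coord_op i (\<lambda>t u. proj_ker K u t) E x \<partial>unif)"
    by (rule coord_op_adjoint[OF bdd_ker_kP g E])
  also have "(\<integral>x. g x * E x \<partial>unif) - \<dots> = (\<integral>x. g x * resid K i E x \<partial>unif)"
    unfolding resid_def right_diff_distrib
    by (intro Bochner_Integration.integral_diff[symmetric] bdd_borel_integrable bdd_borel_mult g E bdd_borel_op bdd_ker_kP_transpose)
  also have "\<dots> = (-1) ^ m * (\<integral>x. D x * T x \<partial>unif)"
    unfolding T_def E_def[abs_def] by (rule integral_resid_eq[OF K g D m weak e])
  also have "(\<integral>x. D x * T x \<partial>unif) = (\<integral>x. (D x - c x) * T x \<partial>unif)"
  proof -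
    have z: "(\<integral>x. c x * T x \<partial>unif) = 0"
      using cc
    proof
      assume a: "m \<le> s \<and> (\<forall>x t. same_cell K (x $ i) t \<longrightarrow> c (upd x i t) = c x)"
      then show ?thesis unfolding T_def by (intro integral_cellwise_const_int_resid[OF K c _ E]) auto
    qed simp
    have "integrable unif (\<lambda>x. D x * T x)" by (rule integrable_mult_bb[OF D T])
    then have "(\<integral>x. D x * T x - c x * T x \<partial>unif) = (\<integral>x. D x * T x \<partial>unif) - (\<integral>x. c x * T x \<partial>unif)"
      by (rule Bochner_Integration.integral_diff) (intro bdd_borel_integrable bdd_borel_mult c T)
    then show ?thesis by (simp add: z left_diff_distrib)
  qed
  also have "(-1) ^ m * (\<integral>x. (D x - c x) * T x \<partial>unif) \<le> \<bar>\<integral>x. (D x - c x) * T x \<partial>unif\<bar>"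
    by (cases "even m") auto
  also have "\<dots> \<le> (\<integral>x. \<bar>(D x - c x) * T x\<bar> \<partial>unif)" by (rule abs_integral_le)
  \<comment> \<open>Young's inequality with weights such that the bound B * X for the squared norm
    of \<open>T\<close> costs exactly X / 2, which is absorbed on the left.\<close>
  also have "\<dots> \<le> (\<integral>x. B / 2 * (D x - c x)\<^sup>2 + 1 / (2 * B) * (T x)\<^sup>2 \<partial>unif)"
  proof (rule integral_mono_AE')
    have T2: "integrable unif (\<lambda>x. (T x)\<^sup>2)"
      unfolding power2_eq_square by (intro bdd_borel_integrable bdd_borel_mult T)
    then show "integrable unif (\<lambda>x. B / 2 * (D x - c x)\<^sup>2 + 1 / (2 * B) * (T x)\<^sup>2)"
      using D2 by (intro Bochner_Integration.integrable_add integrable_mult_right) auto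
    show "AE x in unif. \<bar>(D x - c x) * T x\<bar> \<le> B / 2 * (D x - c x)\<^sup>2 + 1 / (2 * B) * (T x)\<^sup>2"
    proof (rule AE_I2)
      fix x
      have "a * b \<le> B / 2 * a\<^sup>2 + 1 / (2 * B) * b\<^sup>2" for a b :: real
      proof -
        have "0 \<le> (B * a - b)\<^sup>2 / (2 * B)" using B by simp
        also have "\<dots> = B / 2 * a\<^sup>2 + 1 / (2 * B) * b\<^sup>2 - a * b"
          using B by (simp add: power2_diff field_simps power2_eq_square)
        finally show ?thesis by simp
      qed
      from this[of "\<bar>D x - c x\<bar>" "\<bar>T x\<bar>"]
      show "\<bar>(D x - c x) * T x\<bar> \<le> B / 2 * (D x - c x)\<^sup>2 + 1 / (2 * B) * (T x)\<^sup>2"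
        by (simp only: power2_abs abs_mult)
    qed
  qed (use B in simp)
  also have "\<dots> = B / 2 * (\<integral>x. (D x - c x)\<^sup>2 \<partial>unif) + 1 / (2 * B) * (\<integral>x. (T x)\<^sup>2 \<partial>unif)"
  proof -
    have T2: "integrable unif (\<lambda>x. (T x)\<^sup>2)"
      unfolding power2_eq_square by (intro bdd_borel_integrable bdd_borel_mult T)
    show ?thesis using D2 T2
      by (subst Bochner_Integration.integral_add) (auto intro!: integrable_mult_right)
  qed
  also have "\<dots> \<le> B / 2 * (\<integral>x. (D x - c x)\<^sup>2 \<partial>unif) + 1 / (2 * B) * (B * X)"
    using int_resid_L2[OF K E, of m i] B unfolding T_def[symmetric] B_def[symmetric] X_def[symmetric]
    by (intro add_left_mono mult_left_mono) auto
  also have "1 / (2 * B) * (B * X) = X / 2" using B by simp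
  finally have "X \<le> B * (\<integral>x. (D x - c x)\<^sup>2 \<partial>unif)" by simp
  then show ?thesis using Xe unfolding e_def B_def by simp
qed

end

section \<open>Weak derivatives on the open cube tested with products of bumps\<close>

lemma box_subset_unit_cube: "box 0 One \<subseteq> (unit_cube :: (real ^ 'd::finite) set)"
  unfolding unit_cube_def by (auto simp: mem_unit_box less_imp_le)

lemma interior_unit_cube: "interior (unit_cube :: (real ^ 'd::finite) set) = box 0 One"
proof
  show "box 0 One \<subseteq> interior (unit_cube :: (real ^ 'd) set)"
    by (rule interior_maximal[OF box_subset_unit_cube open_box])
  show "interior (unit_cube :: (real ^ 'd) set) \<subseteq> box 0 One"
  proof
    fix x :: "real ^ 'd"
    assume x: "x \<in> interior unit_cube"
    then obtain e where e: "e > 0" "ball x e \<subseteq> unit_cube" unfolding mem_interior by blast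
    have "0 < x $ i \<and> x $ i < 1" for i
    proof -
      have "x + (- (e / 2)) *\<^sub>R axis i 1 \<in> ball x e"
        using e(1) by (simp add: dist_norm)
      then have "x + (- (e / 2)) *\<^sub>R axis i 1 \<in> unit_cube" using e(2) by blast
      then have "0 \<le> (x + (- (e / 2)) *\<^sub>R axis i 1) $ i" unfolding unit_cube_def by blast
      moreover have "x \<in> unit_cube" using x interior_subset by blast
      ultimately show ?thesis using e(1) by (auto simp: unit_cube_def)
    qed
    then show "x \<in> box 0 One" by (simp add: mem_unit_box)
  qed
qed

text \<open>The explicit family of all partial derivatives of a product of one-variable functions,
  in the shape that \<open>test_function\<close> asks for.\<close>

definition bump_derivs :: "('d::finite \<Rightarrow> real \<Rightarrow> real) \<Rightarrow> ('d \<Rightarrow> nat) \<Rightarrow> real ^ 'd \<Rightarrow> real" where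
  "bump_derivs \<phi> \<kappa> x = (\<Prod>j\<in>UNIV. (deriv ^^ \<kappa> j) (\<phi> j) (x $ j))"

lemma test_function_bump_derivs:
  fixes \<phi> :: "'d::finite \<Rightarrow> real \<Rightarrow> real"
  assumes \<phi>: "\<And>j. bump_fun (\<phi> j)"
  shows "test_function (interior unit_cube) (bump_derivs \<phi>)"
  unfolding test_function_def
proof (intro conjI allI)
  have sm: "smooth ((deriv ^^ n) (\<phi> j))" for n j by (rule smooth_funpow_deriv[OF csD[OF \<phi>]])
  fix k
  show "partial_derivatives k UNIV (bump_derivs \<phi> (\<lambda>_. 0)) (bump_derivs \<phi>)"
    unfolding partial_derivatives_def
  proof (intro conjI allI ballI impI)
    fix \<kappa> :: "'d \<Rightarrow> nat" and i and x :: "real ^ 'd"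
    have 1: "bump_derivs \<phi> \<kappa> (x + t *\<^sub>R axis i 1)
        = (deriv ^^ \<kappa> i) (\<phi> i) (x $ i + t) * (\<Prod>j\<in>UNIV - {i}. (deriv ^^ \<kappa> j) (\<phi> j) (x $ j))" for t
      unfolding bump_derivs_def
      by (subst prod.remove[of UNIV i]) (auto simp: axis_def intro!: prod.cong)
    have 2: "bump_derivs \<phi> (\<kappa>(i := Suc (\<kappa> i))) x
        = deriv ((deriv ^^ \<kappa> i) (\<phi> i)) (x $ i + 0) * (\<Prod>j\<in>UNIV - {i}. (deriv ^^ \<kappa> j) (\<phi> j) (x $ j))"
      unfolding bump_derivs_def
      by (subst prod.remove[of UNIV i]) (auto intro!: prod.cong)
    have "((\<lambda>t. (deriv ^^ \<kappa> i) (\<phi> i) (x $ i + t)) has_real_derivative deriv ((deriv ^^ \<kappa> i) (\<phi> i)) (x $ i + 0)) (at 0)"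
      using DERIV_chain2[OF smooth_has_derivative[OF sm, of "\<kappa> i" i "x $ i + 0"] DERIV_add[OF DERIV_const[of "x $ i"] DERIV_ident]]
      by simp
    from DERIV_cmult_right[OF this]
    show "((\<lambda>t. bump_derivs \<phi> \<kappa> (x + t *\<^sub>R axis i 1)) has_real_derivative bump_derivs \<phi> (\<kappa>(i := Suc (\<kappa> i))) x)
        (at 0 within {t. x + t *\<^sub>R axis i 1 \<in> UNIV})"
      unfolding 1 2 by simp
  qed simp
  show "continuous_on UNIV (bump_derivs \<phi> \<kappa>)" for \<kappa>
    unfolding bump_derivs_def[abs_def]
    by (intro continuous_on_prod continuous_on_compose2[OF smooth_continuous[OF sm, of UNIV]] continuous_intros) auto
next
  have "\<forall>j. \<exists>a b. 0 < a \<and> a < b \<and> b < 1 \<and> (\<forall>x. x \<notin> {a..b} \<longrightarrow> \<phi> j x = 0)"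
    using \<phi> unfolding bump_fun_def by blast
  then obtain a b where ab: "\<And>j. 0 < a j" "\<And>j. a j < b j" "\<And>j. b j < 1" "\<And>j x. x \<notin> {a j..b j} \<Longrightarrow> \<phi> j x = 0"
    by metis
  define B :: "(real ^ 'd) set" where "B = cbox (\<chi> j. a j) (\<chi> j. b j)"
  have B: "{x. bump_derivs \<phi> (\<lambda>_. 0) x \<noteq> 0} \<subseteq> B"
  proof
    fix x :: "real ^ 'd" assume "x \<in> {x. bump_derivs \<phi> (\<lambda>_. 0) x \<noteq> 0}"
    then have "\<phi> j (x $ j) \<noteq> 0" for j by (auto simp: bump_derivs_def)
    then have "x $ j \<in> {a j..b j}" for j using ab(4) by blast
    then show "x \<in> B" by (simp add: B_def mem_box_cart)
  qed
  have "closed B" "compact B" unfolding B_def by (auto simp: closed_cbox compact_cbox)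
  then have cl: "closure {x. bump_derivs \<phi> (\<lambda>_. 0) x \<noteq> 0} \<subseteq> B" using B closure_minimal by blast
  then show "compact (closure {x. bump_derivs \<phi> (\<lambda>_. 0) x \<noteq> 0})"
    using bounded_subset[OF compact_imp_bounded[OF \<open>compact B\<close>] B] by simp
  have "B \<subseteq> box 0 One"
  proof
    fix x assume "x \<in> B"
    then have "a j \<le> x $ j \<and> x $ j \<le> b j" for j by (simp add: B_def mem_box_cart)
    then show "x \<in> box 0 One" unfolding mem_unit_box using ab(1,3) by (meson less_le_trans le_less_trans)
  qed
  then show "closure {x. bump_derivs \<phi> (\<lambda>_. 0) x \<noteq> 0} \<subseteq> interior unit_cube"
    using cl interior_unit_cube by blast
qed

text \<open>Local integrability gives Lebesgue measurability on compact sets only. An exhaustion of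
  the open cube by closed boxes transfers it to the cube, and the limit has an almost everywhere
  equal Borel representative, to which the Borel operators and Fubini apply.\<close>

lemma locally_integrable_Borel_version:
  fixes h :: "real ^ 'd::finite \<Rightarrow> real"
  assumes "locally_integrable_on h (interior unit_cube)"
  obtains D where "D \<in> borel_measurable borel" "AE x in lebesgue. x \<in> box 0 One \<longrightarrow> D x = h x"
proof -
  define B :: "nat \<Rightarrow> (real ^ 'd) set" where "B n = cbox (\<chi> j. 1 / real (n + 3)) (\<chi> j. 1 - 1 / real (n + 3))" for n
  have Bs: "B n \<subseteq> box 0 One" for n
  proof
    fix x assume "x \<in> B n"
    then have x: "1 / real (n + 3) \<le> x $ j" "x $ j \<le> 1 - 1 / real (n + 3)" for j by (auto simp: B_def mem_box_cart)
    have "0 < 1 / real (n + 3)" by simp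
    then show "x \<in> box 0 One" unfolding mem_unit_box using x by (smt (verit))
  qed
  have "set_integrable lebesgue (B n) h" for n
    using assms Bs[of n] unfolding locally_integrable_on_def interior_unit_cube B_def by (auto simp: compact_cbox)
  then have m: "(\<lambda>x. indicator (B n) x * h x) \<in> borel_measurable lebesgue" for n
    unfolding set_integrable_def using borel_measurable_integrable by fastforce
  have lim: "(\<lambda>n. indicator (B n) x * h x) \<longlonglongrightarrow> indicator (box 0 One) x * h x" for x
  proof (cases "x \<in> box 0 One")
    case False
    then have "x \<notin> B n" for n using Bs by blast
    then show ?thesis using False by simp
  next
    case True
    define \<delta> where "\<delta> = Min ((\<lambda>j. min (x $ j) (1 - x $ j)) ` UNIV)"
    have d: "\<delta> > 0" unfolding \<delta>_def using True by (subst Min_gr_iff) (auto simp: mem_unit_box)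
    have dj: "\<delta> \<le> x $ j" "\<delta> \<le> 1 - x $ j" for j
      unfolding \<delta>_def by (auto intro!: Min.coboundedI[of _ "min (x $ j) (1 - x $ j)", THEN order.trans])
    have "eventually (\<lambda>n. 1 / real (n + 3) < \<delta>) sequentially"
      using d by real_asymp
    then have "eventually (\<lambda>n. indicator (B n) x * h x = indicator (box 0 One) x * h x) sequentially"
    proof eventually_elim
      case (elim n)
      then have "x \<in> B n" unfolding B_def mem_box_cart using dj by (auto intro: less_imp_le order.trans) (smt (verit))
      then show ?case using True by simp
    qed
    then show ?thesis by (rule tendsto_eventually)
  qed
  have "(\<lambda>x. indicator (box 0 One) x * h x) \<in> borel_measurable (completion lborel)"
    by (rule borel_measurable_LIMSEQ_real[OF lim m])
  from completion_ex_borel_measurable_real[OF this]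
  obtain D where D: "D \<in> borel_measurable lborel" "AE x in lborel. indicator (box 0 One) x * h x = D x" by blast
  then have "AE x in lebesgue. indicator (box 0 One) x * h x = D x" by (intro AE_completion) 
  then have "AE x in lebesgue. x \<in> box 0 One \<longrightarrow> D x = h x"
    by eventually_elim auto
  then show ?thesis using D(1) by (intro that[of D]) auto
qed

lemma lebesgue_box_integral_eq:
  fixes D F h :: "real ^ 'd::finite \<Rightarrow> real"
  assumes [measurable]: "D \<in> borel_measurable borel" "F \<in> borel_measurable borel"
    and "AE x in lebesgue. x \<in> box 0 One \<longrightarrow> D x = h x"
    and hm: "(\<lambda>x. indicator (box 0 One) x * h x) \<in> borel_measurable lebesgue"
  shows "(LINT x:box 0 One|lebesgue. h x * F x) = (\<integral>x. D x * F x \<partial>unif)"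
proof -
  have "(LINT x:box 0 One|lebesgue. h x * F x) = (\<integral>x. (indicator (box 0 One) x * h x) * F x \<partial>lebesgue)"
    unfolding set_lebesgue_integral_def by (simp add: mult.assoc)
  also have "\<dots> = (\<integral>x. indicator (box 0 One) x * (D x * F x) \<partial>lebesgue)"
  proof (rule integral_cong_AE)
    show "AE x in lebesgue. indicator (box 0 One) x * h x * F x = indicator (box 0 One) x * (D x * F x)"
      using assms(3) by eventually_elim (auto simp: indicator_def)
    have Fl: "F \<in> borel_measurable lebesgue" and Dl: "D \<in> borel_measurable lebesgue"
      by (auto intro!: measurable_completion)
    then show "(\<lambda>x. indicator (box 0 One) x * h x * F x) \<in> borel_measurable lebesgue"
      by (intro borel_measurable_times[OF hm])
    show "(\<lambda>x. indicator (box 0 One) x * (D x * F x)) \<in> borel_measurable lebesgue"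
      by (intro measurable_completion) measurable
  qed
  also have "\<dots> = (\<integral>x. indicator (box 0 One) x * (D x * F x) \<partial>lborel)"
    by (rule integral_completion) measurable
  also have "\<dots> = (\<integral>x. D x * F x \<partial>unif)"
    by (subst integral_unif) measurable
  finally show ?thesis .
qed

text \<open>Translates the weak derivative at a pure multi-index into integrals over
  \<open>unif\<close>. The Borel function \<open>g'\<close> agrees with \<open>g\<close> at every
  point of the open cube, whereas \<open>D\<close> agrees with the weak derivative only almost
  everywhere.\<close>

lemma weak_derivative_bumps:
  fixes g h :: "real ^ 'd::finite \<Rightarrow> real" and g' D :: "real ^ 'd \<Rightarrow> real"
  assumes w: "weak_derivative (interior unit_cube) (\<lambda>j. if j = i then m else 0) g h"
    and g': "g' \<in> borel_measurable borel" "\<And>x. x \<in> box 0 One \<Longrightarrow> g' x = g x"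
    and D: "D \<in> borel_measurable borel" "AE x in lebesgue. x \<in> box 0 One \<longrightarrow> D x = h x"
    and \<phi>: "\<And>j. bump_fun (\<phi> j)"
  shows "(\<integral>x. g' x * ((deriv ^^ m) (\<phi> i) (x $ i) * (\<Prod>j\<in>UNIV - {i}. \<phi> j (x $ j))) \<partial>unif)
         = (-1) ^ m * (\<integral>x. D x * (\<Prod>j\<in>UNIV. \<phi> j (x $ j)) \<partial>unif)"
proof -
  let ?\<kappa> = "\<lambda>j. if j = i then m else 0"
  have mo: "mi_order ?\<kappa> = m" by (simp add: mi_order_def)
  have tf: "test_function (interior unit_cube) (bump_derivs \<phi>)" by (rule test_function_bump_derivs[OF \<phi>])
  have b1: "bump_derivs \<phi> ?\<kappa> x = (deriv ^^ m) (\<phi> i) (x $ i) * (\<Prod>j\<in>UNIV - {i}. \<phi> j (x $ j))" for x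
    unfolding bump_derivs_def by (subst prod.remove[of UNIV i]) (auto intro!: prod.cong)
  have b0: "bump_derivs \<phi> (\<lambda>_. 0) x = (\<Prod>j\<in>UNIV. \<phi> j (x $ j))" for x
    by (simp add: bump_derivs_def)
  have bm: "bump_derivs \<phi> \<kappa> \<in> borel_measurable borel" for \<kappa>
    using tf unfolding test_function_def by (intro borel_measurable_continuous_onI) auto
  have "(\<lambda>x. indicator (box 0 One) x * g' x) \<in> borel_measurable lebesgue"
    using g'(1) by (intro measurable_completion) measurable
  also have "(\<lambda>x. indicator (box 0 One) x * g' x) = (\<lambda>x. indicator (box 0 One) x * g x)"
    using g'(2) by (auto simp: fun_eq_iff indicator_def)
  finally have gm: "(\<lambda>x. indicator (box 0 One) x * g x) \<in> borel_measurable lebesgue" .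
  have "(\<lambda>x. indicator (box 0 One) x * D x) \<in> borel_measurable lebesgue"
    using D(1) by (intro measurable_completion) measurable
  moreover have "AE x in lebesgue. indicator (box 0 One) x * D x = indicator (box 0 One) x * h x"
    using D(2) by eventually_elim (auto simp: indicator_def)
  ultimately have hm: "(\<lambda>x. indicator (box 0 One) x * h x) \<in> borel_measurable lebesgue"
    by (rule borel_measurable_AE)
  have "(LINT x:box 0 One|lebesgue. g x * bump_derivs \<phi> ?\<kappa> x)
      = (-1) ^ m * (LINT x:box 0 One|lebesgue. h x * bump_derivs \<phi> (\<lambda>_. 0) x)"
    using w tf unfolding weak_derivative_def mo interior_unit_cube by blast
  moreover have "(LINT x:box 0 One|lebesgue. g x * bump_derivs \<phi> ?\<kappa> x) = (\<integral>x. g' x * bump_derivs \<phi> ?\<kappa> x \<partial>unif)"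
    using g' by (intro lebesgue_box_integral_eq bm gm) auto
  moreover have "(LINT x:box 0 One|lebesgue. h x * bump_derivs \<phi> (\<lambda>_. 0) x) = (\<integral>x. D x * bump_derivs \<phi> (\<lambda>_. 0) x \<partial>unif)"
    by (intro lebesgue_box_integral_eq bm hm D)
  ultimately show ?thesis by (simp only: b1 b0)
qed

section \<open>The projection error for Sobolev functions\<close>

lemma unif_integral_le:
  fixes F :: "'a::euclidean_space \<Rightarrow> real"
  assumes F: "F \<in> borel_measurable borel" "\<And>x. 0 \<le> F x" and C: "0 \<le> C"
    and le: "(\<integral>\<^sup>+x. ennreal (F x) \<partial>unif) \<le> ennreal C"
  shows "integrable unif F" "(\<integral>x. F x \<partial>unif) \<le> C"
proof -
  show i: "integrable unif F"
    using F le by (intro integrableI_nonneg) (auto simp: le_less_trans ennreal_less_top)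
  have "ennreal (\<integral>x. F x \<partial>unif) \<le> ennreal C"
    using nn_integral_eq_integral[OF i] F(2) le by simp
  then show "(\<integral>x. F x \<partial>unif) \<le> C" using C by simp
qed

text \<open>Carries bounds for the Sobolev integrals, which are taken over the half-open cube and
  Lebesgue measure, to Borel representatives. \<open>Q\<close> may be any function, so that inner
  integrals of weak derivatives are covered as well.\<close>

lemma nn_integral_unif_le_lebesgue:
  fixes P Q :: "real ^ 'd::finite \<Rightarrow> ennreal"
  assumes P: "P \<in> borel_measurable borel" and "AE x in lebesgue. x \<in> box 0 One \<longrightarrow> P x \<le> Q x"
  shows "(\<integral>\<^sup>+x. P x \<partial>unif) \<le> (\<integral>\<^sup>+x\<in>unit_cube. Q x \<partial>lebesgue)"
proof -
  have "(\<integral>\<^sup>+x. P x \<partial>unif) = (\<integral>\<^sup>+x. indicator (box 0 One) x * P x \<partial>lebesgue)"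
    by (simp add: nn_integral_unif[OF P] nn_integral_completion)
  also have "\<dots> \<le> (\<integral>\<^sup>+x\<in>unit_cube. Q x \<partial>lebesgue)"
  proof (rule nn_integral_mono_AE)
    show "AE x in lebesgue. indicator (box 0 One) x * P x \<le> Q x * indicator unit_cube x"
      using assms(2)
    proof eventually_elim
      case (elim x)
      then show ?case using box_subset_unit_cube by (auto simp: indicator_def)
    qed
  qed
  finally show ?thesis .
qed

lemma finite_mi_order: "finite {\<kappa> :: 'd::finite \<Rightarrow> nat. mi_order \<kappa> = n}"
proof (rule finite_subset)
  show "{\<kappa> :: 'd \<Rightarrow> nat. mi_order \<kappa> = n} \<subseteq> PiE UNIV (\<lambda>_. {..n})"
  proof
    fix \<kappa> :: "'d \<Rightarrow> nat" assume "\<kappa> \<in> {\<kappa>. mi_order \<kappa> = n}"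
    then have "\<kappa> j \<le> n" for j using member_le_sum[of j UNIV \<kappa>] by (auto simp: mi_order_def)
    then show "\<kappa> \<in> PiE UNIV (\<lambda>_. {..n})" by (simp add: PiE_UNIV_domain)
  qed
  show "finite (PiE (UNIV :: 'd set) (\<lambda>_. {..n}))" by (rule finite_PiE) auto
qed

lemma norm_le_card_mult:
  fixes x :: "real ^ 'd::finite"
  assumes "\<And>j. \<bar>x $ j\<bar> \<le> h"
  shows "norm x \<le> real CARD('d) * h"
proof -
  have "norm x \<le> (\<Sum>j\<in>UNIV. \<bar>x $ j\<bar>)" by (rule norm_le_l1_cart)
  also have "\<dots> \<le> (\<Sum>j\<in>(UNIV :: 'd set). h)" by (intro sum_mono assms)
  finally show ?thesis by simp
qed

text \<open>The interior of the d-dimensional cell of x; the point x itself may lie on its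
  boundary.\<close>

definition cell_box :: "nat \<Rightarrow> real ^ 'd::finite \<Rightarrow> (real ^ 'd) set" where
  "cell_box K x = box (\<chi> j. of_int \<lfloor>real K * x $ j\<rfloor> / real K) (\<chi> j. (of_int \<lfloor>real K * x $ j\<rfloor> + 1) / real K)"

lemma mem_cell_box:
  "z \<in> cell_box K x \<longleftrightarrow> (\<forall>j. of_int \<lfloor>real K * x $ j\<rfloor> / real K < z $ j \<and> z $ j < (of_int \<lfloor>real K * x $ j\<rfloor> + 1) / real K)"
  by (simp add: cell_box_def mem_box_cart)

lemma cell_box_upd:
  assumes "same_cell K (x $ i) t" shows "cell_box K (upd x i t) = cell_box K x"
proof -
  have "\<lfloor>real K * upd x i t $ j\<rfloor> = \<lfloor>real K * x $ j\<rfloor>" for j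
    using assms by (simp add: same_cell_def)
  then show ?thesis by (simp only: cell_box_def)
qed

lemma cell_box_norm:
  fixes x :: "real ^ 'd::finite"
  assumes K: "K > 0" and z: "z \<in> cell_box K x"
  shows "norm (x - z) \<le> real CARD('d) * (1 / real K)"
proof (rule norm_le_card_mult)
  fix j
  have "of_int \<lfloor>real K * x $ j\<rfloor> \<le> real K * x $ j" "real K * x $ j < of_int \<lfloor>real K * x $ j\<rfloor> + 1" by linarith+
  moreover have "of_int \<lfloor>real K * x $ j\<rfloor> < real K * z $ j" "real K * z $ j < of_int \<lfloor>real K * x $ j\<rfloor> + 1"
    using z[unfolded mem_cell_box, rule_format, of j] K by (auto simp: field_simps)
  ultimately have "\<bar>real K * x $ j - real K * z $ j\<bar> \<le> 1" by linarith
  then have "real K * \<bar>x $ j - z $ j\<bar> \<le> 1" using K by (simp add: right_diff_distrib[symmetric] abs_mult)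
  then show "\<bar>(x - z) $ j\<bar> \<le> 1 / real K" using K by (simp add: field_simps)
qed

lemma measurable_cell_box [measurable]:
  "Measurable.pred (borel \<Otimes>\<^sub>M borel) (\<lambda>p. snd p \<in> cell_box K (fst p :: real ^ 'd::finite))"
  unfolding mem_cell_box by measurable

lemma integral_cell_box:
  fixes x :: "real ^ 'd::finite"
  assumes K: "K > 0" and x: "x \<in> box 0 One"
  shows "(\<integral>z. indicator (cell_box K x) z \<partial>unif) = 1 / real K ^ CARD('d)"
proof -
  have f0: "0 \<le> \<lfloor>real K * x $ j\<rfloor>" and f1: "\<lfloor>real K * x $ j\<rfloor> + 1 \<le> int K" for j
  proof -
    have "0 < x $ j" "x $ j < 1" using x by (auto simp: mem_unit_box)
    then show "0 \<le> \<lfloor>real K * x $ j\<rfloor>" using K by simp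
    have "real K * x $ j < real K" using \<open>x $ j < 1\<close> K by simp
    then have "\<lfloor>real K * x $ j\<rfloor> < int K" by (simp add: floor_less_iff)
    then show "\<lfloor>real K * x $ j\<rfloor> + 1 \<le> int K" by simp
  qed
  have sub: "cell_box K x \<subseteq> box 0 One"
  proof
    fix z assume z: "z \<in> cell_box K x"
    have "0 < z $ j \<and> z $ j < 1" for j
    proof
      have "0 \<le> real_of_int \<lfloor>real K * x $ j\<rfloor> / real K" using f0[of j] by simp
      then show "0 < z $ j" using z[unfolded mem_cell_box, rule_format, of j] by linarith
      have "real_of_int \<lfloor>real K * x $ j\<rfloor> + 1 \<le> real K" using f1[of j] by linarith
      then have "(real_of_int \<lfloor>real K * x $ j\<rfloor> + 1) / real K \<le> 1" using K by simp
      then show "z $ j < 1" using z[unfolded mem_cell_box, rule_format, of j] by linarith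
    qed
    then show "z \<in> box 0 One" by (simp add: mem_unit_box)
  qed
  have m: "cell_box K x \<in> sets borel" unfolding cell_box_def by simp
  have "(\<integral>z. indicat_real (cell_box K x) z \<partial>unif) = (\<integral>z. indicat_real (box 0 One) z * indicat_real (cell_box K x) z \<partial>lborel)"
    using m by (intro integral_unif) simp
  also have "\<dots> = (\<integral>z. indicat_real (cell_box K x) z \<partial>lborel)"
    using sub by (intro Bochner_Integration.integral_cong) (auto simp: indicator_def)
  also have "\<dots> = measure lborel (cell_box K x)" using m by simp
  also have "\<dots> = (\<Prod>b\<in>Basis. ((\<chi> j. (of_int \<lfloor>real K * x $ j\<rfloor> + 1) / real K) - (\<chi> j. of_int \<lfloor>real K * x $ j\<rfloor> / real K)) \<bullet> b)"
    unfolding cell_box_def using K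
    by (intro measure_lborel_box) (auto simp: Basis_vec_def inner_axis divide_right_mono)
  also have "\<dots> = (\<Prod>b\<in>(Basis :: (real ^ 'd) set). 1 / real K)"
    by (intro prod.cong refl) (auto simp: Basis_vec_def inner_axis add_divide_distrib)
  also have "\<dots> = 1 / real K ^ CARD('d)" by (simp add: power_divide)
  finally show ?thesis .
qed

section \<open>The Gagliardo seminorm and averages over d-dimensional cells\<close>

context
  fixes D :: "real ^ 'd::finite \<Rightarrow> real" and e G :: real
  assumes D [measurable]: "D \<in> borel_measurable borel" and e: "e > 0" and G: "G \<ge> 0"
    and gag: "(\<integral>\<^sup>+y. (\<integral>\<^sup>+x. ennreal ((D x - D y)\<^sup>2 / norm (x - y) powr e) \<partial>unif) \<partial>unif) \<le> ennreal G"
begin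

lemma gagliardo_term_ge:
  assumes "norm (x - y) \<le> r" "r > 0"
  shows "(D x - D y)\<^sup>2 \<le> r powr e * ((D x - D y)\<^sup>2 / norm (x - y) powr e)"
proof (cases "x = y")
  case False
  then have "norm (x - y) > 0" by simp
  then have "norm (x - y) powr e > 0" "norm (x - y) powr e \<le> r powr e"
    using assms e by (auto intro!: powr_mono2)
  then have "(D x - D y)\<^sup>2 * norm (x - y) powr e \<le> (D x - D y)\<^sup>2 * r powr e"
    by (intro mult_left_mono) auto
  then show ?thesis using \<open>norm (x - y) powr e > 0\<close> by (simp add: field_simps)
qed simp

text \<open>Finiteness of the double integral yields one y in the cube with a finite inner integral.
  Distances in the cube are at most d, so the weight is bounded below; hence D - D y, and with it D,
  is square integrable.\<close>

lemma gagliardo_square_integrable: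
  "integrable unif (\<lambda>x. (D x)\<^sup>2)" "integrable unif D"
proof -
  have "AE y in unif. (\<integral>\<^sup>+x. ennreal ((D x - D y)\<^sup>2 / norm (x - y) powr e) \<partial>unif) \<noteq> \<infinity>"
    using gag by (intro nn_integral_PInf_AE) (auto simp: top_unique)
  then have "AE y in unif. y \<in> box 0 One \<and> (\<integral>\<^sup>+x. ennreal ((D x - D y)\<^sup>2 / norm (x - y) powr e) \<partial>unif) \<noteq> \<infinity>"
    using AE_unif_box by eventually_elim simp
  then obtain y where y: "y \<in> box 0 One" "(\<integral>\<^sup>+x. ennreal ((D x - D y)\<^sup>2 / norm (x - y) powr e) \<partial>unif) \<noteq> \<infinity>"
    using eventually_happens'[OF unif.ae_filter_bot] by blast
  let ?r = "real CARD('d)"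
  have "(\<integral>\<^sup>+x. ennreal ((D x - D y)\<^sup>2) \<partial>unif) \<le> (\<integral>\<^sup>+x. ennreal (?r powr e) * ennreal ((D x - D y)\<^sup>2 / norm (x - y) powr e) \<partial>unif)"
  proof (rule nn_integral_mono_AE)
    show "AE x in unif. ennreal ((D x - D y)\<^sup>2) \<le> ennreal (?r powr e) * ennreal ((D x - D y)\<^sup>2 / norm (x - y) powr e)"
      using AE_unif_box
    proof eventually_elim
      case (elim x)
      have "norm (x - y) \<le> ?r * 1"
      proof (rule norm_le_card_mult)
        have "0 < x $ j" "x $ j < 1" "0 < y $ j" "y $ j < 1" for j
          using elim y(1) by (auto simp: mem_unit_box)
        then show "\<bar>(x - y) $ j\<bar> \<le> 1" for j by (smt (verit) vector_minus_component)
      qed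
      then show ?case
        using gagliardo_term_ge[of x y ?r] by (simp add: ennreal_mult[symmetric])
    qed
  qed
  also have "\<dots> = ennreal (?r powr e) * (\<integral>\<^sup>+x. ennreal ((D x - D y)\<^sup>2 / norm (x - y) powr e) \<partial>unif)"
    by (rule nn_integral_cmult) measurable
  also have "\<dots> < \<infinity>" using y(2) by (simp add: ennreal_mult_less_top less_top)
  finally have i: "integrable unif (\<lambda>x. (D x - D y)\<^sup>2)"
    by (intro integrableI_nonneg) auto
  show sq: "integrable unif (\<lambda>x. (D x)\<^sup>2)"
  proof (rule Bochner_Integration.integrable_bound[of unif "\<lambda>x. 2 * (D x - D y)\<^sup>2 + 2 * (D y)\<^sup>2"])
    show "integrable unif (\<lambda>x. 2 * (D x - D y)\<^sup>2 + 2 * (D y)\<^sup>2)" using i by simp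
    show "AE x in unif. norm ((D x)\<^sup>2) \<le> norm (2 * (D x - D y)\<^sup>2 + 2 * (D y)\<^sup>2)"
    proof (rule AE_I2)
      fix x
      have "0 \<le> (D x - 2 * D y)\<^sup>2" by simp
      then have "(D x)\<^sup>2 \<le> 2 * (D x - D y)\<^sup>2 + 2 * (D y)\<^sup>2"
        by (simp add: power2_eq_square algebra_simps)
      then show "norm ((D x)\<^sup>2) \<le> norm (2 * (D x - D y)\<^sup>2 + 2 * (D y)\<^sup>2)" by simp
    qed
  qed simp
  show "integrable unif D"
    by (rule unif.square_integrable_imp_integrable[OF _ sq]) simp
qed

text \<open>Jensen on a cell of volume K^(-d): the squared deviation of D x from the average is at
  most the mean of the squares of D x - D z. Distances in a cell are at most d/K, so the weight can
  be inserted at the price (d/K)^e. For e = 2 (\<alpha> - s) + d the total factor is d^e K^(-2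
  (\<alpha> - s)).\<close>

lemma cell_average_L2:
  assumes K: "K > 0"
  defines "c \<equiv> \<lambda>x. real K ^ CARD('d) * (\<integral>z. D z * indicator (cell_box K x) z \<partial>unif)"
  shows "bdd_borel c" "same_cell K (x $ i) t \<Longrightarrow> c (upd x i t) = c x"
    "integrable unif (\<lambda>x. (D x - c x)\<^sup>2)"
    "(\<integral>x. (D x - c x)\<^sup>2 \<partial>unif) \<le> real K ^ CARD('d) * (real CARD('d) / real K) powr e * G"
proof -
  note Di = gagliardo_square_integrable
  let ?d = "CARD('d)" and ?r = "real CARD('d) / real K"
  have indm [measurable]: "(\<lambda>p. indicator (cell_box K (fst p)) (snd p) :: real) \<in> borel_measurable (borel \<Otimes>\<^sub>M (borel :: (real ^ 'd) measure))"
    by (rule borel_measurable_indicator') measurable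
  have cbs: "cell_box K x \<in> sets borel" for x :: "real ^ 'd" unfolding cell_box_def by simp
  have cm [measurable]: "c \<in> borel_measurable borel"
  proof -
    have "(\<lambda>x. \<integral>z. (\<lambda>p. D (snd p) * indicator (cell_box K (fst p)) (snd p)) (x, z) \<partial>unif) \<in> borel_measurable borel"
      by (rule unif.borel_measurable_lebesgue_integral)
        (simp cong: measurable_cong_sets sets_pair_measure_cong)
    then show ?thesis unfolding c_def by simp
  qed
  show "bdd_borel c"
  proof (rule bbI[OF cm])
    fix x :: "real ^ 'd"
    have "\<bar>\<integral>z. D z * indicator (cell_box K x) z \<partial>unif\<bar> \<le> (\<integral>z. \<bar>D z * indicator (cell_box K x) z\<bar> \<partial>unif)"
      by (rule abs_integral_le)
    also have "\<dots> \<le> (\<integral>z. \<bar>D z\<bar> \<partial>unif)"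
      using Di(2) by (intro integral_mono_AE') (auto simp: indicator_def)
    finally show "\<bar>c x\<bar> \<le> real K ^ ?d * (\<integral>z. \<bar>D z\<bar> \<partial>unif)"
      unfolding c_def abs_mult by (simp add: mult_left_mono)
  qed
  show "same_cell K (x $ i) t \<Longrightarrow> c (upd x i t) = c x" by (simp add: c_def cell_box_upd)
  have var: "(D x - c x)\<^sup>2 \<le> real K ^ ?d * (\<integral>z. (D x - D z)\<^sup>2 * indicator (cell_box K x) z \<partial>unif)"
    if x: "x \<in> box 0 One" for x
  proof -
    define w where "w z = real K ^ ?d * indicator (cell_box K x) z" for z
    have bw: "bdd_borel w" unfolding w_def[abs_def] by (intro bdd_borel_cmult bdd_borel_indicator cbs)
    have iw: "(\<integral>z. w z \<partial>unif) = 1" unfolding w_def using integral_cell_box[OF K x] K by simp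
    have i1: "integrable unif (\<lambda>z. D z * w z)" by (rule integrable_mult_bb[OF Di(2) bw])
    have i2: "integrable unif (\<lambda>z. (D z)\<^sup>2 * w z)" by (rule integrable_mult_bb[OF Di(1) bw])
    have cx: "c x = (\<integral>z. D z * w z \<partial>unif)"
      unfolding c_def w_def by (simp add: mult.left_commute[of _ "real K ^ ?d"])
    \<comment> \<open>The variance of D under the uniform distribution on the cell is
      non-negative.\<close>
    have "0 \<le> (\<integral>z. (D z - c x)\<^sup>2 * w z \<partial>unif)"
      by (intro Bochner_Integration.integral_nonneg) (auto simp: w_def)
    also have "(\<integral>z. (D z - c x)\<^sup>2 * w z \<partial>unif) = (\<integral>z. (D z)\<^sup>2 * w z - 2 * c x * (D z * w z) + (c x)\<^sup>2 * w z \<partial>unif)"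
      by (intro Bochner_Integration.integral_cong) (auto simp: power2_diff algebra_simps)
    also have "\<dots> = (\<integral>z. (D z)\<^sup>2 * w z \<partial>unif) - 2 * c x * c x + (c x)\<^sup>2"
      using i1 i2 bdd_borel_integrable[OF bw] by (simp add: cx[symmetric] iw)
    finally have v: "(c x)\<^sup>2 \<le> (\<integral>z. (D z)\<^sup>2 * w z \<partial>unif)" by (simp add: power2_eq_square)
    have "(\<integral>z. (D x - D z)\<^sup>2 * w z \<partial>unif) = (\<integral>z. (D z)\<^sup>2 * w z - 2 * D x * (D z * w z) + (D x)\<^sup>2 * w z \<partial>unif)"
      by (intro Bochner_Integration.integral_cong) (auto simp: power2_diff algebra_simps)
    also have "\<dots> = (\<integral>z. (D z)\<^sup>2 * w z \<partial>unif) - 2 * D x * c x + (D x)\<^sup>2"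
      using i1 i2 bdd_borel_integrable[OF bw] by (simp add: cx[symmetric] iw)
    finally have "(D x - c x)\<^sup>2 \<le> (\<integral>z. (D x - D z)\<^sup>2 * w z \<partial>unif)"
      using v by (simp add: power2_diff)
    also have "\<dots> = real K ^ ?d * (\<integral>z. (D x - D z)\<^sup>2 * indicator (cell_box K x) z \<partial>unif)"
      unfolding w_def by (simp add: mult.left_commute[of _ "real K ^ ?d"])
    finally show ?thesis .
  qed
  have ix: "integrable unif (\<lambda>z. (D x - D z)\<^sup>2 * indicator (cell_box K x) z)" for x
  proof (rule integrable_mult_bb)
    have "integrable unif (\<lambda>z. (D z)\<^sup>2 - 2 * D x * D z + (D x)\<^sup>2)" using Di by simp
    then show "integrable unif (\<lambda>z. (D x - D z)\<^sup>2)" by (simp add: power2_diff algebra_simps)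
    show "bdd_borel (indicator (cell_box K x))" by (rule bdd_borel_indicator[OF cbs])
  qed
  have "(\<integral>\<^sup>+x. ennreal ((D x - c x)\<^sup>2) \<partial>unif)
      \<le> (\<integral>\<^sup>+x. ennreal (real K ^ ?d * ?r powr e) * (\<integral>\<^sup>+z. ennreal ((D z - D x)\<^sup>2 / norm (z - x) powr e) \<partial>unif) \<partial>unif)"
  proof (rule nn_integral_mono_AE)
    show "AE x in unif. ennreal ((D x - c x)\<^sup>2)
      \<le> ennreal (real K ^ ?d * ?r powr e) * (\<integral>\<^sup>+z. ennreal ((D z - D x)\<^sup>2 / norm (z - x) powr e) \<partial>unif)"
      using AE_unif_box
    proof eventually_elim
      case (elim x)
      have "ennreal ((D x - c x)\<^sup>2) \<le> ennreal (real K ^ ?d) * ennreal (\<integral>z. (D x - D z)\<^sup>2 * indicator (cell_box K x) z \<partial>unif)"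
        using var[OF elim] by (simp add: ennreal_mult[symmetric] ennreal_leI)
      also have "ennreal (\<integral>z. (D x - D z)\<^sup>2 * indicator (cell_box K x) z \<partial>unif)
          = (\<integral>\<^sup>+z. ennreal ((D x - D z)\<^sup>2 * indicator (cell_box K x) z) \<partial>unif)"
        by (rule nn_integral_eq_integral[OF ix, symmetric]) simp
      also have "\<dots> \<le> (\<integral>\<^sup>+z. ennreal (?r powr e) * ennreal ((D z - D x)\<^sup>2 / norm (z - x) powr e) \<partial>unif)"
      proof (rule nn_integral_mono)
        fix z
        show "ennreal ((D x - D z)\<^sup>2 * indicator (cell_box K x) z) \<le> ennreal (?r powr e) * ennreal ((D z - D x)\<^sup>2 / norm (z - x) powr e)"
        proof (cases "z \<in> cell_box K x")
          case True
          have "norm (z - x) \<le> ?r" using cell_box_norm[OF K True] by (simp add: norm_minus_commute)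
          then show ?thesis
            using gagliardo_term_ge[of z x ?r] K True
            by (simp add: ennreal_mult[symmetric] power2_commute[of "D x"] ennreal_leI)
        qed simp
      qed
      also have "\<dots> = ennreal (?r powr e) * (\<integral>\<^sup>+z. ennreal ((D z - D x)\<^sup>2 / norm (z - x) powr e) \<partial>unif)"
        by (rule nn_integral_cmult) measurable
      finally show ?case by (simp add: ennreal_mult mult.assoc mult_left_mono)
    qed
  qed
  also have "\<dots> = ennreal (real K ^ ?d * ?r powr e) * (\<integral>\<^sup>+x. (\<integral>\<^sup>+z. ennreal ((D z - D x)\<^sup>2 / norm (z - x) powr e) \<partial>unif) \<partial>unif)"
  proof (rule nn_integral_cmult)
    have "(\<lambda>x. \<integral>\<^sup>+z. (\<lambda>p. ennreal ((D (snd p) - D (fst p))\<^sup>2 / norm (snd p - fst p) powr e)) (x, z) \<partial>unif) \<in> borel_measurable borel"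
      by (rule unif.borel_measurable_nn_integral)
        (simp cong: measurable_cong_sets sets_pair_measure_cong)
    then show "(\<lambda>x. \<integral>\<^sup>+z. ennreal ((D z - D x)\<^sup>2 / norm (z - x) powr e) \<partial>unif) \<in> borel_measurable unif" by simp
  qed
  also have "\<dots> \<le> ennreal (real K ^ ?d * ?r powr e) * ennreal G"
    by (rule mult_left_mono[OF gag]) simp
  also have "\<dots> = ennreal (real K ^ ?d * ?r powr e * G)"
    using G by (simp add: ennreal_mult)
  finally have *: "(\<integral>\<^sup>+x. ennreal ((D x - c x)\<^sup>2) \<partial>unif) \<le> ennreal (real K ^ ?d * ?r powr e * G)" .
  have C0: "0 \<le> real K ^ ?d * ?r powr e * G" using G by simp
  have m: "(\<lambda>x. (D x - c x)\<^sup>2) \<in> borel_measurable borel" by measurable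
  show "integrable unif (\<lambda>x. (D x - c x)\<^sup>2)" "(\<integral>x. (D x - c x)\<^sup>2 \<partial>unif) \<le> real K ^ ?d * ?r powr e * G"
    using unif_integral_le[OF m _ C0 *] by auto
qed

end

section \<open>The error of one coordinate projection under Sobolev smoothness\<close>

lemma mi_order_single: "mi_order (\<lambda>j. if j = i then m else 0) = m"
  by (simp add: mi_order_def)

text \<open>For integer \<alpha> the strict floor is \<alpha> - 1, so s + 1 = \<alpha> derivatives
  are integrated and \<open>c = 0\<close>. Otherwise s derivatives give K^(-2 s) and the oscillation
  about cell averages supplies the missing K^(-2 (\<alpha> - s)). The power of d stems from the
  fractional case; being at least 1 it may be inserted in the other.\<close>

lemma (in dual_functions) sobolev_coordinate:
  fixes g g' :: "real ^ 'd::finite \<Rightarrow> real"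
  assumes \<alpha>: "\<alpha> > 0" and s: "s = strict_floor \<alpha>" and K: "K > 0"
    and g: "g \<in> sobolev_class \<alpha> l" and g': "bdd_borel g'" "\<And>x. x \<in> box 0 One \<Longrightarrow> g' x = g x"
  shows "(\<integral>x. (g' x - coord_op i (proj_ker K) g' x)\<^sup>2 \<partial>unif)
    \<le> (2 + 2 * proj_const\<^sup>2) * real CARD('d) powr (2 * (\<alpha> - real s) + real CARD('d)) * real K powr (- 2 * \<alpha>) * l\<^sup>2"
proof -
  define e where "e = 2 * (\<alpha> - real s) + real CARD('d)"
  have e: "e > 0" unfolding e_def s using strict_floor_greatest(1)[OF \<alpha>] by (simp add: add_pos_pos)
  have d1: "1 \<le> real CARD('d)" using finite_UNIV_card_ge_0[where 'a = 'd] by simp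
  have de: "1 \<le> real CARD('d) powr e" using d1 e by (simp add: ge_one_powr_ge_zero)
  have B0: "2 + 2 * proj_const\<^sup>2 > 0" by (simp add: add_pos_nonneg)
  have Kp: "real K > 0" using K by simp
  have g'm: "g' \<in> borel_measurable borel" by (rule bdd_borel_measurable[OF g'(1)])
  show ?thesis
  proof (cases "\<alpha> \<in> \<int>")
    case True
    define m where "m = Suc s"
    obtain k :: int where k: "\<alpha> = of_int k" using True Ints_cases by blast
    have am: "\<alpha> = real m" using \<alpha> unfolding m_def s strict_floor_def k by simp
    let ?\<kappa> = "\<lambda>j. if j = i then m else 0"
    obtain DD where w: "\<And>\<kappa>. real (mi_order \<kappa>) = \<alpha> \<Longrightarrow> weak_derivative (interior unit_cube) \<kappa> g (DD \<kappa>)"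
      and le: "(\<Sum>\<kappa> | real (mi_order \<kappa>) = \<alpha>. \<integral>\<^sup>+ x\<in>unit_cube. ennreal ((DD \<kappa> x)\<^sup>2) \<partial>lebesgue) \<le> ennreal (l\<^sup>2)"
      using g True unfolding sobolev_class_def by auto
    define h where "h = DD ?\<kappa>"
    have wh: "weak_derivative (interior unit_cube) ?\<kappa> g h"
      unfolding h_def by (rule w) (simp add: mi_order_single am)
    \<comment> \<open>All terms of the sum over multi-indices are non-negative, so the pure
      derivative in direction i can be singled out.\<close>
    have "(\<integral>\<^sup>+ x\<in>unit_cube. ennreal ((h x)\<^sup>2) \<partial>lebesgue)
        \<le> (\<Sum>\<kappa> | real (mi_order \<kappa>) = \<alpha>. \<integral>\<^sup>+ x\<in>unit_cube. ennreal ((DD \<kappa> x)\<^sup>2) \<partial>lebesgue)"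
      unfolding h_def using finite_mi_order[where 'd = 'd, of m]
      by (intro member_le_sum) (auto simp: am mi_order_single)
    then have hle: "(\<integral>\<^sup>+ x\<in>unit_cube. ennreal ((h x)\<^sup>2) \<partial>lebesgue) \<le> ennreal (l\<^sup>2)"
      using le by (rule order.trans)
    have "locally_integrable_on h (interior unit_cube)" using wh by (simp add: weak_derivative_def)
    then obtain D where D: "D \<in> borel_measurable borel" "AE x in lebesgue. x \<in> box 0 One \<longrightarrow> D x = h x"
      by (rule locally_integrable_Borel_version)
    have "(\<integral>\<^sup>+x. ennreal ((D x)\<^sup>2) \<partial>unif) \<le> (\<integral>\<^sup>+ x\<in>unit_cube. ennreal ((h x)\<^sup>2) \<partial>lebesgue)"
    proof (rule nn_integral_unif_le_lebesgue)
      show "(\<lambda>x. ennreal ((D x)\<^sup>2)) \<in> borel_measurable borel" using D(1) by simp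
      show "AE x in lebesgue. x \<in> box 0 One \<longrightarrow> ennreal ((D x)\<^sup>2) \<le> ennreal ((h x)\<^sup>2)"
        using D(2) by eventually_elim simp
    qed
    then have *: "(\<integral>\<^sup>+x. ennreal ((D x)\<^sup>2) \<partial>unif) \<le> ennreal (l\<^sup>2)" using hle by (rule order.trans)
    have D2: "integrable unif (\<lambda>x. (D x)\<^sup>2)" "(\<integral>x. (D x)\<^sup>2 \<partial>unif) \<le> l\<^sup>2"
      using unif_integral_le[OF _ _ _ *] D(1) by auto
    have Di: "integrable unif D" by (rule unif.square_integrable_imp_integrable[OF _ D2(1)]) (simp add: D(1))
    have "(\<integral>x. (g' x - coord_op i (proj_ker K) g' x)\<^sup>2 \<partial>unif) \<le> (2 + 2 * proj_const\<^sup>2) / real K ^ (2 * m) * (\<integral>x. (D x - 0)\<^sup>2 \<partial>unif)"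
    proof (rule coordinate_projection_L2[OF K g'(1) Di, where c = "\<lambda>x. 0"])
      show "(\<integral>x. g' x * ((deriv ^^ m) (\<phi> i) (x $ i) * (\<Prod>j\<in>UNIV - {i}. \<phi> j (x $ j))) \<partial>unif)
         = (-1) ^ m * (\<integral>x. D x * (\<Prod>j\<in>UNIV. \<phi> j (x $ j)) \<partial>unif)" if "\<And>j. bump_fun (\<phi> j)" for \<phi>
        by (rule weak_derivative_bumps[OF wh g'm g'(2) D that])
    qed (use D2 in \<open>auto simp: m_def\<close>)
    also have "\<dots> \<le> (2 + 2 * proj_const\<^sup>2) / real K ^ (2 * m) * l\<^sup>2"
      using D2(2) B0 by (intro mult_left_mono) auto
    also have "\<dots> = (2 + 2 * proj_const\<^sup>2) * 1 * real K powr (- 2 * \<alpha>) * l\<^sup>2"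
    proof -
      have "real K powr (- 2 * \<alpha>) = 1 / real K powr (real (2 * m))"
        using powr_minus_divide[of "real K" "real (2 * m)"] by (simp add: am)
      also have "real K powr (real (2 * m)) = real K ^ (2 * m)" by (rule powr_realpow[OF Kp])
      finally show ?thesis by simp
    qed
    also have "\<dots> \<le> (2 + 2 * proj_const\<^sup>2) * real CARD('d) powr e * real K powr (- 2 * \<alpha>) * l\<^sup>2"
      using de B0 by (intro mult_right_mono mult_left_mono) auto
    finally show ?thesis unfolding e_def .
  next
    case False
    let ?\<kappa> = "\<lambda>j. if j = i then s else 0"
    have ex: "2 * (\<alpha> - real (strict_floor \<alpha>)) + real CARD('d) = e" by (simp add: e_def s)
    obtain DD where w: "\<And>\<kappa>. mi_order \<kappa> = strict_floor \<alpha> \<Longrightarrow> weak_derivative (interior unit_cube) \<kappa> g (DD \<kappa>)"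
      and le: "(\<Sum>\<kappa> | mi_order \<kappa> = strict_floor \<alpha>. \<integral>\<^sup>+ y\<in>unit_cube. (\<integral>\<^sup>+ x\<in>unit_cube.
            ennreal ((DD \<kappa> x - DD \<kappa> y)\<^sup>2 / norm (x - y) powr e) \<partial>lebesgue) \<partial>lebesgue) \<le> ennreal (l\<^sup>2)"
      using g False unfolding sobolev_class_def ex by auto
    define h where "h = DD ?\<kappa>"
    have wh: "weak_derivative (interior unit_cube) ?\<kappa> g h"
      unfolding h_def by (rule w) (simp add: mi_order_single s)
    have "(\<integral>\<^sup>+ y\<in>unit_cube. (\<integral>\<^sup>+ x\<in>unit_cube. ennreal ((h x - h y)\<^sup>2 / norm (x - y) powr e) \<partial>lebesgue) \<partial>lebesgue)
      \<le> (\<Sum>\<kappa> | mi_order \<kappa> = strict_floor \<alpha>. \<integral>\<^sup>+ y\<in>unit_cube. (\<integral>\<^sup>+ x\<in>unit_cube.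
            ennreal ((DD \<kappa> x - DD \<kappa> y)\<^sup>2 / norm (x - y) powr e) \<partial>lebesgue) \<partial>lebesgue)"
      unfolding h_def using finite_mi_order[where 'd = 'd, of "strict_floor \<alpha>"]
      by (intro member_le_sum[of ?\<kappa> _ "\<lambda>\<kappa>. \<integral>\<^sup>+ y\<in>unit_cube. (\<integral>\<^sup>+ x\<in>unit_cube.
            ennreal ((DD \<kappa> x - DD \<kappa> y)\<^sup>2 / norm (x - y) powr e) \<partial>lebesgue) \<partial>lebesgue"]) (auto simp: mi_order_single s)
    then have hle: "(\<integral>\<^sup>+ y\<in>unit_cube. (\<integral>\<^sup>+ x\<in>unit_cube. ennreal ((h x - h y)\<^sup>2 / norm (x - y) powr e) \<partial>lebesgue) \<partial>lebesgue)
        \<le> ennreal (l\<^sup>2)"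
      using le by (rule order.trans)
    have "locally_integrable_on h (interior unit_cube)" using wh by (simp add: weak_derivative_def)
    then obtain D where D: "D \<in> borel_measurable borel" "AE x in lebesgue. x \<in> box 0 One \<longrightarrow> D x = h x"
      by (rule locally_integrable_Borel_version)
    note [measurable] = D(1)
    have "(\<integral>\<^sup>+y. (\<integral>\<^sup>+x. ennreal ((D x - D y)\<^sup>2 / norm (x - y) powr e) \<partial>unif) \<partial>unif)
        \<le> (\<integral>\<^sup>+ y\<in>unit_cube. (\<integral>\<^sup>+ x\<in>unit_cube. ennreal ((h x - h y)\<^sup>2 / norm (x - y) powr e) \<partial>lebesgue) \<partial>lebesgue)"
    proof (rule nn_integral_unif_le_lebesgue)
      have "(\<lambda>y. \<integral>\<^sup>+x. (\<lambda>p. ennreal ((D (snd p) - D (fst p))\<^sup>2 / norm (snd p - fst p) powr e)) (y, x) \<partial>unif) \<in> borel_measurable borel"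
        by (rule unif.borel_measurable_nn_integral)
          (simp cong: measurable_cong_sets sets_pair_measure_cong)
      then show "(\<lambda>y. \<integral>\<^sup>+x. ennreal ((D x - D y)\<^sup>2 / norm (x - y) powr e) \<partial>unif) \<in> borel_measurable borel" by simp
      show "AE y in lebesgue. y \<in> box 0 One \<longrightarrow> (\<integral>\<^sup>+x. ennreal ((D x - D y)\<^sup>2 / norm (x - y) powr e) \<partial>unif)
          \<le> (\<integral>\<^sup>+ x\<in>unit_cube. ennreal ((h x - h y)\<^sup>2 / norm (x - y) powr e) \<partial>lebesgue)"
        using D(2)
      proof eventually_elim
        case (elim y)
        show ?case
        proof
          assume "y \<in> box 0 One"
          then have "D y = h y" using elim by simp
          show "(\<integral>\<^sup>+x. ennreal ((D x - D y)\<^sup>2 / norm (x - y) powr e) \<partial>unif)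
            \<le> (\<integral>\<^sup>+ x\<in>unit_cube. ennreal ((h x - h y)\<^sup>2 / norm (x - y) powr e) \<partial>lebesgue)"
          proof (rule nn_integral_unif_le_lebesgue)
            show "(\<lambda>x. ennreal ((D x - D y)\<^sup>2 / norm (x - y) powr e)) \<in> borel_measurable borel" by measurable
            show "AE x in lebesgue. x \<in> box 0 One \<longrightarrow>
               ennreal ((D x - D y)\<^sup>2 / norm (x - y) powr e) \<le> ennreal ((h x - h y)\<^sup>2 / norm (x - y) powr e)"
              using D(2) by eventually_elim (simp add: \<open>D y = h y\<close>)
          qed
        qed
      qed
    qed
    then have gag: "(\<integral>\<^sup>+y. (\<integral>\<^sup>+x. ennreal ((D x - D y)\<^sup>2 / norm (x - y) powr e) \<partial>unif) \<partial>unif) \<le> ennreal (l\<^sup>2)"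
      using hle by (rule order.trans)
    note Di = gagliardo_square_integrable[OF D(1) e _ gag]
    note ca = cell_average_L2[OF D(1) e _ gag K]
    define c where "c x = real K ^ CARD('d) * (\<integral>z. D z * indicator (cell_box K x) z \<partial>unif)" for x
    have "(\<integral>x. (g' x - coord_op i (proj_ker K) g' x)\<^sup>2 \<partial>unif) \<le> (2 + 2 * proj_const\<^sup>2) / real K ^ (2 * s) * (\<integral>x. (D x - c x)\<^sup>2 \<partial>unif)"
    proof (rule coordinate_projection_L2[OF K g'(1)])
      show "integrable unif D" by (rule Di(2)) simp
      show "(\<integral>x. g' x * ((deriv ^^ s) (\<phi> i) (x $ i) * (\<Prod>j\<in>UNIV - {i}. \<phi> j (x $ j))) \<partial>unif)
         = (-1) ^ s * (\<integral>x. D x * (\<Prod>j\<in>UNIV. \<phi> j (x $ j)) \<partial>unif)" if "\<And>j. bump_fun (\<phi> j)" for \<phi>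
        by (rule weak_derivative_bumps[OF wh g'm g'(2) D that])
      show "bdd_borel c" unfolding c_def[abs_def] by (rule ca(1)) simp
      show "integrable unif (\<lambda>x. (D x - c x)\<^sup>2)" unfolding c_def[abs_def] by (rule ca(3)) simp
      have "c (upd x i t) = c x" if "same_cell K (x $ i) t" for x t
        unfolding c_def by (rule ca(2)[OF _ that]) simp
      then show "c = (\<lambda>x. 0) \<or> s \<le> s \<and> (\<forall>x t. same_cell K (x $ i) t \<longrightarrow> c (upd x i t) = c x)" by blast
    qed simp
    also have "\<dots> \<le> (2 + 2 * proj_const\<^sup>2) / real K ^ (2 * s) * (real K ^ CARD('d) * (real CARD('d) / real K) powr e * l\<^sup>2)"
    proof (rule mult_left_mono)
      show "(\<integral>x. (D x - c x)\<^sup>2 \<partial>unif) \<le> real K ^ CARD('d) * (real CARD('d) / real K) powr e * l\<^sup>2"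
        unfolding c_def by (rule ca(4)) simp
    qed (use B0 in simp)
    also have "\<dots> = (2 + 2 * proj_const\<^sup>2) * real CARD('d) powr e * real K powr (- 2 * \<alpha>) * l\<^sup>2"
    proof -
      have "real K ^ CARD('d) * (real CARD('d) / real K) powr e / real K ^ (2 * s)
          = real CARD('d) powr e * (real K powr real CARD('d) / real K powr e / real K powr real (2 * s))"
        using powr_realpow[OF Kp, of "CARD('d)"] powr_realpow[OF Kp, of "2 * s"]
        by (simp only: powr_divide) simp
      also have "real K powr real CARD('d) / real K powr e / real K powr real (2 * s) = real K powr (- 2 * \<alpha>)"
        by (simp add: powr_diff[symmetric] e_def)
      finally have eq: "real K ^ CARD('d) * (real CARD('d) / real K) powr e / real K ^ (2 * s)
          = real CARD('d) powr e * real K powr (- 2 * \<alpha>)" .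
      have r: "a / b * (x * y) = a * (x / b) * y" for a b x y :: real by simp
      show ?thesis unfolding r eq by (simp only: mult.assoc)
    qed
    finally show ?thesis unfolding e_def .
  qed
qed

text \<open>The supremum norm counterpart of the L2 bound, at every point of the half-open cube:
  under the Hoelder condition the sampling distribution is arbitrary and may charge the
  faces.\<close>

lemma (in dual_functions) coord_op_kP_bound_cube:
  fixes h :: "real ^ 'd::finite \<Rightarrow> real"
  assumes K: "K > 0" and h: "bdd_borel h" and A: "\<And>x. x \<in> unit_cube \<Longrightarrow> \<bar>h x\<bar> \<le> A" and x: "x \<in> unit_cube"
  shows "\<bar>coord_op i (proj_ker K) h x\<bar> \<le> proj_const * A"
proof -
  have u: "0 \<le> x $ i" "x $ i < 1" using x by (auto simp: unit_cube_def)
  have A0: "A \<ge> 0" using A[OF x] by linarith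
  have bk: "bdd_borel (\<lambda>t. proj_ker K (x $ i) t * h (upd x i t))" by (intro bdd_borel_mult bdd_borel_ker bdd_ker_kP bdd_borel_slice h)
  have bw: "bdd_borel (\<lambda>t. proj_const * real K * A * (if same_cell K (x $ i) t then 1 else 0))"
    by (rule bbI[of _ "\<bar>proj_const * real K * A\<bar>"]) (auto split: if_splits)
  have "\<bar>coord_op i (proj_ker K) h x\<bar> \<le> (\<integral>t. \<bar>proj_ker K (x $ i) t * h (upd x i t)\<bar> \<partial>unif)"
    unfolding coord_op_def line_op_def by (rule abs_integral_le)
  also have "\<dots> \<le> (\<integral>t. proj_const * real K * A * (if same_cell K (x $ i) t then 1 else 0) \<partial>unif)"
  proof (rule integral_mono_AE[OF integrable_abs[OF bdd_borel_integrable[OF bk]] bdd_borel_integrable[OF bw]])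
    show "AE t in unif. \<bar>proj_ker K (x $ i) t * h (upd x i t)\<bar> \<le> proj_const * real K * A * (if same_cell K (x $ i) t then 1 else 0)"
      using AE_unif_box
    proof eventually_elim
      case (elim t)
      then have "upd x i t \<in> unit_cube" using x by (auto simp: unit_cube_def less_imp_le)
      from A[OF this] have "\<bar>proj_ker K (x $ i) t\<bar> * \<bar>h (upd x i t)\<bar> \<le> (proj_const * real K * (if same_cell K (x $ i) t then 1 else 0)) * A"
        using proj_const_pos by (intro mult_mono proj_ker_bound) auto
      then show ?case by (simp only: abs_mult ac_simps)
    qed
  qed
  also have "\<dots> = proj_const * real K * A * (\<integral>t. (if same_cell K (x $ i) t then 1 else 0) \<partial>unif)" by simp
  also have "(\<integral>t. (if same_cell K (x $ i) t then 1 else 0) \<partial>unif) = 1 / real K"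
  proof -
    obtain c where c: "c < K" "\<lfloor>real K * x $ i\<rfloor> = int c" using cell_exists[OF K u] .
    \<comment> \<open>The coordinate of x may be 0, whereas the length of a cell was computed for
      interior points; the midpoint \<open>v\<close> of the same cell is interior.\<close>
    define v where "v = (real c + 1 / 2) / real K"
    have v: "real K * v = real c + 1 / 2" using K by (simp add: v_def)
    have "\<lfloor>real K * v\<rfloor> = int c" unfolding v by (simp add: floor_eq_iff)
    then have sc: "same_cell K (x $ i) t = same_cell K v t" for t by (simp add: same_cell_def c(2))
    have "0 < v" using K by (simp add: v_def add_pos_nonneg)
    moreover have "real c + 1 \<le> real K" using c(1) by linarith
    then have "v < 1" using K by (simp add: v_def)
    ultimately show ?thesis unfolding sc by (rule integral_same_cell[OF K])
  qed
  finally show ?thesis using K by simp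
qed

section \<open>The projection error for Hoelder functions\<close>

text \<open>Reproduction of the local polynomial T turns the error at x into (h - T) minus the
  projection of h - T. Both parts are controlled by \<epsilon>, since the kernel sees only the cell
  of the i-th coordinate.\<close>

lemma (in dual_functions) coord_op_kP_local_polynomial:
  fixes h :: "real ^ 'd::finite \<Rightarrow> real"
  assumes K: "K > 0" and h: "bdd_borel h" and x: "x \<in> unit_cube" and c: "\<lfloor>real K * x $ i\<rfloor> = int c"
    and approx: "\<And>t. real c / real K \<le> t \<Longrightarrow> t < real (Suc c) / real K \<Longrightarrow>
       \<bar>h (upd x i t) - (\<Sum>j\<le>s. b j * (real K * t - real c) ^ j)\<bar> \<le> \<epsilon>"
  shows "\<bar>h x - coord_op i (proj_ker K) h x\<bar> \<le> (1 + proj_const) * \<epsilon>"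
proof -
  have u: "0 \<le> x $ i" "x $ i < 1" using x by (auto simp: unit_cube_def)
  have uc: "real c / real K \<le> x $ i" "x $ i < real (Suc c) / real K" using c floor_cell[OF K] by auto
  define T where "T t = (\<Sum>j\<le>s. b j * (if \<lfloor>real K * t\<rfloor> = int c then (real K * t - real c) ^ j else 0))" for t
  have T: "bdd_borel T" unfolding T_def[abs_def] by (intro bdd_borel_sum bdd_borel_cmult bdd_borel_cell_monomial) simp
  have cell: "\<lfloor>real K * t\<rfloor> = int c \<longleftrightarrow> real c / real K \<le> t \<and> t < real (Suc c) / real K" for t
    by (rule floor_cell[OF K])
  \<comment> \<open>The one-variable difference along the line through x, extended to a function on
    the whole space that depends on coordinate i alone. Cut off to the cell, it satisfies the
    premise of the supremum bound.\<close>
  define h' where "h' z = h (upd x i (z $ i)) - T (z $ i)" for z :: "real ^ 'd"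
  define h'' where "h'' z = (if \<lfloor>real K * z $ i\<rfloor> = int c then h' z else 0)" for z
  have h': "bdd_borel h'" unfolding h'_def
    by (intro bdd_borel_diff bdd_borel_compose[OF h] bdd_borel_compose[OF T]) measurable
  have "bdd_borel (\<lambda>z. indicator {z :: real ^ 'd. \<lfloor>real K * z $ i\<rfloor> = int c} z * h' z)"
    by (intro bdd_borel_mult h' bdd_borel_indicator) measurable
  then have h'': "bdd_borel h''" unfolding h''_def by (rule back_subst[of bdd_borel]) (auto simp: indicator_def fun_eq_iff)
  have eps0: "\<epsilon> \<ge> 0" using approx[OF uc] by linarith
  have b1: "\<bar>h'' z\<bar> \<le> \<epsilon>" for z
    using approx[of "z $ i"] eps0 unfolding h''_def h'_def T_def by (auto simp: cell)
  have "\<bar>coord_op i (proj_ker K) h'' x\<bar> \<le> proj_const * \<epsilon>"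
    by (rule coord_op_kP_bound_cube[OF K h'' b1 x])
  moreover have "coord_op i (proj_ker K) h'' x = coord_op i (proj_ker K) h x - T (x $ i)"
  proof -
    have "proj_ker K (x $ i) t * h'' (upd x i t) = proj_ker K (x $ i) t * h (upd x i t) - proj_ker K (x $ i) t * T t" for t
    proof (cases "\<lfloor>real K * t\<rfloor> = int c")
      case True
      then show ?thesis by (simp add: h''_def h'_def right_diff_distrib)
    next
      case False
      then have "\<not> same_cell K (x $ i) t" by (simp add: same_cell_def c)
      then have "proj_ker K (x $ i) t = 0" using proj_ker_bound[of K "x $ i" t] by simp
      then show ?thesis by simp
    qed
    then have "coord_op i (proj_ker K) h'' x = coord_op i (proj_ker K) h x - (\<integral>t. proj_ker K (x $ i) t * T t \<partial>unif)"
      unfolding coord_op_def line_op_def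
      using bdd_borel_integrable[OF bdd_borel_mult[OF bdd_borel_ker[OF bdd_ker_kP] bdd_borel_slice[OF h]]]
        bdd_borel_integrable[OF bdd_borel_mult[OF bdd_borel_ker[OF bdd_ker_kP] T]] by simp
    also have "(\<integral>t. proj_ker K (x $ i) t * T t \<partial>unif) = (\<Sum>j\<le>s. b j *
        (\<integral>t. proj_ker K (x $ i) t * (if \<lfloor>real K * t\<rfloor> = int c then (real K * t - real c) ^ j else 0) \<partial>unif))"
    proof -
      have I: "integrable unif (\<lambda>t. b j * (proj_ker K (x $ i) t * (if \<lfloor>real K * t\<rfloor> = int c then (real K * t - real c) ^ j else 0)))" for j
        by (intro bdd_borel_integrable bdd_borel_cmult bdd_borel_mult bdd_borel_ker bdd_ker_kP bdd_borel_cell_monomial)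
      have "proj_ker K (x $ i) t * T t = (\<Sum>j\<le>s. b j * (proj_ker K (x $ i) t * (if \<lfloor>real K * t\<rfloor> = int c then (real K * t - real c) ^ j else 0)))" for t
        unfolding T_def sum_distrib_left by (intro sum.cong refl) (simp only: mult.left_commute)
      then show ?thesis
        by (simp only: Bochner_Integration.integral_sum I Bochner_Integration.integral_mult_right_zero)
    qed
    also have "\<dots> = (\<Sum>j\<le>s. b j * (real K * x $ i - real c) ^ j)"
      using integral_kP_monomial[OF K u c] by (intro sum.cong) auto
    also have "\<dots> = T (x $ i)" by (simp add: T_def c)
    finally show ?thesis .
  qed
  moreover have "\<bar>h x - T (x $ i)\<bar> \<le> \<epsilon>"
    using approx[OF uc] by (simp add: T_def c)
  ultimately show ?thesis by (simp add: distrib_right)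
qed

text \<open>Taylor's formula along coordinate i, expanded at the left wall of the cell. The Hoelder
  sum carries the weight 1/s! on the pure derivative of order s, hence the factor
  \<open>fact s\<close>.\<close>

lemma holder_line_taylor:
  fixes g :: "real ^ 'd::finite \<Rightarrow> real"
  assumes \<alpha>: "\<alpha> > 0" and s: "s = strict_floor \<alpha>" and K: "K > 0" and L: "L > 0"
    and g: "g \<in> holder_class \<alpha> L" and x: "x \<in> unit_cube" and c: "c < K"
  shows "\<exists>b. \<forall>t. real c / real K \<le> t \<and> t < real (Suc c) / real K \<longrightarrow>
     \<bar>g (upd x i t) - (\<Sum>j\<le>s. b j * (real K * t - real c) ^ j)\<bar> \<le> fact s * L * real K powr (- \<alpha>)"
proof -
  obtain D where pd: "partial_derivatives s unit_cube g D"
    and ho: "\<And>x x'. x \<in> unit_cube \<Longrightarrow> x' \<in> unit_cube \<Longrightarrow>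
        (\<Sum>\<kappa> | mi_order \<kappa> = s. 1 / mi_fact \<kappa> * \<bar>D \<kappa> x - D \<kappa> x'\<bar>) \<le> L * infnorm (x - x') powr (\<alpha> - real s)"
    using g unfolding holder_class_def s[symmetric] by blast
  define \<kappa> where "\<kappa> m = (\<lambda>j. if j = i then m else 0 :: nat)" for m
  define d where "d m t = D (\<kappa> m) (upd x i t)" for m t
  define a where "a = real c / real K"
  define S where "S = {a..<real (Suc c) / real K}"
  have Kp: "real K > 0" using K by simp
  have sa: "\<alpha> - real s > 0" using strict_floor_greatest(1)[OF \<alpha>] s by simp
  have "real c + 1 \<le> real K" using c by linarith
  then have S1: "S \<subseteq> {0..<1}" using Kp unfolding S_def a_def by (auto simp: field_simps)
  have width: "\<bar>t - a\<bar> \<le> 1 / real K" if "t \<in> S" for t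
  proof -
    have "real (Suc c) / real K = a + 1 / real K" by (simp add: a_def add_divide_distrib)
    then show ?thesis using that by (simp add: S_def)
  qed
  have aS: "a \<in> S" using Kp by (simp add: S_def a_def field_simps)
  have cube: "upd x i t \<in> unit_cube \<longleftrightarrow> t \<in> {0..<1}" for t
    using x by (auto simp: unit_cube_def split: if_splits)
  have der: "(d m has_real_derivative d (Suc m) t) (at t within S)" if "m < s" "t \<in> S" for m t
  proof -
    have t: "t \<in> {0..<1}" using that S1 by blast
    define y where "y = upd x i t"
    have y: "y \<in> unit_cube" unfolding y_def using cube t by blast
    have ys: "y + r *\<^sub>R axis i 1 = upd x i (t + r)" for r
      by (auto simp: y_def upd_conv Finite_Cartesian_Product.vec_eq_iff axis_def)
    have k: "(\<kappa> m)(i := Suc (\<kappa> m i)) = \<kappa> (Suc m)" by (auto simp: \<kappa>_def)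
    have "((\<lambda>r. D (\<kappa> m) (y + r *\<^sub>R axis i 1)) has_real_derivative D ((\<kappa> m)(i := Suc (\<kappa> m i))) y)
        (at 0 within {r. y + r *\<^sub>R axis i 1 \<in> unit_cube})"
      by (rule pd[unfolded partial_derivatives_def, THEN conjunct2, rule_format, OF y])
        (use that(1) in \<open>simp add: \<kappa>_def mi_order_single\<close>)
    \<comment> \<open>The definition of partial derivatives speaks about increments at 0. A shift of
      the variable turns this into a derivative of \<open>d m\<close> at t, one-sided for t =
      0.\<close>
    then have "((\<lambda>r. d m (t + r)) has_real_derivative d (Suc m) t) (at 0 within {r. t + r \<in> {0..<1}})"
      unfolding k ys cube d_def by (simp add: y_def)
    moreover have "(\<lambda>v. v - t) ` {0..<1} = {r. t + r \<in> {0..<1}}"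
    proof (intro equalityI subsetI)
      fix r assume "r \<in> {r. t + r \<in> {0..<1}}"
      then show "r \<in> (\<lambda>v. v - t) ` {0..<1}" by (intro image_eqI[of _ _ "t + r"]) auto
    qed auto
    ultimately have "((\<lambda>r. d m (t + r)) has_real_derivative d (Suc m) t) (at ((\<lambda>v. v - t) t) within ((\<lambda>v. v - t) ` {0..<1}))"
      by simp
    moreover have "((\<lambda>v. v - t) has_real_derivative 1) (at t within {0..<1})"
      by (auto intro!: derivative_eq_intros)
    ultimately have "((\<lambda>r. d m (t + r)) \<circ> (\<lambda>v. v - t) has_real_derivative d (Suc m) t * 1) (at t within {0..<1})"
      by (rule DERIV_image_chain)
    then have "(d m has_real_derivative d (Suc m) t) (at t within {0..<1})"
      by (simp add: o_def)
    then show ?thesis by (rule DERIV_subset[OF _ S1])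
  qed
  define Bd where "Bd = fact s * L * (1 / real K) powr (\<alpha> - real s)"
  have osc: "\<bar>d s t - d s a\<bar> \<le> Bd" if "t \<in> S" for t
  proof -
    have c1: "upd x i t \<in> unit_cube" "upd x i a \<in> unit_cube" using cube S1 that aS by blast+
    have "mi_fact (\<kappa> s) = (\<Prod>j\<in>UNIV. if j = i then fact s else 1)"
      unfolding mi_fact_def \<kappa>_def by (intro prod.cong) auto
    then have mf: "mi_fact (\<kappa> s) = fact s" by simp
    have "1 / mi_fact (\<kappa> s) * \<bar>D (\<kappa> s) (upd x i t) - D (\<kappa> s) (upd x i a)\<bar>
       \<le> (\<Sum>\<kappa> | mi_order \<kappa> = s. 1 / mi_fact \<kappa> * \<bar>D \<kappa> (upd x i t) - D \<kappa> (upd x i a)\<bar>)"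
      by (rule member_le_sum[of "\<kappa> s" _ "\<lambda>\<kappa>. 1 / mi_fact \<kappa> * \<bar>D \<kappa> (upd x i t) - D \<kappa> (upd x i a)\<bar>"])
        (auto simp: finite_mi_order mi_order_single \<kappa>_def mi_fact_def intro!: divide_nonneg_nonneg prod_nonneg)
    also have "\<dots> \<le> L * infnorm (upd x i t - upd x i a) powr (\<alpha> - real s)" by (rule ho[OF c1])
    also have "\<dots> \<le> L * (1 / real K) powr (\<alpha> - real s)"
    proof (intro mult_left_mono powr_mono2)
      have "upd x i t - upd x i a = (t - a) *\<^sub>R axis i 1"
        by (auto simp: Finite_Cartesian_Product.vec_eq_iff axis_def)
      then have "infnorm (upd x i t - upd x i a) \<le> \<bar>t - a\<bar>"
        using infnorm_le_norm[of "upd x i t - upd x i a"] by simp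
      also have "\<bar>t - a\<bar> \<le> 1 / real K" by (rule width[OF that])
      finally show "infnorm (upd x i t - upd x i a) \<le> 1 / real K" .
    qed (use L sa in \<open>auto simp: infnorm_pos_le\<close>)
    finally show ?thesis unfolding mf d_def Bd_def by (simp add: field_simps)
  qed
  have KB: "Bd * (1 / real K) ^ s = fact s * L * real K powr (- \<alpha>)"
  proof -
    have "(1 / real K) ^ s = (1 / real K) powr real s" using Kp by (simp add: powr_realpow)
    then have "Bd * (1 / real K) ^ s = fact s * L * (1 / real K) powr \<alpha>"
      unfolding Bd_def by (simp add: powr_add[symmetric] mult.assoc)
    also have "(1 / real K) powr \<alpha> = real K powr (- \<alpha>)" by (simp add: powr_divide powr_minus_divide)
    finally show ?thesis .
  qed
  have Bd0: "Bd \<ge> 0" unfolding Bd_def using L by simp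
  have d0: "d 0 t = g (upd x i t)" if "t \<in> S" for t
  proof -
    have "upd x i t \<in> unit_cube" using cube S1 that by blast
    moreover have "\<kappa> 0 = (\<lambda>_. 0)" by (auto simp: \<kappa>_def)
    ultimately show ?thesis using pd unfolding partial_derivatives_def d_def by simp
  qed
  have taylor: "\<bar>d 0 t - (\<Sum>j\<le>s. d j a * (t - a) ^ j / fact j)\<bar> \<le> Bd * \<bar>t - a\<bar> ^ s" if t: "t \<in> S" for t
  proof (cases s)
    case 0
    then show ?thesis using osc[OF t] by simp
  next
    case (Suc n)
    \<comment> \<open>The term of order s is subtracted beforehand, so the highest derivative
      becomes \<open>d s t - d s a\<close>. This is bounded by the Hoelder oscillation, and Taylor's
      remainder needs no derivative beyond order s.\<close>
    define f where "f j t = d j t - d s a * (t - a) ^ (s - j) / fact (s - j)" for j t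
    have fd: "(f j has_field_derivative f (Suc j) t) (at t within S)" if "t \<in> S" "j \<le> n" for j t
    proof -
      have js: "s - j = Suc (s - Suc j)" using that Suc by simp
      have "((\<lambda>t. (t - a) ^ Suc (s - Suc j)) has_real_derivative (1 + real (s - Suc j)) * (1 * (t - a) ^ (s - Suc j))) (at t within S)"
        by (rule DERIV_power_Suc) (auto intro!: derivative_eq_intros)
      from DERIV_cdivide[OF DERIV_cmult[OF this, of "d s a"], of "fact (Suc (s - Suc j))"]
      have "((\<lambda>t. d s a * (t - a) ^ (s - j) / fact (s - j)) has_real_derivative d s a * (t - a) ^ (s - Suc j) / fact (s - Suc j)) (at t within S)"
        unfolding js
      proof (rule DERIV_cong)
        define m where "m = s - Suc j"
        have fm: "fact (Suc m) = (1 + real m) * (fact m :: real)" by (simp only: fact_Suc of_nat_Suc add.commute)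
        have "A * ((1 + N) * (1 * X)) / ((1 + N) * Y) = A * X / Y" if "N \<ge> 0" for A N X Y :: real
          using that by simp
        from this[of "real m"]
        show "d s a * ((1 + real (s - Suc j)) * (1 * (t - a) ^ (s - Suc j))) / fact (Suc (s - Suc j))
            = d s a * (t - a) ^ (s - Suc j) / fact (s - Suc j)"
          unfolding m_def[symmetric] fm by simp
      qed
      from DERIV_diff[OF der[of j t] this] show ?thesis
        using that Suc unfolding f_def by simp
    qed
    have "norm (f 0 t - (\<Sum>j\<le>n. f j a * (t - a) ^ j / fact j)) \<le> Bd * norm (t - a) ^ Suc n / fact n"
    proof (rule field_Taylor[where f = f and S = S, OF _ fd _ aS t])
      show "convex S" unfolding S_def by (rule convex_real_interval)
      show "norm (f (Suc n) y) \<le> Bd" if "y \<in> S" for y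
        using osc[OF that] Suc by (simp add: f_def)
    qed
    also have "\<dots> \<le> Bd * \<bar>t - a\<bar> ^ s"
    proof -
      have "Bd * norm (t - a) ^ Suc n / fact n \<le> Bd * norm (t - a) ^ Suc n / 1"
        using Bd0 by (intro divide_left_mono mult_nonneg_nonneg) auto
      then show ?thesis by (simp add: Suc)
    qed
    also have "f 0 t - (\<Sum>j\<le>n. f j a * (t - a) ^ j / fact j) = d 0 t - (\<Sum>j\<le>s. d j a * (t - a) ^ j / fact j)"
    proof -
      have "(\<Sum>j\<le>n. f j a * (t - a) ^ j / fact j) = (\<Sum>j\<le>n. d j a * (t - a) ^ j / fact j)"
        using Suc by (intro sum.cong refl) (simp add: f_def)
      then show ?thesis unfolding Suc by (simp add: f_def Suc)
    qed
    finally show ?thesis by simp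
  qed
  show ?thesis
  \<comment> \<open>The Taylor coefficients are rewritten for the local variable K t - c = K (t -
    a).\<close>
  proof (intro exI[of _ "\<lambda>j. d j a / (fact j * real K ^ j)"] allI impI)
    fix t assume "real c / real K \<le> t \<and> t < real (Suc c) / real K"
    then have t: "t \<in> S" by (simp add: S_def a_def)
    note ta = width[OF t]
    have Kt: "real K * t - real c = real K * (t - a)" using Kp by (simp add: a_def field_simps)
    have "(\<Sum>j\<le>s. d j a / (fact j * real K ^ j) * (real K * t - real c) ^ j) = (\<Sum>j\<le>s. d j a * (t - a) ^ j / fact j)"
      unfolding Kt power_mult_distrib using Kp by (intro sum.cong) auto
    moreover have "Bd * \<bar>t - a\<bar> ^ s \<le> Bd * (1 / real K) ^ s"
      using ta Bd0 by (intro mult_left_mono power_mono) auto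
    ultimately show "\<bar>g (upd x i t) - (\<Sum>j\<le>s. d j a / (fact j * real K ^ j) * (real K * t - real c) ^ j)\<bar>
        \<le> fact s * L * real K powr (- \<alpha>)"
      using taylor[OF t] d0[OF t] KB by simp
  qed
qed

lemma (in dual_functions) holder_coordinate:
  fixes g g' :: "real ^ 'd::finite \<Rightarrow> real"
  assumes \<alpha>: "\<alpha> > 0" and s: "s = strict_floor \<alpha>" and K: "K > 0" and L: "L > 0"
    and g: "g \<in> holder_class \<alpha> L" and g': "bdd_borel g'" "\<And>x. x \<in> unit_cube \<Longrightarrow> g' x = g x"
    and x: "x \<in> unit_cube"
  shows "\<bar>g' x - coord_op i (proj_ker K) g' x\<bar> \<le> (1 + proj_const) * (fact s * L * real K powr (- \<alpha>))"
proof -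
  have u: "0 \<le> x $ i" "x $ i < 1" using x by (auto simp: unit_cube_def)
  obtain c where c: "c < K" "\<lfloor>real K * x $ i\<rfloor> = int c" using cell_exists[OF K u] .
  obtain b where b: "\<And>t. real c / real K \<le> t \<Longrightarrow> t < real (Suc c) / real K \<Longrightarrow>
     \<bar>g (upd x i t) - (\<Sum>j\<le>s. b j * (real K * t - real c) ^ j)\<bar> \<le> fact s * L * real K powr (- \<alpha>)"
    using holder_line_taylor[OF \<alpha> s K L g x c(1), of i] by blast
  show ?thesis
  proof (rule coord_op_kP_local_polynomial[OF K g'(1) x c(2)])
    fix t assume t: "real c / real K \<le> t" "t < real (Suc c) / real K"
    have "real c + 1 \<le> real K" using c by linarith
    then have "real (Suc c) / real K \<le> 1" using K by simp
    moreover have "0 \<le> real c / real K" by simp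
    ultimately have "0 \<le> t" "t < 1" using t by linarith+
    then have "upd x i t \<in> unit_cube" using x by (auto simp: unit_cube_def)
    then show "\<bar>g' (upd x i t) - (\<Sum>j\<le>s. b j * (real K * t - real c) ^ j)\<bar> \<le> fact s * L * real K powr (- \<alpha>)"
      using b[OF t] g'(2) by simp
  qed
qed

section \<open>Composition over all coordinates\<close>

context dual_functions
begin

primrec proj :: "nat \<Rightarrow> 'd list \<Rightarrow> (real ^ 'd::finite \<Rightarrow> real) \<Rightarrow> real ^ 'd \<Rightarrow> real" where
  "proj K [] g = g"
| "proj K (i # is) g = coord_op i (proj_ker K) (proj K is g)"

lemma bdd_borel_proj: "bdd_borel g \<Longrightarrow> bdd_borel (proj K is g)"
  by (induction "is") (auto intro: bdd_borel_op bdd_ker_kP)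

lemma proj_measurable:
  fixes G :: "'z \<Rightarrow> real ^ 'd::finite \<Rightarrow> real"
  assumes "(\<lambda>(z, x). G z x) \<in> borel_measurable (M \<Otimes>\<^sub>M borel)"
  shows "(\<lambda>(z, x). proj K is (G z) x) \<in> borel_measurable (M \<Otimes>\<^sub>M borel)"
  using assms by (induction "is") (simp_all add: coord_op_measurable[OF bdd_ker_kP])

lemma proj_bound:
  fixes g :: "real ^ 'd::finite \<Rightarrow> real"
  assumes K: "K > 0" and g: "bdd_borel g" and A: "\<And>x. x \<in> unit_cube \<Longrightarrow> \<bar>g x\<bar> \<le> A"
  shows "x \<in> unit_cube \<Longrightarrow> \<bar>proj K is g x\<bar> \<le> proj_const ^ length is * A"
proof (induction "is" arbitrary: x)
  case (Cons i "is")
  have "\<bar>coord_op i (proj_ker K) (proj K is g) x\<bar> \<le> proj_const * (proj_const ^ length is * A)"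
    by (rule coord_op_kP_bound_cube[OF K bdd_borel_proj[OF g] Cons.IH Cons.prems])
  then show ?case by (simp add: mult.assoc)
qed (simp add: A)

text \<open>From g - P_i h = (g - P_i g) + P_i (g - h): each further coordinate adds its own error
  and multiplies the previous one by the norm of P_i. In \<open>L2_const\<close> the factors 2 come
  from squaring the sum.\<close>

primrec sup_const :: "nat \<Rightarrow> real" where
  "sup_const 0 = 0"
| "sup_const (Suc n) = 1 + proj_const * sup_const n"

primrec L2_const :: "nat \<Rightarrow> real" where
  "L2_const 0 = 0"
| "L2_const (Suc n) = 2 + 2 * proj_const\<^sup>2 * L2_const n"

lemma proj_sup_error:
  fixes g :: "real ^ 'd::finite \<Rightarrow> real"
  assumes K: "K > 0" and g: "bdd_borel g"
    and \<beta>: "\<And>i x. x \<in> unit_cube \<Longrightarrow> \<bar>g x - coord_op i (proj_ker K) g x\<bar> \<le> \<beta>"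
  shows "x \<in> unit_cube \<Longrightarrow> \<bar>g x - proj K is g x\<bar> \<le> sup_const (length is) * \<beta>"
proof (induction "is" arbitrary: x)
  case (Cons i "is")
  have "\<bar>coord_op i (proj_ker K) (\<lambda>x. g x - proj K is g x) x\<bar> \<le> proj_const * (sup_const (length is) * \<beta>)"
    by (rule coord_op_kP_bound_cube[OF K bdd_borel_diff[OF g bdd_borel_proj[OF g]] Cons.IH Cons.prems])
  then have "\<bar>coord_op i (proj_ker K) g x - proj K (i # is) g x\<bar> \<le> proj_const * (sup_const (length is) * \<beta>)"
    by (simp add: coord_op_diff[OF bdd_ker_kP g bdd_borel_proj[OF g]])
  with \<beta>[OF Cons.prems, of i] have "\<bar>g x - proj K (i # is) g x\<bar> \<le> \<beta> + proj_const * (sup_const (length is) * \<beta>)"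
    by linarith
  then show ?case by (simp add: distrib_right mult.assoc)
qed simp

lemma proj_L2_error:
  fixes g :: "real ^ 'd::finite \<Rightarrow> real"
  assumes K: "K > 0" and g: "bdd_borel g"
    and \<beta>: "\<And>i. (\<integral>x. (g x - coord_op i (proj_ker K) g x)\<^sup>2 \<partial>unif) \<le> \<beta>"
  shows "(\<integral>x. (g x - proj K is g x)\<^sup>2 \<partial>unif) \<le> L2_const (length is) * \<beta>"
proof (induction "is")
  case (Cons i "is")
  define u where "u x = g x - coord_op i (proj_ker K) g x" for x
  define v where "v = coord_op i (proj_ker K) (\<lambda>x. g x - proj K is g x)"
  have bv: "bdd_borel v" unfolding v_def by (intro bdd_borel_op bdd_ker_kP bdd_borel_diff g bdd_borel_proj)
  have bu: "bdd_borel u" unfolding u_def[abs_def] by (intro bdd_borel_op bdd_ker_kP bdd_borel_diff g)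
  have sq: "integrable unif (\<lambda>x. (f x)\<^sup>2)" if "bdd_borel f" for f :: "real ^ 'd \<Rightarrow> real"
    unfolding power2_eq_square by (intro bdd_borel_integrable bdd_borel_mult that)
  have uv: "g x - proj K (i # is) g x = u x + v x" for x
    by (simp add: u_def v_def coord_op_diff[OF bdd_ker_kP g bdd_borel_proj[OF g]])
  have "(\<integral>x. (v x)\<^sup>2 \<partial>unif) \<le> proj_const\<^sup>2 * (\<integral>x. (g x - proj K is g x)\<^sup>2 \<partial>unif)"
    unfolding v_def by (rule coord_op_L2_bound[OF K bdd_ker_kP _ proj_ker_bound bdd_borel_diff[OF g bdd_borel_proj[OF g]]]) (use proj_const_pos in simp)
  also have "\<dots> \<le> proj_const\<^sup>2 * (L2_const (length is) * \<beta>)" by (rule mult_left_mono[OF Cons]) simp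
  finally have v2: "(\<integral>x. (v x)\<^sup>2 \<partial>unif) \<le> proj_const\<^sup>2 * (L2_const (length is) * \<beta>)" .
  have "(\<integral>x. (u x + v x)\<^sup>2 \<partial>unif) \<le> (\<integral>x. 2 * (u x)\<^sup>2 + 2 * (v x)\<^sup>2 \<partial>unif)"
  proof (rule integral_mono)
    show "(u x + v x)\<^sup>2 \<le> 2 * (u x)\<^sup>2 + 2 * (v x)\<^sup>2" for x
    proof -
      have "0 \<le> (u x - v x)\<^sup>2" by simp
      then show ?thesis unfolding power2_diff power2_sum by linarith
    qed
  qed (use sq[OF bu] sq[OF bv] sq[OF bdd_borel_add[OF bu bv]] in auto)
  also have "\<dots> = 2 * (\<integral>x. (u x)\<^sup>2 \<partial>unif) + 2 * (\<integral>x. (v x)\<^sup>2 \<partial>unif)"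
    using sq[OF bu] sq[OF bv] by simp
  also have "\<dots> \<le> 2 * \<beta> + 2 * (proj_const\<^sup>2 * (L2_const (length is) * \<beta>))"
    using \<beta>[of i] v2 unfolding u_def by (intro add_mono mult_left_mono) auto
  finally show ?case unfolding uv by (simp add: distrib_right mult.assoc)
qed simp

section \<open>The rank of the product of all coordinate projections\<close>

definition idx :: "nat \<Rightarrow> (nat \<times> nat) set" where
  "idx K = {..<K} \<times> {..s}"

text \<open>A letter (c, j) stands for the j-th local monomial on cell c in one coordinate; a word
  selects one such monomial for every processed coordinate.\<close>

definition words :: "nat \<Rightarrow> nat \<Rightarrow> (nat \<times> nat) list set" where
  "words K n = {w. set w \<subseteq> idx K \<and> length w = n}"

lemma finite_words: "finite (words K n)"
  unfolding words_def by (rule finite_lists_length_eq) (simp add: idx_def)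

lemma card_words: "card (words K n) = (K * Suc s) ^ n"
  unfolding words_def by (subst card_lists_length_eq) (simp_all add: idx_def)

lemma words_Suc: "words K (Suc n) = (\<lambda>(k, w). k # w) ` (idx K \<times> words K n)"
  by (auto simp: words_def length_Suc_conv image_iff)

text \<open>Induction with separated variables: \<open>a w\<close> depends only on processed
  coordinates and \<open>b w y\<close> only on the others. In the next coordinate the integral
  therefore acts on \<open>b\<close> alone. The functions \<open>a w\<close> are the same for all y,
  which is what bounds the rank.\<close>

lemma proj_finite_rank:
  fixes F :: "'y \<Rightarrow> real ^ 'd::finite \<Rightarrow> real"
  assumes K: "K > 0" and F: "\<And>y. bdd_borel (F y)" and "distinct is"
  shows "\<exists>a b. (\<forall>x\<in>unit_cube. \<forall>y. proj K is (F y) x = (\<Sum>w\<in>words K (length is). a w x * b w y x)) \<and>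
     (\<forall>w i t x. i \<notin> set is \<longrightarrow> a w (upd x i t) = a w x) \<and>
     (\<forall>w i t x y. i \<in> set is \<longrightarrow> b w y (upd x i t) = b w y x) \<and> (\<forall>w y. bdd_borel (b w y))"
  using \<open>distinct is\<close>
proof (induction "is")
  case Nil
  have "words K 0 = {[]}" by (auto simp: words_def)
  then show ?case
    by (intro exI[of _ "\<lambda>w x. 1 :: real"] exI[of _ "\<lambda>w y x. F y x"]) (simp add: F)
next
  case (Cons i "is")
  then obtain a b where
    eq: "\<And>x y. x \<in> unit_cube \<Longrightarrow> proj K is (F y) x = (\<Sum>w\<in>words K (length is). a w x * b w y x)"
    and a: "\<And>w j t x. j \<notin> set is \<Longrightarrow> a w (upd x j t) = a w x"
    and b: "\<And>w j t x y. j \<in> set is \<Longrightarrow> b w y (upd x j t) = b w y x" "\<And>w y. bdd_borel (b w y)"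
    by auto
  have i: "i \<notin> set is" using Cons.prems by simp
  define A where "A k u = (if \<lfloor>real K * u\<rfloor> = int (fst k) then (real K * u - real (fst k)) ^ snd k else 0)" for k u
  define B where "B k t = (if snd k \<le> s then real K * \<eta> (snd k) (real K * t - real (fst k)) else 0)" for k t
  have Bm: "(\<lambda>(u :: real, t). B k t) \<in> borel_measurable (borel \<Otimes>\<^sub>M borel)" for k
  proof (cases "snd k \<le> s")
    case True
    have [measurable]: "\<eta> (snd k) \<in> borel_measurable borel" by (rule bump_fun_measurable[OF eta_cs[OF True]])
    show ?thesis using True unfolding B_def by simp
  next
    case False
    then show ?thesis unfolding B_def by simp
  qed
  have Bb: "bdd_ker (\<lambda>u t. B k t)" for k
  proof (rule bkerI[OF Bm])
    show "\<bar>B k t\<bar> \<le> real K * C\<eta>" for t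
      using eta_bound[of "snd k" "real K * t - real (fst k)"] C_eta_pos by (auto simp: B_def abs_mult intro!: mult_left_mono)
  qed
  have kPAB: "proj_ker K u t = (\<Sum>k\<in>idx K. A k u * B k t)" if u: "0 \<le> u" "u < 1" for u t
  proof -
    obtain c where c: "c < K" "\<lfloor>real K * u\<rfloor> = int c" using cell_exists[OF K u] .
    have "(\<Sum>k\<in>idx K. A k u * B k t) = (\<Sum>c'<K. \<Sum>j\<le>s. A (c', j) u * B (c', j) t)"
      unfolding idx_def by (simp add: sum.cartesian_product case_prod_unfold)
    also have "\<dots> = (\<Sum>c'<K. if c' = c then (\<Sum>j\<le>s. A (c, j) u * B (c, j) t) else 0)"
      by (intro sum.cong refl) (auto simp: A_def c(2))
    also have "\<dots> = (\<Sum>j\<le>s. A (c, j) u * B (c, j) t)" using c(1) by simp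
    also have "\<dots> = proj_ker K u t" unfolding proj_ker_eq[OF u c(2)] by (intro sum.cong) (auto simp: A_def B_def c(2))
    finally show ?thesis by simp
  qed
  define a' where "a' w x = A (hd w) (x $ i) * a (tl w) x" for w x
  define b' where "b' w y = coord_op i (\<lambda>u t. B (hd w) t) (b (tl w) y)" for w y
  have main: "proj K (i # is) (F y) x = (\<Sum>w\<in>words K (length (i # is)). a' w x * b' w y x)" if x: "x \<in> unit_cube" for x y
  proof -
    have u: "0 \<le> x $ i" "x $ i < 1" using x by (auto simp: unit_cube_def)
    let ?W = "words K (length is)"
    have I: "integrable unif (\<lambda>t. A k (x $ i) * a w x * (B k t * b w y (upd x i t)))" for k w
      by (intro bdd_borel_integrable bdd_borel_cmult bdd_borel_mult bdd_borel_ker[OF Bb] bdd_borel_slice b(2))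
    have "proj K (i # is) (F y) x = (\<integral>t. proj_ker K (x $ i) t * proj K is (F y) (upd x i t) \<partial>unif)"
      by (simp add: coord_op_def line_op_def)
    also have "\<dots> = (\<integral>t. (\<Sum>k\<in>idx K. \<Sum>w\<in>?W. A k (x $ i) * a w x * (B k t * b w y (upd x i t))) \<partial>unif)"
    proof (rule integral_cong_AE)
      show "AE t in unif. proj_ker K (x $ i) t * proj K is (F y) (upd x i t)
          = (\<Sum>k\<in>idx K. \<Sum>w\<in>?W. A k (x $ i) * a w x * (B k t * b w y (upd x i t)))"
        using AE_unif_box
      proof eventually_elim
        case (elim t)
        then have "upd x i t \<in> unit_cube" using x by (auto simp: unit_cube_def less_imp_le)
        then show ?case
          unfolding kPAB[OF u] eq[OF \<open>upd x i t \<in> unit_cube\<close>] sum_product a[OF i]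
          by (intro sum.cong refl) (simp only: ac_simps)
      qed
      show "(\<lambda>t. proj_ker K (x $ i) t * proj K is (F y) (upd x i t)) \<in> borel_measurable unif"
        using bdd_borel_measurable[OF bdd_borel_mult[OF bdd_borel_ker[OF bdd_ker_kP] bdd_borel_slice[OF bdd_borel_proj[OF F]]]] by simp
      show "(\<lambda>t. \<Sum>k\<in>idx K. \<Sum>w\<in>?W. A k (x $ i) * a w x * (B k t * b w y (upd x i t))) \<in> borel_measurable unif"
        using I by (intro borel_measurable_sum) (rule borel_measurable_integrable)
    qed
    also have "\<dots> = (\<Sum>k\<in>idx K. \<Sum>w\<in>?W. A k (x $ i) * a w x * (\<integral>t. B k t * b w y (upd x i t) \<partial>unif))"
      by (simp only: Bochner_Integration.integral_sum Bochner_Integration.integrable_sum I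
          Bochner_Integration.integral_mult_right_zero)
    also have "\<dots> = (\<Sum>k\<in>idx K. \<Sum>w\<in>?W. a' (k # w) x * b' (k # w) y x)"
      by (simp add: a'_def b'_def coord_op_def line_op_def)
    also have "\<dots> = (\<Sum>p\<in>idx K \<times> ?W. a' (fst p # snd p) x * b' (fst p # snd p) y x)"
      by (simp add: sum.cartesian_product case_prod_unfold)
    also have "\<dots> = (\<Sum>w\<in>words K (Suc (length is)). a' w x * b' w y x)"
      unfolding words_Suc
      by (subst sum.reindex) (auto simp: inj_on_def case_prod_unfold)
    finally show ?thesis by simp
  qed
  show ?case
  proof (intro exI[of _ a'] exI[of _ b'] conjI ballI allI impI)
    show "proj K (i # is) (F y) x = (\<Sum>w\<in>words K (length (i # is)). a' w x * b' w y x)" if "x \<in> unit_cube" for x y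
      by (rule main[OF that])
    show "a' w (upd x j t) = a' w x" if "j \<notin> set (i # is)" for w j t x
      using that a[of j] by (auto simp: a'_def)
    show "b' w y (upd x j t) = b' w y x" if "j \<in> set (i # is)" for w j t x y
    proof (cases "j = i")
      case True
      then show ?thesis by (simp add: b'_def coord_op_def line_op_def)
    next
      case False
      then have "j \<in> set is" using that by simp
      then have "b (tl w) y (upd (upd x j t) i r) = b (tl w) y (upd x i r)" for r
        unfolding upd_commute[OF False] by (rule b(1))
      then show ?thesis using False by (simp add: b'_def coord_op_def line_op_def)
    qed
    show "bdd_borel (b' w y)" for w y unfolding b'_def by (intro bdd_borel_op Bb b(2))
  qed
qed

lemma upd_invariant_const:
  fixes h :: "real ^ 'd::finite \<Rightarrow> real"
  assumes "\<And>x i t. h (upd x i t) = h x"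
  shows "h x = h z"
proof -
  have "h (\<chi> j. if j \<in> S then z $ j else x $ j) = h x" if "finite S" for S
    using that
  proof (induction S rule: finite_induct)
    case empty
    then show ?case by simp
  next
    case (insert i S)
    have "(\<chi> j. if j \<in> insert i S then z $ j else x $ j) = upd (\<chi> j. if j \<in> S then z $ j else x $ j) i (z $ i)"
      by (simp add: Finite_Cartesian_Product.vec_eq_iff)
    then show ?case using insert.IH assms by simp
  qed
  from this[of UNIV] show ?thesis by simp
qed

text \<open>Once all coordinates are processed, the coefficients no longer depend on x. The words
  number (K (s + 1))^d, and the sum is padded with zeros up to r.\<close>

lemma proj_rank:
  fixes F :: "'y \<Rightarrow> real ^ 'd::finite \<Rightarrow> real"
  assumes K: "K > 0" and F: "\<And>y. bdd_borel (F y)" and "distinct is" "set is = UNIV"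
    and r: "(K * Suc s) ^ CARD('d) \<le> r"
  shows "\<exists>a b. \<forall>x\<in>unit_cube. \<forall>y. proj K is (F y) x = (\<Sum>k<r. a k x * b k y)"
proof -
  have len: "length is = CARD('d)" using assms(3,4) distinct_card by fastforce
  let ?W = "words K (length is)"
  obtain a b where
    eq: "\<And>x y. x \<in> unit_cube \<Longrightarrow> proj K is (F y) x = (\<Sum>w\<in>?W. a w x * b w y x)"
    and b: "\<And>w j t x y. b w y (upd x j t) = b w y x"
    using proj_finite_rank[where F = F, OF K F assms(3)] assms(4) by auto
  have b0: "b w y x = b w y 0" for w y x by (rule upd_invariant_const) (rule b)
  obtain f where f: "bij_betw f {..<card ?W} ?W"
    using ex_bij_betw_nat_finite[OF finite_words, of K "length is"] by (auto simp: atLeast0LessThan)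
  have cW: "card ?W \<le> r" using r by (simp add: card_words len)
  have "proj K is (F y) x = (\<Sum>k<r. (if k < card ?W then a (f k) x else 0) * b (f k) y 0)" if "x \<in> unit_cube" for x y
  proof -
    have "proj K is (F y) x = (\<Sum>w\<in>?W. a w x * b w y 0)" unfolding eq[OF that] using b0 by (intro sum.cong) auto
    also have "\<dots> = (\<Sum>k<card ?W. a (f k) x * b (f k) y 0)"
      by (rule sum.reindex_bij_betw[OF f, symmetric])
    also have "\<dots> = (\<Sum>k<r. (if k < card ?W then a (f k) x else 0) * b (f k) y 0)"
      using cW by (intro sum.mono_neutral_cong_left) auto
    finally show ?thesis .
  qed
  then show ?thesis by (intro exI[of _ "\<lambda>k x. if k < card ?W then a (f k) x else 0"] exI[of _ "\<lambda>k y. b (f k) y 0"]) blast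
qed

end

section \<open>Sampling\<close>

lemma unit_cube_borel [measurable]: "(unit_cube :: (real ^ 'd::finite) set) \<in> sets borel"
proof -
  have "Measurable.pred borel (\<lambda>x :: real ^ 'd. \<forall>i. 0 \<le> x $ i \<and> x $ i < 1)" by measurable
  then show ?thesis unfolding unit_cube_def by (simp add: pred_def)
qed

text \<open>The integral of a non-integrable function has the value 0, so for non-negative summands
  such terms can only lower the left side. The eigenvalues, as functions of the sample, thus enter
  through an integrable majorant alone.\<close>

lemma sum_integral_le_integral:
  fixes T :: "'i \<Rightarrow> 'a \<Rightarrow> real"
  assumes I: "finite I" and H: "integrable M H" and T: "\<And>i x. 0 \<le> T i x"
    and le: "\<And>x. x \<in> space M \<Longrightarrow> (\<Sum>i\<in>I. T i x) \<le> H x"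
  shows "(\<Sum>i\<in>I. \<integral>x. T i x \<partial>M) \<le> (\<integral>x. H x \<partial>M)"
proof -
  define J where "J = {i \<in> I. integrable M (T i)}"
  have J: "J \<subseteq> I" "\<And>i. i \<in> J \<Longrightarrow> integrable M (T i)" by (auto simp: J_def)
  have "(\<Sum>i\<in>I. \<integral>x. T i x \<partial>M) = (\<Sum>i\<in>J. \<integral>x. T i x \<partial>M)"
    using I J(1) by (intro sum.mono_neutral_right) (auto simp: J_def not_integrable_integral_eq)
  also have "\<dots> = (\<integral>x. (\<Sum>i\<in>J. T i x) \<partial>M)"
    using J by (intro Bochner_Integration.integral_sum[symmetric])
  also have "\<dots> \<le> (\<integral>x. H x \<partial>M)"
  proof (rule integral_mono)
    show "integrable M (\<lambda>x. \<Sum>i\<in>J. T i x)" using J by (intro Bochner_Integration.integrable_sum)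
    show "(\<Sum>i\<in>J. T i x) \<le> H x" if "x \<in> space M" for x
      using sum_mono2[OF I J(1), of "\<lambda>i. T i x"] T le[OF that] by force
  qed (rule H)
  finally show ?thesis .
qed

lemma cube_distribution_space:
  "cube_distribution \<mu> \<Longrightarrow> space \<mu> = (unit_cube :: (real ^ 'd::finite) set)"
  using sets_eq_imp_space_eq[of \<mu> "restrict_space borel unit_cube"]
  by (simp add: cube_distribution_def space_restrict_space)

text \<open>The half-open and the open cube differ by a null set.\<close>

lemma unif_eq_restrict_lborel:
  assumes A: "A \<in> sets borel"
  shows "emeasure (restrict_space lborel unit_cube) (A \<inter> unit_cube) = emeasure (unif :: (real ^ 'd::finite) measure) A"
proof -
  let ?c = "unit_cube :: (real ^ 'd) set"
  have One0: "0 \<le> (1::real)" by simp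
  have sub: "?c - box 0 One \<subseteq> cbox 0 One - box 0 One"
    by (auto simp: unit_cube_def mem_box_cart sum_Basis_vec_nth less_imp_le)
  have bc: "box 0 One \<subseteq> (cbox 0 One :: (real ^ 'd) set)" by (rule box_subset_cbox)
  have "emeasure lborel (cbox 0 One - box 0 One :: (real ^ 'd) set) = emeasure lborel (cbox 0 One :: (real ^ 'd) set) - emeasure lborel (box 0 One :: (real ^ 'd) set)"
    by (rule emeasure_Diff) (use bc in \<open>auto simp: emeasure_lborel_box_eq\<close>)
  also have "\<dots> = 0" by (simp add: emeasure_lborel_box_eq emeasure_lborel_cbox_eq)
  finally have "cbox 0 One - box 0 One \<in> null_sets (lborel :: (real ^ 'd) measure)" by auto
  then have n: "?c - box 0 One \<in> null_sets lborel"
    by (rule null_sets_subset) (use sub in auto)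
  have "emeasure (restrict_space lborel ?c) (A \<inter> ?c) = emeasure lborel (A \<inter> ?c)"
    by (rule emeasure_restrict_space) auto
  also have "\<dots> = emeasure lborel (A \<inter> box 0 One)"
  proof -
    have "A \<inter> ?c = (A \<inter> box 0 One) \<union> (A \<inter> (?c - box 0 One))"
      using box_subset_unit_cube by auto
    then show ?thesis
      using A by (simp only:) (intro emeasure_Un_null_set null_set_Int1 n, auto)
  qed
  also have "\<dots> = (\<integral>\<^sup>+x. indicator (A \<inter> box 0 One) x \<partial>lborel)"
    using A by (intro nn_integral_indicator[symmetric]) auto
  also have "\<dots> = (\<integral>\<^sup>+x. ennreal (indicator (box 0 One) x) * indicator A x \<partial>lborel)"
    by (intro nn_integral_cong) (auto split: split_indicator)
  also have "\<dots> = emeasure unif A"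
    unfolding unif_def using A by (subst emeasure_density) auto
  finally show ?thesis .
qed

text \<open>Two distinct sample points are independent and uniform. The pair is listed as (x j, x i)
  because the error takes the second argument of the graphon first.\<close>

lemma distr_pair_PiM_unif:
  fixes i j n :: nat
  assumes \<mu>: "prob_space (restrict_space lborel (unit_cube :: (real ^ 'd::finite) set))" and ij: "i < n" "j < n" "i \<noteq> j"
  defines "M \<equiv> Pi\<^sub>M {..<n} (\<lambda>_. restrict_space lborel (unit_cube :: (real ^ 'd) set))"
  shows "distr M (borel \<Otimes>\<^sub>M borel) (\<lambda>x. (x j, x i)) = unif \<Otimes>\<^sub>M (unif :: (real ^ 'd) measure)"
    "(\<lambda>x. (x j, x i)) \<in> M \<rightarrow>\<^sub>M borel \<Otimes>\<^sub>M borel"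
proof -
  let ?c = "unit_cube :: (real ^ 'd) set"
  let ?\<mu> = "restrict_space lborel ?c"
  have sp: "space ?\<mu> = ?c" by (simp add: space_restrict_space)
  interpret \<mu>: prob_space ?\<mu> by (rule \<mu>)
  interpret P: product_prob_space "\<lambda>_ :: nat. ?\<mu>" "{..<n}" by unfold_locales
  have comp: "(\<lambda>x. x k) \<in> M \<rightarrow>\<^sub>M borel" if "k < n" for k
  proof -
    have "(\<lambda>x. x k) \<in> M \<rightarrow>\<^sub>M ?\<mu>" unfolding M_def using that by (intro measurable_component_singleton) simp
    moreover have "(\<lambda>x. x) \<in> ?\<mu> \<rightarrow>\<^sub>M borel" by (rule measurable_restrict_space1) simp
    ultimately show ?thesis by (rule measurable_compose)
  qed
  show meas: "(\<lambda>x. (x j, x i)) \<in> M \<rightarrow>\<^sub>M borel \<Otimes>\<^sub>M borel"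
    by (intro measurable_Pair comp ij)
  show "distr M (borel \<Otimes>\<^sub>M borel) (\<lambda>x. (x j, x i)) = unif \<Otimes>\<^sub>M (unif :: (real ^ 'd) measure)"
  proof (rule pair_measure_eqI[symmetric])
    show "sigma_finite_measure (unif :: (real ^ 'd) measure)" "sigma_finite_measure (unif :: (real ^ 'd) measure)"
      by (rule unif.sigma_finite_measure_axioms)+
    show "sets (unif \<Otimes>\<^sub>M (unif :: (real ^ 'd) measure)) = sets (distr M (borel \<Otimes>\<^sub>M borel) (\<lambda>x. (x j, x i)))"
      by (simp cong: sets_pair_measure_cong)
    fix A B :: "(real ^ 'd) set"
    assume "A \<in> sets unif" "B \<in> sets unif"
    then have AB: "A \<in> sets borel" "B \<in> sets borel" by auto
    define E where "E k = (if k = j then A \<inter> ?c else if k = i then B \<inter> ?c else ?c)" for k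
    have Es: "E k \<in> sets ?\<mu>" for k
      using AB unfolding E_def by (auto simp: sets_restrict_space)
    have "emeasure (distr M (borel \<Otimes>\<^sub>M borel) (\<lambda>x. (x j, x i))) (A \<times> B) = emeasure M ((\<lambda>x. (x j, x i)) -` (A \<times> B) \<inter> space M)"
      using AB by (intro emeasure_distr meas) auto
    also have "(\<lambda>x. (x j, x i)) -` (A \<times> B) \<inter> space M = PiE {..<n} E"
    proof (intro equalityI subsetI)
      fix x assume x: "x \<in> (\<lambda>x. (x j, x i)) -` (A \<times> B) \<inter> space M"
      then have xs: "x \<in> extensional {..<n}" "\<And>k. k < n \<Longrightarrow> x k \<in> ?c"
        by (auto simp: M_def space_PiM sp PiE_iff)
      have "x k \<in> E k" if "k < n" for k using x xs(2)[OF that] by (auto simp: E_def)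
      then show "x \<in> PiE {..<n} E" using xs(1) by (simp add: PiE_iff)
    next
      fix x assume x: "x \<in> PiE {..<n} E"
      then have xE: "x k \<in> E k" if "k < n" for k using that by (simp add: PiE_iff)
      have "E k \<subseteq> ?c" for k by (simp add: E_def)
      then have "x \<in> space M" using x unfolding M_def space_PiM sp PiE_iff by blast
      moreover have "x j \<in> A" "x i \<in> B" using xE[OF ij(1)] xE[OF ij(2)] ij(3) by (simp_all add: E_def)
      ultimately show "x \<in> (\<lambda>x. (x j, x i)) -` (A \<times> B) \<inter> space M" by simp
    qed
    also have "emeasure M (PiE {..<n} E) = (\<Prod>k<n. emeasure ?\<mu> (E k))"
      unfolding M_def by (rule P.emeasure_PiM) (use Es in auto)
    also have "\<dots> = emeasure ?\<mu> (E j) * (emeasure ?\<mu> (E i) * (\<Prod>k\<in>{..<n} - {j} - {i}. emeasure ?\<mu> (E k)))"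
      using ij by (simp add: prod.remove[of "{..<n}" j] prod.remove[of "{..<n} - {j}" i])
    also have "(\<Prod>k\<in>{..<n} - {j} - {i}. emeasure ?\<mu> (E k)) = 1"
      using \<mu>.emeasure_space_1 by (intro prod.neutral) (auto simp: E_def sp)
    finally have "emeasure (distr M (borel \<Otimes>\<^sub>M borel) (\<lambda>x. (x j, x i))) (A \<times> B) = emeasure ?\<mu> (A \<inter> ?c) * emeasure ?\<mu> (B \<inter> ?c)"
      using ij by (simp add: E_def)
    then show "emeasure unif A * emeasure unif B = emeasure (distr M (borel \<Otimes>\<^sub>M borel) (\<lambda>x. (x j, x i))) (A \<times> B)"
      by (simp only: unif_eq_restrict_lborel AB)
  qed
qed

text \<open>The order y, x makes \<open>cube_kernel f y\<close> the section to which projections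
  apply. The extension by 0 is bounded and Borel on the whole space, whereas a graphon is controlled
  on the cube only.\<close>

definition cube_kernel :: "(real ^ 'd \<Rightarrow> real ^ 'd \<Rightarrow> real) \<Rightarrow> real ^ 'd \<Rightarrow> real ^ 'd \<Rightarrow> real" where
  "cube_kernel f y x = (if y \<in> unit_cube \<and> x \<in> unit_cube then f x y else 0)"

lemma cube_kernel_measurable:
  fixes f :: "real ^ 'd::finite \<Rightarrow> real ^ 'd \<Rightarrow> real"
  assumes "graphon f"
  shows "(\<lambda>(y, x). cube_kernel f y x) \<in> borel_measurable (borel \<Otimes>\<^sub>M borel)"
proof -
  let ?c = "unit_cube :: (real ^ 'd) set"
  let ?R = "restrict_space (borel \<Otimes>\<^sub>M borel) {p :: (real ^ 'd) \<times> (real ^ 'd). fst p \<in> ?c \<and> snd p \<in> ?c}"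
  have fm: "(\<lambda>(x, y). f x y) \<in> borel_measurable (restrict_space borel ?c \<Otimes>\<^sub>M restrict_space borel ?c)"
    using assms by (simp add: graphon_def)
  have "(\<lambda>p. (snd p, fst p)) \<in> ?R \<rightarrow>\<^sub>M restrict_space borel ?c \<Otimes>\<^sub>M restrict_space borel ?c"
  proof (rule measurable_Pair)
    show "snd \<in> ?R \<rightarrow>\<^sub>M restrict_space borel ?c"
      by (rule measurable_restrict_space2) (auto simp: space_restrict_space intro!: measurable_restrict_space1)
    show "fst \<in> ?R \<rightarrow>\<^sub>M restrict_space borel ?c"
      by (rule measurable_restrict_space2) (auto simp: space_restrict_space intro!: measurable_restrict_space1)
  qed
  from measurable_compose[OF this fm]
  have 1: "(\<lambda>p. f (snd p) (fst p)) \<in> borel_measurable ?R" by simp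
  have "(\<lambda>p. if fst p \<in> ?c \<and> snd p \<in> ?c then f (snd p) (fst p) else 0) \<in> borel_measurable (borel \<Otimes>\<^sub>M borel)"
    by (subst measurable_If_restrict_space_iff) (use 1 in auto)
  then show ?thesis by (simp add: cube_kernel_def case_prod_unfold)
qed

lemma bdd_borel_cube_kernel:
  fixes f :: "real ^ 'd::finite \<Rightarrow> real ^ 'd \<Rightarrow> real"
  assumes "graphon f"
  shows "bdd_borel (cube_kernel f y)"
proof (rule bbI)
  have "(\<lambda>x. (y, x)) \<in> borel \<rightarrow>\<^sub>M borel \<Otimes>\<^sub>M borel" by simp
  from measurable_compose[OF this cube_kernel_measurable[OF assms]]
  show "cube_kernel f y \<in> borel_measurable borel" by simp
  show "\<bar>cube_kernel f y x\<bar> \<le> 1" for x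
    using assms by (auto simp: graphon_def cube_kernel_def)
qed

section \<open>From the approximation error to expected eigenvalue tails\<close>

context dual_functions
begin

context
  fixes f :: "real ^ 'd::finite \<Rightarrow> real ^ 'd \<Rightarrow> real" and ds :: "'d list" and K :: nat
  assumes f: "graphon f" and ds: "distinct ds" "set ds = UNIV" and K: "K > 0"
begin

definition approx_error :: "real ^ 'd \<Rightarrow> real ^ 'd \<Rightarrow> real" where
  "approx_error y x = cube_kernel f y x - proj K ds (cube_kernel f y) x"

lemma length_ds: "length ds = CARD('d)"
  using ds distinct_card by fastforce

lemma proj_kernel_bound: "x \<in> unit_cube \<Longrightarrow> \<bar>proj K ds (cube_kernel f y) x\<bar> \<le> proj_const ^ CARD('d)"
  using proj_bound[OF K bdd_borel_cube_kernel[OF f], of y 1 x ds] f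
  by (auto simp: length_ds cube_kernel_def graphon_def)

text \<open>On the diagonal the matrix is 0 and not the value of the graphon, so only the bound for
  the approximation itself is available there. These n entries are the source of the term of order
  1/n.\<close>

lemma tail_le_approx_error:
  assumes r: "(K * Suc s) ^ CARD('d) \<le> r" "r \<le> n" and x: "\<And>i. i < n \<Longrightarrow> x i \<in> unit_cube"
  shows "(\<Sum>i=r+1..n. (nth_eigenvalue (graphon_matrix f n x) i)\<^sup>2)
    \<le> real n * proj_const ^ (2 * CARD('d)) + (\<Sum>i<n. \<Sum>j\<in>{..<n} - {i}. (approx_error (x j) (x i))\<^sup>2)"
proof -
  obtain a b where ab: "\<And>x y. x \<in> unit_cube \<Longrightarrow> proj K ds (cube_kernel f y) x = (\<Sum>k<r. a k x * b k y)"
    using proj_rank[where F = "cube_kernel f", OF K bdd_borel_cube_kernel[OF f] ds r(1)] by blast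
  define M where "M i j = (if i = j then 0 else f (x i) (x j))" for i j
  define B where "B i j = proj K ds (cube_kernel f (x j)) (x i)" for i j
  have fs: "f (x i) (x j) = f (x j) (x i)" if "i < n" "j < n" for i j
    using f x[OF that(1)] x[OF that(2)] unfolding graphon_def by blast
  have gm: "graphon_matrix f n x = Matrix.mat n n (\<lambda>(i, j). M i j)"
    by (simp add: graphon_matrix_def M_def)
  have "(\<Sum>i=r+1..n. (nth_eigenvalue (graphon_matrix f n x) i)\<^sup>2) \<le> (\<Sum>i<n. \<Sum>j<n. (M i j - B i j)\<^sup>2)"
    unfolding gm
  proof (rule eigenvalues_abs_desc_tail_le[where a = "\<lambda>k i. a k (x i)" and b = "\<lambda>k j. b k (x j)"])
    show "M i j = M j i" if "i < n" "j < n" for i j using fs[OF that] by (simp add: M_def)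
    show "B i j = (\<Sum>k<r. a k (x i) * b k (x j))" if "i < n" "j < n" for i j
      unfolding B_def by (rule ab[OF x[OF that(1)]])
  qed (rule r(2))
  also have "\<dots> \<le> (\<Sum>i<n. proj_const ^ (2 * CARD('d)) + (\<Sum>j\<in>{..<n} - {i}. (approx_error (x j) (x i))\<^sup>2))"
  proof (rule sum_mono)
    fix i assume "i \<in> {..<n}"
    then have i: "i < n" by simp
    have "(\<Sum>j<n. (M i j - B i j)\<^sup>2) = (M i i - B i i)\<^sup>2 + (\<Sum>j\<in>{..<n} - {i}. (M i j - B i j)\<^sup>2)"
      using i by (intro sum.remove) auto
    also have "(\<Sum>j\<in>{..<n} - {i}. (M i j - B i j)\<^sup>2) = (\<Sum>j\<in>{..<n} - {i}. (approx_error (x j) (x i))\<^sup>2)"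
      using x i by (intro sum.cong refl) (auto simp: M_def B_def approx_error_def cube_kernel_def)
    also have "(M i i - B i i)\<^sup>2 \<le> proj_const ^ (2 * CARD('d))"
    proof -
      have "\<bar>B i i\<bar> ^ 2 \<le> (proj_const ^ CARD('d)) ^ 2"
        unfolding B_def by (intro power_mono proj_kernel_bound x i) auto
      then show ?thesis by (simp add: M_def power_mult[symmetric] mult.commute)
    qed
    finally show "(\<Sum>j<n. (M i j - B i j)\<^sup>2) \<le> proj_const ^ (2 * CARD('d)) + (\<Sum>j\<in>{..<n} - {i}. (approx_error (x j) (x i))\<^sup>2)"
      by simp
  qed
  also have "\<dots> = real n * proj_const ^ (2 * CARD('d)) + (\<Sum>i<n. \<Sum>j\<in>{..<n} - {i}. (approx_error (x j) (x i))\<^sup>2)"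
    by (simp add: sum.distrib)
  finally show ?thesis .
qed

lemma approx_error_bound: "x \<in> unit_cube \<Longrightarrow> \<bar>approx_error y x\<bar> \<le> 1 + proj_const ^ CARD('d)"
  using proj_kernel_bound[of x y] f unfolding approx_error_def graphon_def cube_kernel_def
  by (auto split: if_splits) (smt (verit))+

lemma approx_error_measurable:
  "(\<lambda>(y, x). approx_error y x) \<in> borel_measurable (borel \<Otimes>\<^sub>M borel)"
  using cube_kernel_measurable[OF f] proj_measurable[OF cube_kernel_measurable[OF f]]
  unfolding approx_error_def case_prod_unfold by (rule borel_measurable_diff)

lemma approx_error_holder:
  assumes \<alpha>: "\<alpha> > 0" and s: "s = strict_floor \<alpha>" and L: "L > 0" and h: "holder_condition \<alpha> L f"
    and y: "y \<in> unit_cube" and x: "x \<in> unit_cube"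
  shows "\<bar>approx_error y x\<bar> \<le> sup_const CARD('d) * ((1 + proj_const) * (fact s * L)) * real K powr (- \<alpha>)"
proof -
  have "\<bar>cube_kernel f y x - proj K ds (cube_kernel f y) x\<bar>
     \<le> sup_const (length ds) * ((1 + proj_const) * (fact s * L * real K powr (- \<alpha>)))"
  proof (rule proj_sup_error[OF K bdd_borel_cube_kernel[OF f] _ x])
    have g: "(\<lambda>x. f x y) \<in> holder_class \<alpha> L" using h y by (simp add: holder_condition_def)
    show "\<bar>cube_kernel f y z - coord_op i (proj_ker K) (cube_kernel f y) z\<bar> \<le> (1 + proj_const) * (fact s * L * real K powr (- \<alpha>))"
      if "z \<in> unit_cube" for i z
      by (rule holder_coordinate[OF \<alpha> s K L g bdd_borel_cube_kernel[OF f] _ that]) (simp add: cube_kernel_def y)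
  qed
  then show ?thesis by (simp add: approx_error_def length_ds mult.assoc)
qed

text \<open>The squared error J y for fixed y is at most k * (l y)^2 and is Borel in y. Division by
  k, which is positive because the dimension is at least 1, compares it directly with the integral
  of the squared function l.\<close>

lemma approx_error_sobolev:
  assumes \<alpha>: "\<alpha> > 0" and s: "s = strict_floor \<alpha>" and h: "sobolev_condition \<alpha> L \<mu> f"
  defines "Q \<equiv> L2_const CARD('d) * ((2 + 2 * proj_const\<^sup>2) * real CARD('d) powr (2 * (\<alpha> - real s) + real CARD('d)))"
  shows "(\<integral>y. (\<integral>x. (approx_error y x)\<^sup>2 \<partial>unif) \<partial>unif) \<le> Q * L\<^sup>2 * real K powr (- 2 * \<alpha>)"
proof -
  obtain l where l: "(\<integral>\<^sup>+ y\<in>unit_cube. ennreal ((l y)\<^sup>2) \<partial>lebesgue) \<le> ennreal (L\<^sup>2)"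
    and g: "\<And>y. y \<in> unit_cube \<Longrightarrow> (\<lambda>x. f x y) \<in> sobolev_class \<alpha> (l y)"
    using h unfolding sobolev_condition_def by blast
  have "L2_const n \<ge> 0" for n by (induction n) auto
  moreover have "CARD('d) > 0" by simp
  then obtain d' where "CARD('d) = Suc d'" using gr0_implies_Suc by blast
  ultimately have L2p: "L2_const CARD('d) > 0" by (simp add: add_pos_nonneg)
  have Q: "Q > 0" unfolding Q_def using L2p by (intro mult_pos_pos) (auto simp: add_pos_nonneg)
  define k where "k = Q * real K powr (- 2 * \<alpha>)"
  have k: "k > 0" unfolding k_def using Q K by simp
  define J where "J y = (\<integral>x. (approx_error y x)\<^sup>2 \<partial>unif)" for y
  have J0: "J y \<ge> 0" for y unfolding J_def by simp
  have Jm: "J \<in> borel_measurable borel"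
  proof -
    have "(\<lambda>p. (approx_error (fst p) (snd p))\<^sup>2) \<in> borel_measurable (borel \<Otimes>\<^sub>M unif)"
      using approx_error_measurable by (simp add: case_prod_unfold cong: measurable_cong_sets sets_pair_measure_cong)
    then show ?thesis
      using unif.borel_measurable_lebesgue_integral[of "\<lambda>y x. (approx_error y x)\<^sup>2" borel]
      unfolding J_def by (simp add: case_prod_unfold)
  qed
  have le: "J y \<le> k * (l y)\<^sup>2" if y: "y \<in> unit_cube" for y
  proof -
    have "J y \<le> L2_const (length ds) * ((2 + 2 * proj_const\<^sup>2) * real CARD('d) powr (2 * (\<alpha> - real s) + real CARD('d)) * real K powr (- 2 * \<alpha>) * (l y)\<^sup>2)"
      unfolding J_def approx_error_def
    proof (rule proj_L2_error[OF K bdd_borel_cube_kernel[OF f]])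
      show "(\<integral>x. (cube_kernel f y x - coord_op i (proj_ker K) (cube_kernel f y) x)\<^sup>2 \<partial>unif)
        \<le> (2 + 2 * proj_const\<^sup>2) * real CARD('d) powr (2 * (\<alpha> - real s) + real CARD('d)) * real K powr (- 2 * \<alpha>) * (l y)\<^sup>2" for i
        by (rule sobolev_coordinate[OF \<alpha> s K g[OF y] bdd_borel_cube_kernel[OF f]])
          (use box_subset_unit_cube y in \<open>auto simp: cube_kernel_def\<close>)
    qed
    then show ?thesis unfolding k_def Q_def length_ds by (simp only: mult.assoc)
  qed
  have "(\<integral>\<^sup>+y. ennreal (J y / k) \<partial>unif) \<le> (\<integral>\<^sup>+ y\<in>unit_cube. ennreal ((l y)\<^sup>2) \<partial>lebesgue)"
  proof (rule nn_integral_unif_le_lebesgue)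
    show "(\<lambda>y. ennreal (J y / k)) \<in> borel_measurable borel" using Jm by simp
    show "AE y in lebesgue. y \<in> box 0 One \<longrightarrow> ennreal (J y / k) \<le> ennreal ((l y)\<^sup>2)"
    proof (rule AE_I2, intro impI ennreal_leI)
      fix y :: "real ^ 'd" assume "y \<in> box 0 One"
      then have "J y \<le> k * (l y)\<^sup>2" using box_subset_unit_cube le by blast
      then show "J y / k \<le> (l y)\<^sup>2" using k by (simp add: divide_le_eq mult.commute)
    qed
  qed
  then have *: "(\<integral>\<^sup>+y. ennreal (J y / k) \<partial>unif) \<le> ennreal (L\<^sup>2)" using l by (rule order.trans)
  have "(\<integral>y. J y / k \<partial>unif) \<le> L\<^sup>2"
    by (rule unif_integral_le(2)[OF _ _ _ *]) (use Jm J0 k in auto)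
  then show ?thesis using k unfolding J_def k_def by (simp add: divide_le_eq mult_ac)
qed

text \<open>Both conditions are brought to an integrable majorant \<open>H\<close> of the
  off-diagonal error: a constant under the Hoelder condition, and the error cut off to the cube
  under the Sobolev condition, where all pairs of distinct sample points have the same expectation.
  The constant \<open>c\<close> adds up the two cases.\<close>

lemma sum_eigenvalues_le:
  assumes \<alpha>: "\<alpha> > 0" and s: "s = strict_floor \<alpha>" and L: "L > 0"
    and \<mu>: "cube_distribution \<mu>" and cond: "holder_condition \<alpha> L f \<or> sobolev_condition \<alpha> L \<mu> f"
    and r: "(K * Suc s) ^ CARD('d) \<le> r" "r \<le> n"
  defines "c \<equiv> (sup_const CARD('d) * ((1 + proj_const) * (fact s * L)))\<^sup>2
      + L2_const CARD('d) * ((2 + 2 * proj_const\<^sup>2) * real CARD('d) powr (2 * (\<alpha> - real s) + real CARD('d))) * L\<^sup>2"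
  shows "(\<Sum>i=r+1..n. LINT x|Pi\<^sub>M {..<n} (\<lambda>_. \<mu>). (nth_eigenvalue (graphon_matrix f n x) i)\<^sup>2)
    \<le> real n * proj_const ^ (2 * CARD('d)) + (real n)\<^sup>2 * c * real K powr (- 2 * \<alpha>)"
proof -
  interpret \<mu>: prob_space \<mu> using \<mu> by (simp add: cube_distribution_def)
  let ?M = "Pi\<^sub>M {..<n} (\<lambda>_. \<mu>)"
  interpret P: prob_space ?M by (intro prob_space_PiM \<mu>.prob_space_axioms)
  have xs: "x i \<in> unit_cube" if "x \<in> space ?M" "i < n" for x i
    using that cube_distribution_space[OF \<mu>] by (auto simp: space_PiM)
  define q where "q = c * real K powr (- 2 * \<alpha>)"
  have L20: "L2_const n \<ge> 0" for n by (induction n) auto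
  have double_sum: "(\<Sum>i<n. \<Sum>j\<in>{..<n} - {i}. t) \<le> (real n)\<^sup>2 * t" if "t \<ge> 0" for t :: real
  proof -
    have "(\<Sum>i<n. \<Sum>j\<in>{..<n} - {i}. t) \<le> (\<Sum>i<n. \<Sum>j<n. t)"
      using that by (intro sum_mono sum_mono2) auto
    then show ?thesis by (simp add: power2_eq_square mult.assoc)
  qed
  have c0: "c \<ge> 0" unfolding c_def using L20[of "CARD('d)"] by (intro add_nonneg_nonneg mult_nonneg_nonneg) auto
  have q0: "q \<ge> 0" unfolding q_def using c0 by simp
  have K2: "(real K powr (- \<alpha>))\<^sup>2 = real K powr (- 2 * \<alpha>)"
    unfolding power2_eq_square by (simp add: powr_add[symmetric])
  have "\<exists>H. integrable ?M H \<and> (\<forall>x\<in>space ?M. (\<Sum>i<n. \<Sum>j\<in>{..<n} - {i}. (approx_error (x j) (x i))\<^sup>2) \<le> H x)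
      \<and> (\<integral>x. H x \<partial>?M) \<le> (real n)\<^sup>2 * q"
    using cond
  proof
    assume h: "holder_condition \<alpha> L f"
    define t where "t = (sup_const CARD('d) * ((1 + proj_const) * (fact s * L)) * real K powr (- \<alpha>))\<^sup>2"
    have "t = (sup_const CARD('d) * ((1 + proj_const) * (fact s * L)))\<^sup>2 * real K powr (- 2 * \<alpha>)"
      unfolding t_def power_mult_distrib[of "_ * _" "real K powr _"] K2 ..
    also have "\<dots> \<le> q" unfolding q_def c_def using L20[of "CARD('d)"]
      by (intro mult_right_mono) auto
    finally have tq: "t \<le> q" .
    have "(\<Sum>i<n. \<Sum>j\<in>{..<n} - {i}. (approx_error (x j) (x i))\<^sup>2) \<le> (real n)\<^sup>2 * q" if x: "x \<in> space ?M" for x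
    proof -
      have "(\<Sum>i<n. \<Sum>j\<in>{..<n} - {i}. (approx_error (x j) (x i))\<^sup>2) \<le> (\<Sum>i<n. \<Sum>j\<in>{..<n} - {i}. q)"
      proof (intro sum_mono)
        fix i j assume "i \<in> {..<n}" "j \<in> {..<n} - {i}"
        then have "\<bar>approx_error (x j) (x i)\<bar> \<le> sup_const CARD('d) * ((1 + proj_const) * (fact s * L)) * real K powr (- \<alpha>)"
          using xs[OF x] by (intro approx_error_holder \<alpha> s L h) auto
        then have "\<bar>approx_error (x j) (x i)\<bar>\<^sup>2 \<le> t" unfolding t_def by (intro power_mono) auto
        then show "(approx_error (x j) (x i))\<^sup>2 \<le> q" using tq by simp
      qed
      then show ?thesis using double_sum[OF q0] by linarith
    qed
    then show ?thesis by (intro exI[of _ "\<lambda>_. (real n)\<^sup>2 * q"]) (auto simp: P.prob_space)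
  next
    assume h: "sobolev_condition \<alpha> L \<mu> f"
    then have \<mu>e: "\<mu> = restrict_space lborel unit_cube" by (simp add: sobolev_condition_def)
    define t where "t = (\<integral>y. (\<integral>x. (approx_error y x)\<^sup>2 \<partial>unif) \<partial>unif)"
    have tq: "t \<le> q"
    proof -
      have "t \<le> L2_const CARD('d) * ((2 + 2 * proj_const\<^sup>2) * real CARD('d) powr (2 * (\<alpha> - real s) + real CARD('d))) * L\<^sup>2 * real K powr (- 2 * \<alpha>)"
        unfolding t_def by (rule approx_error_sobolev[OF \<alpha> s h])
      also have "\<dots> \<le> q" unfolding q_def c_def by (intro mult_right_mono) auto
      finally show ?thesis .
    qed
    \<comment> \<open>The error is bounded on the cube only; the cut-off makes its square bounded
      and hence integrable for the product measure.\<close>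
    define e2 where "e2 p = (approx_error (fst p) (snd p))\<^sup>2 * indicator (unit_cube \<times> unit_cube) p" for p
    have e2m: "e2 \<in> borel_measurable (borel \<Otimes>\<^sub>M borel)"
      using approx_error_measurable unfolding e2_def[abs_def] by (simp add: case_prod_unfold)
    have e2b: "\<bar>e2 p\<bar> \<le> (1 + proj_const ^ CARD('d))\<^sup>2" for p
    proof (cases "p \<in> unit_cube \<times> unit_cube")
      case True
      then have "\<bar>approx_error (fst p) (snd p)\<bar>\<^sup>2 \<le> (1 + proj_const ^ CARD('d))\<^sup>2"
        by (intro power_mono approx_error_bound) auto
      then show ?thesis using True by (simp add: e2_def)
    qed (simp add: e2_def)
    have e2i: "integrable (unif \<Otimes>\<^sub>M unif) e2"
      using e2m e2b by (intro unif_pair.P.integrable_const_bound[of _ "(1 + proj_const ^ CARD('d))\<^sup>2"])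
        (auto cong: measurable_cong_sets sets_pair_measure_cong)
    have pm: "prob_space (restrict_space lborel (unit_cube :: (real ^ 'd) set))"
      using \<mu>.prob_space_axioms by (simp add: \<mu>e)
    have ij: "integrable ?M (\<lambda>x. e2 (x j, x i)) \<and> (\<integral>x. e2 (x j, x i) \<partial>?M) = t" if "i < n" "j < n" "i \<noteq> j" for i j
    proof -
      note dm = distr_pair_PiM_unif[OF pm that, folded \<mu>e]
      have "integrable ?M (\<lambda>x. e2 (x j, x i))"
        using e2i integrable_distr_eq[OF dm(2) e2m] by (simp add: dm(1))
      moreover have "(\<integral>x. e2 (x j, x i) \<partial>?M) = (\<integral>p. e2 p \<partial>(unif \<Otimes>\<^sub>M unif))"
        using integral_distr[OF dm(2) e2m] by (simp add: dm(1))
      moreover have "(\<integral>p. e2 p \<partial>(unif \<Otimes>\<^sub>M unif)) = (\<integral>y. (\<integral>x. e2 (y, x) \<partial>unif) \<partial>unif)"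
        using unif_pair.integral_fst'[OF e2i] by simp
      moreover have "(\<integral>y. (\<integral>x. e2 (y, x) \<partial>unif) \<partial>unif) = t"
      proof -
        have m1: "(\<lambda>x. e2 (y, x)) \<in> borel_measurable borel" "(\<lambda>x. (approx_error y x)\<^sup>2) \<in> borel_measurable borel" for y
          using measurable_compose[OF _ e2m, of "\<lambda>x. (y, x)" borel] measurable_compose[OF _ approx_error_measurable, of "\<lambda>x. (y, x)" borel]
          by simp_all
        have in_eq: "(\<integral>x. e2 (y, x) \<partial>unif) = (\<integral>x. (approx_error y x)\<^sup>2 \<partial>unif)" if "y \<in> box 0 One" for y
        proof (rule integral_cong_AE)
          show "AE x in unif. e2 (y, x) = (approx_error y x)\<^sup>2"
            using AE_unif_box
          proof eventually_elim
            case (elim x)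
            then have "y \<in> unit_cube" "x \<in> unit_cube" using that box_subset_unit_cube by blast+
            then show ?case by (simp add: e2_def)
          qed
        qed (use m1 in simp_all)
        have "(\<lambda>p. (approx_error (fst p) (snd p))\<^sup>2) \<in> borel_measurable (borel \<Otimes>\<^sub>M unif)"
          using approx_error_measurable by (simp add: case_prod_unfold cong: measurable_cong_sets sets_pair_measure_cong)
        then have m2: "(\<lambda>y. \<integral>x. (approx_error y x)\<^sup>2 \<partial>unif) \<in> borel_measurable borel"
          using unif.borel_measurable_lebesgue_integral[of "\<lambda>y x. (approx_error y x)\<^sup>2" borel] by (simp add: case_prod_unfold)
        have "e2 \<in> borel_measurable (borel \<Otimes>\<^sub>M unif)"
          using e2m by (simp cong: measurable_cong_sets sets_pair_measure_cong)
        then have m3: "(\<lambda>y. \<integral>x. e2 (y, x) \<partial>unif) \<in> borel_measurable borel"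
          using unif.borel_measurable_lebesgue_integral[of "\<lambda>y x. e2 (y, x)" borel] by (simp add: case_prod_unfold)
        show ?thesis unfolding t_def
        proof (rule integral_cong_AE)
          show "AE y in unif. (\<integral>x. e2 (y, x) \<partial>unif) = (\<integral>x. (approx_error y x)\<^sup>2 \<partial>unif)"
            using AE_unif_box by eventually_elim (rule in_eq)
        qed (use m2 m3 in simp_all)
      qed
      ultimately show ?thesis by simp
    qed
    define H where "H x = (\<Sum>i<n. \<Sum>j\<in>{..<n} - {i}. e2 (x j, x i))" for x
    have Hi: "integrable ?M H" unfolding H_def
      using ij by (intro Bochner_Integration.integrable_sum) auto
    have "(\<integral>x. H x \<partial>?M) = (\<Sum>i<n. \<integral>x. (\<Sum>j\<in>{..<n} - {i}. e2 (x j, x i)) \<partial>?M)"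
      unfolding H_def using ij by (intro Bochner_Integration.integral_sum Bochner_Integration.integrable_sum) auto
    also have "\<dots> = (\<Sum>i<n. \<Sum>j\<in>{..<n} - {i}. \<integral>x. e2 (x j, x i) \<partial>?M)"
      using ij by (intro sum.cong refl Bochner_Integration.integral_sum) auto
    also have "\<dots> = (\<Sum>i<n. \<Sum>j\<in>{..<n} - {i}. t)"
      using ij by (intro sum.cong refl) auto
    also have "\<dots> \<le> (\<Sum>i<n. \<Sum>j\<in>{..<n} - {i}. q)" by (intro sum_mono tq)
    finally have "(\<integral>x. H x \<partial>?M) \<le> (real n)\<^sup>2 * q" using double_sum[OF q0] by linarith
    moreover have "(\<Sum>i<n. \<Sum>j\<in>{..<n} - {i}. (approx_error (x j) (x i))\<^sup>2) \<le> H x" if "x \<in> space ?M" for x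
      unfolding H_def using xs[OF that] by (intro sum_mono) (auto simp: e2_def)
    ultimately show ?thesis using Hi by blast
  qed
  then obtain H where H: "integrable ?M H"
    "\<And>x. x \<in> space ?M \<Longrightarrow> (\<Sum>i<n. \<Sum>j\<in>{..<n} - {i}. (approx_error (x j) (x i))\<^sup>2) \<le> H x"
    "(\<integral>x. H x \<partial>?M) \<le> (real n)\<^sup>2 * q" by blast
  have "(\<Sum>i=r+1..n. LINT x|?M. (nth_eigenvalue (graphon_matrix f n x) i)\<^sup>2)
      \<le> (\<integral>x. real n * proj_const ^ (2 * CARD('d)) + H x \<partial>?M)"
  proof (rule sum_integral_le_integral)
    show "integrable ?M (\<lambda>x. real n * proj_const ^ (2 * CARD('d)) + H x)" using H(1) by simp
    show "(\<Sum>i=r+1..n. (nth_eigenvalue (graphon_matrix f n x) i)\<^sup>2) \<le> real n * proj_const ^ (2 * CARD('d)) + H x"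
      if "x \<in> space ?M" for x
      using tail_le_approx_error[OF r, of x] xs[OF that] H(2)[OF that] by force
  qed auto
  also have "\<dots> = real n * proj_const ^ (2 * CARD('d)) + (\<integral>x. H x \<partial>?M)" using H(1) by (simp add: P.prob_space)
  also have "\<dots> \<le> real n * proj_const ^ (2 * CARD('d)) + (real n)\<^sup>2 * c * real K powr (- 2 * \<alpha>)"
    using H(3) by (simp add: q_def mult.assoc)
  finally show ?thesis .
qed

end

end

text \<open>Comparison with the zero matrix, whose rank is admissible for every r; all entries lie
  in [0,1]. This covers ranks too small for one cell per direction.\<close>

lemma sum_eigenvalues_trivial:
  assumes f: "graphon f" and \<mu>: "cube_distribution \<mu>" and r: "r \<le> n"
  shows "(\<Sum>i=r+1..n. LINT x|Pi\<^sub>M {..<n} (\<lambda>_. \<mu>). (nth_eigenvalue (graphon_matrix f n x) i)\<^sup>2) \<le> (real n)\<^sup>2"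
proof -
  interpret \<mu>: prob_space \<mu> using \<mu> by (simp add: cube_distribution_def)
  let ?M = "Pi\<^sub>M {..<n} (\<lambda>_. \<mu>)"
  interpret P: prob_space ?M by (intro prob_space_PiM \<mu>.prob_space_axioms)
  have "(\<Sum>i=r+1..n. LINT x|?M. (nth_eigenvalue (graphon_matrix f n x) i)\<^sup>2) \<le> (\<integral>x. (real n)\<^sup>2 \<partial>?M)"
  proof (rule sum_integral_le_integral)
    fix x assume x: "x \<in> space ?M"
    have xs: "x i \<in> unit_cube" if "i < n" for i
      using x that cube_distribution_space[OF \<mu>] by (auto simp: space_PiM)
    define M where "M i j = (if i = j then 0 else f (x i) (x j))" for i j
    have fs: "0 \<le> f (x i) (x j) \<and> f (x i) (x j) \<le> 1 \<and> f (x i) (x j) = f (x j) (x i)" if "i < n" "j < n" for i j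
      using f xs[OF that(1)] xs[OF that(2)] unfolding graphon_def by auto
    have gm: "graphon_matrix f n x = Matrix.mat n n (\<lambda>(i, j). M i j)"
      by (simp add: graphon_matrix_def M_def)
    have "(\<Sum>i=r+1..n. (nth_eigenvalue (graphon_matrix f n x) i)\<^sup>2) \<le> (\<Sum>i<n. \<Sum>j<n. (M i j - 0)\<^sup>2)"
      unfolding gm
    proof (rule eigenvalues_abs_desc_tail_le[where a = "\<lambda>k i. 0" and b = "\<lambda>k i. 0"])
      show "M i j = M j i" if "i < n" "j < n" for i j using fs[OF that] by (simp add: M_def)
    qed (use r in simp_all)
    also have "\<dots> \<le> (\<Sum>i<n. \<Sum>j<n. 1)"
      using fs by (intro sum_mono) (auto simp: M_def abs_square_le_1)
    also have "\<dots> = (real n)\<^sup>2" by (simp add: power2_eq_square)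
    finally show "(\<Sum>i=r+1..n. (nth_eigenvalue (graphon_matrix f n x) i)\<^sup>2) \<le> (real n)\<^sup>2" .
  qed auto
  then show ?thesis by (simp add: P.prob_space)
qed

theorem proposition1:
  fixes \<alpha> L :: real
  assumes "\<alpha> > 0" and "L > 0"
  shows "\<exists>C>0. \<forall>(f :: real ^ 'd::finite \<Rightarrow> real ^ 'd \<Rightarrow> real) \<mu> n r.
           graphon f \<longrightarrow> cube_distribution \<mu> \<longrightarrow>
           holder_condition \<alpha> L f \<or> sobolev_condition \<alpha> L \<mu> f \<longrightarrow>
           r < n \<longrightarrow>
           ereal (1 / (real n)\<^sup>2 *
             (\<Sum>i = r + 1..n. LINT x|Pi\<^sub>M {..<n} (\<lambda>_. \<mu>).
                (nth_eigenvalue (graphon_matrix f n x) i)\<^sup>2))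
           \<le> ereal C * (ereal (1 / real n) +
               (if r = 0 then \<infinity> else ereal (real r powr (- 2 * \<alpha> / real CARD('d)))))"
proof -
  define s where "s = strict_floor \<alpha>"
  obtain \<eta> C\<eta> where "dual_functions s \<eta> C\<eta>" using dual_functions_exist by blast
  then interpret dual_functions s \<eta> C\<eta> .
  obtain ds :: "'d list" where ds: "set ds = UNIV" "distinct ds" using finite_distinct_list[OF finite] by blast
  let ?d = "CARD('d)"
  have d: "real ?d > 0" by simp
  define c1 where "c1 = proj_const ^ (2 * ?d)"
  define c where "c = (sup_const ?d * ((1 + proj_const) * (fact s * L)))\<^sup>2
      + L2_const ?d * ((2 + 2 * proj_const\<^sup>2) * real ?d powr (2 * (\<alpha> - real s) + real ?d)) * L\<^sup>2"
  \<comment> \<open>The number K of cells per direction will be at least \<rho>/2 with \<rho> =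
    r^(1/d) / (s + 1); raised to the power -2 \<alpha>, this is \<open>c3\<close> times r^(-2
    \<alpha> / d).\<close>
  define c3 where "c3 = (2 * real (Suc s)) powr (2 * \<alpha>)"
  have L20: "L2_const n \<ge> 0" for n by (induction n) auto
  have c0: "c \<ge> 0" unfolding c_def using L20[of ?d] by (intro add_nonneg_nonneg mult_nonneg_nonneg) auto
  have c10: "c1 > 0" unfolding c1_def using proj_const_pos by simp
  have c30: "c3 > 0" unfolding c3_def by simp
  \<comment> \<open>The summand 1 added to \<open>c\<close> pays for the case \<rho> < 1, where the
    trivial bound 1 is compared with \<open>c3 * R\<close>.\<close>
  define C where "C = c1 + (c + 1) * c3"
  have C: "C > 0" unfolding C_def using c0 c10 c30 by (intro add_pos_nonneg) auto
  show ?thesis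
  proof (intro exI[of _ C] conjI C allI impI)
    fix f :: "real ^ 'd \<Rightarrow> real ^ 'd \<Rightarrow> real" and \<mu> and n r :: nat
    assume f: "graphon f" and \<mu>: "cube_distribution \<mu>"
      and cond: "holder_condition \<alpha> L f \<or> sobolev_condition \<alpha> L \<mu> f" and rn: "r < n"
    define S where "S = (\<Sum>i = r + 1..n. LINT x|Pi\<^sub>M {..<n} (\<lambda>_. \<mu>). (nth_eigenvalue (graphon_matrix f n x) i)\<^sup>2)"
    define R where "R = real r powr (- 2 * \<alpha> / real ?d)"
    have n: "real n > 0" using rn by simp
    show "ereal (1 / (real n)\<^sup>2 * (\<Sum>i = r + 1..n. LINT x|Pi\<^sub>M {..<n} (\<lambda>_. \<mu>). (nth_eigenvalue (graphon_matrix f n x) i)\<^sup>2))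
           \<le> ereal C * (ereal (1 / real n) + (if r = 0 then \<infinity> else ereal (real r powr (- 2 * \<alpha> / real ?d))))"
    proof (cases "r = 0")
      case True
      then show ?thesis using C by simp
    next
      case False
      then have r: "real r > 0" by simp
      \<comment> \<open>The solution of (\<rho> (s + 1))^d = r, that is, the largest real number of
        cells per direction compatible with rank r.\<close>
      define \<rho> where "\<rho> = real r powr (1 / real ?d) / real (Suc s)"
      have \<rho>0: "\<rho> > 0" unfolding \<rho>_def using r by simp
      have R\<rho>: "(\<rho> / 2) powr (- 2 * \<alpha>) = c3 * R"
      proof -
        have "\<rho> / 2 = real r powr (1 / real ?d) / (2 * real (Suc s))" by (simp add: \<rho>_def)
        then have "(\<rho> / 2) powr (- 2 * \<alpha>) = (real r powr (1 / real ?d)) powr (- 2 * \<alpha>) / (2 * real (Suc s)) powr (- 2 * \<alpha>)"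
          by (simp only: powr_divide)
        also have "(real r powr (1 / real ?d)) powr (- 2 * \<alpha>) = R"
          unfolding R_def powr_powr by simp
        also have "R / (2 * real (Suc s)) powr (- 2 * \<alpha>) = c3 * R"
          unfolding c3_def using powr_minus_divide[of "2 * real (Suc s)" "2 * \<alpha>"] by simp
        finally show ?thesis .
      qed
      have "1 / (real n)\<^sup>2 * S \<le> c1 * (1 / real n) + (c + 1) * (c3 * R)"
      proof (cases "\<rho> \<ge> 1")
        case True
        \<comment> \<open>Because \<rho> \<ge> 1, rounding down leaves at least one cell and loses
          at most a factor 2.\<close>
        define K where "K = nat \<lfloor>\<rho>\<rfloor>"
        have "1 \<le> \<lfloor>\<rho>\<rfloor>" using True by simp
        then have "real K = of_int \<lfloor>\<rho>\<rfloor>" "1 \<le> real_of_int \<lfloor>\<rho>\<rfloor>" by (simp_all add: K_def)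
        moreover have "of_int \<lfloor>\<rho>\<rfloor> \<le> \<rho>" "\<rho> < of_int \<lfloor>\<rho>\<rfloor> + 1" by linarith+
        ultimately have K: "K > 0" "real K \<le> \<rho>" "\<rho> / 2 \<le> real K" by linarith+
        have "real ((K * Suc s) ^ ?d) \<le> (\<rho> * real (Suc s)) ^ ?d"
          unfolding of_nat_power of_nat_mult using K by (intro power_mono mult_right_mono) auto
        also have "\<rho> * real (Suc s) = real r powr (1 / real ?d)" by (simp add: \<rho>_def del: of_nat_Suc)
        also have "(real r powr (1 / real ?d)) ^ ?d = real r"
          using r d by (simp add: powr_realpow[symmetric] powr_powr)
        finally have rK: "(K * Suc s) ^ ?d \<le> r" by (simp only: of_nat_le_iff)
        have "S \<le> real n * c1 + (real n)\<^sup>2 * c * real K powr (- 2 * \<alpha>)"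
          unfolding S_def c1_def c_def
          using sum_eigenvalues_le[OF f ds(2,1) K(1) assms(1) s_def assms(2) \<mu> cond rK] rn by simp
        also have "real K powr (- 2 * \<alpha>) \<le> (\<rho> / 2) powr (- 2 * \<alpha>)"
          using K \<rho>0 assms(1) by (intro powr_mono2') auto
        then have "(real n)\<^sup>2 * c * real K powr (- 2 * \<alpha>) \<le> (real n)\<^sup>2 * c * (c3 * R)"
          unfolding R\<rho>[symmetric] using c0 by (intro mult_left_mono) auto
        finally have "S \<le> real n * c1 + (real n)\<^sup>2 * c * (c3 * R)" by simp
        then have "1 / (real n)\<^sup>2 * S \<le> 1 / (real n)\<^sup>2 * (real n * c1 + (real n)\<^sup>2 * c * (c3 * R))"
          by (intro mult_left_mono) auto
        also have "\<dots> = c1 * (1 / real n) + c * (c3 * R)"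
          using n by (simp add: field_simps power2_eq_square)
        also have "\<dots> \<le> c1 * (1 / real n) + (c + 1) * (c3 * R)"
          using c30 by (intro add_left_mono mult_right_mono) (auto simp: R_def)
        finally show ?thesis .
      next
        case False
        have "S \<le> (real n)\<^sup>2" unfolding S_def by (rule sum_eigenvalues_trivial[OF f \<mu>]) (use rn in simp)
        then have "1 / (real n)\<^sup>2 * S \<le> 1" using n by (simp add: divide_le_eq)
        also have "1 \<le> (\<rho> / 2) powr (- 2 * \<alpha>)"
          using powr_mono2'[of "- 2 * \<alpha>" "\<rho> / 2" 1] False \<rho>0 assms(1) by simp
        also have "\<dots> = 1 * (c3 * R)" by (simp only: R\<rho> mult_1_left)
        also have "\<dots> \<le> (c + 1) * (c3 * R)"
          using c0 c30 by (intro mult_right_mono) (auto simp: R_def)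
        also have "\<dots> \<le> c1 * (1 / real n) + (c + 1) * (c3 * R)" using c10 by simp
        finally show ?thesis .
      qed
      also have "\<dots> \<le> C * (1 / real n + R)"
      proof -
        have "0 \<le> (c + 1) * c3 * (1 / real n)" "0 \<le> c1 * R" using c0 c10 c30 by (auto simp: R_def)
        then show ?thesis unfolding C_def by (simp add: algebra_simps)
      qed
      finally show ?thesis using False unfolding S_def R_def by simp
    qed
  qed
qed

end
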